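(* Let $k$ be a field and let $\Lambda$ and $\Gamma$ be augmented $k$-algebras, each of which is either finite-dimensional or graded connected and finitely generated. Then $$\operatorname{Ext}^*_{\Lambda*\Gamma}(k,k)\;\cong\;\operatorname{Ext}^*_\Lambda(k,k)\sqcup\operatorname{Ext}^*_\Gamma(k,k)$$ as augmented $k$-algebras.
   Context: An augmented $k$-algebra is a unital $k$-algebra $\Lambda$ together with a $k$-algebra homomorphism $\varepsilon_\Lambda:\Lambda\to k$; write $I(\Lambda)=\ker\varepsilon_\Lambda$. Morphisms of augmented algebras are $k$-algebra homomorphisms commuting with the augmentations. The field $k$ is a $\Lambda$-module via $\varepsilon_\Lambda$. A graded connected algebra is a non-negatively graded $k$-algebra whose degree zero part equals $k$, augmented by projection onto degree zero. Product: $\Lambda*\Gamma=\{(\lambda,\gamma)\in\Lambda\oplus\Gamma:\varepsilon_\Lambda(\lambda)=\varepsilon_\Gamma(\gamma)\}$, augmented by $(\lambda,\gamma)\mapsto\varepsilon_\Lambda(\lambda)=\varepsilon_\Gamma(\gamma)$. Coproduct (free product): for augmented algebras $A,B$, $A\sqcup B=\bigoplus_{n\ge 0}R_n$, where $R_0=k$ and, for $n>0$, $R_n=(I(A)\otimes_k I(B)\otimes_k\cdots)\oplus(I(B)\otimes_k I(A)\otimes_k\cdots)$ with both summands alternating tensor products of length $n$. Multiplication is $(u_1\otimes\cdots\otimes u_r)(v_1\otimes\cdots\otimes v_s)=u_1\otimes\cdots\otimes(u_rv_1)\otimes v_2\otimes\cdots\otimes v_s$ if $u_r,v_1$ are both in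 $A$ or both in $B$, and $u_1\otimes\cdots\otimes u_r\otimes v_1\otimes\cdots\otimes v_s$ otherwise. The augmentation kills all $R_n$ with $n>0$. $\operatorname{Ext}^*_\Lambda(k,k)$ is a graded $k$-algebra under the Yoneda product, augmented by the map killing all elements of positive degree.
   Formalization: For graded connected algebras (and products with them) Ext is graded Ext, the direct sum of the Ext^{n,j} over internal degrees j; with ordinary Ext the claim fails when some Ext^n is infinite-dimensional. Finite-dimensional algebras are put in degree 0, where Ext is the ordinary one. *)

theory Defs
  imports "HOL-Algebra.Module" "HOL-Algebra.QuotRing" "HOL-Algebra.Subrings"
begin

section \<open>Augmented algebras\<close>

record ('k, 'a) aug_algebra = "('k, 'a) module" +
  aug :: "'a \<Rightarrow> 'k"

text \<open>Algebras are unital and associative but not assumed commutative, so the locale \<open>algebra\<close>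
  of HOL-Algebra cannot be used.\<close>

locale augmented_algebra = K: field K + A: ring A + V: module K A
  for K :: "'k ring" and A :: "('k, 'a, 'r) aug_algebra_scheme" +
  assumes smult_mult_left:
      "\<lbrakk>c \<in> carrier K; x \<in> carrier A; y \<in> carrier A\<rbrakk>
        \<Longrightarrow> (c \<odot>\<^bsub>A\<^esub> x) \<otimes>\<^bsub>A\<^esub> y = c \<odot>\<^bsub>A\<^esub> (x \<otimes>\<^bsub>A\<^esub> y)"
    and smult_mult_right:
      "\<lbrakk>c \<in> carrier K; x \<in> carrier A; y \<in> carrier A\<rbrakk>
        \<Longrightarrow> x \<otimes>\<^bsub>A\<^esub> (c \<odot>\<^bsub>A\<^esub> y) = c \<odot>\<^bsub>A\<^esub> (x \<otimes>\<^bsub>A\<^esub> y)"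
    and aug_ring_hom: "aug A \<in> ring_hom A K"
    and aug_smult:
      "\<lbrakk>c \<in> carrier K; x \<in> carrier A\<rbrakk> \<Longrightarrow> aug A (c \<odot>\<^bsub>A\<^esub> x) = c \<otimes>\<^bsub>K\<^esub> aug A x"

definition aug_ideal :: "'k ring \<Rightarrow> ('k, 'a, 'r) aug_algebra_scheme \<Rightarrow> 'a set" where
  "aug_ideal K A = a_kernel A K (aug A)"

definition aug_algebra_isos ::
    "'k ring \<Rightarrow> ('k, 'a, 'r) aug_algebra_scheme \<Rightarrow> ('k, 'b, 's) aug_algebra_scheme \<Rightarrow> ('a \<Rightarrow> 'b) set"
  where "aug_algebra_isos K A B =
    {\<phi> \<in> ring_iso A B.
       (\<forall>c\<in>carrier K. \<forall>x\<in>carrier A. \<phi> (c \<odot>\<^bsub>A\<^esub> x) = c \<odot>\<^bsub>B\<^esub> \<phi> x) \<and>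
       (\<forall>x\<in>carrier A. aug B (\<phi> x) = aug A x)}"

definition finite_dimensional :: "'k ring \<Rightarrow> ('k, 'a, 'r) module_scheme \<Rightarrow> bool" where
  "finite_dimensional K V \<longleftrightarrow>
    (\<exists>S. finite S \<and> S \<subseteq> carrier V \<and>
      (\<forall>x\<in>carrier V. \<exists>c. c \<in> S \<rightarrow> carrier K \<and> x = (\<Oplus>\<^bsub>V\<^esub> s\<in>S. c s \<odot>\<^bsub>V\<^esub> s)))"

definition fin_gen_algebra :: "'k ring \<Rightarrow> ('k, 'a, 'r) module_scheme \<Rightarrow> bool" where
  "fin_gen_algebra K A \<longleftrightarrow>
    (\<exists>S. finite S \<and> S \<subseteq> carrier A \<and>
      (\<forall>B. subring B A \<and> submodule B K A \<and> S \<subseteq> B \<longrightarrow> B = carrier A))"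

section \<open>Gradings\<close>

text \<open>\<open>V\<close> is the internal direct sum of the subgroups \<open>G j\<close>.\<close>

definition is_grading :: "('a, 'r) ring_scheme \<Rightarrow> (int \<Rightarrow> 'a set) \<Rightarrow> bool" where
  "is_grading V G \<longleftrightarrow>
    (\<forall>j. additive_subgroup (G j) V) \<and>
    (\<forall>x\<in>carrier V. \<exists>!f. (\<forall>j. f j \<in> G j) \<and> finite {j. f j \<noteq> \<zero>\<^bsub>V\<^esub>} \<and>
       x = (\<Oplus>\<^bsub>V\<^esub> j\<in>{j. f j \<noteq> \<zero>\<^bsub>V\<^esub>}. f j))"

record ('k, 'a) gr_aug_algebra = "('k, 'a) aug_algebra" +
  alg_gr :: "int \<Rightarrow> 'a set"

locale graded_augmented_algebra = augmented_algebra K A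
  for K :: "'k ring" and A :: "('k, 'a, 'r) gr_aug_algebra_scheme" +
  assumes grading: "is_grading A (alg_gr A)"
    and gr_smult: "\<lbrakk>c \<in> carrier K; x \<in> alg_gr A j\<rbrakk> \<Longrightarrow> c \<odot>\<^bsub>A\<^esub> x \<in> alg_gr A j"
    and gr_mult: "\<lbrakk>x \<in> alg_gr A i; y \<in> alg_gr A j\<rbrakk> \<Longrightarrow> x \<otimes>\<^bsub>A\<^esub> y \<in> alg_gr A (i + j)"
    and gr_nonneg: "j < 0 \<Longrightarrow> alg_gr A j = {\<zero>\<^bsub>A\<^esub>}"
    and gr_aug: "\<lbrakk>j \<noteq> 0; x \<in> alg_gr A j\<rbrakk> \<Longrightarrow> aug A x = \<zero>\<^bsub>K\<^esub>"

definition connected_algebra :: "'k ring \<Rightarrow> ('k, 'a, 'r) gr_aug_algebra_scheme \<Rightarrow> bool" where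
  "connected_algebra K A \<longleftrightarrow> alg_gr A 0 = {c \<odot>\<^bsub>A\<^esub> \<one>\<^bsub>A\<^esub> | c. c \<in> carrier K}"

text \<open>An algebra without a grading is regarded as a graded algebra concentrated in degree zero.\<close>

definition concentrated_in_degree_0 :: "('k, 'a, 'r) gr_aug_algebra_scheme \<Rightarrow> bool" where
  "concentrated_in_degree_0 A \<longleftrightarrow> alg_gr A = (\<lambda>j. if j = 0 then carrier A else {\<zero>\<^bsub>A\<^esub>})"

section \<open>The product of augmented algebras\<close>

definition aug_product ::
    "('k, 'a, 'r) gr_aug_algebra_scheme \<Rightarrow> ('k, 'b, 's) gr_aug_algebra_scheme
      \<Rightarrow> ('k, 'a \<times> 'b) gr_aug_algebra"
  where "aug_product A B =
    \<lparr>carrier = {(x, y). x \<in> carrier A \<and> y \<in> carrier B \<and> aug A x = aug B y},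
     mult = (\<lambda>(x, y) (x', y'). (x \<otimes>\<^bsub>A\<^esub> x', y \<otimes>\<^bsub>B\<^esub> y')),
     one = (\<one>\<^bsub>A\<^esub>, \<one>\<^bsub>B\<^esub>),
     zero = (\<zero>\<^bsub>A\<^esub>, \<zero>\<^bsub>B\<^esub>),
     add = (\<lambda>(x, y) (x', y'). (x \<oplus>\<^bsub>A\<^esub> x', y \<oplus>\<^bsub>B\<^esub> y')),
     smult = (\<lambda>c (x, y). (c \<odot>\<^bsub>A\<^esub> x, c \<odot>\<^bsub>B\<^esub> y)),
     aug = (\<lambda>(x, y). aug A x),
     alg_gr = (\<lambda>j. {(x, y). x \<in> alg_gr A j \<and> y \<in> alg_gr B j \<and> aug A x = aug B y})\<rparr>"

section \<open>The coproduct of augmented algebras\<close>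

text \<open>The sum of all alternating tensor products \<open>R\<^sub>n\<close> is realised as the free vector space on
  alternating words in \<open>I(A)\<close> and \<open>I(B)\<close> (the word algebra), modulo multilinearity in each letter.
  The empty word spans \<open>R\<^sub>0\<close>; the words of length \<open>n > 0\<close> starting in \<open>I(A)\<close>, respectively
  \<open>I(B)\<close>, give the two summands of \<open>R\<^sub>n\<close>.\<close>

definition alt_words ::
    "'k ring \<Rightarrow> ('k, 'a, 'r) aug_algebra_scheme \<Rightarrow> ('k, 'b, 's) aug_algebra_scheme
      \<Rightarrow> ('a + 'b) list set"
  where "alt_words K A B =
    {w. set w \<subseteq> Inl ` aug_ideal K A \<union> Inr ` aug_ideal K B \<and>
        successively (\<lambda>x y. isl x \<noteq> isl y) w}"

definition word_mult ::
    "('k, 'a, 'r) aug_algebra_scheme \<Rightarrow> ('k, 'b, 's) aug_algebra_scheme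
      \<Rightarrow> ('a + 'b) list \<Rightarrow> ('a + 'b) list \<Rightarrow> ('a + 'b) list"
  where "word_mult A B u v =
    (if u = [] \<or> v = [] then u @ v
     else case (last u, hd v) of
       (Inl x, Inl y) \<Rightarrow> butlast u @ [Inl (x \<otimes>\<^bsub>A\<^esub> y)] @ tl v
     | (Inr x, Inr y) \<Rightarrow> butlast u @ [Inr (x \<otimes>\<^bsub>B\<^esub> y)] @ tl v
     | _ \<Rightarrow> u @ v)"

definition single :: "'k ring \<Rightarrow> 'w \<Rightarrow> 'w \<Rightarrow> 'k" where
  "single K w = (\<lambda>v. if v = w then \<one>\<^bsub>K\<^esub> else \<zero>\<^bsub>K\<^esub>)"

definition word_algebra ::
    "'k ring \<Rightarrow> ('k, 'a, 'r) aug_algebra_scheme \<Rightarrow> ('k, 'b, 's) aug_algebra_scheme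
      \<Rightarrow> ('k, ('a + 'b) list \<Rightarrow> 'k) aug_algebra"
  where "word_algebra K A B =
    \<lparr>carrier = {f. (\<forall>w. f w \<in> carrier K) \<and> {w. f w \<noteq> \<zero>\<^bsub>K\<^esub>} \<subseteq> alt_words K A B \<and>
                   finite {w. f w \<noteq> \<zero>\<^bsub>K\<^esub>}},
     mult = (\<lambda>f g w. \<Oplus>\<^bsub>K\<^esub> p\<in>{(u, v). f u \<noteq> \<zero>\<^bsub>K\<^esub> \<and> g v \<noteq> \<zero>\<^bsub>K\<^esub> \<and> word_mult A B u v = w}.
               f (fst p) \<otimes>\<^bsub>K\<^esub> g (snd p)),
     one = single K [],
     zero = (\<lambda>w. \<zero>\<^bsub>K\<^esub>),
     add = (\<lambda>f g w. f w \<oplus>\<^bsub>K\<^esub> g w),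
     smult = (\<lambda>c f w. c \<otimes>\<^bsub>K\<^esub> f w),
     aug = (\<lambda>f. f [])\<rparr>"

definition tensor_relations ::
    "'k ring \<Rightarrow> ('k, 'a, 'r) aug_algebra_scheme \<Rightarrow> ('k, 'b, 's) aug_algebra_scheme
      \<Rightarrow> (('a + 'b) list \<Rightarrow> 'k) set"
  where "tensor_relations K A B = (let W = word_algebra K A B; \<delta> = single K in
    {\<delta> (u @ [Inl (x \<oplus>\<^bsub>A\<^esub> y)] @ v) \<ominus>\<^bsub>W\<^esub> (\<delta> (u @ [Inl x] @ v) \<oplus>\<^bsub>W\<^esub> \<delta> (u @ [Inl y] @ v)) | u v x y.
       u @ [Inl x] @ v \<in> alt_words K A B \<and> u @ [Inl y] @ v \<in> alt_words K A B} \<union>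
    {\<delta> (u @ [Inl (c \<odot>\<^bsub>A\<^esub> x)] @ v) \<ominus>\<^bsub>W\<^esub> c \<odot>\<^bsub>W\<^esub> \<delta> (u @ [Inl x] @ v) | u v c x.
       c \<in> carrier K \<and> u @ [Inl x] @ v \<in> alt_words K A B} \<union>
    {\<delta> (u @ [Inr (x \<oplus>\<^bsub>B\<^esub> y)] @ v) \<ominus>\<^bsub>W\<^esub> (\<delta> (u @ [Inr x] @ v) \<oplus>\<^bsub>W\<^esub> \<delta> (u @ [Inr y] @ v)) | u v x y.
       u @ [Inr x] @ v \<in> alt_words K A B \<and> u @ [Inr y] @ v \<in> alt_words K A B} \<union>
    {\<delta> (u @ [Inr (c \<odot>\<^bsub>B\<^esub> x)] @ v) \<ominus>\<^bsub>W\<^esub> c \<odot>\<^bsub>W\<^esub> \<delta> (u @ [Inr x] @ v) | u v c x.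
       c \<in> carrier K \<and> u @ [Inr x] @ v \<in> alt_words K A B})"

definition tensor_ideal ::
    "'k ring \<Rightarrow> ('k, 'a, 'r) aug_algebra_scheme \<Rightarrow> ('k, 'b, 's) aug_algebra_scheme
      \<Rightarrow> (('a + 'b) list \<Rightarrow> 'k) set"
  where "tensor_ideal K A B =
    \<Inter>{N. submodule N K (word_algebra K A B) \<and> tensor_relations K A B \<subseteq> N}"

definition coset_smult ::
    "('k, 'a, 'r) module_scheme \<Rightarrow> 'a set \<Rightarrow> 'k \<Rightarrow> 'a set \<Rightarrow> 'a set"
  where "coset_smult V N c X = (\<Union>x\<in>X. N +>\<^bsub>V\<^esub> (c \<odot>\<^bsub>V\<^esub> x))"

definition aug_coproduct ::
    "'k ring \<Rightarrow> ('k, 'a, 'r) aug_algebra_scheme \<Rightarrow> ('k, 'b, 's) aug_algebra_scheme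
      \<Rightarrow> ('k, (('a + 'b) list \<Rightarrow> 'k) set) aug_algebra"
  where "aug_coproduct K A B = (let W = word_algebra K A B; N = tensor_ideal K A B in
    \<lparr>carrier = a_rcosets\<^bsub>W\<^esub> N,
     mult = rcoset_mult W N,
     one = N +>\<^bsub>W\<^esub> \<one>\<^bsub>W\<^esub>,
     zero = N,
     add = set_add W,
     smult = coset_smult W N,
     aug = (\<lambda>X. the_elem (aug W ` X))\<rparr>)"

section \<open>Graded modules and homomorphisms\<close>

text \<open>The locale \<open>module\<close> of HOL-Algebra requires a commutative base ring.\<close>

locale left_module = A: ring A + M: abelian_group M
  for A :: "('a, 'r) ring_scheme" and M :: "('a, 'm, 's) module_scheme" +
  assumes left_smult_closed:
      "\<lbrakk>a \<in> carrier A; x \<in> carrier M\<rbrakk> \<Longrightarrow> a \<odot>\<^bsub>M\<^esub> x \<in> carrier M"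
    and left_smult_l_distr:
      "\<lbrakk>a \<in> carrier A; b \<in> carrier A; x \<in> carrier M\<rbrakk>
        \<Longrightarrow> (a \<oplus>\<^bsub>A\<^esub> b) \<odot>\<^bsub>M\<^esub> x = a \<odot>\<^bsub>M\<^esub> x \<oplus>\<^bsub>M\<^esub> b \<odot>\<^bsub>M\<^esub> x"
    and left_smult_r_distr:
      "\<lbrakk>a \<in> carrier A; x \<in> carrier M; y \<in> carrier M\<rbrakk>
        \<Longrightarrow> a \<odot>\<^bsub>M\<^esub> (x \<oplus>\<^bsub>M\<^esub> y) = a \<odot>\<^bsub>M\<^esub> x \<oplus>\<^bsub>M\<^esub> a \<odot>\<^bsub>M\<^esub> y"
    and left_smult_assoc:
      "\<lbrakk>a \<in> carrier A; b \<in> carrier A; x \<in> carrier M\<rbrakk>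
        \<Longrightarrow> (a \<otimes>\<^bsub>A\<^esub> b) \<odot>\<^bsub>M\<^esub> x = a \<odot>\<^bsub>M\<^esub> (b \<odot>\<^bsub>M\<^esub> x)"
    and left_smult_one: "x \<in> carrier M \<Longrightarrow> \<one>\<^bsub>A\<^esub> \<odot>\<^bsub>M\<^esub> x = x"

record ('a, 'm) gr_module = "('a, 'm) module" +
  mod_gr :: "int \<Rightarrow> 'm set"

locale graded_left_module = left_module A M
  for A :: "('k, 'a, 'r) gr_aug_algebra_scheme" and M :: "('a, 'm, 's) gr_module_scheme" +
  assumes mod_grading: "is_grading M (mod_gr M)"
    and mod_gr_smult:
      "\<lbrakk>a \<in> alg_gr A i; x \<in> mod_gr M j\<rbrakk> \<Longrightarrow> a \<odot>\<^bsub>M\<^esub> x \<in> mod_gr M (i + j)"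

text \<open>A basis consisting of homogeneous elements. The ring underlying an augmented algebra is
  nonzero.\<close>

definition graded_free ::
    "('k, 'a, 'r) gr_aug_algebra_scheme \<Rightarrow> ('a, 'm, 's) gr_module_scheme \<Rightarrow> bool"
  where "graded_free A M \<longleftrightarrow>
    (\<exists>X. X \<subseteq> (\<Union>j. mod_gr M j) \<and>
      (\<forall>y\<in>carrier M. \<exists>!c. (\<forall>x. c x \<in> carrier A) \<and> {x. c x \<noteq> \<zero>\<^bsub>A\<^esub>} \<subseteq> X \<and>
         finite {x. c x \<noteq> \<zero>\<^bsub>A\<^esub>} \<and> y = (\<Oplus>\<^bsub>M\<^esub> x\<in>{x. c x \<noteq> \<zero>\<^bsub>A\<^esub>}. c x \<odot>\<^bsub>M\<^esub> x)))"

definition left_linear_maps ::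
    "('a, 'r) ring_scheme \<Rightarrow> ('a, 'm, 's) module_scheme \<Rightarrow> ('a, 'n, 't) module_scheme
      \<Rightarrow> ('m \<Rightarrow> 'n) set"
  where "left_linear_maps A M N =
    {f \<in> carrier M \<rightarrow> carrier N.
       (\<forall>x\<in>carrier M. \<forall>y\<in>carrier M. f (x \<oplus>\<^bsub>M\<^esub> y) = f x \<oplus>\<^bsub>N\<^esub> f y) \<and>
       (\<forall>a\<in>carrier A. \<forall>x\<in>carrier M. f (a \<odot>\<^bsub>M\<^esub> x) = a \<odot>\<^bsub>N\<^esub> f x)}"

definition homs_of_degree ::
    "('a, 'r) ring_scheme \<Rightarrow> ('a, 'm, 's) gr_module_scheme \<Rightarrow> ('a, 'n, 't) gr_module_scheme
      \<Rightarrow> int \<Rightarrow> ('m \<Rightarrow> 'n) set"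
  where "homs_of_degree A M N j =
    {f \<in> left_linear_maps A M N. \<forall>i. f ` mod_gr M i \<subseteq> mod_gr N (i + j)}"

text \<open>The graded Hom: the direct sum, over all internal degrees \<open>j\<close>, of the homomorphisms of
  degree \<open>j\<close>, as a subset of the linear maps.\<close>

definition graded_homs ::
    "('a, 'r) ring_scheme \<Rightarrow> ('a, 'm, 's) gr_module_scheme \<Rightarrow> ('a, 'n, 't) gr_module_scheme
      \<Rightarrow> ('m \<Rightarrow> 'n) set"
  where "graded_homs A M N =
    {f \<in> left_linear_maps A M N.
       \<exists>J h. finite J \<and> (\<forall>j\<in>J. h j \<in> homs_of_degree A M N j) \<and>
         (\<forall>x\<in>carrier M. f x = (\<Oplus>\<^bsub>N\<^esub> j\<in>J. h j x))}"

definition trivial_module ::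
    "'k ring \<Rightarrow> ('k, 'a, 'r) aug_algebra_scheme \<Rightarrow> ('a, 'k) gr_module"
  where "trivial_module K A =
    \<lparr>carrier = carrier K, mult = mult K, one = one K, zero = zero K, add = add K,
     smult = (\<lambda>a c. aug A a \<otimes>\<^bsub>K\<^esub> c),
     mod_gr = (\<lambda>j. if j = 0 then carrier K else {\<zero>\<^bsub>K\<^esub>})\<rparr>"

section \<open>Free resolutions of the ground field\<close>

text \<open>\<open>res_diff P n\<close> is the differential from term \<open>n + 1\<close> to term \<open>n\<close>, and \<open>res_aug P\<close> is the
  augmentation of the resolution, from term \<open>0\<close> to the ground field.\<close>

record ('a, 'm, 'k) resolution =
  res_mod :: "nat \<Rightarrow> ('a, 'm) gr_module"
  res_diff :: "nat \<Rightarrow> 'm \<Rightarrow> 'm"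
  res_aug :: "'m \<Rightarrow> 'k"

definition graded_free_resolution ::
    "'k ring \<Rightarrow> ('k, 'a, 'r) gr_aug_algebra_scheme \<Rightarrow> ('a, 'm, 'k) resolution \<Rightarrow> bool"
  where "graded_free_resolution K A P \<longleftrightarrow>
    (\<forall>n. graded_left_module A (res_mod P n) \<and> graded_free A (res_mod P n)) \<and>
    (\<forall>n. res_diff P n \<in> homs_of_degree A (res_mod P (Suc n)) (res_mod P n) 0) \<and>
    res_aug P \<in> homs_of_degree A (res_mod P 0) (trivial_module K A) 0 \<and>
    (\<forall>n. {x \<in> carrier (res_mod P (Suc n)). res_diff P n x = \<zero>\<^bsub>res_mod P n\<^esub>} =
         res_diff P (Suc n) ` carrier (res_mod P (Suc (Suc n)))) \<and>
    {x \<in> carrier (res_mod P 0). res_aug P x = \<zero>\<^bsub>K\<^esub>} = res_diff P 0 ` carrier (res_mod P 1) \<and>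
    res_aug P ` carrier (res_mod P 0) = carrier K"

section \<open>The Ext algebra\<close>

text \<open>Ext is formed in the category of graded modules: its \<open>n\<close>-th component is the cohomology of
  the graded Hom complex, that is, the direct sum over \<open>j\<close> of the bigraded pieces \<open>Ext\<^sup>n\<^sup>,\<^sup>j\<close>. Over an
  algebra concentrated in degree zero, an ungraded free resolution is a graded one concentrated in
  degree zero, and every linear map from it to \<open>k\<close> belongs to the graded Hom, so this is the
  ordinary Ext.

  The internal grading matters when some \<open>Ext\<^sup>n\<close> of a connected finitely generated algebra is
  infinite-dimensional: the dual of a tensor product is then larger than the tensor product of the
  duals unless duals are taken degreewise.

  Cochains are extensional functions, so that they are determined by their values on the carrier.\<close>

definition cochains ::
    "'k ring \<Rightarrow> ('k, 'a, 'r) gr_aug_algebra_scheme \<Rightarrow> ('a, 'm, 'k) resolution \<Rightarrow> nat \<Rightarrow> ('m \<Rightarrow> 'k) set"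
  where "cochains K A P n =
    graded_homs A (res_mod P n) (trivial_module K A) \<inter> extensional (carrier (res_mod P n))"

definition cocycles ::
    "'k ring \<Rightarrow> ('k, 'a, 'r) gr_aug_algebra_scheme \<Rightarrow> ('a, 'm, 'k) resolution \<Rightarrow> nat \<Rightarrow> ('m \<Rightarrow> 'k) set"
  where "cocycles K A P n =
    {f \<in> cochains K A P n. \<forall>x\<in>carrier (res_mod P (Suc n)). f (res_diff P n x) = \<zero>\<^bsub>K\<^esub>}"

fun coboundaries ::
    "'k ring \<Rightarrow> ('k, 'a, 'r) gr_aug_algebra_scheme \<Rightarrow> ('a, 'm, 'k) resolution \<Rightarrow> nat \<Rightarrow> ('m \<Rightarrow> 'k) set"
  where
    "coboundaries K A P 0 = {\<lambda>x\<in>carrier (res_mod P 0). \<zero>\<^bsub>K\<^esub>}"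
  | "coboundaries K A P (Suc n) =
      (\<lambda>h. \<lambda>x\<in>carrier (res_mod P (Suc n)). h (res_diff P n x)) ` cochains K A P n"

text \<open>The multiplicative fields of the next two records are irrelevant.\<close>

definition cocycle_space ::
    "'k ring \<Rightarrow> ('k, 'a, 'r) gr_aug_algebra_scheme \<Rightarrow> ('a, 'm, 'k) resolution \<Rightarrow> nat
      \<Rightarrow> ('k, 'm \<Rightarrow> 'k) module"
  where "cocycle_space K A P n = (let C = carrier (res_mod P n) in
    \<lparr>carrier = cocycles K A P n,
     mult = undefined, one = undefined,
     zero = (\<lambda>x\<in>C. \<zero>\<^bsub>K\<^esub>),
     add = (\<lambda>f g. \<lambda>x\<in>C. f x \<oplus>\<^bsub>K\<^esub> g x),
     smult = (\<lambda>c f. \<lambda>x\<in>C. c \<otimes>\<^bsub>K\<^esub> f x)\<rparr>)"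

definition Ext_space ::
    "'k ring \<Rightarrow> ('k, 'a, 'r) gr_aug_algebra_scheme \<Rightarrow> ('a, 'm, 'k) resolution \<Rightarrow> nat
      \<Rightarrow> ('k, ('m \<Rightarrow> 'k) set) module"
  where "Ext_space K A P n = (let Z = cocycle_space K A P n; B = coboundaries K A P n in
    \<lparr>carrier = a_rcosets\<^bsub>Z\<^esub> B,
     mult = undefined, one = undefined,
     zero = B,
     add = set_add Z,
     smult = coset_smult Z B\<rparr>)"

definition Ext_class ::
    "'k ring \<Rightarrow> ('k, 'a, 'r) gr_aug_algebra_scheme \<Rightarrow> ('a, 'm, 'k) resolution \<Rightarrow> nat
      \<Rightarrow> ('m \<Rightarrow> 'k) \<Rightarrow> ('m \<Rightarrow> 'k) set"
  where "Ext_class K A P n f =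
    coboundaries K A P n +>\<^bsub>cocycle_space K A P n\<^esub> restrict f (carrier (res_mod P n))"

text \<open>Liftings of a cocycle \<open>g\<close> of degree \<open>m\<close> to a chain map \<open>t\<close>, whose \<open>i\<close>-th component goes from
  term \<open>m + i\<close> to term \<open>i\<close>.\<close>

definition chain_lifts ::
    "'k ring \<Rightarrow> ('k, 'a, 'r) gr_aug_algebra_scheme \<Rightarrow> ('a, 'm, 'k) resolution \<Rightarrow> nat
      \<Rightarrow> ('m \<Rightarrow> 'k) \<Rightarrow> (nat \<Rightarrow> 'm \<Rightarrow> 'm) set"
  where "chain_lifts K A P m g =
    {t. (\<forall>i. t i \<in> graded_homs A (res_mod P (m + i)) (res_mod P i)) \<and>
        (\<forall>x\<in>carrier (res_mod P m). res_aug P (t 0 x) = g x) \<and>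
        (\<forall>i. \<forall>x\<in>carrier (res_mod P (Suc (m + i))).
           res_diff P i (t (Suc i) x) = t i (res_diff P (m + i) x))}"

text \<open>The Yoneda product of the class of \<open>f\<close> in degree \<open>n\<close> and the class of \<open>g\<close> in degree \<open>m\<close> is
  the class of \<open>f \<circ> t n\<close>, for a lifting \<open>t\<close> of \<open>g\<close>. All choices give the same coset, so the union
  is this coset.\<close>

definition yoneda ::
    "'k ring \<Rightarrow> ('k, 'a, 'r) gr_aug_algebra_scheme \<Rightarrow> ('a, 'm, 'k) resolution \<Rightarrow> nat \<Rightarrow> nat
      \<Rightarrow> ('m \<Rightarrow> 'k) set \<Rightarrow> ('m \<Rightarrow> 'k) set \<Rightarrow> ('m \<Rightarrow> 'k) set"
  where "yoneda K A P n m X Y =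
    (\<Union>f\<in>X. \<Union>g\<in>Y. \<Union>t\<in>chain_lifts K A P m g. Ext_class K A P (m + n) (\<lambda>x. f (t n x)))"

text \<open>The elements of the Ext algebra are the finitely supported sequences of Ext classes. The
  degree zero part is spanned by the class of the augmentation of the resolution, which is the unit.\<close>

definition Ext_algebra ::
    "'k ring \<Rightarrow> ('k, 'a, 'r) gr_aug_algebra_scheme \<Rightarrow> ('a, 'm, 'k) resolution
      \<Rightarrow> ('k, nat \<Rightarrow> ('m \<Rightarrow> 'k) set) aug_algebra"
  where "Ext_algebra K A P = (let E = Ext_space K A P; u = Ext_class K A P 0 (res_aug P) in
    \<lparr>carrier = {x. (\<forall>n. x n \<in> carrier (E n)) \<and> finite {n. x n \<noteq> \<zero>\<^bsub>E n\<^esub>}},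
     mult = (\<lambda>x y n. \<Oplus>\<^bsub>E n\<^esub> i\<in>{..n}. yoneda K A P i (n - i) (x i) (y (n - i))),
     one = (\<lambda>n. if n = 0 then u else \<zero>\<^bsub>E n\<^esub>),
     zero = (\<lambda>n. \<zero>\<^bsub>E n\<^esub>),
     add = (\<lambda>x y n. x n \<oplus>\<^bsub>E n\<^esub> y n),
     smult = (\<lambda>c x n. c \<odot>\<^bsub>E n\<^esub> x n),
     aug = (\<lambda>x. THE c. c \<in> carrier K \<and> x 0 = c \<odot>\<^bsub>E 0\<^esub> u)\<rparr>)"

end

(* Choose a homogeneous basis of the augmentation ideal. The reduced bar resolution on words in this
basis is free, and dualising it degreewise gives the cobar algebra: finitely supported functions on
words with the concatenation product and a differential given by the structure constants. A free
resolution of k is homotopy equivalent to the bar resolution, so Ext is the cohomology algebra of the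
cobar algebra. In the product the two augmentation ideals annihilate each other, so its cobar algebra is
the free product of the two cobar algebras as a differential algebra. A contraction of each factor,
extended over the maximal blocks of letters from one alphabet, shows that over a field cohomology takes
free products to free products. *)
theory Submission
  imports Defs
begin

\<comment> \<open>The finiteness hypotheses enter through one consequence: the augmentation ideal
  has a finite basis in every internal degree, and these degrees are nonnegative. Hence only
  finitely many words have a given length and degree, so graded cochains on the bar resolution are
  exactly the finitely supported functions on words of one length, and the differential preserves
  finite support.

  The isomorphism cannot be a map of complexes, since the coproduct on the right is built from
  cohomology classes. A choice of representing cocycles is linear and multiplicative only up to
  coboundaries, which suffices to send a word of classes to a well-defined class of the product.
  Injectivity is the delicate point: it needs a linear map on all cochains, not only cocycles, that
  recovers the word modulo the tensor relations and kills coboundaries. The operator p = 1 - ds - sd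
  of a factor supplies it, because pd = 0 and p preserves the classes of cocycles. The same p,
  applied block by block, is homotopic to the identity and gives surjectivity. The signs in that
  homotopy force s to anticommute with the length parity.\<close>
syntax "_index" :: "logic => index" ("\<^sub>_" [1000] 1000)
notation res_mod ("_$_" [1000, 1000] 1000)
notation carrier ("car")
abbreviation supp ("supp.\<index> _" [1000] 999) where "supp.\<^bsub>R\<^esub> f == {w. f w ~= \<zero>\<^bsub>R\<^esub>}"
abbreviation zf ("zf.\<index>") where "zf.\<^bsub>R\<^esub> == %w. \<zero>\<^bsub>R\<^esub>"
abbreviation "lmaps == left_linear_maps"
abbreviation "ghoms == graded_homs"
abbreviation "dhoms == homs_of_degree"
lemmas (in abelian_group) ab = abelian_group_axioms

section \<open>Additive maps and left modules\<close>

definition additive_maps :: "('a, 'r) ring_scheme => ('b, 's) ring_scheme => ('a => 'b) set" where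
 "additive_maps M N =
  {f : car M \<rightarrow> car N. ALL x:car M. ALL y:car M. f (x \<oplus>\<^sub>M y) = f x \<oplus>\<^sub>N f y}"

lemma additive_mapsI:
 assumes "!!x. x : car M ==> f x : car N"
  and "!!x y. [|x : car M; y : car M|] ==> f (x \<oplus>\<^sub>M y) = f x \<oplus>\<^sub>N f y"
 shows "f : additive_maps M N"
 using assms unfolding additive_maps_def by auto

lemma additive_closed: "f : additive_maps M N ==> x : car M ==> f x : car N"
 by(auto simp:additive_maps_def)

lemma additive_add:
 "f : additive_maps M N ==> x : car M ==> y : car M ==> f (x \<oplus>\<^sub>M y) = f x \<oplus>\<^sub>N f y"
 by(auto simp:additive_maps_def)

lemma additive_zero:
 assumes "abelian_group M" "abelian_group N" "f : additive_maps M N"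
 shows "f \<zero>\<^sub>M = \<zero>\<^sub>N"
proof -
 interpret M: abelian_group M by fact
 interpret N: abelian_group N by fact
 have c: "f \<zero>\<^sub>M : car N" using assms(3) by(auto simp:additive_closed)
 have "f \<zero>\<^sub>M \<oplus>\<^sub>N f \<zero>\<^sub>M = f \<zero>\<^sub>M \<oplus>\<^sub>N \<zero>\<^sub>N"
  using additive_add[OF assms(3), of "\<zero>\<^sub>M" "\<zero>\<^sub>M"] c by simp
 thus ?thesis using c by(simp add:N.add.l_cancel_one)
qed

lemma additive_minus:
 assumes "abelian_group M" "abelian_group N" "f : additive_maps M N" "x : car M"
 shows "f (\<ominus>\<^sub>M x) = \<ominus>\<^sub>N f x"
proof -
 interpret M: abelian_group M by fact
 interpret N: abelian_group N by fact
 have "f (\<ominus>\<^sub>M x) \<oplus>\<^sub>N f x = \<zero>\<^sub>N"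
  using additive_add[OF assms(3), of "\<ominus>\<^sub>M x" x] assms(4) additive_zero[OF assms(1-3)]
  by(simp add:M.l_neg)
 thus ?thesis
  using assms(3,4) by(metis M.a_inv_closed N.minus_equality additive_closed)
qed

lemma additive_diff:
 assumes "abelian_group M" "abelian_group N" "f : additive_maps M N"
  "x : car M" "y : car M"
 shows "f (x \<ominus>\<^sub>M y) = f x \<ominus>\<^sub>N f y"
proof -
 interpret M: abelian_group M by fact
 show ?thesis using assms additive_minus[OF assms(1-3)]
  by(simp add:a_minus_def additive_add)
qed

lemma additive_finsum:
 assumes "abelian_group M" "abelian_group N" "f : additive_maps M N" "g : I \<rightarrow> car M"
 shows "f (\<Oplus>\<^sub>M i\<in>I. g i) = (\<Oplus>\<^sub>N i\<in>I. f (g i))"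
proof -
 interpret M: abelian_group M by fact
 interpret N: abelian_group N by fact
 show ?thesis using assms(4)
 proof (induct I rule:infinite_finite_induct)
  case (infinite A)
  thus ?case by(simp add:additive_zero[OF assms(1-3)])
 next
  case empty
  thus ?case by(simp add:additive_zero[OF assms(1-3)])
 next
  case (insert x F)
  hence "g : F \<rightarrow> car M" "g x : car M" by auto
  moreover have "(%i. f (g i)) : F \<rightarrow> car N" "f (g x) : car N"
  using insert.prems by(auto intro!: additive_closed[OF assms(3)])
  ultimately show ?case using insert assms(3) by(simp add:additive_add)
 qed
qed

context abelian_group
begin

lemma minus_add4:
 "[|a : car G; b : car G; c : car G; d : car G|]
  ==> (a \<oplus> b) \<ominus> (c \<oplus> d) = (a \<ominus> c) \<oplus> (b \<ominus> d)"
 by(simp add:a_minus_def minus_add a_ac)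

lemma add4:
 "[|a : car G; b : car G; c : car G; d : car G|]
  ==> (a \<oplus> b) \<oplus> (c \<oplus> d) = (a \<oplus> c) \<oplus> (b \<oplus> d)"
 by(simp add:a_ac)

lemma minus_minus_add:
 "[|a : car G; b : car G|] ==> (a \<ominus> b) \<oplus> b = a"
 by(simp add:a_minus_def a_assoc l_neg)

lemma add_minus_cancel:
 "[|a : car G; b : car G|] ==> (a \<oplus> b) \<ominus> b = a"
 by(simp add:a_minus_def a_assoc r_neg)

lemma diff_zero_iff:
 "[|a : car G; b : car G|] ==> a \<ominus> b = \<zero> \<longleftrightarrow> a = b"
 using minus_minus_add[of a b] by(auto simp:a_minus_def r_neg)

lemma diff_eq_iff:
 "[|a : car G; b : car G; c : car G|] ==> a \<ominus> b = c \<longleftrightarrow> a = b \<oplus> c"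
 using minus_minus_add[of a b] add_minus_cancel[of c b] by(auto simp:a_comm)

lemma diff_diff_cancel:
 assumes "a : car G" "b : car G" "c : car G"
 shows "(a \<ominus> b) \<ominus> (a \<ominus> c) = c \<ominus> b"
proof -
 have "(a \<ominus> b) \<ominus> (a \<ominus> c) = (a \<ominus> a) \<oplus> (c \<ominus> b)"
  using assms by(simp add:a_minus_def minus_add minus_minus a_ac)
 thus ?thesis using assms by(simp add:a_minus_def r_neg)
qed

lemma zero_diff: "a : car G ==> \<zero> \<ominus> a = \<ominus> a"
 by(simp add:a_minus_def)

lemma diff_zero: "a : car G ==> a \<ominus> \<zero> = a"
 by(simp add:a_minus_def)

lemma diff_self: "a : car G ==> a \<ominus> a = \<zero>"
 by(simp add:a_minus_def r_neg)

lemma finsum_superset: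
 assumes "finite B" "A \<subseteq> B" "!!i. i : B - A ==> f i = \<zero>" "f : B \<rightarrow> car G"
 shows "finsum G f A = finsum G f B"
 using assms by(intro add.finprod_mono_neutral_cong_left) auto

lemma finsum_single:
 assumes "finite I" "i : I" "f i : car G" "!!j. j : I ==> j ~= i ==> f j = \<zero>"
 shows "finsum G f I = f i"
proof -
 have "finsum G f {i} = finsum G f I"
  using assms by(intro finsum_superset) (auto simp:Pi_iff, metis zero_closed)
 thus ?thesis using assms(3) by simp
qed

lemma finsum_zeroI: "(!!i. i : I ==> f i = \<zero>) ==> finsum G f I = \<zero>"
 by(rule add.finprod_one_eqI)

lemma finsum_neg:
 assumes "f : I \<rightarrow> car G" shows "(\<Oplus>i\<in>I. \<ominus> f i) = \<ominus> (\<Oplus>i\<in>I. f i)"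
proof -
 have "(%x. \<ominus> x) : additive_maps G G"
  by(intro additive_mapsI) (auto simp:minus_add)
 from additive_finsum[OF ab ab this assms] show ?thesis by simp
qed

lemma finsum_filter:
 assumes "finite I" "!!i. i : I ==> P i ==> f i : car G"
 shows "(\<Oplus>i\<in>{i\<in>I. P i}. f i) = (\<Oplus>i\<in>I. if P i then f i else \<zero>)"
 using assms by(intro add.finprod_mono_neutral_cong_left) auto

end

context left_module
begin

lemma smult_zero_r [simp]: "a : car A ==> a \<odot>\<^sub>M \<zero>\<^sub>M = \<zero>\<^sub>M"
 by(metis M.add.l_cancel_one' M.l_zero M.zero_closed left_smult_closed left_smult_r_distr)

lemma smult_zero_l [simp]: "x : car M ==> \<zero>\<^sub>A \<odot>\<^sub>M x = \<zero>\<^sub>M"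
 by(metis A.l_zero A.zero_closed M.add.l_cancel_one' left_smult_closed left_smult_l_distr)

lemma smult_minus_r: "[|a : car A; x : car M|] ==> a \<odot>\<^sub>M (\<ominus>\<^sub>M x) = \<ominus>\<^sub>M (a \<odot>\<^sub>M x)"
 by(metis M.a_inv_closed M.l_neg M.minus_equality left_smult_closed left_smult_r_distr smult_zero_r)

lemma smult_minus_l: "[|a : car A; x : car M|] ==> (\<ominus>\<^sub>A a) \<odot>\<^sub>M x = \<ominus>\<^sub>M (a \<odot>\<^sub>M x)"
 by(metis A.a_inv_closed A.l_neg M.minus_equality left_smult_closed left_smult_l_distr smult_zero_l)

lemma smult_diff_r:
 "[|a : car A; x : car M; y : car M|]
  ==> a \<odot>\<^sub>M (x \<ominus>\<^sub>M y) = a \<odot>\<^sub>M x \<ominus>\<^sub>M a \<odot>\<^sub>M y"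
 by(simp add:a_minus_def left_smult_r_distr smult_minus_r)

lemma smult_finsum:
 "[|a : car A; f : I \<rightarrow> car M|] ==> a \<odot>\<^sub>M (\<Oplus>\<^sub>M i\<in>I. f i) = (\<Oplus>\<^sub>M i\<in>I. a \<odot>\<^sub>M f i)"
 by(intro additive_finsum[of M M "%x. a \<odot>\<^sub>M x"] M.ab additive_mapsI)
  (auto simp:left_smult_closed left_smult_r_distr)

lemma lm: "left_module A M" ..

end

lemma linear_mapsI:
 assumes "!!x. x : car M ==> f x : car N"
  and "!!x y. [|x : car M; y : car M|] ==> f (x \<oplus>\<^sub>M y) = f x \<oplus>\<^sub>N f y"
  and "!!a x. [|a : car A; x : car M|] ==> f (a \<odot>\<^sub>M x) = a \<odot>\<^sub>N f x"
 shows "f : lmaps A M N"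
 using assms unfolding left_linear_maps_def by auto

lemma linear_additive: "f : lmaps A M N ==> f : additive_maps M N"
 by(auto simp:left_linear_maps_def additive_maps_def)

lemma linear_closed: "f : lmaps A M N ==> x : car M ==> f x : car N"
 by(auto simp:left_linear_maps_def)

lemma linear_add:
 "f : lmaps A M N ==> x : car M ==> y : car M ==> f (x \<oplus>\<^sub>M y) = f x \<oplus>\<^sub>N f y"
 by(auto simp:left_linear_maps_def)

lemma linear_smult:
 "f : lmaps A M N ==> a : car A ==> x : car M ==> f (a \<odot>\<^sub>M x) = a \<odot>\<^sub>N f x"
 by(auto simp:left_linear_maps_def)

lemmas linear_zero = additive_zero[OF _ _ linear_additive]
lemmas linear_minus = additive_minus[OF _ _ linear_additive]
lemmas linear_diff = additive_diff[OF _ _ linear_additive]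
lemmas linear_finsum = additive_finsum[OF _ _ linear_additive]

lemma linear_comp:
 "f : lmaps A M N ==> g : lmaps A L M ==> (%x. f (g x)) : lmaps A L N"
 unfolding left_linear_maps_def by(auto simp:Pi_iff)

lemma linear_cong:
 assumes "f : lmaps A M N" "!!x. x : car M ==> g x = f x" "left_module A M"
 shows "g : lmaps A M N"
proof -
 interpret left_module A M by fact
 show ?thesis using assms(1,2)
  by(intro linear_mapsI) (auto simp:linear_closed linear_add linear_smult left_smult_closed)
qed

lemma linear_id: "(%x. x) : lmaps A M M"
 by(auto simp:left_linear_maps_def)

lemma linear_addf:
 assumes "left_module A M" "left_module A N"
  "f : lmaps A M N" "g : lmaps A M N"
 shows "(%x. f x \<oplus>\<^sub>N g x) : lmaps A M N"
proof -
 interpret N: left_module A N by fact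
 show ?thesis using assms(3,4)
  by(intro linear_mapsI)
  (auto simp:linear_closed linear_add linear_smult N.left_smult_r_distr N.M.add4)
qed

lemma linear_negf:
 assumes "left_module A N" "f : lmaps A M N"
 shows "(%x. \<ominus>\<^sub>N f x) : lmaps A M N"
proof -
 interpret N: left_module A N by fact
 show ?thesis using assms(2)
  by(intro linear_mapsI)
  (auto simp:linear_closed linear_add linear_smult N.smult_minus_r N.M.minus_add)
qed

lemma linear_zerof:
 assumes "left_module A N" shows "zf.\<^sub>N : lmaps A M N"
proof -
 interpret N: left_module A N by fact
 show ?thesis by(intro linear_mapsI) auto
qed

lemma linear_finsumf:
 assumes "left_module A M" "left_module A N" "!!i. i : I ==> f i : lmaps A M N"
 shows "(%x. \<Oplus>\<^sub>N i\<in>I. f i x) : lmaps A M N"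
proof -
 interpret N: left_module A N by fact
 have cl: "i : I ==> x : car M ==> f i x : car N" for i x
  using assms(3) linear_closed by fastforce
 show ?thesis
 proof (rule linear_mapsI)
  fix x assume "x : car M"
  thus "(\<Oplus>\<^sub>N i\<in>I. f i x) : car N"
  using cl by(auto intro!: N.M.finsum_closed)
 next
  fix x y assume xy: "x : car M" "y : car M"
  have "(\<Oplus>\<^sub>N i\<in>I. f i (x \<oplus>\<^sub>M y)) = (\<Oplus>\<^sub>N i\<in>I. f i x \<oplus>\<^sub>N f i y)"
  using assms(3) xy cl
  by(intro N.M.finsum_cong') (auto simp:linear_add[OF assms(3)])
  also have "... = (\<Oplus>\<^sub>N i\<in>I. f i x) \<oplus>\<^sub>N (\<Oplus>\<^sub>N i\<in>I. f i y)"
  using xy cl by(intro N.M.finsum_addf) auto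
  finally show "(\<Oplus>\<^sub>N i\<in>I. f i (x \<oplus>\<^sub>M y)) = (\<Oplus>\<^sub>N i\<in>I. f i x) \<oplus>\<^sub>N (\<Oplus>\<^sub>N i\<in>I. f i y)" .
 next
  fix a x assume ax: "a : car A" "x : car M"
  have "(\<Oplus>\<^sub>N i\<in>I. f i (a \<odot>\<^sub>M x)) = (\<Oplus>\<^sub>N i\<in>I. a \<odot>\<^sub>N f i x)"
  using assms(3) ax cl
  by(intro N.M.finsum_cong') (auto simp:linear_smult[OF assms(3)] N.left_smult_closed)
  thus "(\<Oplus>\<^sub>N i\<in>I. f i (a \<odot>\<^sub>M x)) = a \<odot>\<^sub>N (\<Oplus>\<^sub>N i\<in>I. f i x)"
  using ax cl by(subst N.smult_finsum) auto
 qed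
qed

section \<open>Modules of finitely supported functions\<close>

definition mon :: "('a, 'r) ring_scheme => 'a => 'w => 'w => 'a" where
 "mon A a w = (%v. if v = w then a else \<zero>\<^sub>A)"

definition ffun :: "('a, 'r) ring_scheme => 'w set => ('w => 'a) set" where
 "ffun A W = {f. (ALL w. f w : car A) & (supp.\<^sub>A f) \<subseteq> W & finite (supp.\<^sub>A f)}"

definition lin_ext ::
  "('a, 'r) ring_scheme => ('a, 'n, 's) module_scheme => ('w => 'n) => ('w => 'a) => 'n" where
 "lin_ext A N \<phi> f = (\<Oplus>\<^sub>N w\<in>(supp.\<^sub>A f). f w \<odot>\<^sub>N \<phi> w)"

definition free_mod :: "('a, 'r) ring_scheme => 'w set => ('a, 'w => 'a) module" where
 "free_mod A W = \<lparr>carrier = ffun A W, mult = undefined, one = undefined,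
  zero = zf.\<^sub>A, add = (%f g w. f w \<oplus>\<^sub>A g w), smult = (%a f w. a \<otimes>\<^sub>A f w)\<rparr>"

text \<open>Any record whose additive structure and scalar multiplication are those of \<open>free_mod\<close>;
 the remaining record fields are arbitrary.\<close>

locale fun_module = A: ring A
 for A :: "('a, 'r) ring_scheme" and W :: "'w set" and M :: "('a, 'w => 'a, 's) module_scheme" +
 assumes carrier_eq: "car M = ffun A W"
  and zero_eq: "\<zero>\<^sub>M = zf.\<^sub>A"
  and add_eq: "f \<oplus>\<^sub>M g = (%w. f w \<oplus>\<^sub>A g w)"
  and smult_eq: "a \<odot>\<^sub>M f = (%w. a \<otimes>\<^sub>A f w)"

lemma fun_module_free_mod: "ring A ==> fun_module A W (free_mod A W)"
 unfolding fun_module_def fun_module_axioms_def free_mod_def by simp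

lemma ffun_closed: "f : ffun A W ==> f w : car A"
 by(simp add:ffun_def)

lemma ffun_supp: "f : ffun A W ==> f w ~= \<zero>\<^sub>A ==> w : W"
 by(auto simp:ffun_def)

lemma ffun_finite: "f : ffun A W ==> finite (supp.\<^sub>A f)"
 by(simp add:ffun_def)

lemma ffunI:
 assumes "!!w. f w : car A" "finite S" "!!w. f w ~= \<zero>\<^sub>A ==> w : S" "!!w. f w ~= \<zero>\<^sub>A ==> w : W"
 shows "f : ffun A W"
 unfolding ffun_def using assms by(auto intro:finite_subset[of _ S])

lemma ffun_mono: "f : ffun A V ==> V \<subseteq> W ==> f : ffun A W"
 by(auto simp:ffun_def)

context ring
begin

lemma ffun_zero: "zf. : ffun R W"
 by(simp add:ffun_def)

lemma ffun_add:
 assumes "f : ffun R W" "g : ffun R W" shows "(%w. f w \<oplus> g w) : ffun R W"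
proof (rule ffunI[where S = "(supp. f) \<union> (supp. g)"])
 show "w : W" if "f w \<oplus> g w ~= \<zero>" for w
  using assms that ffun_supp[of f R W w] ffun_supp[of g R W w] ffun_closed[of g R W w]
  by(cases "f w = \<zero>") auto
qed (use assms in "auto simp:ffun_closed ffun_finite")

lemma ffun_neg:
 assumes "f : ffun R W" shows "(%w. \<ominus> f w) : ffun R W"
proof -
 have "f w = \<zero> ==> \<ominus> f w = \<zero>" for w by simp
 with assms show ?thesis
  by(intro ffunI[where S = "(supp. f)"])
  (auto simp:ffun_closed ffun_finite intro:ffun_supp)
qed

lemma ffun_diff:
 assumes "f : ffun R W" "g : ffun R W" shows "(%w. f w \<ominus> g w) : ffun R W"
 using ffun_add[OF assms(1) ffun_neg[OF assms(2)]] by(simp add:a_minus_def)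

lemma ffun_smult:
 assumes "a : car R" "f : ffun R W" shows "(%w. a \<otimes> f w) : ffun R W"
proof -
 have "f w = \<zero> ==> a \<otimes> f w = \<zero>" for w using assms(1) by simp
 with assms show ?thesis
  by(intro ffunI[where S = "(supp. f)"])
  (auto simp:ffun_closed ffun_finite intro:ffun_supp)
qed

lemma ffun_mon: "a : car R ==> w : W ==> mon R a w : ffun R W"
 by(rule ffunI[where S = "{w}"]) (auto simp:mon_def split:if_splits)

text \<open>Induction on the size of the support, removing one monomial at a time. Monomials keep a
  coefficient, so the rule also serves for maps that are additive without being linear, such as
  \<open>hh\<close>.\<close>

lemma ffun_induct [consumes 1, case_names zero add mon]:
 fixes f :: "'w => 'a"
 assumes f: "f : ffun R W"
  and zero: "P zf."
  and add:"!!f g. [|f : ffun R W; g : ffun R W; P f; P g|] ==> P (%w. f w \<oplus> g w)"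
  and mon: "!!a w. [|a : car R; w : W|] ==> P (mon R a w)"
 shows "P f"
proof -
 have "ALL f :: 'w => 'a. f : ffun R W --> (supp. f) = S --> P f" if "finite S" for S
  using that
 proof (induct S)
  case empty
  show ?case
  proof (intro allI impI)
  fix f :: "'w => 'a" assume "(supp. f) = {}"
  hence "f = zf." by auto
  thus "P f" using zero by simp
  qed
 next
  case (insert x F)
  show ?case
  proof (intro allI impI)
  fix f assume f: "f : ffun R W" "(supp. f) = insert x F"
  let ?g = "f(x := \<zero>)"
  have g: "?g : ffun R W"
  by(rule ffunI[where S = "(supp. f)"])
  (use f(1) in "auto simp:ffun_closed ffun_finite dest:ffun_supp split:if_splits")
  have "{w. ?g w ~= \<zero>} = F" using f(2) insert(2) by auto
  hence Pg: "P ?g" using g insert(3) by blast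
  have x: "x : W" using f ffun_supp by fastforce
  have fx: "f x : car R" using f(1) by(simp add:ffun_closed)
  have "P (%w. ?g w \<oplus> mon R (f x) x w)"
  using g Pg mon[OF fx x] ffun_mon[OF fx x] by(intro add)
  moreover have "(%w. ?g w \<oplus> mon R (f x) x w) = f"
  using f(1) by(auto simp:mon_def ffun_closed)
  ultimately show "P f" by simp
  qed
 qed
 thus ?thesis using f ffun_finite by blast
qed

end

context fun_module
begin

lemma lm: "left_module A M"
proof -
 have inv: "EX g:car M. g \<oplus>\<^sub>M f = \<zero>\<^sub>M" if "f : car M" for f
 proof
  show "(%w. \<ominus>\<^sub>A f w) : car M" using that by(simp add:carrier_eq A.ffun_neg)
  show "(%w. \<ominus>\<^sub>A f w) \<oplus>\<^sub>M f = \<zero>\<^sub>M"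
  using that by(simp add:add_eq zero_eq carrier_eq ffun_closed A.l_neg)
 qed
 interpret M: abelian_group M
  by(rule abelian_groupI)
  (use inv in "auto simp:carrier_eq zero_eq add_eq A.ffun_zero A.ffun_add
  ffun_closed A.a_ac")
 show ?thesis
  by unfold_locales
  (auto simp:carrier_eq add_eq smult_eq A.ffun_smult ffun_closed A.l_distr A.r_distr A.m_assoc)
qed

sublocale left_module A M by(rule lm)

lemma mon_closed [simp]: "a : car A ==> w : W ==> mon A a w : car M"
 by(simp add:carrier_eq A.ffun_mon)

lemma minus_eq: "f : car M ==> \<ominus>\<^sub>M f = (%w. \<ominus>\<^sub>A f w)"
 by(rule M.minus_equality)
  (auto simp:add_eq zero_eq carrier_eq ffun_closed A.l_neg A.ffun_neg)

lemma diff_eq: "f : car M ==> g : car M ==> f \<ominus>\<^sub>M g = (%w. f w \<ominus>\<^sub>A g w)"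
 by(simp add:a_minus_def minus_eq add_eq)

lemma mon_smult: "a : car A ==> b : car A ==> a \<odot>\<^sub>M mon A b w = mon A (a \<otimes>\<^sub>A b) w"
 by(auto simp:smult_eq mon_def)

lemma finsum_apply:
 assumes "F : I \<rightarrow> car M" shows "(\<Oplus>\<^sub>M i\<in>I. F i) w = (\<Oplus>\<^sub>A i\<in>I. F i w)"
 by(rule additive_finsum[OF M.ab A.ab _ assms])
  (auto intro!: additive_mapsI simp:carrier_eq ffun_closed add_eq)

lemma induct [consumes 1, case_names zero add mon]:
 assumes "f : car M" and "P \<zero>\<^sub>M"
  and "!!f g. [|f : car M; g : car M; P f; P g|] ==> P (f \<oplus>\<^sub>M g)"
  and "!!a w. [|a : car A; w : W|] ==> P (mon A a w)"
 shows "P f"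
 using A.ffun_induct[of f W P] assms by(simp add:carrier_eq add_eq zero_eq)

lemma additive_eqI:
 assumes "abelian_group N" "F : additive_maps M N" "G : additive_maps M N"
  and "!!a w. [|a : car A; w : W|] ==> F (mon A a w) = G (mon A a w)"
  and "f : car M"
 shows "F f = G f"
 using assms(5)
proof (induct rule:induct)
 case zero
 thus ?case using assms by(simp add:additive_zero[OF M.ab])
next
 case (add f g)
 thus ?case using assms by(simp add:additive_add)
next
 case (mon a w)
 thus ?case using assms by simp
qed

lemma linear_eqI:
 assumes "left_module A N" "F : lmaps A M N" "G : lmaps A M N"
  and "!!w. w : W ==> F (mon A \<one>\<^sub>A w) = G (mon A \<one>\<^sub>A w)"
  and "f : car M"
 shows "F f = G f"
proof -
 interpret N: left_module A N by fact
 show ?thesis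
 proof (rule additive_eqI[OF N.M.ab linear_additive[OF assms(2)] linear_additive[OF assms(3)] _ assms(5)])
  fix a w assume aw: "a : car A" "w : W"
  have "mon A a w = a \<odot>\<^sub>M mon A \<one>\<^sub>A w" using aw by(simp add:mon_smult)
  thus "F (mon A a w) = G (mon A a w)"
  using aw assms by(simp add:linear_smult[OF assms(2)] linear_smult[OF assms(3)])
 qed
qed

text \<open>\<open>lin_ext\<close> sums over the support of its argument, which moves with the
  argument. Over a common finite set, additivity and scaling become termwise.\<close>

lemma lin_ext_superset:
 assumes "left_module A N" "\<phi> : W \<rightarrow> car N" "f : car M" "finite S" "(supp.\<^sub>A f) \<subseteq> S" "S \<subseteq> W"
 shows "lin_ext A N \<phi> f = (\<Oplus>\<^sub>N w\<in>S. f w \<odot>\<^sub>N \<phi> w)"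
proof -
 interpret N: left_module A N by fact
 show ?thesis unfolding lin_ext_def
  using assms(2-6) by(intro N.M.finsum_superset) (auto simp:carrier_eq ffun_closed intro!: N.left_smult_closed N.smult_zero_l)
qed

lemma lin_ext_linear:
 assumes "left_module A N" "\<phi> : W \<rightarrow> car N"
 shows "lin_ext A N \<phi> : lmaps A M N"
proof -
 interpret N: left_module A N by fact
 have cl: "f w \<odot>\<^sub>N \<phi> w : car N" if "f : car M" "w : W" for f w
  using assms(2) that by(auto simp:carrier_eq ffun_closed intro!: N.left_smult_closed)
 have supp: "finite (supp.\<^sub>A f)" "(supp.\<^sub>A f) \<subseteq> W" if "f : car M" for f
  using that by(auto simp:carrier_eq ffun_finite dest:ffun_supp)
 show ?thesis
 proof (rule linear_mapsI)
  fix f assume f: "f : car M"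
  show "lin_ext A N \<phi> f : car N"
  unfolding lin_ext_def using cl[OF f] supp[OF f] by(auto intro!: N.M.finsum_closed)
 next
  fix f g assume f: "f : car M" and g: "g : car M"
  let ?S = "(supp.\<^sub>A f) \<union> (supp.\<^sub>A g)"
  have S: "finite ?S" "?S \<subseteq> W" using supp f g by auto
  have fg: "f \<oplus>\<^sub>M g : car M" using f g by simp
  have "{w. (f \<oplus>\<^sub>M g) w ~= \<zero>\<^sub>A} \<subseteq> ?S" using f g by(auto simp:add_eq)
  hence "lin_ext A N \<phi> (f \<oplus>\<^sub>M g) = (\<Oplus>\<^sub>N w\<in>?S. (f \<oplus>\<^sub>M g) w \<odot>\<^sub>N \<phi> w)"
  using fg S by(intro lin_ext_superset assms) auto
  also have "... = (\<Oplus>\<^sub>N w\<in>?S. f w \<odot>\<^sub>N \<phi> w \<oplus>\<^sub>N g w \<odot>\<^sub>N \<phi> w)"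
  using assms(2) S f g cl
  by(intro N.M.finsum_cong')
  (auto simp:add_eq carrier_eq ffun_closed Pi_iff subset_iff intro!: N.left_smult_l_distr)
  also have "... = lin_ext A N \<phi> f \<oplus>\<^sub>N lin_ext A N \<phi> g"
  using S f g cl by(subst N.M.finsum_addf)
  (auto simp:Pi_iff subset_iff lin_ext_superset[OF assms f S(1) _ S(2)] lin_ext_superset[OF assms g S(1) _ S(2)])
  finally show "lin_ext A N \<phi> (f \<oplus>\<^sub>M g) = lin_ext A N \<phi> f \<oplus>\<^sub>N lin_ext A N \<phi> g" .
 next
  fix a f assume a: "a : car A" and f: "f : car M"
  let ?S = "(supp.\<^sub>A f)"
  have S: "finite ?S" "?S \<subseteq> W" using supp f by auto
  have af: "a \<odot>\<^sub>M f : car M" using f a by(simp add:left_smult_closed)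
  have "{w. (a \<odot>\<^sub>M f) w ~= \<zero>\<^sub>A} \<subseteq> ?S" using f a by(auto simp:smult_eq)
  hence "lin_ext A N \<phi> (a \<odot>\<^sub>M f) = (\<Oplus>\<^sub>N w\<in>?S. (a \<odot>\<^sub>M f) w \<odot>\<^sub>N \<phi> w)"
  using af S by(intro lin_ext_superset assms) auto
  also have "... = (\<Oplus>\<^sub>N w\<in>?S. a \<odot>\<^sub>N (f w \<odot>\<^sub>N \<phi> w))"
  using assms(2) S f a cl
  by(intro N.M.finsum_cong')
  (auto simp:smult_eq carrier_eq ffun_closed Pi_iff subset_iff intro!: N.left_smult_assoc N.left_smult_closed)
  also have "... = a \<odot>\<^sub>N lin_ext A N \<phi> f"
  unfolding lin_ext_def using a S f cl by(subst N.smult_finsum) auto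
  finally show "lin_ext A N \<phi> (a \<odot>\<^sub>M f) = a \<odot>\<^sub>N lin_ext A N \<phi> f" .
 qed
qed

lemma lin_ext_mon:
 assumes "left_module A N" "\<phi> : W \<rightarrow> car N" "a : car A" "w : W"
 shows "lin_ext A N \<phi> (mon A a w) = a \<odot>\<^sub>N \<phi> w"
proof -
 interpret N: left_module A N by fact
 have "lin_ext A N \<phi> (mon A a w) = (\<Oplus>\<^sub>N v\<in>{w}. mon A a w v \<odot>\<^sub>N \<phi> v)"
  using assms mon_closed[OF assms(3,4)] by(intro lin_ext_superset) (auto simp:mon_def)
 thus ?thesis using assms by(auto simp:mon_def N.left_smult_closed Pi_iff)
qed

lemma lin_ext_mon_one:
 assumes "left_module A N" "\<phi> : W \<rightarrow> car N" "w : W"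
 shows "lin_ext A N \<phi> (mon A \<one>\<^sub>A w) = \<phi> w"
proof -
 interpret N: left_module A N by fact
 show ?thesis using assms by(auto simp:lin_ext_mon N.left_smult_one Pi_iff)
qed

end

section \<open>Complements of subspaces\<close>

lemma left_module_module:
 assumes "field K" "module K V" shows "left_module K V"
proof -
 interpret module K V by fact
 show ?thesis
  by unfold_locales (auto simp:smult_l_distr smult_r_distr smult_assoc1 smult_one)
qed

locale vector_space_over = F: field K + left_module K V
 for K :: "('k, 'r) ring_scheme" and V :: "('k, 'v, 's) module_scheme" (structure)

text \<open>Closure under negation is not listed, being scaling by -1. \<open>submodule_iff\<close>
  identifies this notion with \<open>submodule\<close>, which occurs in
  \<open>tensor_ideal\<close>.\<close>

definition subspace :: "('k, 'r) ring_scheme => ('k, 'v, 's) module_scheme => 'v set => bool" where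
 "subspace K V N \<longleftrightarrow> N \<subseteq> car V & \<zero>\<^sub>V : N & (ALL x:N. ALL y:N. x \<oplus>\<^sub>V y : N) &
  (ALL c:car K. ALL x:N. c \<odot>\<^sub>V x : N)"

context vector_space_over
begin

lemma subspace_neg: "subspace K V N ==> x : N ==> \<ominus> x : N"
proof -
 assume N: "subspace K V N" "x : N"
 hence x: "x : car V" by(auto simp:subspace_def)
 have "\<ominus> x = (\<ominus>\<^sub>K \<one>\<^sub>K) \<odot> x" using x by(simp add:smult_minus_l left_smult_one)
 thus ?thesis using N by(simp add:subspace_def)
qed

lemma subspace_diff: "subspace K V N ==> x : N ==> y : N ==> x \<ominus> y : N"
 using subspace_neg by(simp add:a_minus_def subspace_def)

lemma subspace_finsum:
 assumes "subspace K V N" "f : I \<rightarrow> N" shows "(\<Oplus> i\<in>I. f i) : N"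
 using assms(2)
proof (induct I rule:infinite_finite_induct)
 case (insert x F)
 moreover have "f : F \<rightarrow> car V" "f x : car V"
  using insert.prems assms(1) by(auto simp:subspace_def)
 ultimately show ?case using assms(1) by(auto simp:subspace_def)
qed (use assms in "auto simp:subspace_def")

lemma smult_inverse:
 assumes "c : car K" "c ~= \<zero>\<^sub>K" "x : car V"
 shows "inv\<^bsub>K\<^esub> c : car K" "inv\<^bsub>K\<^esub> c \<odot> (c \<odot> x) = x"
proof -
 have u: "c : Units K" using assms F.field_Units by simp
 thus 1: "inv\<^bsub>K\<^esub> c : car K" by simp
 have "inv\<^bsub>K\<^esub> c \<odot> (c \<odot> x) = (inv\<^bsub>K\<^esub> c \<otimes>\<^sub>K c) \<odot> x"
  using assms 1 by(simp add:left_smult_assoc)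
 thus "inv\<^bsub>K\<^esub> c \<odot> (c \<odot> x) = x" using u assms by(simp add:left_smult_one)
qed

text \<open>Zorn's lemma for the subspaces that meet N only in zero. A maximal one, C, spans V
  together with N: a vector x outside N + C could be adjoined to C.\<close>

lemma complement_exists:
 assumes N: "subspace K V N"
 obtains C where "subspace K V C" "C \<inter> N = {\<zero>}"
  "!!x. x : car V ==> EX n:N. EX c:C. x = n \<oplus> c"
proof -
 let ?P = "%C. subspace K V C & C \<inter> N = {\<zero>}"
 have z: "?P {\<zero>}" using N by(auto simp:subspace_def)
 have "EX M:{C. ?P C}. ALL X:{C. ?P C}. M \<subseteq> X --> X = M"
 proof (rule subset_Zorn_nonempty)
  show "{C. ?P C} ~= {}" using z by blast
 next
  fix \<C> assume ne: "\<C> ~= {}" and ch: "subset.chain {C. ?P C} \<C>"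
  have P: "?P C" if "C : \<C>" for C using ch that by(auto simp:subset_chain_def)
  have two: "EX C:\<C>. x : C & y : C" if "x : \<Union>\<C>" "y : \<Union>\<C>" for x y
  proof -
  from that obtain C1 C2 where "C1 : \<C>" "C2 : \<C>" "x : C1" "y : C2" by blast
  moreover hence "C1 \<subseteq> C2 \<or> C2 \<subseteq> C1" using ch by(auto simp:subset_chain_def)
  ultimately show ?thesis by blast
  qed
  have "subspace K V (\<Union>\<C>)"
  unfolding subspace_def
  proof (intro conjI ballI)
  show "\<Union>\<C> \<subseteq> car V" using P unfolding subspace_def by blast
  show "\<zero> : \<Union>\<C>" using P ne unfolding subspace_def by blast
  show "x \<oplus> y : \<Union>\<C>" if "x : \<Union>\<C>" "y : \<Union>\<C>" for x y
  using two[OF that] P unfolding subspace_def by blast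
  show "c \<odot> x : \<Union>\<C>" if "c : car K" "x : \<Union>\<C>" for c x
  using that P unfolding subspace_def by blast
  qed
  moreover have "\<Union>\<C> \<inter> N = {\<zero>}" using P ne by blast
  ultimately show "\<Union>\<C> : {C. ?P C}" by blast
 qed
 then obtain C where C0: "C : {C. ?P C}" "ALL X:{C. ?P C}. C \<subseteq> X --> X = C" by(rule bexE)
 hence C: "?P C" and max: "!!X. ?P X ==> C \<subseteq> X ==> X = C" by simp_all
 have "EX n:N. EX c:C. x = n \<oplus> c" if x: "x : car V" for x
 proof (rule ccontr)
  assume no: "\<not> (EX n:N. EX c:C. x = n \<oplus> c)"
  have NC: "N \<subseteq> car V" "C \<subseteq> car V" using N C by(auto simp:subspace_def)
  let ?X = "{c \<oplus> a \<odot> x | c a. c : C & a : car K}"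
  have "subspace K V ?X"
  unfolding subspace_def
  proof (intro conjI ballI)
  show "?X \<subseteq> car V" using NC x by(auto simp:left_smult_closed)
  have "\<zero> = \<zero> \<oplus> \<zero>\<^sub>K \<odot> x" using x by simp
  thus "\<zero> : ?X" using C unfolding subspace_def by blast
  next
  fix u v assume "u : ?X" "v : ?X"
  then obtain c a d b where *: "u = c \<oplus> a \<odot> x" "v = d \<oplus> b \<odot> x"
  "c : C" "d : C" "a : car K" "b : car K" by blast
  hence "u \<oplus> v = (c \<oplus> d) \<oplus> (a \<oplus>\<^sub>K b) \<odot> x"
  using NC x by(auto simp:left_smult_closed left_smult_l_distr subset_iff M.add4)
  moreover have "c \<oplus> d : C" using C * by(auto simp:subspace_def)
  ultimately show "u \<oplus> v : ?X" using * by auto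
  next
  fix b u assume b: "b : car K" and "u : ?X"
  then obtain c a where *: "u = c \<oplus> a \<odot> x" "c : C" "a : car K" by blast
  hence "b \<odot> u = b \<odot> c \<oplus> (b \<otimes>\<^sub>K a) \<odot> x"
  using NC x b by(auto simp:left_smult_closed left_smult_r_distr subset_iff left_smult_assoc)
  moreover have "b \<odot> c : C" using C * b by(auto simp:subspace_def)
  ultimately show "b \<odot> u : ?X" using * b by auto
  qed
  moreover have "?X \<inter> N = {\<zero>}"
  proof -
  have "u = \<zero>" if "u : ?X" "u : N" for u
  proof -
  from that obtain c a where *: "u = c \<oplus> a \<odot> x" "c : C" "a : car K" by blast
  have cV: "c : car V" "u : car V" using * NC that by auto
  \<comment> \<open>If a were nonzero, dividing u = c + a x by a would write x as a sum from N and
    C.\<close>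
  have "a = \<zero>\<^sub>K"
  proof (rule ccontr)
  assume a: "a ~= \<zero>\<^sub>K"
  have i: "inv\<^bsub>K\<^esub> a : car K" using smult_inverse[OF *(3) a x] by simp
  have "a \<odot> x = u \<ominus> c" using * cV x
  by(metis M.a_comm M.add_minus_cancel left_smult_closed)
  hence "x = inv\<^bsub>K\<^esub> a \<odot> (u \<ominus> c)"
  using smult_inverse[OF *(3) a x] by simp
  also have "... = inv\<^bsub>K\<^esub> a \<odot> u \<oplus> (\<ominus> (inv\<^bsub>K\<^esub> a \<odot> c))"
  using i cV by(simp add:a_minus_def left_smult_r_distr smult_minus_r)
  finally have "x = inv\<^bsub>K\<^esub> a \<odot> u \<oplus> (\<ominus> (inv\<^bsub>K\<^esub> a \<odot> c))" .
  moreover have "inv\<^bsub>K\<^esub> a \<odot> u : N" using N that i by(auto simp:subspace_def)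
  moreover have "\<ominus> (inv\<^bsub>K\<^esub> a \<odot> c) : C"
  using C i * subspace_neg by(auto simp:subspace_def)
  ultimately show False using no by blast
  qed
  hence "u = c" using * x cV by simp
  thus ?thesis using C * that by blast
  qed
  moreover have "\<zero> : ?X" "\<zero> : N" using \<open>subspace K V ?X\<close> N by(auto simp:subspace_def)
  ultimately show ?thesis by blast
  qed
  moreover have "C \<subseteq> ?X"
  proof
  fix c assume c: "c : C"
  hence "c = c \<oplus> \<zero>\<^sub>K \<odot> x" using NC x by auto
  thus "c : ?X" using c by blast
  qed
  ultimately have XC: "?X = C" using max by blast
  have "x = \<zero> \<oplus> \<one>\<^sub>K \<odot> x" using x by(simp add:left_smult_one)
  hence "x : ?X" using C unfolding subspace_def by blast
  hence "x : C" using XC by simp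
  moreover have "x = \<zero> \<oplus> x" using x by simp
  ultimately show False using no N unfolding subspace_def by blast
 qed
 thus ?thesis using that C by blast
qed

text \<open>The projection onto a complement along N. It serves twice: to split a differential, and
  later as a linear map whose vanishing detects membership in the span of the tensor
  relations.\<close>

lemma projection_exists:
 assumes N: "subspace K V N"
 obtains rh where "rh : lmaps K V V" "!!x. x : car V ==> rh x = \<zero> \<longleftrightarrow> x : N"
  "!!x. x : car V ==> x \<ominus> rh x : N"
proof -
 obtain C where C: "subspace K V C" "C \<inter> N = {\<zero>}"
  "!!x. x : car V ==> EX n:N. EX c:C. x = n \<oplus> c" using complement_exists[OF N] by metis
 have NC: "N \<subseteq> car V" "C \<subseteq> car V" using N C by(auto simp:subspace_def)
 define rh where "rh x = (SOME c. c : C & x \<ominus> c : N)" for x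
 have rh: "rh x : C & x \<ominus> rh x : N" if x: "x : car V" for x
 proof -
  obtain n c where "n : N" "c : C" "x = n \<oplus> c" using C(3)[OF x] by blast
  hence "c : C & x \<ominus> c : N" using NC by(auto simp:M.add_minus_cancel subset_iff)
  thus ?thesis unfolding rh_def by(rule someI)
 qed
 \<comment> \<open>Two candidates for the component of x in C differ by an element of both C and N.
   Linearity of the chosen component follows from this uniqueness.\<close>
 have uniq: "rh x = c" if x: "x : car V" "c : C" "x \<ominus> c : N" for x c
 proof -
  have cl: "rh x : car V" "c : car V" using rh x NC by auto
  have "(x \<ominus> c) \<ominus> (x \<ominus> rh x) = rh x \<ominus> c"
  using cl x by(intro M.diff_diff_cancel)
  moreover have "(x \<ominus> c) \<ominus> (x \<ominus> rh x) : N" using rh x subspace_diff[OF N] by blast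
  moreover have "rh x \<ominus> c : C" using rh x subspace_diff[OF C(1)] by blast
  ultimately have "rh x \<ominus> c = \<zero>" using C(2) by auto
  thus ?thesis using cl by(simp add:M.diff_zero_iff)
 qed
 show ?thesis
 proof
  show "rh : lmaps K V V"
  proof (rule linear_mapsI)
  show "rh x : car V" if "x : car V" for x using rh that NC by auto
  next
  fix x y assume xy: "x : car V" "y : car V"
  have cl: "rh x : car V" "rh y : car V" using rh xy NC by auto
  show "rh (x \<oplus> y) = rh x \<oplus> rh y"
  using xy cl rh N C(1) by(intro uniq) (auto simp:subspace_def M.minus_add4)
  next
  fix a x assume ax: "a : car K" "x : car V"
  have cl: "rh x : car V" using rh ax NC by auto
  show "rh (a \<odot> x) = a \<odot> rh x"
  using ax cl rh N C(1)
  by(intro uniq) (auto simp:subspace_def left_smult_closed smult_diff_r[symmetric])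
  qed
  show "rh x = \<zero> \<longleftrightarrow> x : N" if "x : car V" for x
  proof
  assume "rh x = \<zero>"
  thus "x : N" using rh[OF that] that by(simp add:M.diff_zero)
  next
  assume "x : N"
  thus "rh x = \<zero>" using that C(1) by(intro uniq) (auto simp:subspace_def M.diff_zero)
  qed
  show "x \<ominus> rh x : N" if "x : car V" for x using rh that by auto
 qed
qed

text \<open>Over a field both the kernel and the image of d have complements. The map s kills a
  complement of the image and sends an element of the image to its preimage in a complement of the
  kernel.\<close>

lemma generalized_inverse_exists:
 assumes d: "d : lmaps K V V"
 obtains s where "s : lmaps K V V" "!!x. x : car V ==> d (s (d x)) = d x"
proof -
 have sub1: "subspace K V {x : car V. d x = \<zero>}"
  unfolding subspace_def using linear_zero[OF M.ab M.ab d]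
  by(auto simp:linear_add[OF d] linear_smult[OF d] left_smult_closed)
 have sub2: "subspace K V (d ` car V)"
  unfolding subspace_def
 proof (intro conjI ballI)
  show "d ` car V \<subseteq> car V" using linear_closed[OF d] by auto
  show "\<zero> : d ` car V"
  using linear_zero[OF M.ab M.ab d] by(metis M.zero_closed image_eqI)
  show "x \<oplus> y : d ` car V" if "x : d ` car V" "y : d ` car V" for x y
  using that linear_add[OF d] by(metis (no_types, lifting) M.a_closed image_iff)
  show "c \<odot> x : d ` car V" if "c : car K" "x : d ` car V" for c x
  using that linear_smult[OF d] by(metis (no_types, lifting) image_iff left_smult_closed)
 qed
 obtain rh where rh: "rh : lmaps K V V" "!!x. x : car V ==> rh x = \<zero> \<longleftrightarrow> d x = \<zero>"
  "!!x. x : car V ==> d (x \<ominus> rh x) = \<zero>"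
  by(rule projection_exists[OF sub1]) auto
 obtain \<tau> where \<tau>: "\<tau> : lmaps K V V" "!!x. x : car V ==> \<tau> x = \<zero> \<longleftrightarrow> x : d ` car V"
  "!!x. x : car V ==> x \<ominus> \<tau> x : d ` car V"
  by(fact projection_exists[OF sub2])
 define q where "q y = (SOME x. x : car V & d x = y \<ominus> \<tau> y)" for y
 have q: "q y : car V & d (q y) = y \<ominus> \<tau> y" if y: "y : car V" for y
 proof -
  obtain x where "y \<ominus> \<tau> y = d x" "x : car V" using \<tau>(3)[OF y] by(rule imageE)
  hence "x : car V & d x = y \<ominus> \<tau> y" by(intro conjI) (assumption, rule sym)
  thus ?thesis unfolding q_def by(rule someI)
 qed
 have drh: "d (rh x) = d x" if "x : car V" for x
  using rh(3)[OF that] that linear_closed[OF rh(1)] linear_closed[OF d]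
  by(simp add:linear_diff[OF M.ab M.ab d] M.diff_zero_iff)
 \<comment> \<open>\<open>q\<close> is a mere choice of preimages. Two preimages of the same element
   differ by an element of the kernel, which \<open>rh\<close> removes, so \<open>rh\<close> after
   \<open>q\<close> is linear.\<close>
 have rheq: "rh x = rh y" if "x : car V" "y : car V" "d x = d y" for x y
 proof -
  have "rh (x \<ominus> y) = \<zero>" using that linear_closed[OF d]
  by(simp add:rh(2) linear_diff[OF M.ab M.ab d] M.diff_self)
  thus ?thesis using that linear_closed[OF rh(1)]
  by(simp add:linear_diff[OF M.ab M.ab rh(1)] M.diff_zero_iff)
 qed
 show ?thesis
 proof
  show "(%y. rh (q y)) : lmaps K V V"
  proof (rule linear_mapsI)
  show "rh (q x) : car V" if "x : car V" for x using that q linear_closed[OF rh(1)] by auto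
  next
  fix x y assume xy: "x : car V" "y : car V"
  have "rh (q (x \<oplus> y)) = rh (q x \<oplus> q y)"
  using xy q linear_closed[OF \<tau>(1)] by(intro rheq) (auto simp:linear_add[OF d] linear_add[OF \<tau>(1)] M.minus_add4)
  thus "rh (q (x \<oplus> y)) = rh (q x) \<oplus> rh (q y)" using xy q by(simp add:linear_add[OF rh(1)])
  next
  fix a x assume ax: "a : car K" "x : car V"
  have "rh (q (a \<odot> x)) = rh (a \<odot> q x)"
  using ax q linear_closed[OF \<tau>(1)]
  by(intro rheq) (auto simp:linear_smult[OF d] linear_smult[OF \<tau>(1)] smult_diff_r left_smult_closed)
  thus "rh (q (a \<odot> x)) = a \<odot> rh (q x)" using ax q by(simp add:linear_smult[OF rh(1)])
  qed
  show "d (rh (q (d x))) = d x" if "x : car V" for x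
  proof -
  have "d x : car V" using that linear_closed[OF d] by auto
  moreover have "\<tau> (d x) = \<zero>" using \<tau>(2) calculation that by auto
  ultimately show ?thesis using q drh by(auto simp:M.diff_zero)
  qed
 qed
qed

end

section \<open>Graded groups and graded homomorphisms\<close>

definition gcomp :: "('a, 'r) ring_scheme => (int => 'a set) => 'a => int => 'a" where
 "gcomp V G x = (THE f. (ALL j. f j : G j) & finite (supp.\<^sub>V f) &
  x = (\<Oplus>\<^sub>V j\<in>(supp.\<^sub>V f). f j))"

locale graded_group = abelian_group V for V :: "('a, 'r) ring_scheme" +
 fixes G :: "int => 'a set"
 assumes is_grading: "is_grading V G"
begin

lemma piece_subgroup: "additive_subgroup (G j) V"
 using is_grading by(simp add:is_grading_def)

lemma piece_closed: "x : G j ==> x : car V"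
 using additive_subgroup.a_subset[OF piece_subgroup[of j]] by blast

lemma piece_zero [simp]: "\<zero>\<^sub>V : G j"
 by(rule additive_subgroup.zero_closed[OF piece_subgroup])

lemma piece_add: "x : G j ==> y : G j ==> x \<oplus>\<^sub>V y : G j"
 by(rule additive_subgroup.a_closed[OF piece_subgroup])

lemma piece_neg: "x : G j ==> \<ominus>\<^sub>V x : G j"
 by(rule additive_subgroup.a_inv_closed[OF piece_subgroup])

lemma piece_finsum: "f : I \<rightarrow> G j ==> (\<Oplus>\<^sub>V i\<in>I. f i) : G j"
proof (induct I rule:infinite_finite_induct)
 case (insert x F)
 hence "f : F \<rightarrow> car V" "f x : car V" using piece_closed by auto
 with insert show ?case by(auto intro:piece_add)
qed auto

lemma gcomp_props:
 assumes "x : car V"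
 shows "gcomp V G x j : G j" "finite {j. gcomp V G x j ~= \<zero>\<^sub>V}"
  "x = (\<Oplus>\<^sub>V j\<in>{j. gcomp V G x j ~= \<zero>\<^sub>V}. gcomp V G x j)"
proof -
 have "EX! f. (ALL j. f j : G j) & finite (supp.\<^sub>V f) & x = (\<Oplus>\<^sub>V j\<in>(supp.\<^sub>V f). f j)"
  using is_grading assms by(simp add:is_grading_def)
 from theI'[OF this] show "gcomp V G x j : G j" "finite {j. gcomp V G x j ~= \<zero>\<^sub>V}"
  "x = (\<Oplus>\<^sub>V j\<in>{j. gcomp V G x j ~= \<zero>\<^sub>V}. gcomp V G x j)"
  unfolding gcomp_def by blast+
qed

lemma gcomp_closed [simp]: "x : car V ==> gcomp V G x j : car V"
 using gcomp_props(1) piece_closed by blast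

lemma gcomp_unique:
 assumes "!!j. f j : G j" "finite S" "!!j. j \<notin> S ==> f j = \<zero>\<^sub>V" "x = (\<Oplus>\<^sub>V j\<in>S. f j)"
 shows "gcomp V G x = f"
proof -
 have fc: "f : S \<rightarrow> car V" using assms(1) piece_closed by auto
 have sub: "(supp.\<^sub>V f) \<subseteq> S" using assms(3) by auto
 have "x = (\<Oplus>\<^sub>V j\<in>(supp.\<^sub>V f). f j)"
  using fc sub assms(2) unfolding assms(4) by(intro finsum_superset[symmetric]) auto
 moreover have "x : car V" using assms(4) fc by simp
 moreover have "finite (supp.\<^sub>V f)" using sub assms(2) finite_subset by blast
 moreover have "EX! f. (ALL j. f j : G j) & finite (supp.\<^sub>V f) & x = (\<Oplus>\<^sub>V j\<in>(supp.\<^sub>V f). f j)"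
  using is_grading calculation(2) by(simp add:is_grading_def)
 ultimately show ?thesis unfolding gcomp_def using assms(1) by(intro the1_equality) auto
qed

lemma gcomp_sum:
 assumes "x : car V" "finite S" "!!j. j \<notin> S ==> gcomp V G x j = \<zero>\<^sub>V"
 shows "x = (\<Oplus>\<^sub>V j\<in>S. gcomp V G x j)"
proof -
 have "(\<Oplus>\<^sub>V j\<in>{j. gcomp V G x j ~= \<zero>\<^sub>V}. gcomp V G x j) = (\<Oplus>\<^sub>V j\<in>S. gcomp V G x j)"
  using assms by(intro finsum_superset) auto
 thus ?thesis using gcomp_props(3)[OF assms(1)] by simp
qed

lemma gcomp_homog: "x : G i ==> gcomp V G x j = (if j = i then x else \<zero>\<^sub>V)"
 using gcomp_unique[of "%j. if j = i then x else \<zero>\<^sub>V" "{i}" x] piece_closed[of x i] by auto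

lemma gcomp_add:
 assumes "x : car V" "y : car V"
 shows "gcomp V G (x \<oplus>\<^sub>V y) j = gcomp V G x j \<oplus>\<^sub>V gcomp V G y j"
proof -
 let ?S = "{j. gcomp V G x j ~= \<zero>\<^sub>V} \<union> {j. gcomp V G y j ~= \<zero>\<^sub>V}"
 have fin: "finite ?S" using gcomp_props(2) assms by simp
 have "gcomp V G (x \<oplus>\<^sub>V y) = (%j. gcomp V G x j \<oplus>\<^sub>V gcomp V G y j)"
 proof (rule gcomp_unique[OF _ fin])
  show "gcomp V G x j \<oplus>\<^sub>V gcomp V G y j : G j" for j
  using gcomp_props(1) assms piece_add by auto
  show "gcomp V G x j \<oplus>\<^sub>V gcomp V G y j = \<zero>\<^sub>V" if "j \<notin> ?S" for j using that by auto
  have "x = (\<Oplus>\<^sub>V j\<in>?S. gcomp V G x j)" "y = (\<Oplus>\<^sub>V j\<in>?S. gcomp V G y j)"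
  using assms fin by(auto intro!: gcomp_sum)
  thus "x \<oplus>\<^sub>V y = (\<Oplus>\<^sub>V j\<in>?S. gcomp V G x j \<oplus>\<^sub>V gcomp V G y j)"
  using assms by(subst finsum_addf) auto
 qed
 thus ?thesis by simp
qed

lemma gcomp_additive: "(%x. gcomp V G x j) : additive_maps V V"
 by(intro additive_mapsI) (auto simp:gcomp_add)

lemma gcomp_finsum:
 "f : I \<rightarrow> car V ==> gcomp V G (\<Oplus>\<^sub>V i\<in>I. f i) j = (\<Oplus>\<^sub>V i\<in>I. gcomp V G (f i) j)"
 by(rule additive_finsum[OF ab ab gcomp_additive])

lemma graded_induct [consumes 1, case_names zero add homog]:
 assumes "x : car V" "P \<zero>\<^sub>V"
  and "!!x y. [|x : car V; y : car V; P x; P y|] ==> P (x \<oplus>\<^sub>V y)"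
  and "!!j x. x : G j ==> P x"
 shows "P x"
proof -
 have "P (\<Oplus>\<^sub>V j\<in>S. gcomp V G x j)" if "finite S" for S
  using that
 proof (induct S)
  case (insert j S)
  have "(\<Oplus>\<^sub>V j\<in>S. gcomp V G x j) : car V" using assms(1) by(simp add:Pi_iff)
  thus ?case using insert assms(3)[OF gcomp_closed[OF assms(1)]] assms(4)[OF gcomp_props(1)[OF assms(1)]] assms(1)
  by(simp add:Pi_iff)
 qed (use assms in simp)
 thus ?thesis using gcomp_props(2,3)[OF assms(1)] by metis
qed

end

lemma (in abelian_group) additive_subgroup_intro:
 assumes "H \<subseteq> car G" "\<zero> : H" "!!x y. x : H ==> y : H ==> x \<oplus> y : H" "!!x. x : H ==> \<ominus> x : H"
 shows "additive_subgroup H G"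
 using assms by(intro additive_subgroup.intro add.subgroupI) auto

text \<open>Additive projections p suffice: applied to any decomposition of x, they return its
  terms, so the decomposition is unique.\<close>

lemma is_gradingI:
 assumes "abelian_group V" and sub: "!!j. additive_subgroup (G j) V"
  and p: "!!x j. x : car V ==> p x j : G j"
  "!!x. x : car V ==> finite {j. p x j ~= \<zero>\<^sub>V}"
  "!!x. x : car V ==> x = (\<Oplus>\<^sub>V j\<in>{j. p x j ~= \<zero>\<^sub>V}. p x j)"
  "!!x y j. x : car V ==> y : car V ==> p (x \<oplus>\<^sub>V y) j = p x j \<oplus>\<^sub>V p y j"
  "!!x i j. x : G i ==> p x j = (if j = i then x else \<zero>\<^sub>V)"
 shows "is_grading V G"
 unfolding is_grading_def
proof (intro conjI ballI allI sub)
 interpret V: abelian_group V by fact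
 fix x assume x: "x : car V"
 have GV: "y : G j ==> y : car V" for y j using additive_subgroup.a_subset[OF sub] by blast
 have pa: "(%x. p x j) : additive_maps V V" for j
  by(intro additive_mapsI p) (use GV p in auto)
 show "EX! f. (ALL j. f j : G j) & finite (supp.\<^sub>V f) & x = (\<Oplus>\<^sub>V j\<in>(supp.\<^sub>V f). f j)"
 proof (rule ex1I[of _ "p x"])
  show "(ALL j. p x j : G j) & finite {j. p x j ~= \<zero>\<^sub>V} & x = (\<Oplus>\<^sub>V j\<in>{j. p x j ~= \<zero>\<^sub>V}. p x j)"
  using p(1-3)[OF x] by blast
 next
  fix f assume f: "(ALL j. f j : G j) & finite (supp.\<^sub>V f) & x = (\<Oplus>\<^sub>V j\<in>(supp.\<^sub>V f). f j)"
  let ?S = "(supp.\<^sub>V f)"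
  have fV: "f j : car V" for j using f GV by blast
  show "f = p x"
  proof
  fix j
  have "p x j = (\<Oplus>\<^sub>V i\<in>?S. p (f i) j)"
  using additive_finsum[OF assms(1,1) pa, of f ?S j] f fV by auto
  also have "... = (\<Oplus>\<^sub>V i\<in>?S. if j = i then f i else \<zero>\<^sub>V)"
  using f p(5) fV by(intro V.finsum_cong') auto
  also have "... = f j"
  proof (cases "j : ?S")
  case True
  thus ?thesis using f fV by(subst V.finsum_single[of _ j]) auto
  next
  case False
  hence "(\<Oplus>\<^sub>V i\<in>?S. if j = i then f i else \<zero>\<^sub>V) = \<zero>\<^sub>V" by(intro V.finsum_zeroI) auto
  thus ?thesis using False by simp
  qed
  finally show "f j = p x j" by simp
  qed
 qed
qed

text \<open>Both sides are additive in x, so homogeneous x suffice. The cases of interest are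
  multiplication by a homogeneous element, scaling, and maps of degree zero between modules.\<close>

lemma gcomp_shift:
 assumes "graded_group V G" "graded_group W H" "f : additive_maps V W"
  and deg: "!!i y. y : G i ==> f y : H (i + k)" and x: "x : car V"
 shows "gcomp W H (f x) (i + k) = f (gcomp V G x i)"
proof -
 interpret V: graded_group V G by fact
 interpret W: graded_group W H by fact
 note z = additive_zero[OF V.ab W.ab assms(3)]
 note fc = additive_closed[OF assms(3)]
 show ?thesis using x
 proof (induct rule:V.graded_induct)
  case zero
  thus ?case using z V.gcomp_homog[OF V.piece_zero] W.gcomp_homog[OF W.piece_zero] by simp
 next
  case (add x y)
  thus ?case using fc by(simp add:additive_add[OF assms(3)] W.gcomp_add V.gcomp_add)
 next
  case (homog j x)
  thus ?case using z W.gcomp_homog[OF deg[OF homog]] V.gcomp_homog[OF homog] by auto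
 qed
qed

lemma glm_group: "graded_left_module A M ==> graded_group M (mod_gr M)"
 unfolding graded_left_module_def graded_left_module_axioms_def graded_group_def graded_group_axioms_def
  left_module_def by blast

lemma graded_left_module_left: "graded_left_module A M ==> left_module A M"
 by(simp add:graded_left_module_def)

lemma hd_linear: "f : dhoms A M N j ==> f : lmaps A M N"
 by(simp add:homs_of_degree_def)

lemma hd_piece: "f : dhoms A M N j ==> x : mod_gr M i ==> f x : mod_gr N (i + j)"
 by(auto simp:homs_of_degree_def)

lemma hdI:
 "f : lmaps A M N ==> (!!i x. x : mod_gr M i ==> f x : mod_gr N (i + j))
  ==> f : dhoms A M N j"
 by(auto simp:homs_of_degree_def)

lemma gh_linear: "f : ghoms A M N ==> f : lmaps A M N"
 by(simp add:graded_homs_def)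

lemma gh_closed: "f : ghoms A M N ==> x : car M ==> f x : car N"
 using gh_linear linear_closed by metis

lemma gh_cong:
 assumes "f : ghoms A M N" "!!x. x : car M ==> g x = f x" "left_module A M"
 shows "g : ghoms A M N"
 using assms(1,2) linear_cong[OF gh_linear[OF assms(1)] assms(2,3)]
 unfolding graded_homs_def by simp

section \<open>Closure of graded Hom under linear operations\<close>

context
 fixes A :: "('a, 'r) ring_scheme" and M :: "('a, 'm, 's) gr_module_scheme"
  and N :: "('a, 'n, 't) gr_module_scheme"
 assumes M: "left_module A M" "graded_group M (mod_gr M)"
  and N: "left_module A N" "graded_group N (mod_gr N)"
begin

interpretation M: left_module A M by(rule M)
interpretation N: left_module A N by(rule N)
interpretation MG: graded_group M "mod_gr M" by(rule M)
interpretation NG: graded_group N "mod_gr N" by(rule N)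

lemma hd_add:
 assumes "f : dhoms A M N j" "g : dhoms A M N j"
 shows "(%x. f x \<oplus>\<^sub>N g x) : dhoms A M N j"
 using assms linear_addf[OF M(1) N(1) hd_linear[OF assms(1)] hd_linear[OF assms(2)]]
 by(intro hdI) (auto intro:NG.piece_add hd_piece)

lemma hd_zero: "zf.\<^sub>N : dhoms A M N j"
 using linear_zerof[OF N(1)] by(intro hdI) auto

lemma hd_graded:
 assumes "f : dhoms A M N j" shows "f : ghoms A M N"
proof -
 have "f x = (\<Oplus>\<^sub>N i\<in>{j}. f x)" if "x : car M" for x
  using linear_closed[OF hd_linear[OF assms] that] by simp
 thus ?thesis unfolding graded_homs_def
  using hd_linear[OF assms] assms
  by(auto intro!: exI[of _ "{j}"] exI[of _ "%_. f"])
qed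

lemma gh_zero: "zf.\<^sub>N : ghoms A M N"
 by(rule hd_graded[OF hd_zero])

lemma gh_add:
 assumes "f : ghoms A M N" "g : ghoms A M N"
 shows "(%x. f x \<oplus>\<^sub>N g x) : ghoms A M N"
proof -
 obtain I h where I: "finite I" "!!j. j : I ==> h j : dhoms A M N j"
  "!!x. x : car M ==> f x = (\<Oplus>\<^sub>N j\<in>I. h j x)"
  using assms(1) unfolding graded_homs_def by blast
 obtain J k where J: "finite J" "!!j. j : J ==> k j : dhoms A M N j"
  "!!x. x : car M ==> g x = (\<Oplus>\<^sub>N j\<in>J. k j x)"
  using assms(2) unfolding graded_homs_def by blast
 \<comment> \<open>The two decompositions may involve different sets of degrees; both are extended
   by zero to the union.\<close>
 define h' where "h' j x = (if j : I then h j x else \<zero>\<^sub>N)" for j x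
 define k' where "k' j x = (if j : J then k j x else \<zero>\<^sub>N)" for j x
 have h': "h' j : dhoms A M N j" and k': "k' j : dhoms A M N j" for j
  using I(2)[of j] J(2)[of j] hd_zero[of j] unfolding h'_def k'_def
  by(cases "j : I"; cases "j : J"; simp)+
 have cl: "h' j x : car N" "k' j x : car N" if "x : car M" for j x
  using linear_closed[OF hd_linear[OF h'] that] linear_closed[OF hd_linear[OF k'] that] by auto
 have fx: "f x = (\<Oplus>\<^sub>N j\<in>I \<union> J. h' j x)" if "x : car M" for x
  unfolding I(3)[OF that] using I(1) J(1) cl[OF that] h'_def
  by(intro N.M.add.finprod_mono_neutral_cong_left) auto
 have gx: "g x = (\<Oplus>\<^sub>N j\<in>I \<union> J. k' j x)" if "x : car M" for x
  unfolding J(3)[OF that] using I(1) J(1) cl[OF that] k'_def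
  by(intro N.M.add.finprod_mono_neutral_cong_left) auto
 have "f x \<oplus>\<^sub>N g x = (\<Oplus>\<^sub>N j\<in>I \<union> J. h' j x \<oplus>\<^sub>N k' j x)" if "x : car M" for x
  using fx[OF that] gx[OF that] cl[OF that] by(simp add:N.M.finsum_addf)
 moreover have "(%x. h' j x \<oplus>\<^sub>N k' j x) : dhoms A M N j" for j
  using hd_add h' k' by blast
 ultimately show ?thesis unfolding graded_homs_def
  using I(1) J(1) linear_addf[OF M(1) N(1) gh_linear[OF assms(1)] gh_linear[OF assms(2)]]
  by(auto intro!: exI[of _ "I \<union> J"] exI[of _ "%j x. h' j x \<oplus>\<^sub>N k' j x"])
qed

lemma gh_finsum:
 "finite I ==> (!!i. i : I ==> f i : ghoms A M N) ==> (%x. \<Oplus>\<^sub>N i\<in>I. f i x) : ghoms A M N"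
proof (induct I rule:finite_induct)
 case empty
 thus ?case using gh_zero by simp
next
 case (insert i I)
 have "(%x. f i x \<oplus>\<^sub>N (\<Oplus>\<^sub>N i\<in>I. f i x)) : ghoms A M N"
  using insert by(intro gh_add) auto
 thus ?case
 proof (rule gh_cong[OF _ _ M(1)])
  fix x assume "x : car M"
  hence "f j x : car N" if "j : insert i I" for j
  using insert.prems[OF that] gh_closed by metis
  thus "(\<Oplus>\<^sub>N i\<in>insert i I. f i x) = f i x \<oplus>\<^sub>N (\<Oplus>\<^sub>N i\<in>I. f i x)"
  using insert by(intro N.M.finsum_insert) auto
 qed
qed

lemma gh_neg:
 assumes "f : ghoms A M N" shows "(%x. \<ominus>\<^sub>N f x) : ghoms A M N"
proof -
 obtain I h where I: "finite I" "!!j. j : I ==> h j : dhoms A M N j"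
  "!!x. x : car M ==> f x = (\<Oplus>\<^sub>N j\<in>I. h j x)"
  using assms unfolding graded_homs_def by blast
 have n: "(%x. \<ominus>\<^sub>N h j x) : dhoms A M N j" if "j : I" for j
  using I(2)[OF that] linear_negf[OF N(1) hd_linear[OF I(2)[OF that]]]
  by(intro hdI) (auto intro:NG.piece_neg hd_piece)
 have "(%x. \<Oplus>\<^sub>N j\<in>I. \<ominus>\<^sub>N h j x) : ghoms A M N"
  using gh_finsum[OF I(1), of "%j x. \<ominus>\<^sub>N h j x"] hd_graded n by blast
 thus ?thesis
 proof (rule gh_cong[OF _ _ M(1)])
  fix x assume x: "x : car M"
  hence "(%j. h j x) : I \<rightarrow> car N" using I(2) hd_linear linear_closed by fastforce
  thus "\<ominus>\<^sub>N f x = (\<Oplus>\<^sub>N j\<in>I. \<ominus>\<^sub>N h j x)" using I(3)[OF x] by(simp add:N.M.finsum_neg)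
 qed
qed

lemma gh_diff:
 assumes "f : ghoms A M N" "g : ghoms A M N"
 shows "(%x. f x \<ominus>\<^sub>N g x) : ghoms A M N"
 using gh_add[OF assms(1) gh_neg[OF assms(2)]] by(simp add:a_minus_def)

end

text \<open>Composing homogeneous parts adds their degrees, so the composite is a finite double sum
  of homogeneous maps.\<close>

lemma gh_comp:
 assumes L: "left_module A L" "graded_group L (mod_gr L)"
  and M: "left_module A M" "graded_group M (mod_gr M)"
  and N: "left_module A N" "graded_group N (mod_gr N)"
  and f: "f : ghoms A M N" and g: "g : ghoms A L M"
 shows "(%x. f (g x)) : ghoms A L N"
proof -
 interpret M: left_module A M by fact
 interpret N: left_module A N by fact
 obtain I h where I: "finite I" "!!j. j : I ==> h j : dhoms A M N j"
  "!!x. x : car M ==> f x = (\<Oplus>\<^sub>N j\<in>I. h j x)"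
  using f unfolding graded_homs_def by blast
 obtain J k where J: "finite J" "!!j. j : J ==> k j : dhoms A L M j"
  "!!x. x : car L ==> g x = (\<Oplus>\<^sub>M j\<in>J. k j x)"
  using g unfolding graded_homs_def by blast
 have "(%x. h i (k j x)) : dhoms A L N (j + i)" if "i : I" "j : J" for i j
  using linear_comp[OF hd_linear[OF I(2)[OF that(1)]] hd_linear[OF J(2)[OF that(2)]]]
  hd_piece[OF I(2)[OF that(1)] hd_piece[OF J(2)[OF that(2)]]]
  by(intro hdI) (auto simp:add.assoc)
 hence "(%x. h i (k j x)) : ghoms A L N" if "i : I" "j : J" for i j
  using hd_graded[OF L N] that by blast
 hence "(%x. \<Oplus>\<^sub>N i\<in>I. \<Oplus>\<^sub>N j\<in>J. h i (k j x)) : ghoms A L N"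
  using I(1) J(1) by(intro gh_finsum[OF L N]) auto
 thus ?thesis
 proof (rule gh_cong[OF _ _ L(1)])
  fix x assume x: "x : car L"
  have kx: "(%j. k j x) : J \<rightarrow> car M" using J(2) hd_linear linear_closed[OF _ x] by fastforce
  hence gx: "g x : car M" using J(3)[OF x] by simp
  have eq: "h i (g x) = (\<Oplus>\<^sub>N j\<in>J. h i (k j x))" if "i : I" for i
  unfolding J(3)[OF x]
  by(rule linear_finsum[OF M.M.ab N.M.ab hd_linear[OF I(2)[OF that]] kx])
  have cl: "h i (g x) : car N" if "i : I" for i using linear_closed[OF hd_linear[OF I(2)[OF that]] gx] .
  show "f (g x) = (\<Oplus>\<^sub>N i\<in>I. \<Oplus>\<^sub>N j\<in>J. h i (k j x))"
  unfolding I(3)[OF gx] using eq cl by(intro N.M.finsum_cong') (auto simp:eq[symmetric])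
 qed
qed

section \<open>The augmentation, the trivial module and the unit\<close>

context graded_augmented_algebra
begin

sublocale AG: graded_group A "alg_gr A"
 by(intro graded_group.intro graded_group_axioms.intro A.ab grading)

lemma aug_closed [simp]: "a : car A ==> aug A a : car K"
 using ring_hom_closed[OF aug_ring_hom] .

lemma aug_add: "a : car A ==> b : car A ==> aug A (a \<oplus>\<^sub>A b) = aug A a \<oplus>\<^sub>K aug A b"
 using ring_hom_add[OF aug_ring_hom] .

lemma aug_mult: "a : car A ==> b : car A ==> aug A (a \<otimes>\<^sub>A b) = aug A a \<otimes>\<^sub>K aug A b"
 using ring_hom_mult[OF aug_ring_hom] .

lemma aug_one [simp]: "aug A \<one>\<^sub>A = \<one>\<^sub>K"
 using ring_hom_one[OF aug_ring_hom] .

lemma aug_additive: "aug A : additive_maps A K"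
 by(intro additive_mapsI) (auto simp:aug_add)

lemma aug_zero [simp]: "aug A \<zero>\<^sub>A = \<zero>\<^sub>K"
 by(rule additive_zero[OF A.ab K.ab aug_additive])

abbreviation "triv \<equiv> trivial_module K A"

lemma triv_simps [simp]:
 "car triv = car K" "\<zero>\<^sub>triv = \<zero>\<^sub>K" "add triv = add K"
 "smult triv a c = aug A a \<otimes>\<^sub>K c" "mod_gr triv j = (if j = 0 then car K else {\<zero>\<^sub>K})"
 by(simp_all add:trivial_module_def)

text \<open>\<open>finsum\<close> sees only the carrier, zero and addition, which the trivial module
  shares with K.\<close>

lemma triv_finsum [simp]: "finsum triv f I = finsum K f I"
 by(simp add:finsum_def finprod_def)

lemma triv_neg [simp]: "\<ominus>\<^sub>triv x = \<ominus>\<^sub>K x" "x \<ominus>\<^sub>triv y = x \<ominus>\<^sub>K y"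
 by(simp_all add:a_inv_def a_minus_def m_inv_def)

lemma triv_left_module: "left_module A triv"
proof -
 interpret T: abelian_group triv
  by(rule abelian_groupI) (auto simp:K.a_ac intro:bexI[of _ "\<ominus>\<^sub>K x" for x] K.r_neg)
 show ?thesis
  by unfold_locales (auto simp:aug_add aug_mult K.l_distr K.r_distr K.m_assoc)
qed

lemma triv_graded: "graded_left_module A triv"
proof -
 interpret T: left_module A triv by(rule triv_left_module)
 have "is_grading triv (mod_gr triv)"
 proof (rule is_gradingI[where p = "%x j. if j = 0 then x else \<zero>\<^sub>K"])
  show "additive_subgroup (mod_gr triv j) triv" for j
  by(rule T.M.additive_subgroup_intro) auto
  show "finite {j::int. (if j = 0 then x else \<zero>\<^sub>K) ~= \<zero>\<^sub>triv}" for x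
  by(rule finite_subset[of _ "{0}"]) auto
  fix x assume x: "x : car triv"
  have "(\<Oplus>\<^sub>K j\<in>{j::int. (if j = 0 then x else \<zero>\<^sub>K) ~= \<zero>\<^sub>K}. if j = 0 then x else \<zero>\<^sub>K) =
  (\<Oplus>\<^sub>K j\<in>{0::int}. if j = 0 then x else \<zero>\<^sub>K)"
  using x by(intro K.finsum_superset) (auto split:if_splits)
  also have "... = x" using x by simp
  finally show "x = (\<Oplus>\<^sub>triv j\<in>{j::int. (if j = 0 then x else \<zero>\<^sub>K) ~= \<zero>\<^sub>triv}. if j = 0 then x else \<zero>\<^sub>K)"
  unfolding triv_simps triv_finsum by(rule sym)
 qed (auto simp:T.M.ab split:if_splits)
 moreover have "a \<odot>\<^sub>triv x : mod_gr triv (i + j)"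
  if a: "a : alg_gr A i" and x: "x : mod_gr triv j" for a x i j
 proof (cases "i = 0")
  case True
  thus ?thesis using a x AG.piece_closed[OF a] by(auto split:if_splits)
 next
  case False
  thus ?thesis using gr_aug[OF False a] x by(auto split:if_splits)
 qed
 ultimately show ?thesis
  by(intro graded_left_module.intro triv_left_module graded_left_module_axioms.intro)
qed

text \<open>The degree zero component u of the unit is a right unit: for homogeneous x, comparing
  components of degree deg x in x 1 = x gives x u = x. Taking x = 1 yields 1 = u.\<close>

lemma one_homogeneous: "\<one>\<^sub>A : alg_gr A 0"
proof -
 let ?u = "gcomp A (alg_gr A) \<one>\<^sub>A"
 have u: "?u 0 : car A" by simp
 have "x = x \<otimes>\<^sub>A ?u 0" if "x : car A" for x
  using that
 proof (induct rule:AG.graded_induct)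
  case zero
  thus ?case using u by simp
 next
  case (add x y)
  thus ?case using u by(metis A.l_distr)
 next
  case (homog j x)
  have x: "x : car A" using homog AG.piece_closed by blast
  have "gcomp A (alg_gr A) (x \<otimes>\<^sub>A \<one>\<^sub>A) (0 + j) = x \<otimes>\<^sub>A ?u 0"
  proof (rule gcomp_shift[OF AG.graded_group_axioms AG.graded_group_axioms])
  show "(\<otimes>\<^sub>A) x : additive_maps A A" using x by(intro additive_mapsI) (auto simp:A.r_distr)
  show "x \<otimes>\<^sub>A y : alg_gr A (i + j)" if "y : alg_gr A i" for i y
  using gr_mult[OF homog that] by(simp add:add.commute)
  qed simp
  thus ?case using x AG.gcomp_homog[OF homog] by simp
 qed
 from this[of "\<one>\<^sub>A"] have "\<one>\<^sub>A = ?u 0" using u by simp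
 thus ?thesis using AG.gcomp_props(1)[of "\<one>\<^sub>A" 0] by simp
qed

section \<open>Lifting through free modules\<close>

text \<open>\<open>graded_free\<close> only asks the basis to be homogeneous. The degrees of the
  coordinates come from uniqueness: replacing every coordinate of a homogeneous y by its component
  of the expected degree gives another expansion of y.\<close>

lemma graded_free_coords:
 assumes F: "graded_left_module A F" "graded_free A F"
 obtains X deg c where "X \<subseteq> car F" "!!x. x : X ==> x : mod_gr F (deg x)"
  "c : lmaps A F (free_mod A X)"
  "!!y. y : car F ==> lin_ext A F (%x. x) (c y) = y"
  "!!x y i. y : mod_gr F i ==> x : X ==> c y x : alg_gr A (i - deg x)"
proof -
 interpret F: graded_left_module A F by fact
 interpret FG: graded_group F "mod_gr F" by(rule glm_group[OF F(1)])
 obtain X where X: "X \<subseteq> (\<Union>j. mod_gr F j)"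
  and ex: "ALL y:car F. EX! c. (ALL x. c x : car A) & (supp.\<^sub>A c) \<subseteq> X &
  finite (supp.\<^sub>A c) & y = (\<Oplus>\<^sub>F x\<in>(supp.\<^sub>A c). c x \<odot>\<^sub>F x)"
  using F(2) unfolding graded_free_def by(elim exE conjE) (rule that)
 interpret X: fun_module A X "free_mod A X" by(rule fun_module_free_mod[OF A.ring_axioms])
 have XF: "X \<subseteq> car F" using X FG.piece_closed by blast
 have idX: "(%x. x) : X \<rightarrow> car F" using XF by auto
 have ex': "EX! c. c : car (free_mod A X) & y = lin_ext A F (%x. x) c" if "y : car F" for y
 proof -
  have "c : car (free_mod A X) & y = lin_ext A F (%x. x) c \<longleftrightarrow> (ALL x. c x : car A) & (supp.\<^sub>A c) \<subseteq> X &
  finite (supp.\<^sub>A c) & y = (\<Oplus>\<^sub>F x\<in>(supp.\<^sub>A c). c x \<odot>\<^sub>F x)" for c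
  unfolding X.carrier_eq ffun_def lin_ext_def mem_Collect_eq by(simp only: conj_assoc)
  thus ?thesis using bspec[OF ex that] by(simp only:)
 qed
 define c where "c y = (THE c. c : car (free_mod A X) & y = lin_ext A F (%x. x) c)" for y
 have c: "c y : car (free_mod A X)" "lin_ext A F (%x. x) (c y) = y" if "y : car F" for y
  using theI'[OF ex'[OF that]] unfolding c_def by auto
 have cu: "c (lin_ext A F (%x. x) d) = d" if "d : car (free_mod A X)" for d
  using ex'[of "lin_ext A F (%x. x) d"] that linear_closed[OF X.lin_ext_linear[OF F.lm idX] that]
  unfolding c_def by(intro the1_equality) auto
 note le = X.lin_ext_linear[OF F.lm idX]
 have clin: "c : lmaps A F (free_mod A X)"
 proof (rule linear_mapsI)
  fix x y assume xy: "x : car F" "y : car F"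
  show "c (x \<oplus>\<^sub>F y) = c x \<oplus>\<^bsub>free_mod A X\<^esub> c y"
  using cu[of "c x \<oplus>\<^bsub>free_mod A X\<^esub> c y"] c xy by(simp add:linear_add[OF le])
 next
  fix a x assume ax: "a : car A" "x : car F"
  show "c (a \<odot>\<^sub>F x) = a \<odot>\<^bsub>free_mod A X\<^esub> c x"
  using cu[of "a \<odot>\<^bsub>free_mod A X\<^esub> c x"] c ax by(simp add:linear_smult[OF le] X.left_smult_closed)
 qed (use c in auto)
 define deg where "deg x = (SOME j. x : mod_gr F j)" for x
 have deg: "x : mod_gr F (deg x)" if "x : X" for x
 proof -
  obtain j where "x : mod_gr F j" using X \<open>x : X\<close> by blast
  thus ?thesis unfolding deg_def by(rule someI)
 qed
 have "c y x : alg_gr A (i - deg x)" if y: "y : mod_gr F i" and x: "x : X" for x y i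
 proof -
  have yF: "y : car F" using y FG.piece_closed by blast
  define d where "d x = (if x : X then gcomp A (alg_gr A) (c y x) (i - deg x) else \<zero>\<^sub>A)" for x
  have cyc: "c y x : car A" for x using c(1)[OF yF] by(simp add:X.carrier_eq ffun_closed)
  have g0: "gcomp A (alg_gr A) \<zero>\<^sub>A j = \<zero>\<^sub>A" for j using AG.gcomp_homog[OF AG.piece_zero] by auto
  have dz: "d x ~= \<zero>\<^sub>A ==> c y x ~= \<zero>\<^sub>A" for x using g0 by(auto simp:d_def split:if_splits)
  let ?S = "{x. c y x ~= \<zero>\<^sub>A}"
  have S: "finite ?S" "?S \<subseteq> X" using c(1)[OF yF] by(auto simp:X.carrier_eq ffun_finite dest:ffun_supp)
  have dc: "d : car (free_mod A X)"
  unfolding X.carrier_eq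
  by(rule ffunI[OF _ S(1)]) (use cyc dz S in "auto simp:d_def split:if_splits")
  have "lin_ext A F (%x. x) d = (\<Oplus>\<^sub>F x\<in>?S. d x \<odot>\<^sub>F x)"
  using S dz by(intro X.lin_ext_superset[OF F.lm idX dc]) auto
  also have "... = (\<Oplus>\<^sub>F x\<in>?S. gcomp F (mod_gr F) (c y x \<odot>\<^sub>F x) i)"
  proof (rule F.M.finsum_cong')
  show "(%x. gcomp F (mod_gr F) (c y x \<odot>\<^sub>F x) i) : ?S \<rightarrow> car F"
  using S XF cyc by(auto intro!: FG.gcomp_closed F.left_smult_closed)
  fix x assume "x : ?S"
  hence x: "x : X" "x : car F" using S XF by auto
  have "gcomp F (mod_gr F) (c y x \<odot>\<^sub>F x) ((i - deg x) + deg x) = gcomp A (alg_gr A) (c y x) (i - deg x) \<odot>\<^sub>F x"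
  proof (rule gcomp_shift[OF AG.graded_group_axioms FG.graded_group_axioms _ _ cyc])
  show "(%a. a \<odot>\<^sub>F x) : additive_maps A F"
  using x by(intro additive_mapsI) (auto simp:F.left_smult_closed F.left_smult_l_distr)
  show "a \<odot>\<^sub>F x : mod_gr F (i + deg x)" if "a : alg_gr A i" for i a
  using F.mod_gr_smult[OF that deg[OF x(1)]] .
  qed
  thus "d x \<odot>\<^sub>F x = gcomp F (mod_gr F) (c y x \<odot>\<^sub>F x) i" using x by(simp add:d_def)
  qed simp
  also have "... = gcomp F (mod_gr F) (\<Oplus>\<^sub>F x\<in>?S. c y x \<odot>\<^sub>F x) i"
  using S XF cyc by(intro FG.gcomp_finsum[symmetric]) (auto intro!: F.left_smult_closed)
  also have "(\<Oplus>\<^sub>F x\<in>?S. c y x \<odot>\<^sub>F x) = y" using c(2)[OF yF] by(simp add:lin_ext_def)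
  also have "gcomp F (mod_gr F) y i = y" using FG.gcomp_homog[OF y] by simp
  finally have cy: "c y = d" using cu[OF dc] by simp
  have "d x : alg_gr A (i - deg x)" using x AG.gcomp_props(1)[OF cyc] by(simp add:d_def)
  thus ?thesis by(simp only: cy)
 qed
 from that[OF XF deg clin c(2) this] show ?thesis .
qed

text \<open>Projectivity of a free module, by choosing preimages of basis elements. Each preimage is
  replaced by its component of degree \<open>deg x + j\<close>; since \<open>dl\<close> has degree
  zero, this component still maps to \<open>h x\<close>.\<close>

lemma lift_degree:
 assumes F: "graded_left_module A F" "graded_free A F"
  and N: "graded_left_module A N" and N': "graded_left_module A N'"
  and dl: "dl : dhoms A N' N 0" and h: "h : dhoms A F N j"
  and im: "!!x. x : car F ==> h x : dl ` car N'"
 shows "EX \<psi>:dhoms A F N' j. ALL x:car F. dl (\<psi> x) = h x"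
proof -
 interpret F: graded_left_module A F by fact
 interpret N: graded_left_module A N by fact
 interpret N': graded_left_module A N' by fact
 interpret FG: graded_group F "mod_gr F" by(rule glm_group[OF F(1)])
 interpret NG: graded_group N "mod_gr N" by(rule glm_group[OF N])
 interpret NG': graded_group N' "mod_gr N'" by(rule glm_group[OF N'])
 obtain X deg c where X: "X \<subseteq> car F" "!!x. x : X ==> x : mod_gr F (deg x)"
  "c : lmaps A F (free_mod A X)"
  "!!y. y : car F ==> lin_ext A F (%x. x) (c y) = y"
  "!!x y i. y : mod_gr F i ==> x : X ==> c y x : alg_gr A (i - deg x)"
  by(fact graded_free_coords[OF F])
 interpret X: fun_module A X "free_mod A X" by(rule fun_module_free_mod[OF A.ring_axioms])
 have idX: "(%x. x) : X \<rightarrow> car F" using X by auto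
 have "EX y. y : mod_gr N' (deg x + j) & dl y = h x" if x: "x : X" for x
 proof -
  obtain y where y: "y : car N'" "h x = dl y" using im X(1) x by blast
  have hx: "h x : mod_gr N (deg x + j)" using hd_piece[OF h X(2)[OF x]] .
  have "gcomp N (mod_gr N) (dl y) ((deg x + j) + 0) = dl (gcomp N' (mod_gr N') y (deg x + j))"
  using gcomp_shift[OF NG'.graded_group_axioms NG.graded_group_axioms linear_additive[OF hd_linear[OF dl]] hd_piece[OF dl] y(1)] .
  hence "dl (gcomp N' (mod_gr N') y (deg x + j)) = h x" using NG.gcomp_homog[OF hx] y(2) by simp
  thus ?thesis using NG'.gcomp_props(1)[OF y(1)] by blast
 qed
 hence "ALL x. EX y. x : X --> y : mod_gr N' (deg x + j) & dl y = h x" by blast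
 from choice[OF this] obtain q where q: "!!x. x : X ==> q x : mod_gr N' (deg x + j) & dl (q x) = h x"
  by blast
 have qX: "q : X \<rightarrow> car N'" using q NG'.piece_closed by blast
 define \<psi> where "\<psi> y = lin_ext A N' q (c y)" for y
 have \<psi>: "\<psi> : lmaps A F N'"
  unfolding \<psi>_def by(rule linear_comp[OF X.lin_ext_linear[OF N'.lm qX] X(3)])
 moreover have "\<psi> y : mod_gr N' (i + j)" if y: "y : mod_gr F i" for i y
  unfolding \<psi>_def lin_ext_def
 proof (rule NG'.piece_finsum, rule)
  fix x assume "x : {x. c y x ~= \<zero>\<^sub>A}"
  hence x: "x : X" using linear_closed[OF X(3) FG.piece_closed[OF y]] by(auto simp:X.carrier_eq dest:ffun_supp)
  have "c y x \<odot>\<^bsub>N'\<^esub> q x : mod_gr N' ((i - deg x) + (deg x + j))"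
  using q x by(intro N'.mod_gr_smult X(5)[OF y]) auto
  thus "c y x \<odot>\<^bsub>N'\<^esub> q x : mod_gr N' (i + j)" by simp
 qed
 ultimately have "\<psi> : dhoms A F N' j" by(intro hdI)
 moreover have "dl (\<psi> y) = h y" if y: "y : car F" for y
 proof -
  have "dl (lin_ext A N' q f) = h (lin_ext A F (%x. x) f)" if "f : car (free_mod A X)" for f
  proof (rule X.linear_eqI[OF N.lm _ _ _ that])
  show "(%f. dl (lin_ext A N' q f)) : lmaps A (free_mod A X) N"
  by(rule linear_comp[OF hd_linear[OF dl] X.lin_ext_linear[OF N'.lm qX]])
  show "(%f. h (lin_ext A F (%x. x) f)) : lmaps A (free_mod A X) N"
  by(rule linear_comp[OF hd_linear[OF h] X.lin_ext_linear[OF F.lm idX]])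
  show "dl (lin_ext A N' q (mon A \<one>\<^sub>A w)) = h (lin_ext A F (%x. x) (mon A \<one>\<^sub>A w))" if "w : X" for w
  using that q by(simp add:X.lin_ext_mon_one[OF N'.lm qX] X.lin_ext_mon_one[OF F.lm idX])
  qed
  thus ?thesis using linear_closed[OF X(3) y] X(4)[OF y] by(simp add:\<psi>_def)
 qed
 ultimately show ?thesis by blast
qed

text \<open>The lift is made separately for each homogeneous part of f. The hypothesis on the image,
  stated for f, has to be transferred to these parts.\<close>

lemma lift_graded:
 assumes F: "graded_left_module A F" "graded_free A F"
  and N: "graded_left_module A N" and N': "graded_left_module A N'"
  and dl: "dl : dhoms A N' N 0" and f: "f : ghoms A F N"
  and im: "!!x. x : car F ==> f x : dl ` car N'"
 shows "EX \<psi>:ghoms A F N'. ALL x:car F. dl (\<psi> x) = f x"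
proof -
 interpret F: graded_left_module A F by fact
 interpret N: graded_left_module A N by fact
 interpret N': graded_left_module A N' by fact
 interpret FG: graded_group F "mod_gr F" by(rule glm_group[OF F(1)])
 interpret NG: graded_group N "mod_gr N" by(rule glm_group[OF N])
 interpret NG': graded_group N' "mod_gr N'" by(rule glm_group[OF N'])
 note dlz = linear_zero[OF N'.M.ab N.M.ab hd_linear[OF dl]]
 obtain J h where J: "finite J" "!!j. j : J ==> h j : dhoms A F N j"
  "!!x. x : car F ==> f x = (\<Oplus>\<^sub>N j\<in>J. h j x)"
  using f unfolding graded_homs_def by blast
 \<comment> \<open>On a homogeneous x of degree i, \<open>h j x\<close> is the component of degree i
   + j of \<open>f x\<close>, hence the image under \<open>dl\<close> of the same component of a
   preimage of \<open>f x\<close>.\<close>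
 have im_h: "h j x : dl ` car N'" if j: "j : J" and x: "x : car F" for j x
  using x
 proof (induct rule:FG.graded_induct)
  case zero
  have "h j \<zero>\<^sub>F = \<zero>\<^sub>N"
  using linear_zero[OF F.M.ab N.M.ab hd_linear[OF J(2)[OF j]]] .
  thus ?case using dlz N'.M.zero_closed by(metis image_eqI)
 next
  case (add x y)
  then obtain u v where "u : car N'" "v : car N'" "h j x = dl u" "h j y = dl v" by auto
  hence "h j (x \<oplus>\<^sub>F y) = dl (u \<oplus>\<^bsub>N'\<^esub> v)"
  using add by(simp add:linear_add[OF hd_linear[OF J(2)[OF j]]] linear_add[OF hd_linear[OF dl]])
  thus ?case using \<open>u : _\<close> \<open>v : _\<close> by simp
 next
  case (homog i x)
  have xF: "x : car F" using homog FG.piece_closed by blast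
  have hx: "h k x : mod_gr N (i + k)" if "k : J" for k using hd_piece[OF J(2)[OF that] homog] .
  have "gcomp N (mod_gr N) (f x) (i + j) = (\<Oplus>\<^sub>N k\<in>J. gcomp N (mod_gr N) (h k x) (i + j))"
  unfolding J(3)[OF xF] using hx NG.piece_closed by(intro NG.gcomp_finsum) blast
  also have "... = (\<Oplus>\<^sub>N k\<in>J. if k = j then h j x else \<zero>\<^sub>N)"
  using hx NG.piece_closed[OF hx] by(intro N.M.finsum_cong') (auto simp:NG.gcomp_homog[OF hx] j)
  also have "... = h j x"
  using j NG.piece_closed[OF hx[OF j]] J(1) by(subst N.M.finsum_single[of _ j]) auto
  finally have 1: "gcomp N (mod_gr N) (f x) (i + j) = h j x" .
  obtain y where y: "y : car N'" "f x = dl y" using im[OF xF] by blast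
  have "gcomp N (mod_gr N) (dl y) ((i + j) + 0) = dl (gcomp N' (mod_gr N') y (i + j))"
  using gcomp_shift[OF NG'.graded_group_axioms NG.graded_group_axioms linear_additive[OF hd_linear[OF dl]] hd_piece[OF dl] y(1)] .
  hence "h j x = dl (gcomp N' (mod_gr N') y (i + j))" using 1 y by simp
  thus ?case using NG'.gcomp_closed[OF y(1)] by blast
 qed
 have "\<exists>\<psi>. j : J --> \<psi> : dhoms A F N' j & (ALL x:car F. dl (\<psi> x) = h j x)" for j
  using lift_degree[OF F N N' dl J(2) im_h, of j] by blast
 hence "ALL j. \<exists>\<psi>. j : J --> \<psi> : dhoms A F N' j & (ALL x:car F. dl (\<psi> x) = h j x)" by blast
 from choice[OF this] obtain \<psi> where \<psi>: "!!j. j : J ==> \<psi> j : dhoms A F N' j"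
  "!!j x. j : J ==> x : car F ==> dl (\<psi> j x) = h j x" by blast
 let ?\<psi> = "%x. \<Oplus>\<^bsub>N'\<^esub> j\<in>J. \<psi> j x"
 have "?\<psi> : ghoms A F N'"
  using gh_finsum[OF F.lm FG.graded_group_axioms N'.lm NG'.graded_group_axioms J(1)]
  hd_graded[OF F.lm FG.graded_group_axioms N'.lm NG'.graded_group_axioms \<psi>(1)] by blast
 moreover have "dl (?\<psi> x) = f x" if x: "x : car F" for x
 proof -
  have "(%j. \<psi> j x) : J \<rightarrow> car N'" using linear_closed[OF hd_linear[OF \<psi>(1)] x] by blast
  hence "dl (?\<psi> x) = (\<Oplus>\<^sub>N j\<in>J. dl (\<psi> j x))"
  by(rule linear_finsum[OF N'.M.ab N.M.ab hd_linear[OF dl]])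
  also have "... = f x" unfolding J(3)[OF x] using \<psi>(2) x linear_closed[OF hd_linear[OF J(2)] x]
  by(intro N.M.finsum_cong') auto
  finally show ?thesis .
 qed
 ultimately show ?thesis by(intro bexI[of _ ?\<psi>] ballI)
qed

end

section \<open>Quotient spaces\<close>

context vector_space_over
begin

context
 fixes N assumes N: "subspace K V N"
begin

lemma subspace_abelian_subgroup: "abelian_subgroup N V"
proof (rule abelian_subgroupI3[OF _ M.ab])
 show "additive_subgroup N V"
  using N subspace_neg[OF N] by(intro M.additive_subgroup_intro) (auto simp:subspace_def)
qed

interpretation N: abelian_subgroup N V by(rule subspace_abelian_subgroup)

lemma coset_mem:
 assumes x: "x : car V" shows "y : N +> x \<longleftrightarrow> y : car V & y \<ominus> x : N"
proof -
 have "y : N +> x ==> y : car V" using N.a_elemrcos_carrier[OF x] .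
 moreover have "y : car V ==> y : N +> x \<longleftrightarrow> y \<ominus> x : N"
  using N.a_rcos_module[OF x] by(simp add:a_minus_def)
 ultimately show ?thesis by argo
qed

lemma coset_eq_iff:
 assumes "x : car V" "y : car V"
 shows "N +> x = N +> y \<longleftrightarrow> x \<ominus> y : N"
proof
 assume "N +> x = N +> y"
 hence "x : N +> y" using N.a_rcos_self[OF assms(1)] by simp
 thus "x \<ominus> y : N" using coset_mem[OF assms(2)] by simp
next
 assume "x \<ominus> y : N"
 hence "x : N +> y" using coset_mem[OF assms(2)] assms(1) by simp
 thus "N +> x = N +> y" using N.a_repr_independence'[OF _ assms(2)] by simp
qed

lemma coset_add:
 "x : car V ==> y : car V ==> (N +> x) <+> (N +> y) = N +> (x \<oplus> y)"
 by(rule N.a_rcos_sum)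

lemma coset_zero: "N +> \<zero> = N"
 using N.a_subset by(rule M.a_coset_add_zero)

text \<open>\<open>coset_smult\<close> is a union over representatives. All of them yield the same
  coset and there is at least one.\<close>

lemma coset_smult_eq:
 assumes "c : car K" "x : car V"
 shows "coset_smult V N c (N +> x) = N +> (c \<odot> x)"
proof -
 have "N +> (c \<odot> y) = N +> (c \<odot> x)" if "y : N +> x" for y
 proof -
  have y: "y : car V" "y \<ominus> x : N" using that coset_mem[OF assms(2)] by auto
  hence "c \<odot> (y \<ominus> x) : N" using N assms(1) by(simp add:subspace_def)
  thus ?thesis using y assms by(simp add:coset_eq_iff left_smult_closed smult_diff_r)
 qed
 hence "coset_smult V N c (N +> x) = (\<Union>y\<in>N +> x. N +> (c \<odot> x))"
  unfolding coset_smult_def by(intro SUP_cong) simp_all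
 moreover have "N +> x ~= {}" using N.a_rcos_self[OF assms(2)] by blast
 ultimately show ?thesis by(simp only: UN_constant if_False)
qed

lemma rcosets_eq: "a_rcosets N = (%x. N +> x) ` car V"
 by(auto simp:A_RCOSETS_def')

end

end

section \<open>Comparison of free resolutions\<close>

context graded_augmented_algebra
begin

context
 fixes P :: "('a, 'p, 'k) resolution"
 assumes P: "graded_free_resolution K A P"
begin

lemma res_graded: "graded_left_module A P$n"
 using P by(simp add:graded_free_resolution_def)

lemma res_free: "graded_free A P$n"
 using P by(simp add:graded_free_resolution_def)

lemma res_left: "left_module A P$n"
 by(rule graded_left_module_left[OF res_graded])

lemma res_group: "graded_group P$n (mod_gr P$n)"
 by(rule glm_group[OF res_graded])

lemma res_ab: "abelian_group P$n"
 using res_left[of n] by(simp add:left_module_def)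

lemma diff_hd: "res_diff P n : dhoms A P$(Suc n) P$n 0"
 using P by(simp add:graded_free_resolution_def)

lemma aug_hd: "res_aug P : dhoms A P$0 triv 0"
 using P by(simp add:graded_free_resolution_def)

lemma diff_gh: "res_diff P n : ghoms A P$(Suc n) P$n"
 by(rule hd_graded[OF res_left res_group res_left res_group diff_hd])

lemma triv_group: "graded_group triv (mod_gr triv)"
 by(rule glm_group[OF triv_graded])

lemma aug_gh: "res_aug P : ghoms A P$0 triv"
 by(rule hd_graded[OF res_left res_group triv_left_module triv_group aug_hd])

lemma diff_closed: "x : car P$(Suc n) ==> res_diff P n x : car P$n"
 by(rule linear_closed[OF hd_linear[OF diff_hd]])

lemma res_aug_closed: "x : car P$0 ==> res_aug P x : car K"
 using linear_closed[OF hd_linear[OF aug_hd]] by simp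

lemma diff_exact: "{x : car P$(Suc n). res_diff P n x = \<zero>\<^bsub>P$n\<^esub>} =
  res_diff P (Suc n) ` car (res_mod P (Suc (Suc n)))"
 using P by(simp add:graded_free_resolution_def)

lemma aug_exact: "{x : car P$0. res_aug P x = \<zero>\<^sub>K} = res_diff P 0 ` car P$(Suc 0)"
 using P by(simp add:graded_free_resolution_def)

lemma res_aug_surj: "res_aug P ` car P$0 = car K"
 using P by(simp add:graded_free_resolution_def)

lemma diff_diff: "x : car (res_mod P (Suc (Suc n))) ==> res_diff P n (res_diff P (Suc n) x) = \<zero>\<^bsub>P$n\<^esub>"
 using diff_exact[of n] by blast

lemma aug_diff: "x : car P$(Suc 0) ==> res_aug P (res_diff P 0 x) = \<zero>\<^sub>K"
 using aug_exact by blast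

lemma diff_zero_im:
 "x : car P$(Suc n) ==> res_diff P n x = \<zero>\<^bsub>P$n\<^esub> ==>
  x : res_diff P (Suc n) ` car (res_mod P (Suc (Suc n)))"
 using diff_exact[of n] by blast

lemma aug_zero_im:
 "x : car P$0 ==> res_aug P x = \<zero>\<^sub>K ==> x : res_diff P 0 ` car P$(Suc 0)"
 using aug_exact by blast

lemmas res_diff_zero = linear_zero[OF res_ab res_ab hd_linear[OF diff_hd]]
lemmas res_diff_diff = linear_diff[OF res_ab res_ab hd_linear[OF diff_hd]]

end

lemmas res_mods = res_left res_group

context
 fixes F :: "('a, 'f, 'k) resolution" and T :: "('a, 't, 'k) resolution"
 assumes F: "graded_free_resolution K A F" and T: "graded_free_resolution K A T"
begin

text \<open>The comparison theorem. The invariant \<open>?I\<close> carries, besides gradedness, the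
  statement that the current map sends boundaries into the image of the next differential, which
  makes the next lift possible. The shift m covers both maps of resolutions (m = 0) and liftings of
  cocycles for the Yoneda product.\<close>

lemma lift_exists:
 assumes g: "g : ghoms A F$m triv"
  and gd: "!!x. x : car F$(Suc m) ==> g (res_diff F m x) = \<zero>\<^sub>K"
 obtains t where "!!i. t i : ghoms A F$(m + i) T$i"
  "!!x. x : car F$m ==> res_aug T (t 0 x) = g x"
  "!!i x. x : car (res_mod F (Suc (m + i))) ==> res_diff T i (t (Suc i) x) = t i (res_diff F (m + i) x)"
proof -
 let ?I = "%i t. t : ghoms A F$(m + i) T$i &
  (ALL x:car (res_mod F (Suc (m + i))). t (res_diff F (m + i) x) : res_diff T i ` car T$(Suc i))"
 let ?Q = "%i t t'. ALL x:car (res_mod F (Suc (m + i))). res_diff T i (t' x) = t (res_diff F (m + i) x)"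
 obtain t0 where t0: "t0 : ghoms A F$m T$0"
  "!!x. x : car F$m ==> res_aug T (t0 x) = g x"
 proof -
  have "g x : res_aug T ` car T$0" if "x : car F$m" for x
  using gh_closed[OF g that] unfolding res_aug_surj[OF T] by simp
  from lift_graded[OF res_graded[OF F] res_free[OF F] triv_graded res_graded[OF T] aug_hd[OF T] g this]
  obtain \<psi> where "\<psi> : ghoms A F$m T$0"
  "ALL x:car F$m. res_aug T (\<psi> x) = g x" by(rule bexE)
  thus ?thesis by(intro that) auto
 qed
 have step: "EX t'. ?I (Suc i) t' & ?Q i t t'" if I: "?I i t" for i t
 proof -
  have c: "(%x. t (res_diff F (m + i) x)) : ghoms A (res_mod F (Suc (m + i))) T$i"
  by(rule gh_comp[OF res_mods[OF F] res_mods[OF F] res_mods[OF T] conjunct1[OF I] diff_gh[OF F]])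
  from lift_graded[OF res_graded[OF F] res_free[OF F] res_graded[OF T] res_graded[OF T] diff_hd[OF T] c bspec[OF conjunct2[OF I]]]
  obtain t' where t': "t' : ghoms A (res_mod F (Suc (m + i))) T$(Suc i)"
  "ALL x:car (res_mod F (Suc (m + i))). res_diff T i (t' x) = t (res_diff F (m + i) x)" by(rule bexE)
  have "t' (res_diff F (Suc (m + i)) x) : res_diff T (Suc i) ` car (res_mod T (Suc (Suc i)))"
  if x: "x : car (res_mod F (Suc (Suc (m + i))))" for x
  proof (rule diff_zero_im[OF T])
  have dx: "res_diff F (Suc (m + i)) x : car (res_mod F (Suc (m + i)))"
  by(rule diff_closed[OF F x])
  show "t' (res_diff F (Suc (m + i)) x) : car T$(Suc i)"
  by(rule gh_closed[OF t'(1) dx])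
  have "res_diff T i (t' (res_diff F (Suc (m + i)) x)) = t \<zero>\<^bsub>res_mod F (m + i)\<^esub>"
  using t'(2) dx diff_diff[OF F x] by simp
  thus "res_diff T i (t' (res_diff F (Suc (m + i)) x)) = \<zero>\<^bsub>T$i\<^esub>"
  using linear_zero[OF res_ab[OF F] res_ab[OF T] gh_linear[OF conjunct1[OF I]]] by simp
  qed
  thus ?thesis using t' by(intro exI[of _ t']) simp
 qed
 have base: "EX t. ?I 0 t & t = t0"
 proof -
  have "t0 (res_diff F m x) : res_diff T 0 ` car T$(Suc 0)"
  if x: "x : car F$(Suc m)" for x
  using gh_closed[OF t0(1) diff_closed[OF F x]] t0(2)[OF diff_closed[OF F x]] gd[OF x]
  by(intro aug_zero_im[OF T]) simp_all
  thus ?thesis using t0(1) by simp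
 qed
 \<comment> \<open>The clause for n = 0 fixes the start of the sequence, so the compatibility of
   \<open>t0\<close> with the augmentation is not lost in the choice.\<close>
 have "EX f. ALL n. (?I n (f n) & (n = 0 --> f n = t0)) & ?Q n (f n) (f (Suc n))"
 proof (rule dependent_nat_choice)
  show "EX t. ?I 0 t & (0 = (0::nat) --> t = t0)" using base by simp
  show "EX t'. (?I (Suc n) t' & (Suc n = 0 --> t' = t0)) & ?Q n t t'"
  if "?I n t & (n = 0 --> t = t0)" for t n
  using step[OF conjunct1[OF that]] by simp
 qed
 then obtain f where f: "!!n. (?I n (f n) & (n = 0 --> f n = t0)) & ?Q n (f n) (f (Suc n))"
  by(elim exE) (rule that, erule spec)
 show ?thesis
 proof (rule that)
  show "f i : ghoms A F$(m + i) T$i" for i using f[of i] by simp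
  show "res_aug T (f 0 x) = g x" if "x : car F$m" for x using f[of 0] t0(2)[OF that] by simp
  show "res_diff T i (f (Suc i) x) = f i (res_diff F (m + i) x)"
  if "x : car (res_mod F (Suc (m + i)))" for i x using f[of i] that by simp
 qed
qed

text \<open>The familiar case has b = 0 and \<open>u\<close> of zero augmentation. The correction b,
  a map vanishing on boundaries, plays the role of a homotopy term coming from below degree m; it
  admits maps whose augmentation is a coboundary rather than zero.\<close>

lemma homotopy_exists:
 assumes u: "!!i. u i : ghoms A F$(m + i) T$i"
  and ud: "!!i x. x : car (res_mod F (Suc (m + i))) ==> res_diff T i (u (Suc i) x) = u i (res_diff F (m + i) x)"
  and b: "b : ghoms A F$m T$0"
  and bd: "!!x. x : car F$(Suc m) ==> b (res_diff F m x) = \<zero>\<^bsub>T$0\<^esub>"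
  and ub: "!!x. x : car F$m ==> res_aug T (u 0 x) = res_aug T (b x)"
 obtains s where "!!i. s i : ghoms A F$(m + i) T$(Suc i)"
  "!!x. x : car F$m ==> u 0 x = res_diff T 0 (s 0 x) \<oplus>\<^bsub>T$0\<^esub> b x"
  "!!i x. x : car (res_mod F (Suc (m + i))) ==>
  u (Suc i) x = res_diff T (Suc i) (s (Suc i) x) \<oplus>\<^bsub>res_mod T (Suc i)\<^esub> s i (res_diff F (m + i) x)"
proof -
 interpret TM: left_module A "T$j" for j by(rule res_left[OF T])
 let ?v = "%i s x. u (Suc i) x \<ominus>\<^bsub>res_mod T (Suc i)\<^esub> s (res_diff F (m + i) x)"
 let ?I = "%i s. s : ghoms A F$(m + i) T$(Suc i) &
  (ALL x:car (res_mod F (Suc (m + i))). res_diff T i (?v i s x) = \<zero>\<^bsub>T$i\<^esub>)"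
 let ?Q = "%i s s'. ALL x:car (res_mod F (Suc (m + i))). res_diff T (Suc i) (s' x) = ?v i s x"
 have uc: "u i x : car T$i" if "x : car F$(m + i)" for i x
  using gh_closed[OF u that] .
 obtain s0 where s0: "s0 : ghoms A F$m T$(Suc 0)"
  "!!x. x : car F$m ==> res_diff T 0 (s0 x) = u 0 x \<ominus>\<^bsub>T$0\<^esub> b x"
 proof -
  have c: "(%x. u 0 x \<ominus>\<^bsub>T$0\<^esub> b x) : ghoms A F$m T$0"
  using gh_diff[OF res_mods[OF F] res_mods[OF T] _ b, of "u 0"] u[of 0] by simp
  have "u 0 x \<ominus>\<^bsub>T$0\<^esub> b x : res_diff T 0 ` car T$(Suc 0)" if x: "x : car F$m" for x
  proof (rule aug_zero_im[OF T])
  have ux: "u 0 x : car T$0" using uc[of x 0] x by simp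
  note bx = gh_closed[OF b x]
  show "u 0 x \<ominus>\<^bsub>T$0\<^esub> b x : car T$0" using gh_closed[OF c x] .
  have "res_aug T (u 0 x \<ominus>\<^bsub>T$0\<^esub> b x) = res_aug T (u 0 x) \<ominus>\<^sub>triv res_aug T (b x)"
  by(rule linear_diff[OF res_ab[OF T] _ hd_linear[OF aug_hd[OF T]] ux bx])
  (use triv_left_module in "simp add:left_module_def")
  thus "res_aug T (u 0 x \<ominus>\<^bsub>T$0\<^esub> b x) = \<zero>\<^sub>K"
  using ub[OF x] res_aug_closed[OF T bx] by(simp add:K.diff_self)
  qed
  from lift_graded[OF res_graded[OF F] res_free[OF F] res_graded[OF T] res_graded[OF T] diff_hd[OF T] c this]
  obtain \<psi> where "\<psi> : ghoms A F$m T$(Suc 0)"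
  "ALL x:car F$m. res_diff T 0 (\<psi> x) = u 0 x \<ominus>\<^bsub>T$0\<^esub> b x" by(rule bexE)
  thus ?thesis by(intro that) auto
 qed
 have step: "EX s'. ?I (Suc i) s' & ?Q i s s'" if I: "?I i s" for i s
 proof -
  have c: "?v i s : ghoms A (res_mod F (Suc (m + i))) T$(Suc i)"
  using u[of "Suc i"]
  by(intro gh_diff[OF res_mods[OF F] res_mods[OF T]]
  gh_comp[OF res_mods[OF F] res_mods[OF F] res_mods[OF T] conjunct1[OF I] diff_gh[OF F]]) simp
  have "?v i s x : res_diff T (Suc i) ` car (res_mod T (Suc (Suc i)))"
  if x: "x : car (res_mod F (Suc (m + i)))" for x
  using gh_closed[OF c x] bspec[OF conjunct2[OF I] x] by(rule diff_zero_im[OF T])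
  from lift_graded[OF res_graded[OF F] res_free[OF F] res_graded[OF T] res_graded[OF T] diff_hd[OF T] c this]
  obtain s' where s': "s' : ghoms A (res_mod F (Suc (m + i))) (res_mod T (Suc (Suc i)))"
  "ALL x:car (res_mod F (Suc (m + i))). res_diff T (Suc i) (s' x) = ?v i s x" by(rule bexE)
  have "res_diff T (Suc i) (?v (Suc i) s' x) = \<zero>\<^bsub>res_mod T (Suc i)\<^esub>"
  if x: "x : car (res_mod F (Suc (Suc (m + i))))" for x
  proof -
  have dx: "res_diff F (Suc (m + i)) x : car (res_mod F (Suc (m + i)))"
  by(rule diff_closed[OF F x])
  have uu: "u (Suc (Suc i)) x : car (res_mod T (Suc (Suc i)))" using uc[of x "Suc (Suc i)"] x by simp
  have ud': "u (Suc i) (res_diff F (Suc (m + i)) x) : car T$(Suc i)"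
  using uc[of _ "Suc i"] dx by simp
  have "res_diff T (Suc i) (?v (Suc i) s' x) =
  res_diff T (Suc i) (u (Suc (Suc i)) x) \<ominus>\<^bsub>res_mod T (Suc i)\<^esub> res_diff T (Suc i) (s' (res_diff F (Suc (m + i)) x))"
  using res_diff_diff[OF T uu gh_closed[OF s'(1) dx]] by simp
  also have "res_diff T (Suc i) (s' (res_diff F (Suc (m + i)) x)) = ?v i s (res_diff F (Suc (m + i)) x)"
  using s'(2) dx by blast
  also have "s (res_diff F (m + i) (res_diff F (Suc (m + i)) x)) = \<zero>\<^bsub>res_mod T (Suc i)\<^esub>"
  using diff_diff[OF F x] linear_zero[OF res_ab[OF F] res_ab[OF T] gh_linear[OF conjunct1[OF I]]] by simp
  finally show ?thesis using ud[of x "Suc i"] x ud' by(simp add:TM.M.diff_zero TM.M.diff_self)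
  qed
  thus ?thesis using s' by(intro exI[of _ s']) simp
 qed
 have base: "?I 0 s0"
 proof -
  have "res_diff T 0 (?v 0 s0 x) = \<zero>\<^bsub>T$0\<^esub>" if x: "x : car F$(Suc m)" for x
  proof -
  note dx = diff_closed[OF F x]
  have u0: "u 0 (res_diff F m x) : car T$0" using uc[of _ 0] dx by simp
  have u1: "u (Suc 0) x : car T$(Suc 0)" using uc[of _ "Suc 0"] x by simp
  have "res_diff T 0 (?v 0 s0 x) = res_diff T 0 (u (Suc 0) x) \<ominus>\<^bsub>T$0\<^esub> res_diff T 0 (s0 (res_diff F m x))"
  using res_diff_diff[OF T u1 gh_closed[OF s0(1) dx]] by simp
  also have "... = \<zero>\<^bsub>T$0\<^esub>"
  using ud[of x 0] x s0(2)[OF dx] bd[OF x] u0 by(simp add:TM.M.diff_zero TM.M.diff_self)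
  finally show ?thesis .
  qed
  thus ?thesis using s0(1) by simp
 qed
 have "EX f. ALL n. (?I n (f n) & (n = 0 --> f n = s0)) & ?Q n (f n) (f (Suc n))"
 proof (rule dependent_nat_choice)
  show "EX s. ?I 0 s & (0 = (0::nat) --> s = s0)" using base by(intro exI[of _ s0]) simp
  show "EX s'. (?I (Suc n) s' & (Suc n = 0 --> s' = s0)) & ?Q n s s'"
  if "?I n s & (n = 0 --> s = s0)" for s n
  using step[OF conjunct1[OF that]] by simp
 qed
 then obtain f where f: "!!n. (?I n (f n) & (n = 0 --> f n = s0)) & ?Q n (f n) (f (Suc n))"
  by(elim exE) (rule that, erule spec)
 show ?thesis
 proof (rule that)
  show "f i : ghoms A F$(m + i) T$(Suc i)" for i using f[of i] by simp
  show "u 0 x = res_diff T 0 (f 0 x) \<oplus>\<^bsub>T$0\<^esub> b x" if x: "x : car F$m" for x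
  using f[of 0] s0(2)[OF x] uc[of x 0] x gh_closed[OF b x] by(simp add:TM.M.minus_minus_add)
  show "u (Suc i) x = res_diff T (Suc i) (f (Suc i) x) \<oplus>\<^bsub>res_mod T (Suc i)\<^esub> f i (res_diff F (m + i) x)"
  if x: "x : car (res_mod F (Suc (m + i)))" for i x
  proof -
  have fi: "f i : ghoms A F$(m + i) T$(Suc i)" using f[of i] by simp
  have "f i (res_diff F (m + i) x) : car T$(Suc i)"
  by(rule gh_closed[OF fi diff_closed[OF F x]])
  moreover have "u (Suc i) x : car T$(Suc i)" using uc[of x "Suc i"] x by simp
  moreover have "res_diff T (Suc i) (f (Suc i) x) = ?v i (f i) x" using f[of i] x by blast
  ultimately show ?thesis by(simp add:TM.M.minus_minus_add)
  qed
 qed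
qed

end

section \<open>Ext classes\<close>

text \<open>Together with \<open>cocyc\<close> this describes \<open>coboundaries\<close> and
  \<open>cocycles\<close> without the demand that functions be extensional, so composites such as f
  after a chain map need not be restricted. \<open>coboundaries_eq\<close> and
  \<open>cocycles_eq\<close> translate.\<close>

definition bdry :: "('a, 'p, 'k) resolution => nat => ('p => 'k) => bool" where
 "bdry P n f \<longleftrightarrow> (case n of
  0 => ALL x:car P$0. f x = \<zero>\<^sub>K
  | Suc m => EX y:ghoms A P$m triv. ALL x:car P$n. f x = y (res_diff P m x))"

definition cocyc :: "('a, 'p, 'k) resolution => nat => ('p => 'k) set" where
 "cocyc P n = {f : ghoms A P$n triv.
  ALL x:car P$(Suc n). f (res_diff P n x) = \<zero>\<^sub>K}"

lemma triv_mods: "left_module A triv" "graded_group triv (mod_gr triv)"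
 by(rule triv_left_module, rule glm_group[OF triv_graded])

lemma triv_ab: "abelian_group triv"
 using triv_left_module by(simp add:left_module_def)

context
 fixes P :: "('a, 'p, 'k) resolution"
 assumes P: "graded_free_resolution K A P"
begin

lemma cocyc_closed: "f : cocyc P n ==> x : car P$n ==> f x : car K"
 using gh_closed[of f A "P$n" triv x] by(simp add:cocyc_def)

lemma bdry_cong: "(!!x. x : car P$n ==> f x = g x) ==> bdry P n f = bdry P n g"
 unfolding bdry_def by(cases n) auto

lemma gh_triv_ops:
 assumes "f : ghoms A P$n triv" "g : ghoms A P$n triv" "c : car K"
 shows "(%x. f x \<oplus>\<^sub>K g x) : ghoms A P$n triv"
  "(%x. f x \<ominus>\<^sub>K g x) : ghoms A P$n triv"
  "(%x. c \<otimes>\<^sub>K f x) : ghoms A P$n triv"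
  "zf.\<^sub>K : ghoms A P$n triv"
proof -
 show "(%x. f x \<oplus>\<^sub>K g x) : ghoms A P$n triv"
  using gh_add[OF res_mods[OF P] triv_mods assms(1,2)] by simp
 show "(%x. f x \<ominus>\<^sub>K g x) : ghoms A P$n triv"
  using gh_diff[OF res_mods[OF P] triv_mods assms(1,2)] by simp
 show "zf.\<^sub>K : ghoms A P$n triv"
  using gh_zero[OF res_mods[OF P] triv_mods] by simp
 have "(%x. c \<otimes>\<^sub>K x) : dhoms A triv triv 0"
  using assms(3) by(intro hdI linear_mapsI) (auto simp:K.r_distr K.m_lcomm split:if_splits)
 thus "(%x. c \<otimes>\<^sub>K f x) : ghoms A P$n triv"
  using gh_comp[OF res_mods[OF P] triv_mods triv_mods hd_graded[OF triv_mods triv_mods] assms(1)] by blast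
qed

lemma bdry_add:
 assumes "bdry P n f" "bdry P n g" shows "bdry P n (%x. f x \<oplus>\<^sub>K g x)"
proof (cases n)
 case 0
 thus ?thesis using assms by(simp add:bdry_def)
next
 case (Suc m)
 then obtain y z where "y : ghoms A P$m triv" "z : ghoms A P$m triv"
  "ALL x:car P$n. f x = y (res_diff P m x)" "ALL x:car P$n. g x = z (res_diff P m x)"
  using assms unfolding bdry_def by auto
 thus ?thesis unfolding bdry_def Suc nat.case
  by(intro bexI[of _ "%x. y x \<oplus>\<^sub>K z x"]) (auto simp:Suc intro:gh_triv_ops(1)[OF _ _ K.zero_closed])
qed

lemma bdry_smult:
 assumes "bdry P n f" "c : car K" shows "bdry P n (%x. c \<otimes>\<^sub>K f x)"
proof (cases n)
 case 0
 thus ?thesis using assms by(simp add:bdry_def)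
next
 case (Suc m)
 then obtain y where "y : ghoms A P$m triv"
  "ALL x:car P$n. f x = y (res_diff P m x)"
  using assms unfolding bdry_def by auto
 thus ?thesis unfolding bdry_def Suc nat.case
  using assms(2) by(intro bexI[of _ "%x. c \<otimes>\<^sub>K y x"]) (auto simp:Suc intro:gh_triv_ops(3))
qed

lemma bdry_zero: "bdry P n zf.\<^sub>K"
proof (cases n)
 case 0
 thus ?thesis by(simp add:bdry_def)
next
 case (Suc m)
 have "zf.\<^sub>K : ghoms A P$m triv"
  using gh_zero[OF res_mods[OF P] triv_mods] by simp
 thus ?thesis unfolding bdry_def Suc nat.case by(intro bexI[of _ "%x. \<zero>\<^sub>K"]) auto
qed

lemma cocyc_add: "f : cocyc P n ==> g : cocyc P n ==> (%x. f x \<oplus>\<^sub>K g x) : cocyc P n"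
 by(auto simp:cocyc_def intro:gh_triv_ops(1)[OF _ _ K.zero_closed])

lemma cocyc_diff: "f : cocyc P n ==> g : cocyc P n ==> (%x. f x \<ominus>\<^sub>K g x) : cocyc P n"
 by(auto simp:cocyc_def K.diff_zero intro:gh_triv_ops(2)[OF _ _ K.zero_closed])

lemma cocyc_smult: "f : cocyc P n ==> c : car K ==> (%x. c \<otimes>\<^sub>K f x) : cocyc P n"
 by(auto simp:cocyc_def intro:gh_triv_ops(3))

lemma cocyc_zero: "zf.\<^sub>K : cocyc P n"
 using gh_zero[OF res_mods[OF P] triv_mods, of n] by(simp add:cocyc_def)

lemma cocyc_cong:
 assumes "f : cocyc P n" "!!x. x : car P$n ==> g x = f x"
 shows "g : cocyc P n"
 using assms gh_cong[of f A "P$n" triv g] res_left[OF P, of n] diff_closed[OF P, of _ n]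
 by(simp add:cocyc_def)

lemma bdry_cocyc: "bdry P n f ==> f : cocyc P n"
proof (cases n)
 case 0
 assume "bdry P n f"
 thus ?thesis using 0 cocyc_cong[OF cocyc_zero, of 0 f] by(simp add:bdry_def)
next
 case (Suc m)
 assume "bdry P n f"
 then obtain y where y: "y : ghoms A P$m triv"
  "ALL x:car P$n. f x = y (res_diff P m x)"
  using Suc unfolding bdry_def by auto
 have "(%x. y (res_diff P m x)) : cocyc P n"
  using gh_comp[OF res_mods[OF P] res_mods[OF P] triv_mods y(1) diff_gh[OF P]] Suc
  linear_zero[OF res_ab[OF P] triv_ab gh_linear[OF y(1)]] diff_diff[OF P]
  by(simp add:cocyc_def)
 from cocyc_cong[OF this, of f] y(2) show ?thesis by simp
qed

lemma cocycles_eq: "cocycles K A P n = cocyc P n \<inter> extensional (car P$n)"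
 unfolding cocycles_def cochains_def cocyc_def by auto

lemma restrict_cocyc: "f : cocyc P n ==> restrict f (car P$n) : cocycles K A P n"
 unfolding cocycles_eq using cocyc_cong[of f n "restrict f (car P$n)"] by auto

lemma coboundaries_eq:
 "coboundaries K A P n = {f : extensional (car P$n). bdry P n f}"
proof (cases n)
 case 0
 have "f = (\<lambda>x\<in>car P$0. \<zero>\<^sub>K)"
  if "f : extensional (car P$0)" "bdry P 0 f" for f
  using that by(intro extensionalityI[of _ "car P$0"]) (auto simp:bdry_def)
 moreover have "bdry P 0 (\<lambda>x\<in>car P$0. \<zero>\<^sub>K)" by(simp add:bdry_def)
 ultimately show ?thesis using 0 by auto
next
 case (Suc m)
 have "f : (%h. \<lambda>x\<in>car P$(Suc m). h (res_diff P m x)) ` cochains K A P m"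
  if f: "f : extensional (car P$n)" "bdry P n f" for f
 proof -
  obtain y where y: "y : ghoms A P$m triv"
  "ALL x:car P$n. f x = y (res_diff P m x)"
  using f(2) Suc unfolding bdry_def by auto
  let ?h = "restrict y (car P$m)"
  have "?h : cochains K A P m"
  unfolding cochains_def using gh_cong[OF y(1), of ?h] res_left[OF P] by auto
  moreover have "f = (\<lambda>x\<in>car P$(Suc m). ?h (res_diff P m x))"
  using f(1) y(2) diff_closed[OF P] Suc by(intro extensionalityI[of _ "car P$n"]) auto
  ultimately show ?thesis by blast
 qed
 moreover have "bdry P n (\<lambda>x\<in>car P$(Suc m). h (res_diff P m x))" if "h : cochains K A P m" for h
  using that unfolding bdry_def Suc nat.case cochains_def by(intro bexI[of _ h]) auto
 ultimately show ?thesis using Suc by auto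
qed

lemma cocycle_space_module: "left_module K (cocycle_space K A P n)"
proof -
 let ?C = "car P$n" and ?Z = "cocycle_space K A P n"
 have s: "car ?Z = cocycles K A P n" "\<zero>\<^bsub>?Z\<^esub> = (\<lambda>x\<in>?C. \<zero>\<^sub>K)"
  "f \<oplus>\<^bsub>?Z\<^esub> g = (\<lambda>x\<in>?C. f x \<oplus>\<^sub>K g x)" "c \<odot>\<^bsub>?Z\<^esub> f = (\<lambda>x\<in>?C. c \<otimes>\<^sub>K f x)" for f g c
  by(simp_all add:cocycle_space_def Let_def)
 have cl: "f x : car K" if "f : car ?Z" "x : ?C" for f x
  using that cocyc_closed[of f n x] by(simp add:s cocycles_eq)
 have ext: "f : extensional ?C" if "f : car ?Z" for f using that by(simp add:s cocycles_eq)
 have cc: "f : cocyc P n" if "f : car ?Z" for f using that by(simp add:s cocycles_eq)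
 have closed: "\<zero>\<^bsub>?Z\<^esub> : car ?Z" "f : car ?Z ==> g : car ?Z ==> f \<oplus>\<^bsub>?Z\<^esub> g : car ?Z"
  "c : car K ==> f : car ?Z ==> c \<odot>\<^bsub>?Z\<^esub> f : car ?Z" for f g c
  unfolding s using restrict_cocyc cocyc_zero cocyc_add cocyc_smult cc unfolding s by auto
 have eqI: "f = g" if "f : extensional ?C" "g : extensional ?C" "!!x. x : ?C ==> f x = g x" for f g :: "'p => 'k"
  using that by(rule extensionalityI)
 interpret Z: abelian_group ?Z
 proof (rule abelian_groupI)
  fix f g h assume fgh: "f : car ?Z" "g : car ?Z" "h : car ?Z"
  show "f \<oplus>\<^bsub>?Z\<^esub> g \<oplus>\<^bsub>?Z\<^esub> h = f \<oplus>\<^bsub>?Z\<^esub> (g \<oplus>\<^bsub>?Z\<^esub> h)"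
  by(rule eqI) (use cl fgh in "auto simp:s(3) K.a_assoc")
 next
  fix f g assume fg: "f : car ?Z" "g : car ?Z"
  show "f \<oplus>\<^bsub>?Z\<^esub> g = g \<oplus>\<^bsub>?Z\<^esub> f" by(rule eqI) (use cl fg in "auto simp:s(3) K.a_comm")
 next
  fix f assume f: "f : car ?Z"
  show "\<zero>\<^bsub>?Z\<^esub> \<oplus>\<^bsub>?Z\<^esub> f = f" by(rule eqI) (use cl f ext in "auto simp:s(2,3)")
  have m: "\<ominus>\<^sub>K \<one>\<^sub>K : car K" by simp
  show "EX g:car ?Z. g \<oplus>\<^bsub>?Z\<^esub> f = \<zero>\<^bsub>?Z\<^esub>"
  by(rule bexI[OF _ closed(3)[OF m f]], rule eqI)
  (use cl f in "auto simp:s(2-4) K.l_minus K.l_neg")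
 qed (use closed in auto)
 show ?thesis
 proof (unfold_locales)
  show "a \<odot>\<^bsub>?Z\<^esub> x : car ?Z" if "a : car K" "x : car ?Z" for a x using closed(3) that by blast
  show "(a \<oplus>\<^sub>K b) \<odot>\<^bsub>?Z\<^esub> x = a \<odot>\<^bsub>?Z\<^esub> x \<oplus>\<^bsub>?Z\<^esub> b \<odot>\<^bsub>?Z\<^esub> x"
  if "a : car K" "b : car K" "x : car ?Z" for a b x
  by(rule eqI) (use cl that in "auto simp:s(3,4) K.l_distr")
  show "a \<odot>\<^bsub>?Z\<^esub> (x \<oplus>\<^bsub>?Z\<^esub> y) = a \<odot>\<^bsub>?Z\<^esub> x \<oplus>\<^bsub>?Z\<^esub> a \<odot>\<^bsub>?Z\<^esub> y"
  if "a : car K" "x : car ?Z" "y : car ?Z" for a x y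
  by(rule eqI) (use cl that in "auto simp:s(3,4) K.r_distr")
  show "(a \<otimes>\<^sub>K b) \<odot>\<^bsub>?Z\<^esub> x = a \<odot>\<^bsub>?Z\<^esub> (b \<odot>\<^bsub>?Z\<^esub> x)"
  if "a : car K" "b : car K" "x : car ?Z" for a b x
  by(rule eqI) (use cl that in "auto simp:s(4) K.m_assoc")
  show "\<one>\<^sub>K \<odot>\<^bsub>?Z\<^esub> x = x" if "x : car ?Z" for x
  by(rule eqI) (use cl ext that in "auto simp:s(4)")
 qed
qed

lemma cyc_simps:
 "car (cocycle_space K A P n) = cocycles K A P n"
 "add (cocycle_space K A P n) = (%f g. \<lambda>x\<in>car P$n. f x \<oplus>\<^sub>K g x)"
 "smult (cocycle_space K A P n) = (%c f. \<lambda>x\<in>car P$n. c \<otimes>\<^sub>K f x)"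
 "zero (cocycle_space K A P n) = (\<lambda>x\<in>car P$n. \<zero>\<^sub>K)"
 by(simp_all add:cocycle_space_def Let_def)

lemma cocycle_vs: "vector_space_over K (cocycle_space K A P n)"
 by(intro vector_space_over.intro cocycle_space_module K.field_axioms)

lemma bdry_restrict: "bdry P n (restrict f (car P$n)) \<longleftrightarrow> bdry P n f"
 by(rule bdry_cong) simp

lemma cob_sub: "subspace K (cocycle_space K A P n) (coboundaries K A P n)"
proof -
 have "coboundaries K A P n \<subseteq> cocycles K A P n"
  unfolding coboundaries_eq cocycles_eq using bdry_cocyc by auto
 thus ?thesis unfolding subspace_def cyc_simps
  unfolding coboundaries_eq
  by(auto simp:bdry_restrict bdry_zero bdry_add bdry_smult)
qed

text \<open>Negation in the cocycle space is given only implicitly by its group structure, so the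
  difference is found by solving f = g + h for h.\<close>

lemma cocycle_diff:
 assumes "f : cocyc P n" "g : cocyc P n"
 shows "restrict f (car P$n) \<ominus>\<^bsub>cocycle_space K A P n\<^esub> restrict g (car P$n)
  = (\<lambda>x\<in>car P$n. f x \<ominus>\<^sub>K g x)"
proof -
 interpret Z: vector_space_over K "cocycle_space K A P n" by(rule cocycle_vs)
 have "restrict f (car P$n) = restrict g (car P$n) \<oplus>\<^bsub>cocycle_space K A P n\<^esub>
  (\<lambda>x\<in>car P$n. f x \<ominus>\<^sub>K g x)"
  using cocyc_closed[OF assms(1)] cocyc_closed[OF assms(2)]
  by(intro extensionalityI[of _ "car P$n"])
  (auto simp:cyc_simps a_minus_def K.a_lcomm K.r_neg)
 thus ?thesis using restrict_cocyc[OF assms(1)] restrict_cocyc[OF assms(2)]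
  restrict_cocyc[OF cocyc_diff[OF assms]]
  by(subst Z.M.diff_eq_iff) (auto simp:cyc_simps(1))
qed

abbreviation "cls n f \<equiv> Ext_class K A P n f"
abbreviation "ES n \<equiv> Ext_space K A P n"

lemma ES_simps:
 "car (ES n) = a_rcosets\<^bsub>cocycle_space K A P n\<^esub> (coboundaries K A P n)"
 "zero (ES n) = coboundaries K A P n" "add (ES n) = set_add (cocycle_space K A P n)"
 "smult (ES n) = coset_smult (cocycle_space K A P n) (coboundaries K A P n)"
 by(simp_all add:Ext_space_def Let_def)

lemma cls_closed: "f : cocyc P n ==> cls n f : car (ES n)"
 unfolding ES_simps vector_space_over.rcosets_eq[OF cocycle_vs cob_sub] Ext_class_def
 using restrict_cocyc by(auto simp:cyc_simps)

lemma cls_surj: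
 assumes "X : car (ES n)" obtains f where "f : cocyc P n" "X = cls n f"
proof -
 obtain f where f: "f : cocycles K A P n" "X = coboundaries K A P n +>\<^bsub>cocycle_space K A P n\<^esub> f"
  using assms unfolding ES_simps vector_space_over.rcosets_eq[OF cocycle_vs cob_sub]
  cyc_simps by blast
 hence "restrict f (car P$n) = f" "f : cocyc P n"
  unfolding cocycles_eq by(auto simp:extensional_restrict)
 thus ?thesis using that[of f] f(2) by(simp add:Ext_class_def)
qed

lemma cls_eq_iff:
 assumes "f : cocyc P n" "g : cocyc P n"
 shows "cls n f = cls n g \<longleftrightarrow> bdry P n (%x. f x \<ominus>\<^sub>K g x)"
 unfolding Ext_class_def
 using restrict_cocyc[OF assms(1)] restrict_cocyc[OF assms(2)]
 by(subst vector_space_over.coset_eq_iff[OF cocycle_vs cob_sub])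
  (auto simp:cyc_simps(1) cocycle_diff[OF assms] coboundaries_eq bdry_restrict)

lemma cls_cong:
 assumes "!!x. x : car P$n ==> f x = g x" shows "cls n f = cls n g"
 unfolding Ext_class_def using assms by(simp cong: restrict_cong)

lemma cls_mem:
 assumes "f : cocyc P n" "f' : cls n f"
 shows "f' : cocyc P n" "bdry P n (%x. f' x \<ominus>\<^sub>K f x)"
proof -
 have *: "f' : cocycles K A P n"
  "f' \<ominus>\<^bsub>cocycle_space K A P n\<^esub> restrict f (car P$n) : coboundaries K A P n"
  using assms(2) restrict_cocyc[OF assms(1)]
  vector_space_over.coset_mem[OF cocycle_vs cob_sub, of "restrict f (car P$n)" n f']
  unfolding Ext_class_def cyc_simps by auto
 thus 1: "f' : cocyc P n" by(simp add:cocycles_eq)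
 have "restrict f' (car P$n) = f'" using *(1) by(simp add:cocycles_eq extensional_restrict)
 thus "bdry P n (%x. f' x \<ominus>\<^sub>K f x)"
  using *(2) cocycle_diff[OF 1 assms(1)] by(simp add:coboundaries_eq bdry_restrict)
qed

lemma cls_self: "f : cocyc P n ==> restrict f (car P$n) : cls n f"
 unfolding Ext_class_def using restrict_cocyc[of f n]
  vector_space_over.coset_mem[OF cocycle_vs cob_sub, of "restrict f (car P$n)" n
  "restrict f (car P$n)"] cocycle_diff[of f n f] cocyc_closed[of f n]
  bdry_cong[of n "%x. f x \<ominus>\<^sub>K f x" "%x. \<zero>\<^sub>K"]
 by(auto simp:cyc_simps coboundaries_eq bdry_restrict bdry_zero K.diff_self)

lemma cls_add:
 assumes "f : cocyc P n" "g : cocyc P n"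
 shows "cls n f \<oplus>\<^bsub>ES n\<^esub> cls n g = cls n (%x. f x \<oplus>\<^sub>K g x)"
proof -
 have "restrict f (car P$n) \<oplus>\<^bsub>cocycle_space K A P n\<^esub> restrict g (car P$n)
  = restrict (%x. f x \<oplus>\<^sub>K g x) (car P$n)"
  by(auto simp:cyc_simps)
 thus ?thesis unfolding ES_simps Ext_class_def
  using restrict_cocyc[OF assms(1)] restrict_cocyc[OF assms(2)]
  by(subst vector_space_over.coset_add[OF cocycle_vs cob_sub])
  (auto simp:cyc_simps(1))
qed

lemma cls_smult:
 assumes "f : cocyc P n" "c : car K"
 shows "c \<odot>\<^bsub>ES n\<^esub> cls n f = cls n (%x. c \<otimes>\<^sub>K f x)"
proof -
 have "c \<odot>\<^bsub>cocycle_space K A P n\<^esub> restrict f (car P$n)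
  = restrict (%x. c \<otimes>\<^sub>K f x) (car P$n)"
  by(auto simp:cyc_simps)
 thus ?thesis unfolding ES_simps Ext_class_def
  using restrict_cocyc[OF assms(1)] assms(2)
  by(subst vector_space_over.coset_smult_eq[OF cocycle_vs cob_sub])
  (auto simp:cyc_simps(1))
qed

lemma cls_zero: "cls n zf.\<^sub>K = \<zero>\<^bsub>ES n\<^esub>"
 unfolding ES_simps Ext_class_def
 using vector_space_over.coset_zero[OF cocycle_vs cob_sub, of n]
 by(simp add:cyc_simps)

lemma ES_group: "abelian_group (ES n)"
proof (rule abelian_groupI)
 fix X Y Z assume X: "X : car (ES n)" and Y: "Y : car (ES n)" and Z: "Z : car (ES n)"
 obtain f where f: "f : cocyc P n" "X = cls n f" by(rule cls_surj[OF X])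
 obtain g where g: "g : cocyc P n" "Y = cls n g" by(rule cls_surj[OF Y])
 obtain h where h: "h : cocyc P n" "Z = cls n h" by(rule cls_surj[OF Z])
 have "cls n (%x. f x \<oplus>\<^sub>K g x \<oplus>\<^sub>K h x) = cls n (%x. f x \<oplus>\<^sub>K (g x \<oplus>\<^sub>K h x))"
  by(rule cls_cong) (simp add:K.a_assoc cocyc_closed[OF f(1)] cocyc_closed[OF g(1)] cocyc_closed[OF h(1)])
 thus "X \<oplus>\<^bsub>ES n\<^esub> Y \<oplus>\<^bsub>ES n\<^esub> Z = X \<oplus>\<^bsub>ES n\<^esub> (Y \<oplus>\<^bsub>ES n\<^esub> Z)"
  using f g h by(simp add:cls_add cocyc_add)
next
 fix X Y assume X: "X : car (ES n)" and Y: "Y : car (ES n)"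
 obtain f where f: "f : cocyc P n" and [simp]: "X = cls n f" by(rule cls_surj[OF X])
 obtain g where g: "g : cocyc P n" and [simp]: "Y = cls n g" by(rule cls_surj[OF Y])
 note fg = f g
 show "X \<oplus>\<^bsub>ES n\<^esub> Y : car (ES n)" using fg by(simp add:cls_add cls_closed cocyc_add)
 have "cls n (%x. f x \<oplus>\<^sub>K g x) = cls n (%x. g x \<oplus>\<^sub>K f x)"
  by(rule cls_cong) (simp add:K.a_comm cocyc_closed[OF f] cocyc_closed[OF g])
 thus "X \<oplus>\<^bsub>ES n\<^esub> Y = Y \<oplus>\<^bsub>ES n\<^esub> X" using fg by(simp add:cls_add)
next
 show "\<zero>\<^bsub>ES n\<^esub> : car (ES n)" using cls_closed[OF cocyc_zero] by(simp add:cls_zero)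
 fix X assume X: "X : car (ES n)"
 obtain f where f: "f : cocyc P n" and [simp]: "X = cls n f" by(rule cls_surj[OF X])
 have "cls n (%x. \<zero>\<^sub>K \<oplus>\<^sub>K f x) = cls n f"
  by(rule cls_cong) (simp add:cocyc_closed[OF f])
 thus "\<zero>\<^bsub>ES n\<^esub> \<oplus>\<^bsub>ES n\<^esub> X = X"
  using f by(simp add:cls_zero[symmetric] cls_add cocyc_zero)
 have n: "(%x. (\<ominus>\<^sub>K \<one>\<^sub>K) \<otimes>\<^sub>K f x) : cocyc P n" using f by(intro cocyc_smult) auto
 have "cls n (%x. (\<ominus>\<^sub>K \<one>\<^sub>K) \<otimes>\<^sub>K f x \<oplus>\<^sub>K f x) = cls n zf.\<^sub>K"
  by(rule cls_cong) (simp add:cocyc_closed[OF f] K.l_minus K.l_neg)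
 hence "cls n (%x. (\<ominus>\<^sub>K \<one>\<^sub>K) \<otimes>\<^sub>K f x) \<oplus>\<^bsub>ES n\<^esub> X = \<zero>\<^bsub>ES n\<^esub>"
  by(simp add:cls_add[OF n f] cls_zero)
 thus "EX Y:car (ES n). Y \<oplus>\<^bsub>ES n\<^esub> X = \<zero>\<^bsub>ES n\<^esub>" using cls_closed[OF n] by(rule bexI)
qed

text \<open>A homotopy changes the pullback of a cocycle by a coboundary; \<open>b\<close> accounts for
 replacing the lifted cocycle by a cohomologous one.\<close>

lemma homotopy_bdry:
 fixes T :: "('a, 't, 'k) resolution"
 assumes T: "graded_free_resolution K A T" and z: "z : cocyc T n"
  and u: "!!i. u i : ghoms A P$(m + i) T$i"
  and ud: "!!i x. x : car (res_mod P (Suc (m + i))) ==> res_diff T i (u (Suc i) x) = u i (res_diff P (m + i) x)"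
  and ub: "bdry P m (%x. res_aug T (u 0 x))"
 shows "bdry P (m + n) (%x. z (u n x))"
proof -
 have zgh: "z : ghoms A T$n triv" using z by(simp add:cocyc_def)
 interpret TM: left_module A "T$j" for j by(rule res_left[OF T])
 \<comment> \<open>If the augmentation of \<open>u 0\<close> is y d, lifting y through the
   augmentation of T to a map v gives b = v d. For m = 0 the augmentation vanishes and b = 0
   works.\<close>
 obtain b where b: "b : ghoms A P$m T$0"
  "!!x. x : car P$(Suc m) ==> b (res_diff P m x) = \<zero>\<^bsub>T$0\<^esub>"
  "!!x. x : car P$m ==> res_aug T (u 0 x) = res_aug T (b x)"
  "n = 0 ==> bdry P m (%x. z (b x))"
 proof (cases m)
  case 0
  show ?thesis
  proof (rule that[of "%x. \<zero>\<^bsub>T$0\<^esub>"])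
  show "(%x. \<zero>\<^bsub>T$0\<^esub>) : ghoms A P$m T$0"
  by(rule gh_zero[OF res_mods[OF P] res_mods[OF T]])
  show "res_aug T (u 0 x) = res_aug T \<zero>\<^bsub>T$0\<^esub>" if "x : car P$m" for x
  using ub that 0 linear_zero[OF res_ab[OF T] triv_ab hd_linear[OF aug_hd[OF T]]] by(simp add:bdry_def)
  show "bdry P m (%x. z \<zero>\<^bsub>T$0\<^esub>)" if n0: "n = 0"
  proof -
  have "z \<zero>\<^bsub>T$0\<^esub> = \<zero>\<^sub>K"
  using linear_zero[OF res_ab[OF T] triv_ab gh_linear[OF zgh]] by(simp add:n0)
  thus ?thesis using bdry_zero[of m] by simp
  qed
  qed simp
 next
  case (Suc l)
  obtain y where y: "y : ghoms A P$l triv"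
  "ALL x:car P$m. res_aug T (u 0 x) = y (res_diff P l x)"
  using ub Suc unfolding bdry_def by auto
  have "y x : res_aug T ` car T$0" if "x : car P$l" for x
  using gh_closed[OF y(1) that] unfolding res_aug_surj[OF T] by simp
  from lift_graded[OF res_graded[OF P] res_free[OF P] triv_graded res_graded[OF T] aug_hd[OF T] y(1) this]
  obtain v where v: "v : ghoms A P$l T$0"
  "ALL x:car P$l. res_aug T (v x) = y x" by(rule bexE)
  show ?thesis
  proof (rule that[of "%x. v (res_diff P l x)"])
  show "(%x. v (res_diff P l x)) : ghoms A P$m T$0"
  unfolding Suc by(rule gh_comp[OF res_mods[OF P] res_mods[OF P] res_mods[OF T] v(1) diff_gh[OF P]])
  show "v (res_diff P l (res_diff P m x)) = \<zero>\<^bsub>T$0\<^esub>" if "x : car P$(Suc m)" for x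
  using that diff_diff[OF P, of x l] linear_zero[OF res_ab[OF P] res_ab[OF T] gh_linear[OF v(1)]]
  by(simp add:Suc)
  show "res_aug T (u 0 x) = res_aug T (v (res_diff P l x))" if "x : car P$m" for x
  using that y(2) v(2) diff_closed[OF P, of x l] by(simp add:Suc)
  show "bdry P m (%x. z (v (res_diff P l x)))" if n0: "n = 0"
  unfolding bdry_def Suc nat.case
  using gh_comp[OF res_mods[OF P] res_mods[OF T] triv_mods zgh[unfolded n0] v(1)]
  by(intro bexI[of _ "%x. z (v x)"]) auto
  qed
 qed
 obtain s where s: "!!i. s i : ghoms A P$(m + i) T$(Suc i)"
  "!!x. x : car P$m ==> u 0 x = res_diff T 0 (s 0 x) \<oplus>\<^bsub>T$0\<^esub> b x"
  "!!i x. x : car (res_mod P (Suc (m + i))) ==>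
  u (Suc i) x = res_diff T (Suc i) (s (Suc i) x) \<oplus>\<^bsub>res_mod T (Suc i)\<^esub> s i (res_diff P (m + i) x)"
  by(rule homotopy_exists[OF P T u ud b(1) b(2) b(3)]) (assumption | rule that)+
 have zd: "z (res_diff T n x) = \<zero>\<^sub>K" if "x : car T$(Suc n)" for x
  using z that by(simp add:cocyc_def)
 note zadd = linear_add[OF gh_linear[OF zgh]]
 \<comment> \<open>The cocycle z kills the terms in the image of a differential of T. For n = 0 only
   z b is left, which is a coboundary by the choice of b; for n > 0 it is z s d, the coboundary of z
   s.\<close>
 show ?thesis
 proof (cases n)
  case 0
  have "z (u n x) = z (b x)" if x: "x : car P$m" for x
  proof -
  have sx: "s 0 x : car T$(Suc 0)" using gh_closed[OF s(1)[of 0]] x by simp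
  have "z (u n x) = z (res_diff T 0 (s 0 x)) \<oplus>\<^sub>K z (b x)"
  using zadd[OF _ _, of "res_diff T 0 (s 0 x)" "b x"] diff_closed[OF T sx] gh_closed[OF b(1) x] s(2)[OF x] 0 by simp
  thus ?thesis using zd[unfolded 0, OF sx] gh_closed[OF zgh, of "b x"] gh_closed[OF b(1) x] 0 by simp
  qed
  thus ?thesis using b(4)[OF 0] bdry_cong[of m "%x. z (u n x)" "%x. z (b x)"] 0 by simp
 next
  case (Suc k)
  have "z (u n x) = z (s k (res_diff P (m + k) x))" if x: "x : car (res_mod P (Suc (m + k)))" for x
  proof -
  have sx: "s (Suc k) x : car (res_mod T (Suc (Suc k)))" using gh_closed[OF s(1)[of "Suc k"]] x by simp
  have sd: "s k (res_diff P (m + k) x) : car T$(Suc k)"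
  using gh_closed[OF s(1)[of k] diff_closed[OF P x]] .
  have "z (u n x) = z (res_diff T (Suc k) (s (Suc k) x)) \<oplus>\<^sub>K z (s k (res_diff P (m + k) x))"
  using zadd[OF _ _, of "res_diff T (Suc k) (s (Suc k) x)" "s k (res_diff P (m + k) x)"]
  diff_closed[OF T sx] sd s(3)[OF x] Suc by simp
  thus ?thesis using zd[unfolded Suc, OF sx] gh_closed[OF zgh[unfolded Suc] sd] by simp
  qed
  moreover have "(%x. z (s k x)) : ghoms A P$(m + k) triv"
  by(rule gh_comp[OF res_mods[OF P] res_mods[OF T] triv_mods zgh[unfolded Suc] s(1)])
  ultimately show ?thesis unfolding bdry_def Suc add_Suc_right nat.case
  by(intro bexI[of _ "%x. z (s k x)"]) (auto simp:Suc)
 qed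
qed

end

end

section \<open>The cobar differential algebra in coordinates\<close>

text \<open>The concatenation product: the sum of f u times g v over all factorisations of the word
  into u and v. The recursion on the word separates the factorisation with u empty.\<close>

fun conv :: "('k, 'r) ring_scheme => ('x list => 'k) => ('x list => 'k) => 'x list => 'k" where
 "conv R f g [] = f [] \<otimes>\<^sub>R g []"
| "conv R f g (x # w) = f [] \<otimes>\<^sub>R g (x # w) \<oplus>\<^sub>R conv R (%u. f (x # u)) g w"

text \<open>For an augmentation ideal with basis \<open>e\<close> and products \<open>e x \<cdot> e y = \<Sum> z. c x y z \<cdot> e z\<close>, this is
 \<open>- (f (xy | ...) - f (x | y\<cdot>...) + ...)\<close>, the reduced cobar differential.\<close>

fun cobd :: "('k, 'r) ring_scheme => ('x => 'x => 'x => 'k) => ('x list => 'k) => 'x list => 'k" where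
 "cobd R c f [] = \<zero>\<^sub>R"
| "cobd R c f [x] = \<zero>\<^sub>R"
| "cobd R c f (x # y # v) =
  \<ominus>\<^sub>R (\<Oplus>\<^sub>R z\<in>{z. c x y z ~= \<zero>\<^sub>R}. c x y z \<otimes>\<^sub>R f (z # v)) \<ominus>\<^sub>R cobd R c (%u. f (x # u)) (y # v)"

text \<open>The sign involution given by the parity of the word length, which carries the sign of
  the Leibniz rule.\<close>

definition twist :: "('k, 'r) ring_scheme => ('x list => 'k) => 'x list => 'k" where
 "twist R f = (%w. if even (length w) then f w else \<ominus>\<^sub>R f w)"

definition struct_consts :: "('k, 'r) ring_scheme => ('x => 'x => 'x => 'k) => bool" where
 "struct_consts R c \<longleftrightarrow> (ALL x y z. c x y z : car R) & (ALL x y. finite {z. c x y z ~= \<zero>\<^sub>R})"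

text \<open>Transport of cochains along a map j of alphabets, by zero off the words in its range.
  For injective j it is an embedding for the concatenation product.\<close>

definition relab :: "('k, 'r) ring_scheme => ('x => 'z) => ('x list => 'k) => 'z list => 'k" where
 "relab R j f = (%w. if set w \<subseteq> range j then f (map (inv_into UNIV j) w) else \<zero>\<^sub>R)"

context field
begin

abbreviation vals :: "('w => 'a) => bool" where "vals f \<equiv> ALL w. f w : car R"

lemma conv_closed [simp]: "vals f ==> vals g ==> conv R f g w : car R"
 by(induct w arbitrary: f) auto

lemma conv_add_l:
 assumes "vals f" "vals f'" "vals g"
 shows "conv R (%w. f w \<oplus> f' w) g = (%w. conv R f g w \<oplus> conv R f' g w)"
proof
 show "conv R (%w. f w \<oplus> f' w) g w = conv R f g w \<oplus> conv R f' g w" for w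
  using assms
 proof (induct w arbitrary: f f')
  case (Cons x w)
  from Cons(1)[of "%u. f (x # u)" "%u. f' (x # u)"] Cons(2-) show ?case
  by(simp add:l_distr add4)
 qed (simp add:l_distr)
qed

lemma conv_add_r:
 assumes "vals f" "vals g" "vals g'"
 shows "conv R f (%w. g w \<oplus> g' w) = (%w. conv R f g w \<oplus> conv R f g' w)"
proof
 show "conv R f (%w. g w \<oplus> g' w) w = conv R f g w \<oplus> conv R f g' w" for w
  using assms
 proof (induct w arbitrary: f)
  case (Cons x w)
  from Cons(1)[of "%u. f (x # u)"] Cons(2-) show ?case
  by(simp add:r_distr add4)
 qed (simp add:r_distr)
qed

lemma conv_smult_l:
 assumes "a : car R" "vals f" "vals g"
 shows "conv R (%w. a \<otimes> f w) g = (%w. a \<otimes> conv R f g w)"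
proof
 show "conv R (%w. a \<otimes> f w) g w = a \<otimes> conv R f g w" for w
  using assms
 proof (induct w arbitrary: f)
  case (Cons x w)
  from Cons(1)[of "%u. f (x # u)"] Cons(2-) show ?case
  by(simp add:r_distr m_assoc)
 qed (simp add:m_assoc)
qed

lemma conv_smult_r:
 assumes "a : car R" "vals f" "vals g"
 shows "conv R f (%w. a \<otimes> g w) = (%w. a \<otimes> conv R f g w)"
proof
 show "conv R f (%w. a \<otimes> g w) w = a \<otimes> conv R f g w" for w
  using assms
 proof (induct w arbitrary: f)
  case (Cons x w)
  from Cons(1)[of "%u. f (x # u)"] Cons(2-) show ?case
  by(simp add:r_distr m_lcomm)
 qed (simp add:m_lcomm)
qed

lemma conv_neg_l: "vals f ==> vals g ==> conv R (%w. \<ominus> f w) g = (%w. \<ominus> conv R f g w)"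
 using conv_smult_l[of "\<ominus> \<one>" f g] by(simp add:l_minus)

lemma conv_neg_r: "vals f ==> vals g ==> conv R f (%w. \<ominus> g w) = (%w. \<ominus> conv R f g w)"
 using conv_smult_r[of "\<ominus> \<one>" f g] by(simp add:l_minus)

lemma conv_diff_l:
 "vals f ==> vals f' ==> vals g ==>
  conv R (%w. f w \<ominus> f' w) g = (%w. conv R f g w \<ominus> conv R f' g w)"
 using conv_add_l[of f "%w. \<ominus> f' w" g] by(simp add:a_minus_def conv_neg_l)

lemma conv_diff_r:
 "vals f ==> vals g ==> vals g' ==>
  conv R f (%w. g w \<ominus> g' w) = (%w. conv R f g w \<ominus> conv R f g' w)"
 using conv_add_r[of f g "%w. \<ominus> g' w"] by(simp add:a_minus_def conv_neg_r)

lemma conv_zero_l [simp]: "vals g ==> conv R zf. g = zf."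
 using conv_smult_l[of \<zero> "%w. \<zero>" g] by simp

lemma conv_zero_r [simp]: "vals f ==> conv R f zf. = zf."
 using conv_smult_r[of \<zero> f "%w. \<zero>"] by simp

lemma conv_sum_l:
 assumes "finite S" "!!z. z : S ==> vals (F z)" "vals g"
 shows "conv R (%w. \<Oplus>z\<in>S. F z w) g = (%w. \<Oplus>z\<in>S. conv R (F z) g w)"
 using assms(1,2)
proof (induct S)
 case empty
 thus ?case using assms(3) by simp
next
 case (insert z S)
 have v: "vals (F z)" "vals (%w. \<Oplus>z\<in>S. F z w)" using insert.prems by(auto intro!: finsum_closed)
 have "(\<Oplus>z\<in>insert z S. F z w) = F z w \<oplus> (\<Oplus>z\<in>S. F z w)" for w
  using insert by(intro finsum_insert) auto
 moreover have "(\<Oplus>z\<in>insert z S. conv R (F z) g w) = conv R (F z) g w \<oplus> (\<Oplus>z\<in>S. conv R (F z) g w)" for w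
  using insert assms(3) by(intro finsum_insert) auto
 ultimately show ?case using insert conv_add_l[OF v assms(3)] by simp
qed

lemma conv_assoc:
 assumes "vals f" "vals g" "vals h"
 shows "conv R (conv R f g) h = conv R f (conv R g h)"
proof
 show "conv R (conv R f g) h w = conv R f (conv R g h) w" for w
  using assms
 proof (induct w arbitrary: f g)
  case Nil
  thus ?case by(simp add:m_assoc)
 next
  case (Cons x w)
  have v: "vals (%u. f (x # u))" "vals (%u. g (x # u))" using Cons(2-) by auto
  have "(%u. conv R f g (x # u)) = (%u. f [] \<otimes> g (x # u) \<oplus> conv R (%u. f (x # u)) g u)" by simp
  hence "conv R (%u. conv R f g (x # u)) h w
  = f [] \<otimes> conv R (%u. g (x # u)) h w \<oplus> conv R (conv R (%u. f (x # u)) g) h w"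
  using Cons(2-) v by(simp add:conv_add_l conv_smult_l)
  thus ?case
  using Cons(1)[OF v(1) Cons(3,4)] Cons(2-) v
  by(simp add:m_assoc r_distr a_assoc)
 qed
qed

lemma mon_vals [simp]: "a : car R ==> mon R a w v : car R"
 by(simp add:mon_def)

lemma conv_mon_Nil [simp]:
 assumes "a : car R" "vals g" shows "conv R (mon R a []) g = (%w. a \<otimes> g w)"
proof
 show "conv R (mon R a []) g w = a \<otimes> g w" for w
  using assms by(cases w) (simp_all add:mon_def)
qed

lemma conv_mon_Cons:
 assumes "a : car R" "vals g"
 shows "conv R (mon R a (x # u)) g (y # w) = (if x = y then conv R (mon R a u) g w else \<zero>)"
  "conv R (mon R a (x # u)) g [] = \<zero>"
proof -
 have "(%v. mon R a (x # u) (y # v)) = (if x = y then mon R a u else zf.)"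
  by(auto simp:mon_def)
 moreover have "mon R a (x # u) [] = \<zero>" by(simp add:mon_def)
 ultimately show "conv R (mon R a (x # u)) g (y # w) = (if x = y then conv R (mon R a u) g w else \<zero>)"
  using assms by simp
 show "conv R (mon R a (x # u)) g [] = \<zero>" using assms by(simp add:mon_def)
qed

lemma conv_mon_mon:
 assumes "a : car R" "b : car R"
 shows "conv R (mon R a u) (mon R b v) = mon R (a \<otimes> b) (u @ v)"
proof
 show "conv R (mon R a u) (mon R b v) w = mon R (a \<otimes> b) (u @ v) w" for w
 proof (induct u arbitrary: w)
  case Nil
  show ?case using assms by simp (simp add:mon_def)
 next
  case (Cons x u)
  show ?case
  proof (cases w)
  case Nil
  thus ?thesis using assms by(simp add:conv_mon_Cons) (simp add:mon_def)
  next
  case w: (Cons y t)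
  have "conv R (mon R a (x # u)) (mon R b v) w = (if x = y then mon R (a \<otimes> b) (u @ v) t else \<zero>)"
  unfolding w using assms Cons by(subst conv_mon_Cons) simp_all
  thus ?thesis by(simp add:mon_def w)
  qed
 qed
qed

lemma conv_one_r:
 assumes "vals f" shows "conv R f (mon R \<one> []) = f"
proof
 show "conv R f (mon R \<one> []) w = f w" for w
  using assms
 proof (induct w arbitrary: f)
  case (Cons x w)
  from Cons(1)[of "%u. f (x # u)"] Cons(2) show ?case by(simp add:mon_def)
 qed (simp add:mon_def)
qed

lemma conv_supp:
 "vals f ==> vals g ==> conv R f g w ~= \<zero> ==> EX u v. w = u @ v & f u ~= \<zero> & g v ~= \<zero>"
proof (induct w arbitrary: f)
 case Nil
 thus ?case by(intro exI[of _ "[]"]) auto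
next
 case (Cons x w)
 show ?case
 proof (cases "f [] \<otimes> g (x # w) = \<zero>")
  case True
  hence "conv R (%u. f (x # u)) g w ~= \<zero>" using Cons(2-) by auto
  then obtain u v where "w = u @ v" "f (x # u) ~= \<zero>" "g v ~= \<zero>"
  using Cons(1)[of "%u. f (x # u)"] Cons(2,3) by auto
  thus ?thesis by(intro exI[of _ "x # u"] exI[of _ v]) auto
 next
  case False
  hence "f [] ~= \<zero>" "g (x # w) ~= \<zero>" using Cons(2,3) by auto
  thus ?thesis by(intro exI[of _ "[]"] exI[of _ "x # w"]) auto
 qed
qed

lemma ffun_vals: "f : ffun R W ==> vals f"
 by(simp add:ffun_closed)

lemma conv_fin_gen:
 assumes "f : ffun R U" "g : ffun R V" "!!u v. u : U ==> v : V ==> u @ v : W"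
 shows "conv R f g : ffun R W"
proof (rule ffunI[where S = "(%(u, v). u @ v) ` ((supp. f) \<times> (supp. g))"])
 note v = ffun_vals[OF assms(1)] ffun_vals[OF assms(2)]
 show "conv R f g w : car R" for w using v by simp
 show "finite ((%(u, v). u @ v) ` ((supp. f) \<times> (supp. g)))"
  using assms ffun_finite by blast
 fix w assume "conv R f g w ~= \<zero>"
 then obtain u v where w: "w = u @ v" "f u ~= \<zero>" "g v ~= \<zero>" using conv_supp[OF v] by blast
 thus "w : (%(u, v). u @ v) ` ((supp. f) \<times> (supp. g))" by force
 show "w : W" using w assms ffun_supp by metis
qed

lemma conv_fin: "f : ffun R (lists X) ==> g : ffun R (lists X) ==> conv R f g : ffun R (lists X)"
 by(rule conv_fin_gen) auto

lemma twist_vals [simp]: "vals f ==> twist R f w : car R"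
 by(simp add:twist_def)

lemma twist_twist [simp]: "vals f ==> twist R (twist R f) = f"
 by(auto simp:twist_def)

lemma twist_add: "vals f ==> vals g ==> twist R (%w. f w \<oplus> g w) = (%w. twist R f w \<oplus> twist R g w)"
 by(auto simp:twist_def minus_add)

lemma twist_smult: "a : car R ==> vals f ==> twist R (%w. a \<otimes> f w) = (%w. a \<otimes> twist R f w)"
 by(auto simp:twist_def r_minus)

lemma twist_zero [simp]: "twist R zf. = zf."
 by(auto simp:twist_def)

lemma twist_Cons: "(%u. twist R f (x # u)) = (%u. \<ominus> twist R (%u. f (x # u)) u)" if "vals f"
 using that by(auto simp:twist_def)

lemma twist_fin: "f : ffun R W ==> twist R f : ffun R W"
 by(rule ffunI[where S = "(supp. f)"])
  (auto simp:twist_def ffun_closed ffun_finite dest:ffun_supp split:if_splits)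

lemma sc_closed: "struct_consts R c ==> c x y z : car R"
 by(simp add:struct_consts_def)

lemma sc_finite: "struct_consts R c ==> finite {z. c x y z ~= \<zero>}"
 by(simp add:struct_consts_def)

section \<open>Linearity, locality and Leibniz rule of the cobar differential\<close>

context
 fixes c :: "'x => 'x => 'x => 'a"
 assumes c: "struct_consts R c"
begin

abbreviation "msum x y f v \<equiv> \<Oplus>z\<in>{z. c x y z ~= \<zero>}. c x y z \<otimes> f (z # v)"
abbreviation "dd \<equiv> cobd R c"

lemma sc_sum_closed [simp]: "vals f ==> msum x y f v : car R"
 using sc_closed[OF c] by(intro finsum_closed) auto

lemma msum_add:
 "vals f ==> vals g ==> msum x y (%w. f w \<oplus> g w) v = msum x y f v \<oplus> msum x y g v"
 using sc_closed[OF c] by(subst finsum_addf[symmetric]) (auto simp:r_distr intro!: finsum_cong')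

lemma msum_smult:
 assumes "a : car R" "vals f" shows "msum x y (%w. a \<otimes> f w) v = a \<otimes> msum x y f v"
proof -
 have "a \<otimes> msum x y f v = (\<Oplus>z\<in>{z. c x y z ~= \<zero>}. a \<otimes> (c x y z \<otimes> f (z # v)))"
  using assms sc_closed[OF c] sc_finite[OF c] by(intro finsum_rdistr) auto
 thus ?thesis using assms sc_closed[OF c] by(auto simp:m_lcomm intro!: finsum_cong')
qed

lemma cobd_closed [simp]: "vals f ==> dd f w : car R"
proof (induct w arbitrary: f)
 case (Cons x w)
 show ?case
 proof (cases w)
  case (Cons y v)
  have "dd (%u. f (x # u)) w : car R" using Cons.hyps[of "%u. f (x # u)"] Cons.prems by simp
  thus ?thesis using Cons Cons.prems by simp
 qed simp
qed simp

lemma cobd_add: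
 assumes "vals f" "vals g"
 shows "dd (%w. f w \<oplus> g w) = (%w. dd f w \<oplus> dd g w)"
proof
 show "dd (%w. f w \<oplus> g w) w = dd f w \<oplus> dd g w" for w
  using assms
 proof (induct w arbitrary: f g)
  case (Cons x w)
  show ?case
  proof (cases w)
  case w: (Cons y v)
  have "dd (%u. f (x # u) \<oplus> g (x # u)) w = dd (%u. f (x # u)) w \<oplus> dd (%u. g (x # u)) w"
  using Cons.hyps[of "%u. f (x # u)" "%u. g (x # u)"] Cons.prems by simp
  thus ?thesis using w Cons.prems
  by(simp add:msum_add minus_add minus_add4)
  qed simp
 qed simp
qed

lemma cobd_smult:
 assumes "a : car R" "vals f"
 shows "dd (%w. a \<otimes> f w) = (%w. a \<otimes> dd f w)"
proof
 show "dd (%w. a \<otimes> f w) w = a \<otimes> dd f w" for w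
  using assms
 proof (induct w arbitrary: f)
  case (Cons x w)
  show ?case
  proof (cases w)
  case w: (Cons y v)
  have "dd (%u. a \<otimes> f (x # u)) w = a \<otimes> dd (%u. f (x # u)) w"
  using Cons.hyps[of "%u. f (x # u)"] Cons.prems by simp
  thus ?thesis using w Cons.prems
  by(simp add:msum_smult a_minus_def r_distr r_minus)
  qed (use Cons.prems in simp)
 qed simp
qed

lemma cobd_neg: "vals f ==> dd (%w. \<ominus> f w) = (%w. \<ominus> dd f w)"
 using cobd_smult[of "\<ominus> \<one>" f] by(simp add:l_minus)

lemma cobd_diff: "vals f ==> vals g ==> dd (%w. f w \<ominus> g w) = (%w. dd f w \<ominus> dd g w)"
 using cobd_add[of f "%w. \<ominus> g w"] by(simp add:a_minus_def cobd_neg)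

lemma cobd_zero [simp]: "dd zf. = zf."
 using cobd_smult[of \<zero> "%w. \<zero>"] by simp

text \<open>The value at w involves f only on words one letter shorter. Truncation by length and
  signs depending on length can therefore be moved through the differential.\<close>

lemma cobd_local:
 assumes "!!u. Suc (length u) = length w ==> f u = g u"
 shows "dd f w = dd g w"
 using assms
proof (induct w arbitrary: f g)
 case (Cons x w)
 show ?case
 proof (cases w)
  case w: (Cons y v)
  have "dd (%u. f (x # u)) w = dd (%u. g (x # u)) w" by(rule Cons.hyps) (use Cons.prems in simp)
  moreover have "f (z # v) = g (z # v)" for z by(rule Cons.prems) (simp add:w)
  ultimately show ?thesis using w by simp
 qed simp
qed simp

lemma cobd_twist:
 assumes "vals f" shows "dd (twist R f) = (%w. \<ominus> twist R (dd f) w)"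
proof
 fix w
 show "dd (twist R f) w = \<ominus> twist R (dd f) w"
 proof (cases "even (length w)")
  case True
  have "dd (twist R f) w = dd (%u. \<ominus> f u) w"
  proof (rule cobd_local)
  show "twist R f u = \<ominus> f u" if "Suc (length u) = length w" for u
  using True that even_Suc[of "length u"] by(simp add:twist_def)
  qed
  thus ?thesis using True assms by(simp add:cobd_neg twist_def)
 next
  case False
  have "dd (twist R f) w = dd f w"
  proof (rule cobd_local)
  show "twist R f u = f u" if "Suc (length u) = length w" for u
  using False that even_Suc[of "length u"] by(simp add:twist_def)
  qed
  thus ?thesis using False assms by(simp add:twist_def)
 qed
qed

text \<open>Induction on the word by its first letter. The product of the first two letters acts
  either on the right factor alone, when the left word is empty, or on the left factor; the
  remaining terms of the recursion are those of the shifted left factor.\<close>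

lemma cobd_leibniz:
 assumes "vals f" "vals g"
 shows "dd (conv R f g) = (%w. conv R (dd f) g w \<oplus> conv R (twist R f) (dd g) w)"
proof
 show "dd (conv R f g) w = conv R (dd f) g w \<oplus> conv R (twist R f) (dd g) w" for w
  using assms(1)
 proof (induct w arbitrary: f)
  case Nil
  thus ?case using assms by simp
 next
  case (Cons x w)
  let ?fx = "%u. f (x # u)"
  have v: "vals f" "vals ?fx" "vals g" using Cons.prems assms by auto
  \<comment> \<open>Passing to the shifted left factor changes the parity of the length, hence the
    minus sign; at the empty word the twist does nothing.\<close>
  have tw: "conv R (twist R f) (dd g) (x # w) = f [] \<otimes> dd g (x # w) \<ominus> conv R (twist R ?fx) (dd g) w"
  using v by(simp add:twist_Cons conv_neg_l a_minus_def) (simp add:twist_def)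
  have cx: "(%u. conv R f g (x # u)) = (%u. f [] \<otimes> g (x # u) \<oplus> conv R ?fx g u)" by simp
  show ?case
  proof (cases w)
  case Nil
  thus ?thesis using v tw by(simp add:l_neg a_minus_def r_neg)
  next
  case w: (Cons y t)
  have m: "msum x y (conv R f g) t = f [] \<otimes> msum x y g t \<oplus> conv R (msum x y f) g t"
  proof -
  have "msum x y (conv R f g) t
  = (\<Oplus>z\<in>{z. c x y z ~= \<zero>}. f [] \<otimes> (c x y z \<otimes> g (z # t)) \<oplus> c x y z \<otimes> conv R (%u. f (z # u)) g t)"
  using v sc_closed[OF c] by(intro finsum_cong') (auto simp:r_distr m_lcomm)
  also have "... = (\<Oplus>z\<in>{z. c x y z ~= \<zero>}. f [] \<otimes> (c x y z \<otimes> g (z # t)))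
  \<oplus> (\<Oplus>z\<in>{z. c x y z ~= \<zero>}. c x y z \<otimes> conv R (%u. f (z # u)) g t)"
  using v sc_closed[OF c] by(intro finsum_addf) auto
  also have "(\<Oplus>z\<in>{z. c x y z ~= \<zero>}. f [] \<otimes> (c x y z \<otimes> g (z # t))) = f [] \<otimes> msum x y g t"
  using v sc_closed[OF c] sc_finite[OF c] by(intro finsum_rdistr[symmetric]) auto
  also have "(\<Oplus>z\<in>{z. c x y z ~= \<zero>}. c x y z \<otimes> conv R (%u. f (z # u)) g t) = conv R (msum x y f) g t"
  using v sc_closed[OF c] sc_finite[OF c] by(subst conv_sum_l) (auto simp:conv_smult_l)
  finally show ?thesis .
  qed
  have d1: "dd (%u. conv R f g (x # u)) w = f [] \<otimes> dd (%u. g (x # u)) w \<oplus> dd (conv R ?fx g) w"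
  unfolding cx using v by(subst cobd_add) (auto simp:cobd_smult)
  have d2: "dd (conv R ?fx g) w = conv R (dd ?fx) g w \<oplus> conv R (twist R ?fx) (dd g) w"
  by(rule Cons.hyps[OF v(2)])
  have d3: "conv R (dd ?fx) g w = conv R (%u. dd ?fx (y # u)) g t" using w v by simp
  have d4: "conv R (dd f) g (x # w) = conv R (%u. \<ominus> msum x y f u \<ominus> dd ?fx (y # u)) g t"
  using w v by simp
  also have "... = \<ominus> conv R (msum x y f) g t \<ominus> conv R (%u. dd ?fx (y # u)) g t"
  using v by(simp add:conv_diff_l conv_neg_l)
  finally have d5: "conv R (dd f) g (x # w) = \<ominus> conv R (msum x y f) g t \<ominus> conv R (dd ?fx) g w"
  using d3 by simp
  have d6: "dd g (x # w) = \<ominus> msum x y g t \<ominus> dd (%u. g (x # u)) w" using w by simp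
  have d7: "dd (conv R f g) (x # w) = \<ominus> msum x y (conv R f g) t \<ominus> dd (%u. conv R f g (x # u)) w"
  using w by simp
  let ?a = "f []" and ?p = "msum x y g t" and ?q = "conv R (msum x y f) g t"
  and ?r = "dd (%u. g (x # u)) w" and ?s = "conv R (dd ?fx) g w" and ?u = "conv R (twist R ?fx) (dd g) w"
  have cl: "?a : car R" "?p : car R" "?q : car R" "?r : car R" "?s : car R" "?u : car R"
  using v by(auto intro!: conv_closed)
  have "dd (conv R f g) (x # w) = \<ominus> (?a \<otimes> ?p \<oplus> ?q) \<ominus> (?a \<otimes> ?r \<oplus> (?s \<oplus> ?u))"
  unfolding d7 m d1 d2 ..
  also have "... = (\<ominus> ?q \<ominus> ?s) \<oplus> (?a \<otimes> (\<ominus> ?p \<ominus> ?r) \<ominus> ?u)"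
  using cl by(simp add:a_minus_def minus_add r_distr r_minus a_ac)
  finally show ?thesis unfolding d5 tw d6 .
  qed
 qed
qed

text \<open>The set S absorbs products with left factor in S, so a word beginning in S is fed by
  words beginning in S only. It is applied with S the letters of one side, or the letters outside
  the range of an embedding.\<close>

lemma cobd_avoid:
 assumes S: "!!x y z. x : S ==> c x y z ~= \<zero> ==> z : S" and f: "!!z v. z : S ==> f (z # v) = \<zero>"
  and z: "z : S"
 shows "dd f (z # v) = \<zero>"
proof (cases v)
 case (Cons y t)
 have "msum z y f t = \<zero>" using S[OF z] f sc_closed[OF c] by(intro finsum_zeroI) auto
 moreover have "(%u. f (z # u)) = zf." using f[OF z] by auto
 ultimately show ?thesis using Cons by(simp add:a_minus_def)
qed simp

end

section \<open>Relabelling of letters\<close>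

context
 fixes j :: "'x => 'z"
 assumes j: "inj j"
begin

lemma relab_Nil [simp]: "relab R j f [] = f []"
 by(simp add:relab_def)

lemma relab_in: "(%u. relab R j f (j x # u)) = relab R j (%u. f (x # u))"
 using j by(auto simp:relab_def)

lemma relab_in' [simp]: "relab R j f (j x # u) = relab R j (%u. f (x # u)) u"
 using fun_cong[OF relab_in] .

lemma relab_out [simp]: "z \<notin> range j ==> relab R j f (z # u) = \<zero>"
 by(auto simp:relab_def)

lemma relab_vals [simp]: "vals f ==> relab R j f w : car R"
 by(simp add:relab_def)

lemma relab_add: "relab R j (%w. f w \<oplus> g w) = (%w. relab R j f w \<oplus> relab R j g w)"
 by(auto simp:relab_def)

lemma relab_diff: "relab R j (%w. f w \<ominus> g w) = (%w. relab R j f w \<ominus> relab R j g w)"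
 by(auto simp:relab_def a_minus_def)

lemma relab_neg: "relab R j (%w. \<ominus> f w) = (%w. \<ominus> relab R j f w)"
 by(auto simp:relab_def)

lemma relab_smult: "a : car R ==> relab R j (%w. a \<otimes> f w) = (%w. a \<otimes> relab R j f w)"
 by(auto simp:relab_def)

lemma relab_zero [simp]: "relab R j zf. = zf."
 by(auto simp:relab_def)

lemma relab_twist: "relab R j (twist R f) = twist R (relab R j f)"
 by(auto simp:relab_def twist_def)

lemma relab_mon: "relab R j (mon R a u) = mon R a (map j u)"
proof
 fix w
 have "map (inv_into UNIV j) w = u \<longleftrightarrow> w = map j u" if "set w \<subseteq> range j"
 proof -
  have "map j (map (inv_into UNIV j) w) = w"
  using that by(auto simp:f_inv_into_f map_idI subset_iff)
  moreover have "map (inv_into UNIV j) (map j u) = u" using j by(simp add:comp_def)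
  ultimately show ?thesis by metis
 qed
 moreover have "set w \<subseteq> range j" if "w = map j u" using that by auto
 ultimately have "set w \<subseteq> range j & map (inv_into UNIV j) w = u \<longleftrightarrow> w = map j u" by argo
 thus "relab R j (mon R a u) w = mon R a (map j u) w" unfolding relab_def mon_def by argo
qed

lemma relab_conv:
 assumes "vals f" "vals g" shows "relab R j (conv R f g) = conv R (relab R j f) (relab R j g)"
proof
 show "relab R j (conv R f g) w = conv R (relab R j f) (relab R j g) w" for w
  using assms(1)
 proof (induct w arbitrary: f)
  case (Cons z w)
  show ?case
  proof (cases "z : range j")
  case True
  then obtain x where z: "z = j x" by auto
  have "relab R j (%u. f [] \<otimes> g (x # u) \<oplus> conv R (%u. f (x # u)) g u) w
  = f [] \<otimes> relab R j (%u. g (x # u)) w \<oplus> relab R j (conv R (%u. f (x # u)) g) w"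
  using Cons.prems by(simp add:relab_add relab_smult)
  thus ?thesis using z Cons.hyps[of "%u. f (x # u)"] Cons.prems by(simp add:relab_in)
  next
  case False
  thus ?thesis using Cons.prems assms(2) by simp
  qed
 qed simp
qed

lemma relab_fin:
 assumes "f : ffun R U" "!!u. u : U ==> map j u : W"
 shows "relab R j f : ffun R W"
proof (rule ffunI[where S = "map j ` (supp. f)"])
 fix w assume "relab R j f w ~= \<zero>"
 hence w: "set w \<subseteq> range j" "f (map (inv_into UNIV j) w) ~= \<zero>" by(auto simp:relab_def split:if_splits)
 hence "map j (map (inv_into UNIV j) w) = w"
  by(auto simp:f_inv_into_f map_idI subset_iff)
 thus "w : map j ` (supp. f)" "w : W"
  using w assms ffun_supp[OF assms(1) w(2)] by(metis (mono_tags, lifting) image_eqI mem_Collect_eq)+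
qed (use assms(1) in "auto simp:relab_def ffun_closed ffun_finite")

text \<open>The conditions on \<open>c'\<close> say that a product inside the range of j arises only
  from factors in the range, and likewise outside. Mixed products contribute nothing; for
  \<open>sum_consts\<close> this is the mutual annihilation of the two augmentation ideals.\<close>

lemma relab_cobd:
 assumes c: "struct_consts R c" and c': "struct_consts R c'"
  and cc: "!!x y z. c' (j x) (j y) (j z) = c x y z"
  and cr: "!!x y z. c' x y z ~= \<zero> ==> z : range j \<longleftrightarrow> x : range j"
  "!!x y z. c' x y z ~= \<zero> ==> z : range j \<longleftrightarrow> y : range j"
  and f: "vals f"
 shows "cobd R c' (relab R j f) = relab R j (cobd R c f)"
proof
 show "cobd R c' (relab R j f) w = relab R j (cobd R c f) w" for w
  using f
 proof (induct w arbitrary: f)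
  case Nil
  thus ?case by simp
 next
  case (Cons z w)
  show ?case
  proof (cases "z : range j")
  case False
  have "cobd R c' (relab R j f) (z # w) = \<zero>"
  by(rule cobd_avoid[OF c', of "- range j"]) (use False cr(1) in auto)
  thus ?thesis using False by simp
  next
  case True
  then obtain x where z: "z = j x" by auto
  let ?fx = "%u. f (x # u)"
  show ?thesis
  proof (cases w)
  case Nil
  thus ?thesis using z by simp
  next
  case w: (Cons z' v)
  have rec: "cobd R c' (relab R j ?fx) w = relab R j (cobd R c ?fx) w"
  using Cons.hyps[of ?fx] Cons.prems by simp
  show ?thesis
  proof (cases "z' : range j")
  case False
  have "(\<Oplus>q\<in>{q. c' z z' q ~= \<zero>}. c' z z' q \<otimes> relab R j f (q # v)) = \<zero>"
  using cr(2) False sc_closed[OF c'] by(intro finsum_zeroI) auto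
  moreover have "relab R j (cobd R c ?fx) w = \<zero>" using w False by simp
  moreover have "relab R j (cobd R c f) (z # w) = \<zero>" using w False by(auto simp:relab_def)
  ultimately show ?thesis using rec w z by(simp add:relab_in a_minus_def)
  next
  case True
  then obtain y where z': "z' = j y" by auto
  have "(\<Oplus>q\<in>{q. c' z z' q ~= \<zero>}. c' z z' q \<otimes> relab R j f (q # v))
  = (\<Oplus>q\<in>j ` {q. c x y q ~= \<zero>}. c' z z' q \<otimes> relab R j f (q # v))"
  proof -
  have "{q. c' z z' q ~= \<zero>} = j ` {q. c x y q ~= \<zero>}"
  proof (intro equalityI subsetI)
  fix q assume q: "q : {q. c' z z' q ~= \<zero>}"
  hence "q : range j" using cr(1)[of z z' q] z by simp
  then obtain r where "q = j r" by auto
  thus "q : j ` {q. c x y q ~= \<zero>}" using q z z' cc by simp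
  next
  fix q assume "q : j ` {q. c x y q ~= \<zero>}"
  thus "q : {q. c' z z' q ~= \<zero>}" using z z' cc by auto
  qed
  thus ?thesis by(simp only:)
  qed
  also have "... = (\<Oplus>q\<in>{q. c x y q ~= \<zero>}. c' z z' (j q) \<otimes> relab R j f (j q # v))"
  using Cons.prems sc_closed[OF c'] j
  by(intro finsum_reindex) (auto intro:inj_on_subset)
  also have "... = (\<Oplus>q\<in>{q. c x y q ~= \<zero>}. c x y q \<otimes> relab R j (%u. f (q # u)) v)"
  using z z' cc by simp
  finally have ms: "(\<Oplus>q\<in>{q. c' z z' q ~= \<zero>}. c' z z' q \<otimes> relab R j f (q # v)) =
  (\<Oplus>q\<in>{q. c x y q ~= \<zero>}. c x y q \<otimes> relab R j (%u. f (q # u)) v)" .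
  have ms': "... = relab R j (%u. \<Oplus>q\<in>{q. c x y q ~= \<zero>}. c x y q \<otimes> f (q # u)) v"
  using sc_closed[OF c] by(auto simp:relab_def intro!: finsum_zeroI)
  have "relab R j (cobd R c f) (z # w)
  = relab R j (%u. \<ominus> (\<Oplus>q\<in>{q. c x y q ~= \<zero>}. c x y q \<otimes> f (q # u)) \<ominus> cobd R c ?fx (y # u)) v"
  using z z' w by(simp add:relab_in)
  also have "... = \<ominus> relab R j (%u. \<Oplus>q\<in>{q. c x y q ~= \<zero>}. c x y q \<otimes> f (q # u)) v
  \<ominus> relab R j (%u. cobd R c ?fx (y # u)) v"
  by(simp add:relab_diff relab_neg)
  finally show ?thesis using w z z' rec ms ms' by(simp add:relab_in)
  qed
  qed
  qed
 qed
qed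

end

end

section \<open>Cobar models of augmented algebras\<close>

context ring
begin

text \<open>Linearity expressed by pointwise operations, so that calculations with cochains need not
  mention the records \<open>free_mod\<close>.\<close>

lemma free_lin:
 assumes "F : lmaps R (free_mod R U) (free_mod R V)"
 shows "f : ffun R U ==> F f : ffun R V"
  "f : ffun R U ==> g : ffun R U ==> F (%w. f w \<oplus> g w) = (%w. F f w \<oplus> F g w)"
  "a : car R ==> f : ffun R U ==> F (%w. a \<otimes> f w) = (%w. a \<otimes> F f w)"
  "f : ffun R U ==> F (%w. \<ominus> f w) = (%w. \<ominus> F f w)"
  "f : ffun R U ==> g : ffun R U ==> F (%w. f w \<ominus> g w) = (%w. F f w \<ominus> F g w)"
  "F zf. = zf."
proof -
 interpret U: fun_module R U "free_mod R U" by(rule fun_module_free_mod[OF ring_axioms])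
 interpret V: fun_module R V "free_mod R V" by(rule fun_module_free_mod[OF ring_axioms])
 note ab = U.M.ab V.M.ab
 show cl: "f : ffun R U ==> F f : ffun R V" for f
  using linear_closed[OF assms] by(simp add:U.carrier_eq V.carrier_eq)
 show "f : ffun R U ==> g : ffun R U ==> F (%w. f w \<oplus> g w) = (%w. F f w \<oplus> F g w)"
  using linear_add[OF assms, of f g] by(simp add:U.carrier_eq U.add_eq V.add_eq)
 show "a : car R ==> f : ffun R U ==> F (%w. a \<otimes> f w) = (%w. a \<otimes> F f w)"
  using linear_smult[OF assms, of a f] by(simp add:U.carrier_eq U.smult_eq V.smult_eq)
 show "f : ffun R U ==> F (%w. \<ominus> f w) = (%w. \<ominus> F f w)"
  using linear_minus[OF ab assms, of f] U.minus_eq[of f] V.minus_eq[of "F f"] cl[of f]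
  by(simp add:U.carrier_eq V.carrier_eq)
 show "f : ffun R U ==> g : ffun R U ==> F (%w. f w \<ominus> g w) = (%w. F f w \<ominus> F g w)"
  using linear_diff[OF ab assms, of f g] U.diff_eq[of f g] V.diff_eq[of "F f" "F g"] cl[of f] cl[of g]
  by(simp add:U.carrier_eq V.carrier_eq)
 show "F zf. = zf." using linear_zero[OF ab assms] by(simp add:U.zero_eq V.zero_eq)
qed

lemma free_linI:
 assumes "!!f. f : ffun R U ==> F f : ffun R V"
  "!!f g. f : ffun R U ==> g : ffun R U ==> F (%w. f w \<oplus> g w) = (%w. F f w \<oplus> F g w)"
  "!!a f. a : car R ==> f : ffun R U ==> F (%w. a \<otimes> f w) = (%w. a \<otimes> F f w)"
 shows "F : lmaps R (free_mod R U) (free_mod R V)"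
 using assms by(intro linear_mapsI) (auto simp:free_mod_def)

end

text \<open>A presentation of E as the cohomology algebra of the cobar algebra with structure
  constants c, with \<open>ka\<close> the map from cocycles to classes. Resolutions have disappeared
  from this interface; the argument about free products uses nothing else of Ext.\<close>

locale cobar_model = field K
 for K :: "'k ring" (structure) +
 fixes X :: "'x set" and c :: "'x => 'x => 'x => 'k"
  and E :: "('k, 'e) aug_algebra" and ka :: "('x list => 'k) => 'e"
 assumes sc: "struct_consts K c"
  and d_fin: "f : ffun K (lists X) ==> cobd K c f : ffun K (lists X)"
  and d_d: "f : ffun K (lists X) ==> cobd K c (cobd K c f) = zf."
  and ka_surj: "ka ` {f : ffun K (lists X). cobd K c f = zf.} = car E"
  and ka_eq: "[|f : ffun K (lists X); cobd K c f = zf.; g : ffun K (lists X); cobd K c g = zf.|]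
  ==> ka f = ka g \<longleftrightarrow> (EX b:ffun K (lists X). (%w. f w \<ominus> g w) = cobd K c b)"
  and ka_add: "[|f : ffun K (lists X); cobd K c f = zf.; g : ffun K (lists X); cobd K c g = zf.|]
  ==> ka (%w. f w \<oplus> g w) = ka f \<oplus>\<^sub>E ka g"
  and ka_smult: "[|a : car K; f : ffun K (lists X); cobd K c f = zf.|]
  ==> ka (%w. a \<otimes> f w) = a \<odot>\<^sub>E ka f"
  and ka_mult: "[|f : ffun K (lists X); cobd K c f = zf.; g : ffun K (lists X); cobd K c g = zf.|]
  ==> ka (conv K f g) = ka f \<otimes>\<^sub>E ka g"
  and ka_one: "ka (mon K \<one> []) = \<one>\<^sub>E"
  and ka_aug: "[|f : ffun K (lists X); cobd K c f = zf.|] ==> aug E (ka f) = f []"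
begin

abbreviation "CC \<equiv> ffun K (lists X)"
abbreviation "Cb \<equiv> ffun K (lists X - {[]})"
abbreviation "d \<equiv> cobd K c"
definition "ZZ = {f : CC. d f = zf.}"

lemma ZZ_fin: "f : ZZ ==> f : CC" and ZZ_d: "f : ZZ ==> d f = zf."
 by(auto simp:ZZ_def)

lemma Cb_CC: "f : Cb ==> f : CC"
 by(erule ffun_mono) auto

lemma Cb_iff: "f : Cb \<longleftrightarrow> f : CC & f [] = \<zero>"
 by(auto simp:ffun_def)

lemma d_Cb: "f : CC ==> d f : Cb"
 using d_fin by(simp add:Cb_iff)

lemma CC_vals: "f : CC ==> vals f"
 by(simp add:ffun_closed)

lemma ZZ_add: "f : ZZ ==> g : ZZ ==> (%w. f w \<oplus> g w) : ZZ"
 using CC_vals by(simp add:ZZ_def ffun_add cobd_add[OF sc])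

lemma ZZ_smult: "a : car K ==> f : ZZ ==> (%w. a \<otimes> f w) : ZZ"
 using CC_vals by(simp add:ZZ_def ffun_smult cobd_smult[OF sc])

lemma ZZ_conv: "f : ZZ ==> g : ZZ ==> conv K f g : ZZ"
 using CC_vals by(simp add:ZZ_def conv_fin cobd_leibniz[OF sc])

lemma ZZ_zero: "zf. : ZZ"
 by(simp add:ZZ_def ffun_zero sc)

lemma ZZ_one: "mon K \<one> [] : ZZ"
proof -
 have "d (mon K \<one> []) w = \<zero>" for w
 proof (cases "EX x. w = [x]")
  case False
  have "length w ~= Suc 0" using False by(auto simp:length_Suc_conv)
  hence "d (mon K \<one> []) w = d zf. w"
  by(intro cobd_local[OF sc]) (auto simp:mon_def)
  thus ?thesis using sc by simp
 qed auto
 hence "d (mon K \<one> []) = zf." by auto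
 thus ?thesis using ffun_mon[of \<one> "[]" "lists X"] by(simp add:ZZ_def)
qed

lemma ka_closed: "f : ZZ ==> ka f : car E"
 unfolding ka_surj[symmetric] ZZ_def by(rule imageI)

lemma ka_eq': "f : ZZ ==> g : ZZ ==> ka f = ka g \<longleftrightarrow> (EX b:CC. (%w. f w \<ominus> g w) = d b)"
 using ka_eq by(simp add:ZZ_def)

lemma ka_eqI: "f : ZZ ==> g : ZZ ==> b : CC ==> (%w. f w \<ominus> g w) = d b ==> ka f = ka g"
 using ka_eq' by blast

text \<open>A choice of representing cocycles. It is linear and multiplicative only up to
  coboundaries.\<close>

definition lift :: "'e => 'x list => 'k" where
 "lift e = (SOME f. f : ZZ & ka f = e)"

lemma lift: "e : car E ==> lift e : ZZ" "e : car E ==> ka (lift e) = e"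
proof -
 assume "e : car E"
 then obtain f where "f : ZZ & ka f = e" unfolding ka_surj[symmetric] ZZ_def by blast
 hence "lift e : ZZ & ka (lift e) = e" unfolding lift_def by(rule someI[where P = "%f. f : ZZ & ka f = e"])
 thus "lift e : ZZ" "ka (lift e) = e" by blast+
qed

lemma lift_Cb: "e : aug_ideal K E ==> lift e : ZZ \<inter> Cb"
proof -
 assume "e : aug_ideal K E"
 hence e: "e : car E" "aug E e = \<zero>" by(auto simp:aug_ideal_def a_kernel_def')
 hence "lift e [] = \<zero>" using lift[OF e(1)] ka_aug[of "lift e"] by(simp add:ZZ_def)
 thus ?thesis using lift[OF e(1)] by(simp add:ZZ_def Cb_iff)
qed

lemma ka_ideal: "f : ZZ ==> f : Cb ==> ka f : aug_ideal K E"
 using ka_closed ka_aug by(simp add:aug_ideal_def a_kernel_def' ZZ_def Cb_iff)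

section \<open>A homogeneous contraction and the projection to cocycles\<close>

definition trunc :: "nat => ('x list => 'k) => 'x list => 'k" where
 "trunc n f = (%u. if length u = n then f u else \<zero>)"

text \<open>The operator lives on cochains without constant term, which are the letters of the free
  product below. The last clause makes s odd, as required when it is moved past a sign in a product
  of several letters.\<close>

definition is_contraction where
 "is_contraction s \<longleftrightarrow> s : lmaps K (free_mod K (lists X - {[]})) (free_mod K (lists X - {[]})) &
  (ALL f:Cb. d (s (d f)) = d f) & (ALL f:Cb. s (twist K f) = (%w. \<ominus> twist K (s f) w))"

text \<open>A generalized inverse of the differential, made homogeneous so that it anticommutes with
 the sign involution.\<close>

lemma contraction_exists: "EX s. is_contraction s"
proof -
 let ?M = "free_mod K (lists X - {[]})"
 interpret M: fun_module K "lists X - {[]}" ?M by(rule fun_module_free_mod[OF ring_axioms])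
 interpret V: vector_space_over K ?M
  by(intro vector_space_over.intro field_axioms M.lm)
 have dlin: "d : lmaps K ?M ?M"
  by(rule free_linI) (auto simp:d_Cb[OF Cb_CC] cobd_add[OF sc] cobd_smult[OF sc] ffun_closed)
 obtain s0 where s0: "s0 : lmaps K ?M ?M"
  and dsd0: "!!x. x : car ?M ==> d (s0 (d x)) = d x"
  by(fact V.generalized_inverse_exists[OF dlin])
 note l0 = free_lin[OF s0]
 have tr: "trunc n f : Cb" if "f : Cb" for n f
  by(rule ffunI[where S = "(supp. f)"])
  (use that in "auto simp:trunc_def ffun_closed ffun_finite dest:ffun_supp split:if_splits")
 \<comment> \<open>Only the part of \<open>s0\<close> that lowers the length by one is kept: the
   value at w reads the component of f on words with one letter more.\<close>
 define s where "s f = (%w. s0 (trunc (Suc (length w)) f) w)" for f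
 have sc0: "s0 f w : car K" if "f : Cb" for f w using l0(1)[OF that] by(simp add:ffun_closed)
 have slin: "s : lmaps K ?M ?M"
 proof (rule free_linI)
  fix f assume f: "f : Cb"
  show "s f : Cb"
  proof (rule ffunI)
  show "s f w : car K" for w unfolding s_def using sc0 tr f by blast
  let ?L = "length ` (supp. f)"
  show "finite (\<Union>n\<in>?L. {w. s0 (trunc n f) w ~= \<zero>})"
  using f ffun_finite[OF f] ffun_finite[OF l0(1)[OF tr[OF f]]] by auto
  show "w : (\<Union>n\<in>?L. {w. s0 (trunc n f) w ~= \<zero>})" if "s f w ~= \<zero>" for w
  proof -
  have "trunc (Suc (length w)) f ~= zf."
  using that l0(6) unfolding s_def by auto
  then obtain u where "length u = Suc (length w)" "f u ~= \<zero>"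
  unfolding trunc_def by(metis (full_types))
  hence "Suc (length w) : ?L" by force
  thus ?thesis using that unfolding s_def by blast
  qed
  show "w : lists X - {[]}" if "s f w ~= \<zero>" for w
  using that ffun_supp[OF l0(1)[OF tr[OF f]]] unfolding s_def by blast
  qed
 next
  fix f g assume fg: "f : Cb" "g : Cb"
  have "trunc n (%w. f w \<oplus> g w) = (%w. trunc n f w \<oplus> trunc n g w)" for n by(auto simp:trunc_def)
  thus "s (%w. f w \<oplus> g w) = (%w. s f w \<oplus> s g w)"
  unfolding s_def using l0(2)[OF tr[OF fg(1)] tr[OF fg(2)]] by simp
 next
  fix a f assume af: "a : car K" "f : Cb"
  have "trunc n (%w. a \<otimes> f w) = (%w. a \<otimes> trunc n f w)" for n using af by(auto simp:trunc_def)
  thus "s (%w. a \<otimes> f w) = (%w. a \<otimes> s f w)"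
  unfolding s_def using l0(3)[OF af(1) tr[OF af(2)]] by simp
 qed
 moreover have "d (s (d f)) = d f" if f: "f : Cb" for f
 proof
  fix w
  show "d (s (d f)) w = d f w"
  proof (cases w)
  case (Cons x v)
  let ?n = "length v"
  have t: "trunc (Suc ?n) (d f) = d (trunc ?n f)"
  proof
  fix u
  show "trunc (Suc ?n) (d f) u = d (trunc ?n f) u"
  proof (cases "length u = Suc ?n")
  case True
  hence "d (trunc ?n f) u = d f u" by(intro cobd_local[OF sc]) (simp add:trunc_def)
  thus ?thesis using True by(simp add:trunc_def)
  next
  case False
  hence "d (trunc ?n f) u = d zf. u"
  by(intro cobd_local[OF sc]) (auto simp:trunc_def)
  thus ?thesis using False sc by(simp add:trunc_def)
  qed
  qed
  \<comment> \<open>The differential at w reads words of the length of v only; there s is applied to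
    the component of d f one length higher, which is d of a truncation of f.\<close>
  have "d (s (d f)) w = d (s0 (d (trunc ?n f))) w"
  by(intro cobd_local[OF sc]) (simp add:s_def Cons t)
  also have "... = d (trunc ?n f) w" using dsd0 tr[OF f] by(simp add:M.carrier_eq)
  also have "... = d f w" by(intro cobd_local[OF sc]) (simp add:trunc_def Cons)
  finally show ?thesis .
  qed simp
 qed
 moreover have "s (twist K f) = (%w. \<ominus> twist K (s f) w)" if f: "f : Cb" for f
 proof
  fix w
  have v: "vals f" using f by(simp add:ffun_closed)
  show "s (twist K f) w = \<ominus> twist K (s f) w"
  proof (cases "even (length w)")
  case True
  hence "trunc (Suc (length w)) (twist K f) = (%u. \<ominus> trunc (Suc (length w)) f u)"
  using v by(auto simp:trunc_def twist_def)
  thus ?thesis using True l0(4)[OF tr[OF f]] by(simp add:s_def twist_def)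
  next
  case False
  hence "trunc (Suc (length w)) (twist K f) = trunc (Suc (length w)) f"
  by(auto simp:trunc_def twist_def)
  thus ?thesis using False sc0[OF tr[OF f]] by(simp add:s_def twist_def)
  qed
 qed
 ultimately show ?thesis unfolding is_contraction_def by blast
qed

definition ctr where "ctr = (SOME s. is_contraction s)"
text \<open>The operator p = 1 - ds - sd. It is homotopic to the identity, has cocycles as values
  and vanishes on coboundaries. In contrast to \<open>lift\<close> it is linear, and it is defined
  on all cochains without constant term.\<close>

definition prj where "prj f = (%w. (f w \<ominus> d (ctr f) w) \<ominus> ctr (d f) w)"

lemma ctr: "is_contraction ctr"
 unfolding ctr_def using contraction_exists by(rule someI_ex)

lemmas ctr_lin = ctr[unfolded is_contraction_def, THEN conjunct1]
lemmas ctr_free = free_lin[OF ctr_lin]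

lemma d_ctr_d: "f : Cb ==> d (ctr (d f)) = d f"
 using ctr by(simp add:is_contraction_def)

lemma ctr_twist: "f : Cb ==> ctr (twist K f) = (%w. \<ominus> twist K (ctr f) w)"
 using ctr by(simp add:is_contraction_def)

lemma Cb_vals: "f : Cb ==> vals f"
 by(simp add:ffun_closed)

lemma d_Cb': "f : Cb ==> d f : Cb"
 using d_Cb Cb_CC by blast

lemma prj_Cb: "f : Cb ==> prj f : Cb"
 unfolding prj_def by(intro ffun_diff d_Cb' ctr_free(1)) auto

lemma prj_lin: "prj : lmaps K (free_mod K (lists X - {[]})) (free_mod K (lists X - {[]}))"
proof (rule free_linI)
 fix f g assume fg: "f : Cb" "g : Cb"
 note cl = ctr_free(1)[OF fg(1)] ctr_free(1)[OF fg(2)] d_Cb'[OF fg(1)] d_Cb'[OF fg(2)]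
  ctr_free(1)[OF d_Cb'[OF fg(1)]] ctr_free(1)[OF d_Cb'[OF fg(2)]]
 note v = cl[THEN Cb_vals] fg[THEN Cb_vals]
 show "prj (%w. f w \<oplus> g w) = (%w. prj f w \<oplus> prj g w)"
  unfolding prj_def using fg cl v
  by(simp add:ctr_free(2) cobd_add[OF sc] minus_add4 sc)
next
 fix a f assume af: "a : car K" "f : Cb"
 note cl = ctr_free(1)[OF af(2)] d_Cb'[OF af(2)] ctr_free(1)[OF d_Cb'[OF af(2)]]
 note v = cl[THEN Cb_vals] af(2)[THEN Cb_vals]
 show "prj (%w. a \<otimes> f w) = (%w. a \<otimes> prj f w)"
  unfolding prj_def using af cl v
  by(simp add:ctr_free(3) cobd_smult[OF sc] a_minus_def r_distr r_minus sc)
qed (rule prj_Cb)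

lemmas prj_free = free_lin[OF prj_lin]

lemma d_prj: assumes "f : Cb" shows "d (prj f) = zf."
proof -
 note cl = ctr_free(1)[OF assms] d_Cb'[OF assms] ctr_free(1)[OF d_Cb'[OF assms]]
 note v = cl[THEN Cb_vals] Cb_vals[OF assms]
 have "d (prj f) = (%w. (d f w \<ominus> d (d (ctr f)) w) \<ominus> d (ctr (d f)) w)"
  unfolding prj_def using v by(simp add:cobd_diff[OF sc] sc)
 thus ?thesis using v d_d[OF Cb_CC[OF cl(1)]] d_ctr_d[OF assms] by(simp add:diff_zero diff_self)
qed

lemma prj_ZZ: "f : Cb ==> prj f : ZZ"
 using prj_Cb d_prj Cb_CC by(simp add:ZZ_def)

lemma prj_d: assumes "f : Cb" shows "prj (d f) = zf."
proof -
 note v = Cb_vals[OF d_Cb'[OF assms]]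
 show ?thesis unfolding prj_def using v d_ctr_d[OF assms] d_d[OF Cb_CC[OF assms]]
  by(simp add:diff_self diff_zero ctr_free(6))
qed

lemma prj_twist: assumes "f : Cb" shows "prj (twist K f) = twist K (prj f)"
proof -
 note cl = ctr_free(1)[OF assms] d_Cb'[OF assms] ctr_free(1)[OF d_Cb'[OF assms]]
 note v = cl[THEN Cb_vals] Cb_vals[OF assms]
 have 1: "d (ctr (twist K f)) = twist K (d (ctr f))"
  using v by(simp add:ctr_twist[OF assms] cobd_neg[OF sc] cobd_twist[OF sc] sc)
 have "ctr (d (twist K f)) = ctr (%w. \<ominus> twist K (d f) w)"
  using v by(simp add:cobd_twist[OF sc])
 also have "... = (%w. \<ominus> ctr (twist K (d f)) w)"
  by(rule ctr_free(4)[OF twist_fin[OF cl(2)]])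
 also have "... = twist K (ctr (d f))"
  using v by(simp add:ctr_twist[OF cl(2)])
 finally have 2: "ctr (d (twist K f)) = twist K (ctr (d f))" .
 show ?thesis unfolding prj_def 1 2
  by(auto simp:twist_def a_minus_def minus_add v sc)
qed

lemma ka_prj: assumes "f : ZZ" "f : Cb" shows "ka (prj f) = ka f"
proof (rule ka_eqI[OF prj_ZZ[OF assms(2)] assms(1)])
 let ?b = "%w. \<ominus> ctr f w"
 note cl = ctr_free(1)[OF assms(2)]
 note v = Cb_vals[OF cl] Cb_vals[OF assms(2)]
 show "?b : CC" by(intro ffun_neg Cb_CC cl)
 have "prj f = (%w. f w \<ominus> d (ctr f) w)"
  unfolding prj_def ZZ_d[OF assms(1)] ctr_free(6) using v sc by(simp add:diff_zero)
 thus "(%w. prj f w \<ominus> f w) = d ?b"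
  using v sc by(auto simp:cobd_neg[OF sc] a_minus_def a_ac r_neg1 r_neg2)
qed

end

section \<open>Block decomposition of words in two alphabets\<close>

text \<open>Puts a letter in front, merging it into the first block when both come from the same
  alphabet, so that \<open>blocks\<close> returns the maximal runs.\<close>

fun bcons :: "'x + 'y => ('x list + 'y list) list => ('x list + 'y list) list" where
 "bcons (Inl x) (Inl u # bs) = Inl (x # u) # bs"
| "bcons (Inl x) bs = Inl [x] # bs"
| "bcons (Inr y) (Inr v # bs) = Inr (y # v) # bs"
| "bcons (Inr y) bs = Inr [y] # bs"

definition blocks :: "('x + 'y) list => ('x list + 'y list) list" where
 "blocks w = foldr bcons w []"

definition unblock :: "'x list + 'y list => ('x + 'y) list" where
 "unblock b = (case b of Inl u => map Inl u | Inr v => map Inr v)"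

lemma unblock_simps [simp]: "unblock (Inl u) = map Inl u" "unblock (Inr v) = map Inr v"
 by(simp_all add:unblock_def)

definition block_set :: "'x set => 'y set => ('x list + 'y list) set" where
 "block_set X Y = Inl ` (lists X - {[]}) \<union> Inr ` (lists Y - {[]})"

lemma block_set_simps [simp]:
 "Inl u : block_set X Y \<longleftrightarrow> u : lists X & u ~= []" "Inr v : block_set X Y \<longleftrightarrow> v : lists Y & v ~= []"
 by(auto simp:block_set_def)

abbreviation alt :: "('u + 'v) list => bool" where
 "alt \<equiv> successively (%x y. isl x = (\<not> isl y))"

lemma blocks_Nil [simp]: "blocks [] = []" by(simp add:blocks_def)

lemma blocks_Cons: "blocks (a # w) = bcons a (blocks w)" by(simp add:blocks_def)

lemma bcons_neq: "bcons a bs ~= []" by(cases "(a, bs)" rule:bcons.cases) auto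

lemma bcons_isl: "isl (hd (bcons a bs)) = isl a"
 by(cases "(a, bs)" rule:bcons.cases) auto

lemma bcons_unblock: "concat (map unblock (bcons a bs)) = a # concat (map unblock bs)"
 by(cases "(a, bs)" rule:bcons.cases) (auto simp:unblock_def)

lemma bcons_alt: "alt bs ==> alt (bcons a bs)"
 by(cases "(a, bs)" rule:bcons.cases) (auto simp:successively_Cons)

lemma bcons_set:
 assumes "set bs \<subseteq> block_set X Y" "a : Sum_Type.Plus X Y" shows "set (bcons a bs) \<subseteq> block_set X Y"
 using assms by(cases "(a, bs)" rule:bcons.cases) auto

lemma blocks_isl: "w ~= [] ==> blocks w ~= [] & isl (hd (blocks w)) = isl (hd w)"
 by(cases w) (auto simp:blocks_Cons bcons_neq bcons_isl)

lemma blocks_unblock: "concat (map unblock (blocks w)) = w"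
 by(induct w) (auto simp:blocks_Cons bcons_unblock)

lemma blocks_alt: "alt (blocks w)"
 by(induct w) (auto simp:blocks_Cons bcons_alt)

lemma blocks_set: "w : lists (Sum_Type.Plus X Y) ==> set (blocks w) \<subseteq> block_set X Y"
proof (induct w)
 case (Cons a w)
 hence "set (blocks w) \<subseteq> block_set X Y" "a : Sum_Type.Plus X Y" by auto
 thus ?case unfolding blocks_Cons by(rule bcons_set)
qed simp

lemma blocks_append_Inl:
 "u ~= [] ==> bs = [] \<or> \<not> isl (hd bs) ==> blocks w = bs ==> blocks (map Inl u @ w) = Inl u # bs"
proof (induct u)
 case (Cons x u)
 show ?case
 proof (cases "u = []")
  case True
  thus ?thesis using Cons.prems
  by(cases bs) (auto simp:blocks_Cons, case_tac a, auto)
 next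
  case False
  thus ?thesis using Cons by(simp add:blocks_Cons)
 qed
qed simp

lemma blocks_append_Inr:
 "v ~= [] ==> bs = [] \<or> isl (hd bs) ==> blocks w = bs ==> blocks (map Inr v @ w) = Inr v # bs"
proof (induct v)
 case (Cons y v)
 show ?case
 proof (cases "v = []")
  case True
  thus ?thesis using Cons.prems
  by(cases bs) (auto simp:blocks_Cons, case_tac a, auto)
 next
  case False
  thus ?thesis using Cons by(simp add:blocks_Cons)
 qed
qed simp

text \<open>Alternation keeps neighbouring blocks from merging. With \<open>blocks_unblock\<close>
  this is a bijection between words and alternating lists of nonempty blocks.\<close>

lemma blocks_concat:
 "alt bs ==> set bs \<subseteq> block_set X Y ==> blocks (concat (map unblock bs)) = bs"
proof (induct bs)
 case (Cons b bs)
 have IH: "blocks (concat (map unblock bs)) = bs"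
  using Cons by(auto simp:successively_Cons)
 have h: "bs = [] \<or> isl (hd bs) ~= isl b" using Cons.prems by(auto simp:successively_Cons)
 show ?case
 proof (cases b)
  case (Inl u)
  hence "u ~= []" using Cons.prems by(auto simp:block_set_def)
  thus ?thesis using IH h Inl blocks_append_Inl[of u bs] by simp
 next
  case (Inr v)
  hence "v ~= []" using Cons.prems by(auto simp:block_set_def)
  thus ?thesis using IH h Inr blocks_append_Inr[of v bs] by simp
 qed
qed simp

lemma unblock_lists: "b : block_set X Y ==> unblock b : lists (Sum_Type.Plus X Y) & unblock b ~= [] & isl (hd (unblock b)) = isl b"
 by(auto simp:block_set_def unblock_def hd_map)

lemma concat_unblock_lists: "set bs \<subseteq> block_set X Y ==> concat (map unblock bs) : lists (Sum_Type.Plus X Y)"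
 using unblock_lists by(induct bs) fastforce+

section \<open>The cohomology of a coproduct of cobar algebras\<close>

text \<open>The structure constants of a direct sum of two ideals that annihilate each
  other.\<close>

definition sum_consts ::
  "('k, 'r) ring_scheme => ('x => 'x => 'x => 'k) => ('y => 'y => 'y => 'k) => 'x + 'y => 'x + 'y => 'x + 'y => 'k"
 where "sum_consts R c1 c2 a b z = (case (a, b, z) of
  (Inl x, Inl x', Inl x'') => c1 x x' x''
  | (Inr y, Inr y', Inr y'') => c2 y y' y''
  | _ => \<zero>\<^sub>R)"

text \<open>Of E only the third model is assumed: it is the cohomology of the cobar algebra on the
  disjoint union of the alphabets, with mixed products zero. That E is the coproduct of
  \<open>E1\<close> and \<open>E2\<close> is the conclusion of \<open>coproduct_iso\<close>.\<close>

locale cobar_coproduct = field K +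
 M1: cobar_model K X c1 E1 ka1 + M2: cobar_model K Y c2 E2 ka2 +
 M: cobar_model K "Sum_Type.Plus X Y" "sum_consts K c1 c2" E ka
 for K :: "'k ring" (structure)
  and X :: "'x set" and c1 and E1 :: "('k, 'e1) aug_algebra" and ka1
  and Y :: "'y set" and c2 and E2 :: "('k, 'e2) aug_algebra" and ka2
  and E :: "('k, 'e) aug_algebra" and ka
begin

definition emb :: "('x list => 'k) + ('y list => 'k) => ('x + 'y) list => 'k" where
 "emb a = (case a of Inl f => relab K Inl f | Inr g => relab K Inr g)"

text \<open>A letter is a cochain of one factor tagged by that factor, so addition is partial. The
  default keeps the tag and the membership in \<open>CB\<close>; the additivity statements assume
  equal tags.\<close>

definition ladd where
 "ladd a b = (case (a, b) of (Inl f, Inl g) => Inl (%w. f w \<oplus> g w)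
  | (Inr f, Inr g) => Inr (%w. f w \<oplus> g w) | _ => a)"

definition lsm where "lsm k = map_sum (%f w. k \<otimes> f w) (%f w. k \<otimes> f w)"

definition lmon where "lmon k = map_sum (mon K k) (mon K k)"

definition CB where "CB = Inl ` M1.Cb \<union> Inr ` M2.Cb"

definition ld where "ld = map_sum M1.d M2.d"
definition ls where "ls = map_sum M1.ctr M2.ctr"
definition lp where "lp = map_sum M1.prj M2.prj"
definition lt where "lt = map_sum (twist K) (twist K)"
definition lz where "lz t = (if t then Inl zf. else Inr zf.)"

text \<open>The words that may follow a block of side t without merging with it.\<close>

definition NW :: "bool => ('x + 'y) list set" where
 "NW t = {w : lists (Sum_Type.Plus X Y). w ~= [] --> isl (hd w) ~= t}"

definition AL where "AL cs \<longleftrightarrow> set cs \<subseteq> CB & alt cs"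

abbreviation "TT \<equiv> free_mod K (lists (Sum_Type.Plus X Y))"
abbreviation "D \<equiv> M.d"

sublocale T: fun_module K "lists (Sum_Type.Plus X Y)" TT
 by(rule fun_module_free_mod[OF ring_axioms])

lemma isl_ops [simp]: "isl (ladd a b) = isl a" "isl (lsm k a) = isl a" "isl (lmon k b') = isl b'"
 "isl (ld a) = isl a" "isl (ls a) = isl a" "isl (lp a) = isl a" "isl (lt a) = isl a" "isl (lz t) = t"
 by(cases a; cases b; cases b'; simp add:ladd_def lsm_def lmon_def ld_def ls_def lp_def lt_def lz_def)+

lemma CB_simps [simp]: "Inl f : CB \<longleftrightarrow> f : M1.Cb" "Inr g : CB \<longleftrightarrow> g : M2.Cb"
 by(auto simp:CB_def)

lemma CB_ops: "a : CB ==> ld a : CB" "a : CB ==> ls a : CB" "a : CB ==> lp a : CB" "a : CB ==> lt a : CB"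
 "a : CB ==> k : car K ==> lsm k a : CB" "a : CB ==> b : CB ==> ladd a b : CB"
 "b' : block_set X Y ==> k : car K ==> lmon k b' : CB" "lz t : CB"
 by(cases a; cases b; cases b'; simp add:ld_def ls_def lp_def lt_def lsm_def ladd_def lmon_def lz_def
  M1.d_Cb' M2.d_Cb' M1.ctr_free(1) M2.ctr_free(1) M1.prj_Cb M2.prj_Cb twist_fin ffun_smult
  ffun_add ffun_mon ffun_zero)+

lemma letter_induct [consumes 1, case_names zero add mon]:
 assumes a: "a : CB"
  and z: "P (lz (isl a))"
  and ad: "!!x y. [|x : CB; y : CB; isl x = isl a; isl y = isl a; P x; P y|] ==> P (ladd x y)"
  and mo: "!!k b. [|k : car K; b : block_set X Y; isl b = isl a|] ==> P (lmon k b)"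
 shows "P a"
proof (cases a)
 case (Inl f)
 hence "f : M1.Cb" using a by(auto simp:CB_def)
 hence "P (Inl f)"
 proof (induct rule:ffun_induct)
  case zero
  thus ?case using z Inl by(simp add:lz_def)
 next
  case (add f g)
  thus ?case using ad[of "Inl f" "Inl g"] Inl by(simp add:CB_def ladd_def)
 next
  case (mon k w)
  thus ?case using mo[of k "Inl w"] Inl by(simp add:block_set_def lmon_def)
 qed
 thus ?thesis using Inl by simp
next
 case (Inr f)
 hence "f : M2.Cb" using a by(auto simp:CB_def)
 hence "P (Inr f)"
 proof (induct rule:ffun_induct)
  case zero
  thus ?case using z Inr by(simp add:lz_def)
 next
  case (add f g)
  thus ?case using ad[of "Inr f" "Inr g"] Inr by(simp add:CB_def ladd_def)
 next
  case (mon k w)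
  thus ?case using mo[of k "Inr w"] Inr by(simp add:block_set_def lmon_def)
 qed
 thus ?thesis using Inr by simp
qed

text \<open>A letter has no constant term, so every word in its support is nonempty and begins in
  its own alphabet.\<close>

lemma emb_fin: assumes "a : CB" shows "emb a : ffun K (lists (Sum_Type.Plus X Y) - NW (isl a))"
proof (cases a)
 case (Inl f)
 have "relab K Inl f : ffun K (lists (Sum_Type.Plus X Y) - NW True)"
  by(rule relab_fin[of _ _ "lists X - {[]}"]) (use assms Inl in "auto simp:CB_def NW_def hd_map")
 thus ?thesis using Inl by(simp add:emb_def)
next
 case (Inr f)
 have "relab K Inr f : ffun K (lists (Sum_Type.Plus X Y) - NW False)"
  by(rule relab_fin[of _ _ "lists Y - {[]}"]) (use assms Inr in "auto simp:CB_def NW_def hd_map")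
 thus ?thesis using Inr by(simp add:emb_def)
qed

lemma emb_CC: "a : CB ==> emb a : M.CC"
 using emb_fin by(auto intro:ffun_mono)

lemma emb_vals: "a : CB ==> vals (emb a)"
 using emb_CC M.CC_vals by blast

lemma emb_ladd: "isl a = isl b ==> emb (ladd a b) = (%w. emb a w \<oplus> emb b w)"
 by(cases a; cases b) (auto simp:emb_def ladd_def relab_add)

lemma emb_lsm: "k : car K ==> emb (lsm k a) = (%w. k \<otimes> emb a w)"
 by(cases a) (auto simp:emb_def lsm_def relab_smult)

lemma emb_lmon: "emb (lmon k b) = mon K k (unblock b)"
 by(cases b) (auto simp:emb_def lmon_def unblock_def relab_mon)

lemma emb_lz: "emb (lz t) = zf."
 by(auto simp:emb_def lz_def)

lemma emb_lt: "emb (lt a) = twist K (emb a)"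
 by(cases a) (auto simp:emb_def lt_def relab_twist)

lemma emb_ld:
 assumes "a : CB" shows "D (emb a) = emb (ld a)"
proof (cases a)
 case (Inl f)
 have "D (relab K Inl f) = relab K Inl (M1.d f)"
  by(rule relab_cobd[OF _ M1.sc M.sc])
  (use assms Inl in "auto simp:CB_def ffun_closed sum_consts_def split:sum.splits")
 thus ?thesis using Inl by(simp add:emb_def ld_def)
next
 case (Inr f)
 have "D (relab K Inr f) = relab K Inr (M2.d f)"
  by(rule relab_cobd[OF _ M2.sc M.sc])
  (use assms Inr in "auto simp:CB_def ffun_closed sum_consts_def split:sum.splits")
 thus ?thesis using Inr by(simp add:emb_def ld_def)
qed

lemma emb_homotopy:
 assumes "a : CB" shows "emb (lp a) = (%w. (emb a w \<ominus> emb (ld (ls a)) w) \<ominus> emb (ls (ld a)) w)"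
 by(cases a) (auto simp:emb_def lp_def ld_def ls_def M1.prj_def M2.prj_def relab_diff)

lemma ls_lt: "a : CB ==> emb (ls (lt a)) = (%w. \<ominus> twist K (emb (ls a)) w)"
 by(cases a) (auto simp:CB_def emb_def ls_def lt_def M1.ctr_twist M2.ctr_twist relab_neg relab_twist)

lemma lp_lt: "a : CB ==> lp (lt a) = lt (lp a)"
 by(cases a) (auto simp:CB_def lp_def lt_def M1.prj_twist M2.prj_twist)

lemma lp_ld: "a : CB ==> lp (ld a) = lz (isl a)"
 by(cases a) (auto simp:CB_def lp_def ld_def lz_def M1.prj_d M2.prj_d)

lemma ld_lp: "a : CB ==> ld (lp a) = lz (isl a)"
 by(cases a) (auto simp:CB_def lp_def ld_def lz_def M1.d_prj M2.d_prj)

lemma lt_lz: "lt (lz t) = lz t"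
 by(cases t) (auto simp:lt_def lz_def)

lemma op_lin:
 assumes "op = ld \<or> op = ls \<or> op = lp \<or> op = lt" "a : CB" "b : CB" "isl a = isl b" "k : car K"
 shows "op (ladd a b) = ladd (op a) (op b)" "op (lsm k a) = lsm k (op a)"
proof -
 show "op (ladd a b) = ladd (op a) (op b)"
  using assms by(cases a; cases b)
  (auto simp:ladd_def ld_def ls_def lp_def lt_def cobd_add[OF M1.sc] cobd_add[OF M2.sc]
  M1.ctr_free(2) M2.ctr_free(2) M1.prj_free(2) M2.prj_free(2) twist_add M1.Cb_vals M2.Cb_vals)
 show "op (lsm k a) = lsm k (op a)"
  using assms by(cases a)
  (auto simp:lsm_def ld_def ls_def lp_def lt_def cobd_smult[OF M1.sc] cobd_smult[OF M2.sc]
  M1.ctr_free(3) M2.ctr_free(3) M1.prj_free(3) M2.prj_free(3) twist_smult M1.Cb_vals M2.Cb_vals)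
qed

definition prodl where "prodl cs = foldr (%a g. conv K (emb a) g) cs (mon K \<one> [])"

lemma prodl_simps [simp]: "prodl [] = mon K \<one> []" "prodl (a # cs) = conv K (emb a) (prodl cs)"
 by(simp_all add:prodl_def)

lemma prodl_CC: "set cs \<subseteq> CB ==> prodl cs : M.CC"
 by(induct cs) (auto intro!: conv_fin emb_CC ffun_mon)

lemma prodl_vals: "set cs \<subseteq> CB ==> vals (prodl cs)"
 using prodl_CC M.CC_vals by blast

lemma prodl_append:
 "set cs \<subseteq> CB ==> set cs' \<subseteq> CB ==> prodl (cs @ cs') = conv K (prodl cs) (prodl cs')"
 by(induct cs) (auto simp:prodl_vals emb_vals conv_assoc)

lemma prodl_blocks:
 "set bs \<subseteq> block_set X Y ==> prodl (map (lmon \<one>) bs) = mon K \<one> (concat (map unblock bs))"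
 by(induct bs) (auto simp:emb_lmon conv_mon_mon)

lemma prodl_word: "w : lists (Sum_Type.Plus X Y) ==> prodl (map (lmon \<one>) (blocks w)) = mon K \<one> w"
 using prodl_blocks[OF blocks_set] by(simp add:blocks_unblock)

lemma AL_blocks: "w : lists (Sum_Type.Plus X Y) ==> AL (map (lmon \<one>) (blocks w))"
 using blocks_set[of w X Y] by(auto simp:AL_def successively_map blocks_alt CB_ops)

lemma AL_cong: "AL (ps @ [a] @ cs) ==> b : CB ==> isl b = isl a ==> AL (ps @ [b] @ cs)"
 by(auto simp:AL_def successively_append_iff successively_Cons)

lemma AL_Cons: "AL (a # cs) \<longleftrightarrow> a : CB & AL cs & (cs ~= [] --> isl (hd cs) ~= isl a)"
 by(auto simp:AL_def successively_Cons)

text \<open>A function of alternating words that is linear in every letter extends to a linear function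
 of cochains, which can be evaluated on all products of letters.\<close>

definition multilinear where
 "multilinear V G \<longleftrightarrow> (ALL cs. AL cs --> G cs : car V) &
  (ALL ps a b cs. AL (ps @ [a] @ cs) --> b : CB --> isl a = isl b -->
  G (ps @ [ladd a b] @ cs) = G (ps @ [a] @ cs) \<oplus>\<^sub>V G (ps @ [b] @ cs)) &
  (ALL ps k a cs. AL (ps @ [a] @ cs) --> k : car K -->
  G (ps @ [lsm k a] @ cs) = k \<odot>\<^sub>V G (ps @ [a] @ cs))"

definition mext where "mext V G = lin_ext K V (%w. G (map (lmon \<one>) (blocks w)))"

context
 fixes V :: "('k, 'v, 's) module_scheme" and G
 assumes V: "left_module K V" and G: "multilinear V G"
begin

lemma mext_lin: "mext V G : lmaps K TT V"
 unfolding mext_def using G by(intro T.lin_ext_linear[OF V]) (auto simp:multilinear_def AL_blocks)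

lemma G_zero: assumes "AL (ps @ [lz t] @ cs)" shows "G (ps @ [lz t] @ cs) = \<zero>\<^sub>V"
proof -
 interpret V: left_module K V by(rule V)
 have "lz t = lsm \<zero> (lz t)" by(cases t) (auto simp:lz_def lsm_def)
 hence "G (ps @ [lz t] @ cs) = G (ps @ [lsm \<zero> (lz t)] @ cs)"
  by(rule arg_cong[where f = "%x. G (ps @ [x] @ cs)"])
 also have "... = \<zero> \<odot>\<^sub>V G (ps @ [lz t] @ cs)" using G assms unfolding multilinear_def by blast
 also have "... = \<zero>\<^sub>V" using G assms unfolding multilinear_def by auto
 finally show ?thesis .
qed

text \<open>Induction on the letters not yet expanded. The first of them is reduced by linearity to
  a monomial, which then joins the prefix of single words; once all letters are monomials,
  \<open>blocks_concat\<close> recovers the list from the concatenated word.\<close>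

lemma mext_prodl_prefix:
 assumes "set bs \<subseteq> block_set X Y" "AL (map (lmon \<one>) bs @ cs)"
 shows "mext V G (conv K (mon K \<one> (concat (map unblock bs))) (prodl cs)) = G (map (lmon \<one>) bs @ cs)"
 using assms
proof (induct cs arbitrary: bs)
 case Nil
 have w: "concat (map unblock bs) : lists (Sum_Type.Plus X Y)" using concat_unblock_lists Nil(1) .
 have "alt bs" using Nil(2) by(simp add:AL_def successively_map)
 hence "blocks (concat (map unblock bs)) = bs" using blocks_concat Nil(1) by blast
 moreover have "(%w. G (map (lmon \<one>) (blocks w))) : lists (Sum_Type.Plus X Y) \<rightarrow> car V"
  using G by(auto simp:multilinear_def AL_blocks)
 ultimately show ?case using w T.lin_ext_mon_one[OF V _ w]
  by(simp add:mext_def conv_mon_mon)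
next
 case (Cons a cs)
 let ?m = "mon K \<one> (concat (map unblock bs))"
 have cs: "set cs \<subseteq> CB" and a: "a : CB" using Cons.prems by(auto simp:AL_def)
 have m: "?m : M.CC" by(rule ffun_mon[OF one_closed concat_unblock_lists[OF Cons.prems(1)]])
 interpret V: left_module K V by(rule V)
 have al: "AL (map (lmon \<one>) bs @ [b] @ cs)" if "b : CB" "isl b = isl a" for b
  using AL_cong[of "map (lmon \<one>) bs" a cs b] that Cons.prems(2) by simp
 have cc: "conv K ?m (conv K (emb b) (prodl cs)) : M.CC" if "b : CB" for b
  using m that prodl_CC[OF cs] by(intro conv_fin emb_CC)
 note ml = mext_lin
 have "mext V G (conv K ?m (conv K (emb a) (prodl cs))) = G (map (lmon \<one>) bs @ [a] @ cs)"
  using a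
 proof (induct rule:letter_induct)
  case zero
  have "mext V G zf. = \<zero>\<^sub>V"
  using linear_zero[OF T.M.ab V.M.ab ml] by(simp add:T.zero_eq)
  thus ?case using G_zero[OF al] CB_ops(8) prodl_vals[OF cs]
  by(simp add:emb_lz)
 next
  case (add x y)
  have "conv K ?m (conv K (emb (ladd x y)) (prodl cs))
  = conv K ?m (conv K (emb x) (prodl cs)) \<oplus>\<^sub>TT conv K ?m (conv K (emb y) (prodl cs))"
  using add emb_vals prodl_vals[OF cs] by(simp add:emb_ladd conv_add_l conv_add_r T.add_eq)
  hence "mext V G (conv K ?m (conv K (emb (ladd x y)) (prodl cs)))
  = mext V G (conv K ?m (conv K (emb x) (prodl cs))) \<oplus>\<^sub>V mext V G (conv K ?m (conv K (emb y) (prodl cs)))"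
  using linear_add[OF ml] cc add by(simp add:T.carrier_eq)
  thus ?case using add G al unfolding multilinear_def by metis
 next
  case (mon k b)
  have lb: "lmon \<one> b : CB" "isl (lmon \<one> b) = isl a" using mon by(auto simp:CB_ops)
  have lk: "lmon k b = lsm k (lmon \<one> b)"
  using mon(1) by(cases b) (auto simp:lmon_def lsm_def mon_def)
  have "conv K ?m (conv K (emb (lmon k b)) (prodl cs))
  = k \<odot>\<^sub>TT conv K ?m (conv K (emb (lmon \<one> b)) (prodl cs))"
  unfolding lk using mon lb emb_vals prodl_vals[OF cs]
  by(simp add:emb_lsm conv_smult_l conv_smult_r T.smult_eq)
  hence 1: "mext V G (conv K ?m (conv K (emb (lmon k b)) (prodl cs)))
  = k \<odot>\<^sub>V mext V G (conv K ?m (conv K (emb (lmon \<one> b)) (prodl cs)))"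
  using linear_smult[OF ml] cc lb mon by(simp add:T.carrier_eq)
  have "conv K ?m (conv K (emb (lmon \<one> b)) (prodl cs))
  = conv K (mon K \<one> (concat (map unblock (bs @ [b])))) (prodl cs)"
  using prodl_vals[OF cs] by(simp add:emb_lmon conv_assoc[symmetric] conv_mon_mon)
  moreover have "mext V G (conv K (mon K \<one> (concat (map unblock (bs @ [b])))) (prodl cs))
  = G (map (lmon \<one>) (bs @ [b]) @ cs)"
  using Cons.prems mon al[OF lb] by(intro Cons.hyps) auto
  ultimately have "mext V G (conv K ?m (conv K (emb (lmon k b)) (prodl cs)))
  = k \<odot>\<^sub>V G (map (lmon \<one>) bs @ [lmon \<one> b] @ cs)" using 1 by simp
  also have "... = G (map (lmon \<one>) bs @ [lmon k b] @ cs)"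
  unfolding lk using G al[OF lb] mon(1) unfolding multilinear_def by metis
  finally show ?case .
 qed
 thus ?case by simp
qed

lemma mext_prodl: "AL cs ==> mext V G (prodl cs) = G cs"
 using mext_prodl_prefix[of "[]" cs] prodl_vals[of cs] by(simp add:AL_def)

end

lemma prodl_multilinear:
 assumes op: "op = lp \<or> op = id"
 shows "multilinear TT (%cs. prodl (map op cs))"
proof -
 have ocl: "op a : CB" "isl (op a) = isl a" if "a : CB" for a using op that CB_ops by auto
 have osub: "set (map op cs) \<subseteq> CB" if "set cs \<subseteq> CB" for cs using that ocl by auto
 have oad: "op (ladd a b) = ladd (op a) (op b)" if "a : CB" "b : CB" "isl a = isl b" for a b
  using op op_lin(1)[of lp a b \<one>] that by auto
 have osm: "op (lsm k a) = lsm k (op a)" if "a : CB" "k : car K" for a k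
  using op op_lin(2)[of lp a a k] that by auto
 show ?thesis unfolding multilinear_def
 proof (intro conjI allI impI)
  fix cs assume "AL cs"
  thus "prodl (map op cs) : car TT" using prodl_CC osub by(simp add:T.carrier_eq AL_def)
 next
  fix ps a b cs assume al: "AL (ps @ [a] @ cs)" and b: "b : CB" "isl a = isl b"
  hence s: "set ps \<subseteq> CB" "a : CB" "set cs \<subseteq> CB" by(auto simp:AL_def)
  note v = prodl_vals[OF osub[OF s(1)]] prodl_vals[OF osub[OF s(3)]] emb_vals[OF ocl(1)[OF s(2)]]
  emb_vals[OF ocl(1)[OF b(1)]]
  show "prodl (map op (ps @ [ladd a b] @ cs)) = prodl (map op (ps @ [a] @ cs)) \<oplus>\<^sub>TT prodl (map op (ps @ [b] @ cs))"
  using s b v ocl osub oad[OF s(2) b] CB_ops(6)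
  by(simp add:prodl_append emb_ladd conv_add_l conv_add_r T.add_eq)
 next
  fix ps k a cs assume al: "AL (ps @ [a] @ cs)" and k: "k : car K"
  hence s: "set ps \<subseteq> CB" "a : CB" "set cs \<subseteq> CB" by(auto simp:AL_def)
  note v = prodl_vals[OF osub[OF s(1)]] prodl_vals[OF osub[OF s(3)]] emb_vals[OF ocl(1)[OF s(2)]]
  show "prodl (map op (ps @ [lsm k a] @ cs)) = k \<odot>\<^sub>TT prodl (map op (ps @ [a] @ cs))"
  using s k v ocl osub osm[OF s(2) k] CB_ops(5)
  by(simp add:prodl_append emb_lsm conv_smult_l conv_smult_r T.smult_eq)
 qed
qed

text \<open>The contraction of a tensor product in its usual form: s on the first factor, plus p on
  the first factor followed by the contraction of the others. The factor p carries the sign of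
  moving an odd operator past it.\<close>

fun sl where
 "sl [] = zf."
| "sl (a # cs) = (%w. conv K (emb (ls a)) (prodl cs) w \<oplus> conv K (emb (lt (lp a))) (sl cs) w)"

lemma sl_CC: "set cs \<subseteq> CB ==> sl cs : M.CC"
 by(induct cs) (auto intro!: conv_fin emb_CC ffun_zero ffun_add prodl_CC CB_ops)

lemma sl_vals: "set cs \<subseteq> CB ==> vals (sl cs)"
 using sl_CC M.CC_vals by blast

lemma sl_multilinear: "multilinear TT sl"
 unfolding multilinear_def
proof (intro conjI allI impI)
 fix cs assume "AL cs"
 thus "sl cs : car TT" using sl_CC by(simp add:T.carrier_eq AL_def)
next
 fix ps a b cs assume al: "AL (ps @ [a] @ cs)" and b: "b : CB" "isl a = isl b"
 hence s: "set ps \<subseteq> CB" "a : CB" "set cs \<subseteq> CB" by(auto simp:AL_def)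
 note pm = prodl_multilinear[of id, unfolded multilinear_def, simplified]
 show "sl (ps @ [ladd a b] @ cs) = sl (ps @ [a] @ cs) \<oplus>\<^sub>TT sl (ps @ [b] @ cs)"
  using s(1) al
 proof (induct ps)
  case Nil
  note l = op_lin(1)[OF _ s(2) b one_closed, of ls] op_lin(1)[OF _ s(2) b one_closed, of lp]
  op_lin(1)[of lt "lp a" "lp b" \<one>]
  show ?case using s b l prodl_vals[OF s(3)] sl_vals[OF s(3)] emb_vals CB_ops
  by(simp add:emb_ladd conv_add_l T.add_eq add4)
 next
  case (Cons p ps)
  have al': "AL (ps @ [a] @ cs)" using Cons.prems by(simp add:AL_Cons)
  have sb: "set (ps @ [x] @ cs) \<subseteq> CB" if "x : CB" for x using Cons.prems(1) s that by auto
  have IH: "sl (ps @ [ladd a b] @ cs) = sl (ps @ [a] @ cs) \<oplus>\<^sub>TT sl (ps @ [b] @ cs)"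
  using Cons al' by simp
  have P: "prodl (ps @ [ladd a b] @ cs) = prodl (ps @ [a] @ cs) \<oplus>\<^sub>TT prodl (ps @ [b] @ cs)"
  using pm al' b by simp
  have p: "p : CB" using Cons.prems by simp
  note v = prodl_vals[OF sb[OF s(2)]] prodl_vals[OF sb[OF b(1)]] sl_vals[OF sb[OF s(2)]] sl_vals[OF sb[OF b(1)]]
  emb_vals[OF CB_ops(2)[OF p]] emb_vals[OF CB_ops(4)[OF CB_ops(3)[OF p]]]
  show ?case using IH P v by(simp add:T.add_eq conv_add_r add4)
 qed
next
 fix ps k a cs assume al: "AL (ps @ [a] @ cs)" and k: "k : car K"
 hence s: "set ps \<subseteq> CB" "a : CB" "set cs \<subseteq> CB" by(auto simp:AL_def)
 note pm = prodl_multilinear[of id, unfolded multilinear_def, simplified]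
 show "sl (ps @ [lsm k a] @ cs) = k \<odot>\<^sub>TT sl (ps @ [a] @ cs)"
  using s(1) al
 proof (induct ps)
  case Nil
  note l = op_lin(2)[OF _ s(2) s(2) refl k, of ls] op_lin(2)[OF _ s(2) s(2) refl k, of lp]
  op_lin(2)[of lt "lp a" "lp a" k]
  show ?case using s k l prodl_vals[OF s(3)] sl_vals[OF s(3)] emb_vals CB_ops
  by(simp add:emb_lsm conv_smult_l T.smult_eq r_distr)
 next
  case (Cons p ps)
  have al': "AL (ps @ [a] @ cs)" using Cons.prems by(simp add:AL_Cons)
  have sb: "set (ps @ [a] @ cs) \<subseteq> CB" using Cons.prems(1) s by auto
  have IH: "sl (ps @ [lsm k a] @ cs) = k \<odot>\<^sub>TT sl (ps @ [a] @ cs)" using Cons al' by simp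
  have P: "prodl (ps @ [lsm k a] @ cs) = k \<odot>\<^sub>TT prodl (ps @ [a] @ cs)" using pm al' k by simp
  have p: "p : CB" using Cons.prems by simp
  note v = prodl_vals[OF sb] sl_vals[OF sb] emb_vals[OF CB_ops(2)[OF p]] emb_vals[OF CB_ops(4)[OF CB_ops(3)[OF p]]]
  show ?case using IH P v k by(simp add:T.smult_eq conv_smult_r r_distr)
 qed
qed

end

lemma (in vector_space_over) submodule_iff: "submodule N K V \<longleftrightarrow> subspace K V N"
proof
 assume N: "subspace K V N"
 have "\<ominus>\<^sub>V x : N" if "x : N" for x by(rule subspace_neg[OF N that])
 thus "submodule N K V"
  using N by(intro submodule.intro subgroup.intro submodule_axioms.intro)
  (auto simp:subspace_def a_inv_def)
next
 assume "submodule N K V"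
 then interpret submodule N K V .
 show "subspace K V N"
  using subset m_closed one_closed smult_closed by(auto simp:subspace_def)
qed

lemma (in ring) finsum_times:
 assumes "finite A" "finite B" "!!a b. a : A ==> b : B ==> h a b : car R"
 shows "(\<Oplus>a\<in>A. \<Oplus>b\<in>B. h a b) = (\<Oplus>p\<in>A \<times> B. h (fst p) (snd p))"
 using assms(1,3)
proof (induct A)
 case (insert a A)
 have eq: "insert a A \<times> B = Pair a ` B \<union> A \<times> B" "Pair a ` B \<inter> A \<times> B = {}" using insert(2) by auto
 have "(\<Oplus>p\<in>insert a A \<times> B. h (fst p) (snd p))
  = (\<Oplus>p\<in>Pair a ` B. h (fst p) (snd p)) \<oplus> (\<Oplus>p\<in>A \<times> B. h (fst p) (snd p))"
  unfolding eq(1) using insert assms(2) eq(2) by(intro finsum_Un_disjoint) auto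
 also have "(\<Oplus>p\<in>Pair a ` B. h (fst p) (snd p)) = (\<Oplus>b\<in>B. h a b)"
  using insert.prems by(subst finsum_reindex) (auto simp:inj_on_def)
 finally show ?case using insert assms(2) by(simp add:finsum_closed Pi_iff)
qed simp

context cobar_coproduct
begin

section \<open>The contraction of the coproduct\<close>

text \<open>The values of \<open>sl\<close> are cochains on the joint alphabet, so the extension has
  \<open>TT\<close> as target. The result is a homotopy between the identity and \<open>PP\<close>,
  the operator p applied to every block.\<close>

definition "SS = mext TT sl"
definition "PP = mext TT (%cs. prodl (map lp cs))"

lemmas SS_lin = mext_lin[OF T.lm sl_multilinear, folded SS_def]
lemmas PP_lin = mext_lin[OF T.lm prodl_multilinear[of lp, simplified], folded PP_def]
lemmas SS_free = free_lin[OF SS_lin]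
lemmas PP_free = free_lin[OF PP_lin]

lemma SS_prodl: "AL cs ==> SS (prodl cs) = sl cs"
 unfolding SS_def by(rule mext_prodl[OF T.lm sl_multilinear])

lemma PP_prodl: "AL cs ==> PP (prodl cs) = prodl (map lp cs)"
 unfolding PP_def by(rule mext_prodl[OF T.lm prodl_multilinear[of lp, simplified]])

lemma NW_lists: "f : ffun K (NW t) ==> f : M.CC"
 by(erule ffun_mono) (auto simp:NW_def)

lemma mon_word: "k : car K ==> w : lists (Sum_Type.Plus X Y) ==>
  mon K k w = (%v. k \<otimes> prodl (map (lmon \<one>) (blocks w)) v)"
 by(auto simp:prodl_word mon_def)

lemma AL_sub: "AL cs ==> set cs \<subseteq> CB"
 by(simp add:AL_def)

text \<open>The recursion of \<open>sl\<close> with a general right factor that cannot merge with a.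
  It is needed because the differential of a product of letters is no longer such a product, and it
  follows by linearity from the case of a word.\<close>

lemma SS_conv:
 assumes a: "a : CB" and g: "g : ffun K (NW (isl a))"
 shows "SS (conv K (emb a) g) = (%w. conv K (emb (ls a)) g w \<oplus> conv K (emb (lt (lp a))) (SS g) w)"
 using g
proof (induct rule:ffun_induct)
 note ev = emb_vals[OF a] emb_vals[OF CB_ops(2)[OF a]] emb_vals[OF CB_ops(4)[OF CB_ops(3)[OF a]]]
 {
  case zero
  thus ?case using ev by(simp add:SS_free(6))
 next
  case (add f g)
  hence fg: "f : M.CC" "g : M.CC" using NW_lists by auto
  note v = M.CC_vals[OF fg(1)] M.CC_vals[OF fg(2)] M.CC_vals[OF SS_free(1)[OF fg(1)]] M.CC_vals[OF SS_free(1)[OF fg(2)]]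
  have c: "conv K (emb a) f : M.CC" "conv K (emb a) g : M.CC" using fg a by(auto intro:conv_fin emb_CC)
  show ?case using add ev v c by(simp add:conv_add_r SS_free(2) fg add4)
 next
  case (mon k w)
  let ?cs = "map (lmon \<one>) (blocks w)"
  have w: "w : lists (Sum_Type.Plus X Y)" using mon by(simp add:NW_def)
  have al: "AL ?cs" by(rule AL_blocks[OF w])
  have "AL (a # ?cs)"
  proof (cases "w = []")
  case True
  thus ?thesis using a by(simp add:AL_def)
  next
  case False
  thus ?thesis unfolding AL_Cons using a al mon(2) blocks_isl[OF False] by(simp add:NW_def hd_map)
  qed
  hence s: "SS (conv K (emb a) (prodl ?cs)) = sl (a # ?cs)" using SS_prodl[of "a # ?cs"] by simp
  note v = prodl_vals[OF AL_sub[OF al]] sl_vals[OF AL_sub[OF al]]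
  have c: "conv K (emb a) (prodl ?cs) : M.CC" using a prodl_CC[OF AL_sub[OF al]] by(intro conv_fin emb_CC)
  show ?case unfolding mon_word[OF mon(1) w]
  using s c v ev mon(1) prodl_CC[OF AL_sub[OF al]] SS_prodl[OF al]
  by(simp add:conv_smult_r SS_free(3) r_distr)
 }
qed

lemma prodl_NW:
 assumes "AL (a # cs)" shows "prodl cs : ffun K (NW (isl a))"
proof (cases cs)
 case Nil
 thus ?thesis by(simp add:NW_def ffun_mon)
next
 case (Cons b bs)
 have b: "b : CB" "isl b ~= isl a" "set bs \<subseteq> CB" using assms Cons by(auto simp:AL_Cons AL_def)
 show ?thesis unfolding Cons prodl_simps
  by(rule conv_fin_gen[OF emb_fin[OF b(1)] prodl_CC[OF b(3)]])
  (use b(2) in "auto simp:NW_def hd_append")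
qed

text \<open>A nonzero product of two letters lies in the alphabet of its factors, so the
  differential does not change the alphabet in which words begin.\<close>

lemma D_NW:
 assumes g: "g : ffun K (NW t)" shows "D g : ffun K (NW t)"
proof -
 have DC: "D g : M.CC" using M.d_fin NW_lists g by blast
 show ?thesis
 proof (rule ffunI[OF _ ffun_finite[OF DC]])
  show "w : NW t" if w: "D g w ~= \<zero>" for w
  proof -
  have "w : lists (Sum_Type.Plus X Y)" using ffun_supp[OF DC w] .
  moreover have "isl (hd w) ~= t" if "w ~= []"
  proof
  assume t: "isl (hd w) = t"
  have "D g (hd w # tl w) = \<zero>"
  proof (rule cobd_avoid[OF M.sc, of "{z. isl z = t}"])
  show "g (z # v) = \<zero>" if "z : {z. isl z = t}" for z v
  using ffun_supp[OF g, of "z # v"] that by(auto simp:NW_def)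
  qed (use t in "auto simp:sum_consts_def split:sum.splits")
  thus False using w that by simp
  qed
  ultimately show ?thesis by(simp add:NW_def)
  qed
 qed (use DC in "auto simp:ffun_closed")
qed

text \<open>The tensor product of the homotopies ds + sd = 1 - p. For a letter a and a rest P, the
  cross terms containing both s a and D P cancel by their signs. There remains (a - p a) P + p a (P
  - p P), that is a P - p a p P.\<close>

lemma homotopy_prodl:
 "AL cs ==> (%w. D (SS (prodl cs)) w \<oplus> SS (D (prodl cs)) w) = (%w. prodl cs w \<ominus> prodl (map lp cs) w)"
proof (induct cs)
 case Nil
 have "SS (mon K \<one> []) = zf." using SS_prodl[of "[]"] by(simp add:AL_def)
 moreover have "D (mon K \<one> []) = zf." by(rule M.ZZ_d[OF M.ZZ_one])
 ultimately show ?case using M.sc by(simp add:SS_free(6) diff_self)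
next
 case (Cons a cs)
 have al: "AL cs" and a: "a : CB" using Cons.prems by(auto simp:AL_Cons)
 let ?P = "prodl cs" and ?S = "sl cs" and ?R = "prodl (map lp cs)"
 have sub: "set cs \<subseteq> CB" "set (map lp cs) \<subseteq> CB" using AL_sub[OF al] CB_ops(3) by auto
 have PC: "?P : M.CC" "?S : M.CC" by(rule prodl_CC[OF sub(1)], rule sl_CC[OF sub(1)])
 have DP: "D ?P : ffun K (NW (isl a))" by(rule D_NW[OF prodl_NW[OF Cons.prems]])
 note ops = a CB_ops(1)[OF a] CB_ops(2)[OF a] CB_ops(3)[OF a] CB_ops(4)[OF a] CB_ops(1)[OF CB_ops(2)[OF a]]
  CB_ops(2)[OF CB_ops(1)[OF a]] CB_ops(4)[OF CB_ops(3)[OF a]]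
 note v = ops[THEN emb_vals] M.CC_vals[OF PC(1)] M.CC_vals[OF PC(2)] prodl_vals[OF sub(2)]
  M.CC_vals[OF NW_lists[OF DP]] M.CC_vals[OF SS_free(1)[OF NW_lists[OF DP]]]
 have DSv: "vals (D ?S)" using v M.sc by simp
 have IH: "(%w. D ?S w \<oplus> SS (D ?P) w) = (%w. ?P w \<ominus> ?R w)"
  using Cons.hyps[OF al] SS_prodl[OF al] by simp
 have 1: "SS (prodl (a # cs)) = (%w. conv K (emb (ls a)) ?P w \<oplus> conv K (emb (lt (lp a))) ?S w)"
  using SS_prodl[OF Cons.prems] by simp
 \<comment> \<open>p a is a cocycle, so its Leibniz term drops out.\<close>
 have z: "D (emb (lt (lp a))) = zf."
  using v M.sc emb_lt[of "lp a"] emb_ld[OF ops(4)] ld_lp[OF a] by(simp add:cobd_twist[OF M.sc] emb_lz)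
 have tt: "twist K (emb (lt (lp a))) = emb (lp a)" using v by(simp add:emb_lt)
 have D1: "D (SS (prodl (a # cs))) = (%w. (conv K (emb (ld (ls a))) ?P w \<oplus> conv K (twist K (emb (ls a))) (D ?P) w)
  \<oplus> conv K (emb (lp a)) (D ?S) w)"
  unfolding 1 using v M.sc
  by(simp add:cobd_add[OF M.sc] cobd_leibniz[OF M.sc] z tt emb_ld[OF ops(3)] DSv)
 have D2: "D (prodl (a # cs)) = (%w. conv K (emb (ld a)) ?P w \<oplus> conv K (emb (lt a)) (D ?P) w)"
  using v by(simp add:cobd_leibniz[OF M.sc] emb_ld[OF a] emb_lt)
 \<comment> \<open>p kills the coboundary d a, so only the term with s d a survives.\<close>
 have Sa: "SS (conv K (emb (ld a)) ?P) = (%w. conv K (emb (ls (ld a))) ?P w)"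
 proof -
  have "emb (lt (lp (ld a))) = zf." by(simp add:lp_ld[OF a] lt_lz emb_lz)
  thus ?thesis using SS_conv[OF ops(2), of ?P] prodl_NW[OF Cons.prems] v M.CC_vals[OF SS_free(1)[OF PC(1)]]
  by simp
 qed
 \<comment> \<open>The minus sign comes from s anticommuting with the twist; it makes the cross term
   cancel against the one in \<open>D1\<close>.\<close>
 have Sb: "SS (conv K (emb (lt a)) (D ?P))
  = (%w. (\<ominus> conv K (twist K (emb (ls a))) (D ?P) w) \<oplus> conv K (emb (lp a)) (SS (D ?P)) w)"
 proof -
  have "lt (lt (lp a)) = lp a" using ops(4) by(cases "lp a") (auto simp:lt_def M1.Cb_vals M2.Cb_vals)
  thus ?thesis using SS_conv[OF ops(5), of "D ?P"] DP v
  by(simp add:ls_lt[OF a] lp_lt[OF a] conv_neg_l)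
 qed
 have D3: "SS (D (prodl (a # cs))) = (%w. conv K (emb (ls (ld a))) ?P w \<oplus>
  ((\<ominus> conv K (twist K (emb (ls a))) (D ?P) w) \<oplus> conv K (emb (lp a)) (SS (D ?P)) w))"
  unfolding D2 using Sa Sb NW_lists[OF DP] PC(1) ops
  by(subst SS_free(2)) (auto intro:conv_fin emb_CC)
 have eP: "conv K (emb (lp a)) ?P w = (conv K (emb a) ?P w \<ominus> conv K (emb (ld (ls a))) ?P w) \<ominus> conv K (emb (ls (ld a))) ?P w" for w
  unfolding emb_homotopy[OF a] using v by(simp add:conv_diff_l)
 have eR: "conv K (emb (lp a)) (D ?S) w \<oplus> conv K (emb (lp a)) (SS (D ?P)) w = conv K (emb (lp a)) ?P w \<ominus> conv K (emb (lp a)) ?R w" for w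
  using fun_cong[OF arg_cong[OF IH, of "conv K (emb (lp a))"], of w] v DSv
  by(simp add:conv_add_r conv_diff_r)
 show ?case
 proof
  fix w
  let ?x = "conv K (emb (ld (ls a))) ?P w" and ?y = "conv K (twist K (emb (ls a))) (D ?P) w"
  and ?z = "conv K (emb (lp a)) (D ?S) w" and ?u = "conv K (emb (ls (ld a))) ?P w"
  and ?t = "conv K (emb (lp a)) (SS (D ?P)) w" and ?r = "conv K (emb (lp a)) ?R w"
  and ?e = "conv K (emb a) ?P w" and ?p = "conv K (emb (lp a)) ?P w"
  have cl: "?x : car K" "?y : car K" "?z : car K" "?u : car K" "?t : car K"
  "?r : car K" "?e : car K" "?p : car K" using v DSv by simp_all
  have "((?x \<oplus> ?y) \<oplus> ?z) \<oplus> (?u \<oplus> ((\<ominus> ?y) \<oplus> ?t)) = (?x \<oplus> ?u) \<oplus> (?z \<oplus> ?t)"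
  proof -
  have "((?x \<oplus> ?y) \<oplus> ?z) \<oplus> (?u \<oplus> ((\<ominus> ?y) \<oplus> ?t)) = (?y \<oplus> \<ominus> ?y) \<oplus> ((?x \<oplus> ?u) \<oplus> (?z \<oplus> ?t))"
  using cl by(simp add:a_ac)
  thus ?thesis using cl by(simp add:r_neg)
  qed
  also have "... = (?x \<oplus> ?u) \<oplus> (((?e \<ominus> ?x) \<ominus> ?u) \<ominus> ?r)" unfolding eR eP ..
  also have "... = (?x \<oplus> \<ominus> ?x) \<oplus> ((?u \<oplus> \<ominus> ?u) \<oplus> (?e \<ominus> ?r))" using cl by(simp add:a_minus_def a_ac)
  also have "... = ?e \<ominus> ?r" using cl by(simp add:r_neg)
  finally show "D (SS (prodl (a # cs))) w \<oplus> SS (D (prodl (a # cs))) w = prodl (a # cs) w \<ominus> prodl (map lp (a # cs)) w"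
  unfolding D1 D3 by simp
 qed
qed

lemma homotopy: assumes "f : M.CC" shows "(%w. D (SS f) w \<oplus> SS (D f) w) = (%w. f w \<ominus> PP f w)"
 using assms
proof (induct rule:ffun_induct)
 case zero
 thus ?case using M.sc by(simp add:SS_free(6) PP_free(6) diff_self)
next
 case (add f g)
 note s = SS_free(1)[OF add(1)] SS_free(1)[OF add(2)] PP_free(1)[OF add(1)] PP_free(1)[OF add(2)]
  M.d_fin[OF add(1)] M.d_fin[OF add(2)] SS_free(1)[OF M.d_fin[OF add(1)]] SS_free(1)[OF M.d_fin[OF add(2)]]
 note v = add(1,2)[THEN M.CC_vals] s[THEN M.CC_vals]
 have "(%w. D (SS (%w. f w \<oplus> g w)) w \<oplus> SS (D (%w. f w \<oplus> g w)) w)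
  = (%w. (D (SS f) w \<oplus> SS (D f) w) \<oplus> (D (SS g) w \<oplus> SS (D g) w))"
  using v M.sc by(simp add:SS_free(2) add(1,2) s cobd_add[OF M.sc] add4)
 also have "... = (%w. (f w \<ominus> PP f w) \<oplus> (g w \<ominus> PP g w))"
  using fun_cong[OF add(3)] fun_cong[OF add(4)] by simp
 also have "... = (%w. (f w \<oplus> g w) \<ominus> PP (%w. f w \<oplus> g w) w)"
  using v by(simp add:PP_free(2) add(1,2) minus_add4)
 finally show ?case .
next
 case (mon k w)
 let ?cs = "map (lmon \<one>) (blocks w)"
 have al: "AL ?cs" by(rule AL_blocks[OF mon(2)])
 let ?p = "prodl ?cs"
 have p: "?p : M.CC" by(rule prodl_CC[OF AL_sub[OF al]])
 note s = p SS_free(1)[OF p] PP_free(1)[OF p] M.d_fin[OF p] SS_free(1)[OF M.d_fin[OF p]]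
 note v = s[THEN M.CC_vals]
 have "(%w. D (SS (%w. k \<otimes> ?p w)) w \<oplus> SS (D (%w. k \<otimes> ?p w)) w) = (%w. k \<otimes> (D (SS ?p) w \<oplus> SS (D ?p) w))"
  using v M.sc mon(1) by(simp add:SS_free(3) s cobd_smult[OF M.sc] r_distr)
 also have "... = (%w. k \<otimes> (?p w \<ominus> PP ?p w))"
  using fun_cong[OF homotopy_prodl[OF al]] PP_prodl[OF al] by simp
 also have "... = (%w. k \<otimes> ?p w \<ominus> PP (%w. k \<otimes> ?p w) w)"
  using v mon(1) by(simp add:PP_free(3) s a_minus_def r_distr r_minus)
 finally show ?case unfolding mon_word[OF mon] .
qed

section \<open>The comparison map\<close>

definition "BD = D ` M.CC"
definition "ZB = Inl ` (M1.ZZ \<inter> M1.Cb) \<union> Inr ` (M2.ZZ \<inter> M2.Cb)"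
definition "kal = map_sum ka1 ka2"
definition "lf = map_sum M1.lift M2.lift"

abbreviation "WA \<equiv> word_algebra K E1 E2"
abbreviation "AW \<equiv> alt_words K E1 E2"
abbreviation "NN \<equiv> tensor_ideal K E1 E2"

lemma BD_add: "f : BD ==> g : BD ==> (%w. f w \<oplus> g w) : BD"
proof -
 assume "f : BD" "g : BD"
 then obtain a b where "a : M.CC" "b : M.CC" "f = D a" "g = D b" by(auto simp:BD_def)
 thus ?thesis unfolding BD_def using M.CC_vals
  by(intro image_eqI[of _ _ "%w. a w \<oplus> b w"]) (auto simp:cobd_add[OF M.sc] ffun_add)
qed

lemma BD_smult: "k : car K ==> f : BD ==> (%w. k \<otimes> f w) : BD"
proof -
 assume k: "k : car K" and "f : BD"
 then obtain a where "a : M.CC" "f = D a" by(auto simp:BD_def)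
 thus ?thesis unfolding BD_def using M.CC_vals k
  by(intro image_eqI[of _ _ "%w. k \<otimes> a w"]) (auto simp:cobd_smult[OF M.sc] ffun_smult)
qed

lemma BD_zero: "zf. : BD"
 unfolding BD_def using M.sc by(intro image_eqI[of _ _ "%w. \<zero>"]) (auto simp:ffun_zero)

text \<open>For a cocycle U, the product of U with D b is D of the twist of U times b: the two
  twists compensate the Leibniz sign.\<close>

lemma BD_mult_l: assumes "U : M.ZZ" "f : BD" shows "conv K U f : BD"
proof -
 obtain b where b: "b : M.CC" "f = D b" using assms(2) by(auto simp:BD_def)
 have U: "U : M.CC" "vals U" "D U = zf." using assms(1) M.ZZ_fin M.ZZ_d M.CC_vals by auto
 note bv = M.CC_vals[OF b(1)]
 have "conv K U f = D (conv K (twist K U) b)"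
  using U bv b(2) M.sc by(simp add:cobd_leibniz[OF M.sc] cobd_twist[OF M.sc])
 moreover have "conv K (twist K U) b : M.CC" using U b by(intro conv_fin twist_fin)
 ultimately show ?thesis by(auto simp:BD_def)
qed

lemma BD_mult_r: assumes "V : M.ZZ" "f : BD" shows "conv K f V : BD"
proof -
 obtain b where b: "b : M.CC" "f = D b" using assms(2) by(auto simp:BD_def)
 have V: "V : M.CC" "vals V" "D V = zf." using assms(1) M.ZZ_fin M.ZZ_d M.CC_vals by auto
 have "conv K f V = D (conv K b V)"
  using V M.CC_vals[OF b(1)] b(2) M.sc by(simp add:cobd_leibniz[OF M.sc])
 moreover have "conv K b V : M.CC" using V b by(intro conv_fin)
 ultimately show ?thesis by(auto simp:BD_def)
qed

lemma ZB_simps [simp]: "Inl f : ZB \<longleftrightarrow> f : M1.ZZ \<inter> M1.Cb" "Inr g : ZB \<longleftrightarrow> g : M2.ZZ \<inter> M2.Cb"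
 by(auto simp:ZB_def)

lemma ZB_CB: "a : ZB ==> a : CB"
 by(cases a) auto

lemma emb_ZZ: assumes "a : ZB" shows "emb a : M.ZZ"
proof -
 have "emb (ld a) = zf." using assms by(cases a) (auto simp:ld_def emb_def M1.ZZ_d M2.ZZ_d)
 thus ?thesis using emb_ld[OF ZB_CB[OF assms]] emb_CC[OF ZB_CB[OF assms]] by(simp add:M.ZZ_def)
qed

lemma prodl_ZZ: "set cs \<subseteq> ZB ==> prodl cs : M.ZZ"
 by(induct cs) (auto intro:M.ZZ_conv emb_ZZ M.ZZ_one)

lemma lp_ZB: "a : CB ==> lp a : ZB"
 by(cases a) (auto simp:lp_def M1.prj_ZZ M2.prj_ZZ M1.prj_Cb M2.prj_Cb)

lemma kal_lp: "a : ZB ==> kal (lp a) = kal a"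
 by(cases a) (auto simp:lp_def kal_def M1.ka_prj M2.ka_prj)

lemma kal_isl [simp]: "isl (kal a) = isl a"
 by(cases a) (auto simp:kal_def)

lemma lf_isl [simp]: "isl (lf a) = isl a"
 by(cases a) (auto simp:lf_def)

definition "LS = Inl ` aug_ideal K E1 \<union> Inr ` aug_ideal K E2"

lemma LS_simps [simp]: "Inl x : LS \<longleftrightarrow> x : aug_ideal K E1" "Inr y : LS \<longleftrightarrow> y : aug_ideal K E2"
 by(auto simp:LS_def)

lemma AW_iff: "w : AW \<longleftrightarrow> set w \<subseteq> LS & alt w"
 by(simp add:alt_words_def LS_def)

lemma kal_LS: "a : ZB ==> kal a : LS"
 by(cases a) (auto simp:kal_def M1.ka_ideal M2.ka_ideal)

lemma lf_ZB: "a : LS ==> lf a : ZB"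
 by(cases a) (use M1.lift_Cb M2.lift_Cb in "auto simp:lf_def")

lemma ideal_carrier: "x : aug_ideal K E1 ==> x : car E1" "y : aug_ideal K E2 ==> y : car E2"
 by(auto simp:aug_ideal_def a_kernel_def')

lemma kal_lf: "a : LS ==> kal (lf a) = a"
 by(cases a) (auto simp:kal_def lf_def M1.lift(2) M2.lift(2) ideal_carrier)

text \<open>Equal classes in a factor differ by a coboundary there, and the embedding of a factor is
  a chain map.\<close>

lemma emb_congr:
 assumes "a : ZB" "b : ZB" "kal a = kal b" shows "(%w. emb a w \<ominus> emb b w) : BD"
proof -
 have *: "(%w. relab K j f w \<ominus> relab K j g w) : BD"
  if j: "inj j" and q: "(%w. f w \<ominus> g w) = cobd K c' q" "D (relab K j q) = relab K j (cobd K c' q)"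
  "relab K j q : M.CC" for j :: "'z => 'x + 'y" and f g q c'
 proof -
  have "(%w. relab K j f w \<ominus> relab K j g w) = D (relab K j q)"
  using relab_diff[OF j, of f g] q(1,2) by simp
  thus ?thesis unfolding BD_def using q(3) by(rule image_eqI)
 qed
 show ?thesis
 proof (cases a)
  case (Inl f)
  then obtain g where g: "b = Inl g" using assms(3) by(cases b) (auto simp:kal_def)
  have fg: "f : M1.ZZ" "g : M1.ZZ" "ka1 f = ka1 g" using assms Inl g by(auto simp:kal_def)
  then obtain q where q: "q : M1.CC" "(%w. f w \<ominus> g w) = M1.d q" using M1.ka_eq' by blast
  have "relab K Inl q : M.CC" by(rule relab_fin[OF _ q(1)]) auto
  moreover have "D (relab K Inl q) = relab K Inl (M1.d q)"
  by(rule relab_cobd[OF _ M1.sc M.sc])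
  (use M1.CC_vals[OF q(1)] in "auto simp:sum_consts_def split:sum.splits")
  ultimately show ?thesis unfolding Inl g emb_def sum.case
  by(intro *[OF _ q(2)]) simp_all
 next
  case (Inr f)
  then obtain g where g: "b = Inr g" using assms(3) by(cases b) (auto simp:kal_def)
  have fg: "f : M2.ZZ" "g : M2.ZZ" "ka2 f = ka2 g" using assms Inr g by(auto simp:kal_def)
  then obtain q where q: "q : M2.CC" "(%w. f w \<ominus> g w) = M2.d q" using M2.ka_eq' by blast
  have "relab K Inr q : M.CC" by(rule relab_fin[OF _ q(1)]) auto
  moreover have "D (relab K Inr q) = relab K Inr (M2.d q)"
  by(rule relab_cobd[OF _ M2.sc M.sc])
  (use M2.CC_vals[OF q(1)] in "auto simp:sum_consts_def split:sum.splits")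
  ultimately show ?thesis unfolding Inr g emb_def sum.case
  by(intro *[OF _ q(2)]) simp_all
 qed
qed

text \<open>Cohomologous cochains. Working with the relation on cochains allows congruences to be
  added and multiplied before any class is formed.\<close>

definition cng where "cng f g \<longleftrightarrow> (%w. f w \<ominus> g w) : BD"

lemma cng_refl: "vals f ==> cng f f"
 by(simp add:cng_def BD_zero diff_self)

lemma cng_add: "vals f ==> vals g ==> vals f' ==> vals g' ==> cng f f' ==> cng g g' ==>
  cng (%w. f w \<oplus> g w) (%w. f' w \<oplus> g' w)"
 unfolding cng_def using BD_add[of "%w. f w \<ominus> f' w" "%w. g w \<ominus> g' w"] by(simp add:minus_add4)

lemma cng_smult: "k : car K ==> vals f ==> vals f' ==> cng f f' ==> cng (%w. k \<otimes> f w) (%w. k \<otimes> f' w)"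
 unfolding cng_def using BD_smult[of k "%w. f w \<ominus> f' w"] by(simp add:a_minus_def r_distr r_minus)

lemma cng_trans: "vals f ==> vals g ==> vals h ==> cng f g ==> cng g h ==> cng f h"
 unfolding cng_def using BD_add[of "%w. f w \<ominus> g w" "%w. g w \<ominus> h w"]
 by(simp add:a_minus_def a_assoc r_neg1)

lemma cng_sym: "vals f ==> vals g ==> cng f g ==> cng g f"
 unfolding cng_def using BD_smult[of "\<ominus> \<one>" "%w. f w \<ominus> g w"]
 by(simp add:a_minus_def l_minus minus_add a_comm)

lemma cng_mult:
 assumes "U : M.ZZ" "U' : M.ZZ" "V : M.ZZ" "V' : M.ZZ" "cng U U'" "cng V V'"
 shows "cng (conv K U V) (conv K U' V')"
proof (rule cng_trans)
 note v = assms(1-4)[THEN M.ZZ_fin, THEN M.CC_vals]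
 show "cng (conv K U V) (conv K U' V)"
  using BD_mult_r[OF assms(3) assms(5)[unfolded cng_def]] v by(simp add:cng_def conv_diff_l)
 show "cng (conv K U' V) (conv K U' V')"
  using BD_mult_l[OF assms(2) assms(6)[unfolded cng_def]] v by(simp add:cng_def conv_diff_r)
qed (use assms(1-4)[THEN M.ZZ_fin, THEN M.CC_vals] in simp_all)

lemma ka_cng: "f : M.ZZ ==> g : M.ZZ ==> ka f = ka g \<longleftrightarrow> cng f g"
 unfolding cng_def BD_def using M.ka_eq' by(simp add:image_iff)

lemma prodl_cng:
 "set cs \<subseteq> ZB ==> set cs' \<subseteq> ZB ==> map kal cs = map kal cs' ==> cng (prodl cs) (prodl cs')"
proof (induct cs arbitrary: cs')
 case Nil
 thus ?case by(simp add:cng_refl)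
next
 case (Cons a cs)
 then obtain b bs where cs': "cs' = b # bs" by(cases cs') auto
 show ?case unfolding cs' prodl_simps
  using Cons cs' by(intro cng_mult emb_ZZ prodl_ZZ) (auto simp:cng_def intro:emb_congr)
qed

section \<open>The word algebra and its map to cocycles\<close>

lemma W_fun: "fun_module K AW WA"
 by unfold_locales (simp_all add:word_algebra_def ffun_def)

sublocale W: fun_module K AW WA by(rule W_fun)

lemma W_vs: "vector_space_over K WA"
 by(intro vector_space_over.intro field_axioms W.lm)

sublocale WV: vector_space_over K WA by(rule W_vs)

lemma single_mon: "single K w = mon K \<one> w"
 by(simp add:single_def mon_def)

text \<open>The product of the chosen representatives is a representative of the product, hence
  cohomologous to the chosen one.\<close>

lemma mult_closed_ideal:
 "x : aug_ideal K E1 ==> y : aug_ideal K E1 ==> x \<otimes>\<^sub>E1 y : aug_ideal K E1 & cng (emb (lf (Inl (x \<otimes>\<^sub>E1 y)))) (conv K (emb (lf (Inl x))) (emb (lf (Inl y))))"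
 "x' : aug_ideal K E2 ==> y' : aug_ideal K E2 ==> x' \<otimes>\<^sub>E2 y' : aug_ideal K E2 & cng (emb (lf (Inr (x' \<otimes>\<^sub>E2 y')))) (conv K (emb (lf (Inr x'))) (emb (lf (Inr y'))))"
proof -
 assume xy: "x : aug_ideal K E1" "y : aug_ideal K E1"
 let ?f = "M1.lift x" and ?g = "M1.lift y"
 have fg: "?f : M1.ZZ" "?f : M1.Cb" "?g : M1.ZZ" "?g : M1.Cb" using M1.lift_Cb xy by auto
 have c: "conv K ?f ?g : M1.ZZ" "conv K ?f ?g : M1.Cb"
  using fg M1.ZZ_conv M1.ZZ_fin by(auto simp:M1.Cb_iff intro:conv_fin)
 have k: "ka1 (conv K ?f ?g) = x \<otimes>\<^sub>E1 y"
  using fg M1.ka_mult[of ?f ?g] M1.lift(2) ideal_carrier xy by(simp add:M1.ZZ_def)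
 hence id: "x \<otimes>\<^sub>E1 y : aug_ideal K E1" using M1.ka_ideal[OF c] by simp
 have "cng (emb (lf (Inl (x \<otimes>\<^sub>E1 y)))) (emb (Inl (conv K ?f ?g)))"
  unfolding cng_def using c id k lf_ZB[of "Inl (x \<otimes>\<^sub>E1 y)"] kal_lf[of "Inl (x \<otimes>\<^sub>E1 y)"]
  by(intro emb_congr) (auto simp:kal_def)
 moreover have "emb (Inl (conv K ?f ?g)) = conv K (emb (lf (Inl x))) (emb (lf (Inl y)))"
  using fg M1.Cb_vals by(simp add:emb_def lf_def relab_conv)
 ultimately show "x \<otimes>\<^sub>E1 y : aug_ideal K E1 & cng (emb (lf (Inl (x \<otimes>\<^sub>E1 y)))) (conv K (emb (lf (Inl x))) (emb (lf (Inl y))))"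
  using id by simp
next
 assume xy: "x' : aug_ideal K E2" "y' : aug_ideal K E2"
 let ?f = "M2.lift x'" and ?g = "M2.lift y'"
 have fg: "?f : M2.ZZ" "?f : M2.Cb" "?g : M2.ZZ" "?g : M2.Cb" using M2.lift_Cb xy by auto
 have c: "conv K ?f ?g : M2.ZZ" "conv K ?f ?g : M2.Cb"
  using fg M2.ZZ_conv M2.ZZ_fin by(auto simp:M2.Cb_iff intro:conv_fin)
 have k: "ka2 (conv K ?f ?g) = x' \<otimes>\<^sub>E2 y'"
  using fg M2.ka_mult[of ?f ?g] M2.lift(2) ideal_carrier xy by(simp add:M2.ZZ_def)
 hence id: "x' \<otimes>\<^sub>E2 y' : aug_ideal K E2" using M2.ka_ideal[OF c] by simp
 have "cng (emb (lf (Inr (x' \<otimes>\<^sub>E2 y')))) (emb (Inr (conv K ?f ?g)))"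
  unfolding cng_def using c id k lf_ZB[of "Inr (x' \<otimes>\<^sub>E2 y')"] kal_lf[of "Inr (x' \<otimes>\<^sub>E2 y')"]
  by(intro emb_congr) (auto simp:kal_def)
 moreover have "emb (Inr (conv K ?f ?g)) = conv K (emb (lf (Inr x'))) (emb (lf (Inr y')))"
  using fg M2.Cb_vals by(simp add:emb_def lf_def relab_conv)
 ultimately show "x' \<otimes>\<^sub>E2 y' : aug_ideal K E2 & cng (emb (lf (Inr (x' \<otimes>\<^sub>E2 y')))) (conv K (emb (lf (Inr x'))) (emb (lf (Inr y'))))"
  using id by simp
qed

text \<open>Words interact only where they meet. If the adjoining letters have different tags the
  lifted products agree exactly; if they are merged, the lift of their product replaces the product
  of their lifts, up to a coboundary.\<close>

lemma word_mult_props: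
 assumes "u : AW" "v : AW"
 shows "word_mult E1 E2 u v : AW &
  cng (prodl (map lf (word_mult E1 E2 u v))) (conv K (prodl (map lf u)) (prodl (map lf v)))"
proof (cases "u = [] \<or> v = []")
 case True
 have z: "prodl (map lf w) : M.ZZ" if "w : AW" for w
  using that lf_ZB by(intro prodl_ZZ) (auto simp:AW_iff)
 note zv = M.CC_vals[OF M.ZZ_fin[OF z]]
 show ?thesis using True assms zv[OF assms(1)] zv[OF assms(2)]
  by(auto simp:word_mult_def conv_one_r cng_refl)
next
 case False
 define u' where "u' = butlast u" define a where "a = last u"
 define b where "b = hd v" define v' where "v' = tl v"
 have uv: "u = u' @ [a]" "v = b # v'" using False by(simp_all add:u'_def a_def b_def v'_def)
 have sets: "set u' \<subseteq> LS" "a : LS" "b : LS" "set v' \<subseteq> LS" "alt (u' @ [a])" "alt (b # v')"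
  using assms by(auto simp:AW_iff uv)
 have zb: "set (map lf u') \<subseteq> ZB" "lf a : ZB" "lf b : ZB" "set (map lf v') \<subseteq> ZB"
  using sets lf_ZB by auto
 have cb: "set (map lf u') \<subseteq> CB" "lf a : CB" "lf b : CB" "set (map lf v') \<subseteq> CB"
  using zb ZB_CB by auto
 have split:"conv K (prodl (map lf u)) (prodl (map lf v))
  = conv K (prodl (map lf u')) (conv K (conv K (emb (lf a)) (emb (lf b))) (prodl (map lf v')))"
 proof -
  note v = prodl_vals[OF cb(1)] emb_vals[OF cb(2)] emb_vals[OF cb(3)] prodl_vals[OF cb(4)]
  have vv: "vals (conv K (emb (lf b)) (prodl (map lf v')))" using v by simp
  have "conv K (conv K (prodl (map lf u')) (emb (lf a))) (conv K (emb (lf b)) (prodl (map lf v')))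
  = conv K (prodl (map lf u')) (conv K (conv K (emb (lf a)) (emb (lf b))) (prodl (map lf v')))"
  by(simp only: conv_assoc[OF v(1,2) vv] conv_assoc[OF v(2,3,4)])
  moreover have "prodl (map lf u) = conv K (prodl (map lf u')) (emb (lf a))"
  proof -
  have "set [lf a] \<subseteq> CB" using cb(2) by simp
  from prodl_append[OF cb(1) this] show ?thesis using conv_one_r[OF v(2)] by(simp add:uv)
  qed
  moreover have "prodl (map lf v) = conv K (emb (lf b)) (prodl (map lf v'))" by(simp add:uv)
  ultimately show ?thesis by(simp only:)
 qed
 show ?thesis
 proof (cases "isl a = isl b")
  case False
  hence w: "word_mult E1 E2 u v = u @ v"
  by(auto simp:word_mult_def uv split:sum.splits)
  have "u @ v : AW" using sets False by(auto simp:AW_iff uv successively_append_iff successively_Cons)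
  moreover have "prodl (map lf (u @ v)) = conv K (prodl (map lf u)) (prodl (map lf v))"
  proof -
  have "set (map lf u) \<subseteq> CB" "set (map lf v) \<subseteq> CB" using cb by(auto simp:uv)
  from prodl_append[OF this] show ?thesis by simp
  qed
  moreover have "vals (prodl (map lf (u @ v)))" using cb by(intro prodl_vals) (simp add:uv)
  ultimately show ?thesis unfolding w using cng_refl by simp
 next
  case True
  obtain m where m: "word_mult E1 E2 u v = u' @ [m] @ v'" "m : LS" "isl m = isl a"
  "cng (emb (lf m)) (conv K (emb (lf a)) (emb (lf b)))"
  proof (cases a)
  case (Inl x)
  then obtain y where y: "b = Inl y" using True by(cases b) auto
  have "word_mult E1 E2 u v = u' @ [Inl (x \<otimes>\<^sub>E1 y)] @ v'" by(simp add:word_mult_def uv Inl y)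
  thus ?thesis using that[of "Inl (x \<otimes>\<^sub>E1 y)"] mult_closed_ideal(1)[of x y] sets Inl y by simp
  next
  case (Inr x)
  then obtain y where y: "b = Inr y" using True by(cases b) auto
  have "word_mult E1 E2 u v = u' @ [Inr (x \<otimes>\<^sub>E2 y)] @ v'" by(simp add:word_mult_def uv Inr y)
  thus ?thesis using that[of "Inr (x \<otimes>\<^sub>E2 y)"] mult_closed_ideal(2)[of x y] sets Inr y by simp
  qed
  have "u' @ [m] @ v' : AW" using sets True m
  by(auto simp:AW_iff successively_append_iff successively_Cons)
  moreover have "cng (prodl (map lf (u' @ [m] @ v'))) (conv K (prodl (map lf u)) (prodl (map lf v)))"
  proof -
  have mz: "lf m : ZB" using lf_ZB m by blast
  have "prodl (map lf (u' @ [m] @ v')) = conv K (prodl (map lf u')) (conv K (emb (lf m)) (prodl (map lf v')))"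
  using cb ZB_CB[OF mz] by(simp add:prodl_append)
  moreover have "vals (prodl (map lf u'))" "vals (prodl (map lf v'))" using prodl_vals cb by auto
  ultimately show ?thesis unfolding split using m zb mz
  by(auto intro!: cng_mult prodl_ZZ emb_ZZ M.ZZ_conv cng_refl)
  qed
  ultimately show ?thesis unfolding m(1) by simp
 qed
qed

text \<open>Lifting letters to cocycles and multiplying realises the canonical map of the coproduct on
 the level of cochains.\<close>

definition "Psi = lin_ext K TT (%w. prodl (map lf w))"

lemma prodl_lf: "w : AW ==> prodl (map lf w) : M.ZZ"
 using lf_ZB by(intro prodl_ZZ) (auto simp:AW_iff)

lemma Psi_fun: "(%w. prodl (map lf w)) : AW \<rightarrow> car TT"
 using prodl_lf M.ZZ_fin by(auto simp:T.carrier_eq)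

lemma Psi_linear: "Psi : lmaps K WA TT"
 unfolding Psi_def by(rule W.lin_ext_linear[OF T.lm Psi_fun])

lemma Psi_mon: "k : car K ==> w : AW ==> Psi (mon K k w) = (%v. k \<otimes> prodl (map lf w) v)"
 unfolding Psi_def by(subst W.lin_ext_mon[OF T.lm Psi_fun]) (auto simp:T.smult_eq)

lemma Psi_add: "f : car WA ==> g : car WA ==> Psi (f \<oplus>\<^sub>WA g) = (%w. Psi f w \<oplus> Psi g w)"
 using linear_add[OF Psi_linear] by(simp add:T.add_eq)

lemma Psi_smult: "k : car K ==> f : car WA ==> Psi (k \<odot>\<^sub>WA f) = (%w. k \<otimes> Psi f w)"
 using linear_smult[OF Psi_linear] by(simp add:T.smult_eq)

lemma Psi_zero: "Psi \<zero>\<^sub>WA = zf."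
 using linear_zero[OF W.M.ab T.M.ab Psi_linear] by(simp add:T.zero_eq)

lemma Psi_ZZ: "f : car WA ==> Psi f : M.ZZ"
proof (induct rule:W.induct)
 case zero
 thus ?case by(simp add:Psi_zero M.ZZ_zero)
next
 case (add f g)
 thus ?case by(simp add:Psi_add M.ZZ_add)
next
 case (mon k w)
 thus ?case by(simp add:Psi_mon M.ZZ_smult prodl_lf)
qed

lemma Psi_vals: "f : car WA ==> vals (Psi f)"
 using Psi_ZZ M.ZZ_fin M.CC_vals by blast

lemma Psi_diff: "f : car WA ==> g : car WA ==> Psi (f \<ominus>\<^sub>WA g) = (%w. Psi f w \<ominus> Psi g w)"
 using linear_diff[OF W.M.ab T.M.ab Psi_linear, of f g]
  Psi_ZZ[of f] Psi_ZZ[of g] T.diff_eq[of "Psi f" "Psi g"] by(simp add:T.carrier_eq M.ZZ_fin)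

text \<open>Nonempty words go to products of cochains without constant term. This yields
  compatibility with the augmentations.\<close>

lemma Psi_Nil: assumes "f : car WA" shows "Psi f [] = f []"
 using assms
proof (induct rule:W.induct)
 case zero
 show ?case by(simp only: Psi_zero) (simp add:W.zero_eq)
next
 case (add f g)
 thus ?case by(simp add:Psi_add) (simp add:W.add_eq)
next
 case (mon k w)
 have "prodl (map lf w) [] = (if w = [] then \<one> else \<zero>)"
 proof (cases w)
  case (Cons a v)
  hence cb: "lf a : CB" "set (map lf v) \<subseteq> CB" using mon(2) lf_ZB ZB_CB by(auto simp:AW_iff)
  have "emb (lf a) [] = \<zero>" using cb(1) by(cases "lf a") (auto simp:emb_def M1.Cb_iff M2.Cb_iff)
  thus ?thesis using Cons prodl_vals[OF cb(2)] by simp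
 qed (simp add:mon_def)
 thus ?case using mon by(simp add:Psi_mon) (auto simp:mon_def)
qed

text \<open>The bilinear extension of \<open>word_mult\<close>. \<open>mult_eq_wm\<close> rewrites
  the sum over pairs in \<open>word_algebra\<close> in this form, after which products can be
  treated one monomial at a time.\<close>

definition "wm = (%f g. lin_ext K WA (%u. lin_ext K WA (%v. mon K \<one> (word_mult E1 E2 u v)) g) f)"

lemma wm_inner: "u : AW ==> lin_ext K WA (%v. mon K \<one> (word_mult E1 E2 u v)) : lmaps K WA WA"
 using word_mult_props by(intro W.lin_ext_linear[OF W.lm]) auto

lemma wm_lin: "g : car WA ==> (%f. wm f g) : lmaps K WA WA"
 unfolding wm_def by(intro W.lin_ext_linear[OF W.lm]) (auto intro:linear_closed[OF wm_inner])

lemma wm_mon: "k : car K ==> u : AW ==> g : car WA ==>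
  wm (mon K k u) g = k \<odot>\<^sub>WA lin_ext K WA (%v. mon K \<one> (word_mult E1 E2 u v)) g"
 unfolding wm_def by(intro W.lin_ext_mon[OF W.lm]) (auto intro:linear_closed[OF wm_inner])

lemma mult_eq_wm: assumes f: "f : car WA" and g: "g : car WA" shows "f \<otimes>\<^sub>WA g = wm f g"
proof
 fix w
 let ?F = "(supp. f)" and ?G = "(supp. g)"
 have F: "finite ?F" "?F \<subseteq> AW" using f by(auto simp:W.carrier_eq ffun_finite dest:ffun_supp)
 have G: "finite ?G" "?G \<subseteq> AW" using g by(auto simp:W.carrier_eq ffun_finite dest:ffun_supp)
 have fv: "f u : car K" "g u : car K" for u using f g by(auto simp:W.carrier_eq ffun_closed)
 have mw: "mon K \<one> (word_mult E1 E2 u v) : car WA" if "f u ~= \<zero>" "g v ~= \<zero>" for u v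
 proof -
  have "u : AW" "v : AW" using that F(2) G(2) by blast+
  thus ?thesis using word_mult_props by simp
 qed
 let ?h = "%u v. if word_mult E1 E2 u v = w then f u \<otimes> g v else \<zero>"
 have "wm f g w = (\<Oplus>u\<in>?F. (f u \<odot>\<^sub>WA (\<Oplus>\<^sub>WA v\<in>?G. g v \<odot>\<^sub>WA mon K \<one> (word_mult E1 E2 u v))) w)"
  unfolding wm_def lin_ext_def using F G fv mw
  by(intro W.finsum_apply) (auto intro!: W.left_smult_closed W.M.finsum_closed)
 also have "... = (\<Oplus>u\<in>?F. \<Oplus>v\<in>?G. ?h u v)"
 proof (rule finsum_cong')
  fix u assume u: "u : ?F"
  have "(f u \<odot>\<^sub>WA (\<Oplus>\<^sub>WA v\<in>?G. g v \<odot>\<^sub>WA mon K \<one> (word_mult E1 E2 u v))) w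
  = f u \<otimes> (\<Oplus>v\<in>?G. (g v \<odot>\<^sub>WA mon K \<one> (word_mult E1 E2 u v)) w)"
  unfolding W.smult_eq[of "f u"] using u F G fv mw
  by(subst W.finsum_apply) (auto intro!: W.left_smult_closed)
  also have "... = (\<Oplus>v\<in>?G. f u \<otimes> (g v \<odot>\<^sub>WA mon K \<one> (word_mult E1 E2 u v)) w)"
  using G fv by(intro finsum_rdistr) (auto simp:W.smult_eq)
  also have "... = (\<Oplus>v\<in>?G. ?h u v)"
  using fv by(intro finsum_cong') (auto simp:W.smult_eq mon_def)
  finally show "(f u \<odot>\<^sub>WA (\<Oplus>\<^sub>WA v\<in>?G. g v \<odot>\<^sub>WA mon K \<one> (word_mult E1 E2 u v))) w = (\<Oplus>v\<in>?G. ?h u v)" .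
 qed (use fv in "auto intro!: finsum_closed")
 also have "... = (\<Oplus>p\<in>?F \<times> ?G. ?h (fst p) (snd p))"
  using F G fv by(intro finsum_times) auto
 also have "... = (\<Oplus>p\<in>{p : ?F \<times> ?G. word_mult E1 E2 (fst p) (snd p) = w}. f (fst p) \<otimes> g (snd p))"
  using F G fv by(intro finsum_filter[symmetric]) auto
 also have "{p : ?F \<times> ?G. word_mult E1 E2 (fst p) (snd p) = w}
  = {(u, v). f u ~= \<zero> & g v ~= \<zero> & word_mult E1 E2 u v = w}" by auto
 finally show "(f \<otimes>\<^sub>WA g) w = wm f g w" by(simp add:word_algebra_def)
qed

lemma Psi_mult:
 assumes f: "f : car WA" and g: "g : car WA"
 shows "f \<otimes>\<^sub>WA g : car WA" "cng (Psi (f \<otimes>\<^sub>WA g)) (conv K (Psi f) (Psi g))"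
proof -
 show "f \<otimes>\<^sub>WA g : car WA" unfolding mult_eq_wm[OF f g] by(rule linear_closed[OF wm_lin[OF g] f])
 let ?i = "%u. lin_ext K WA (%v. mon K \<one> (word_mult E1 E2 u v))"
 have inner: "cng (Psi (?i u g)) (conv K (prodl (map lf u)) (Psi g))" if u: "u : AW" for u
  using g
 proof (induct rule:W.induct)
  note pv = M.CC_vals[OF M.ZZ_fin[OF prodl_lf[OF u]]]
  note il = wm_inner[OF u]
  {
  case zero
  have "?i u \<zero>\<^sub>WA = \<zero>\<^sub>WA" by(rule linear_zero[OF W.M.ab W.M.ab il])
  thus ?case using pv by(simp add:Psi_zero cng_refl)
  next
  case (add g h)
  thus ?case using pv linear_closed[OF il] Psi_vals
  by(simp add:linear_add[OF il] Psi_add conv_add_r cng_add)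
  next
  case (mon k v)
  have m: "word_mult E1 E2 u v : AW" using word_mult_props[OF u mon(2)] by blast
  have "?i u (mon K k v) = k \<odot>\<^sub>WA mon K \<one> (word_mult E1 E2 u v)"
  using mon word_mult_props[OF u] by(intro W.lin_ext_mon[OF W.lm]) auto
  hence "Psi (?i u (mon K k v)) = (%w. k \<otimes> prodl (map lf (word_mult E1 E2 u v)) w)"
  using mon m M.CC_vals[OF M.ZZ_fin[OF prodl_lf[OF m]]] by(simp add:W.mon_smult Psi_mon)
  thus ?case
  using mon pv M.CC_vals[OF M.ZZ_fin[OF prodl_lf[OF m]]] M.CC_vals[OF M.ZZ_fin[OF prodl_lf[OF mon(2)]]]
  word_mult_props[OF u mon(2)]
  by(simp add:Psi_mon conv_smult_r cng_smult)
  }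
 qed
 show "cng (Psi (f \<otimes>\<^sub>WA g)) (conv K (Psi f) (Psi g))"
  unfolding mult_eq_wm[OF f g] using f
 proof (induct rule:W.induct)
  note wl = wm_lin[OF g]
  note pv = Psi_vals[OF g]
  {
  case zero
  have "wm \<zero>\<^sub>WA g = \<zero>\<^sub>WA"
  using linear_zero[OF W.M.ab W.M.ab wl] .
  thus ?case using pv by(simp add:Psi_zero cng_refl)
  next
  case (add f h)
  thus ?case using pv linear_closed[OF wl] Psi_vals
  by(simp add:linear_add[OF wl] Psi_add conv_add_l cng_add)
  next
  case (mon k u)
  have ig: "?i u g : car WA" by(rule linear_closed[OF wm_inner[OF mon(2)] g])
  show ?case
  using inner[OF mon(2)] mon ig pv Psi_vals[OF ig] M.CC_vals[OF M.ZZ_fin[OF prodl_lf[OF mon(2)]]]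
  by(simp add:wm_mon[OF mon g] Psi_smult Psi_mon conv_smult_l cng_smult)
  }
 qed
qed

section \<open>The kernel of the comparison map\<close>

definition wadd :: "'e1 + 'e2 => 'e1 + 'e2 => 'e1 + 'e2" where
 "wadd a b = (case (a, b) of (Inl x, Inl y) => Inl (x \<oplus>\<^sub>E1 y) | (Inr x, Inr y) => Inr (x \<oplus>\<^sub>E2 y) | _ => a)"

definition wsm :: "'k => 'e1 + 'e2 => 'e1 + 'e2" where
 "wsm k = map_sum (%x. k \<odot>\<^sub>E1 x) (%x. k \<odot>\<^sub>E2 x)"

abbreviation "dl \<equiv> mon K \<one>"

lemma rel_add:
 assumes "u @ [a] @ v : AW" "u @ [b] @ v : AW" "isl a = isl b"
 shows "dl (u @ [wadd a b] @ v) \<ominus>\<^sub>WA (dl (u @ [a] @ v) \<oplus>\<^sub>WA dl (u @ [b] @ v)) : tensor_relations K E1 E2"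
 using assms unfolding tensor_relations_def Let_def single_mon
 by(cases a; cases b) (auto simp:wadd_def)

lemma rel_smult:
 assumes "u @ [a] @ v : AW" "k : car K"
 shows "dl (u @ [wsm k a] @ v) \<ominus>\<^sub>WA k \<odot>\<^sub>WA dl (u @ [a] @ v) : tensor_relations K E1 E2"
 using assms unfolding tensor_relations_def Let_def single_mon
 by(cases a) (auto simp:wsm_def)

text \<open>Tagged letters reduce the four families of relations to additivity and homogeneity in
  one letter.\<close>

lemma rel_cases [consumes 1, case_names add smult]:
 assumes "r : tensor_relations K E1 E2"
  and "!!u a b v. [|u @ [a] @ v : AW; u @ [b] @ v : AW; isl a = isl b;
  r = dl (u @ [wadd a b] @ v) \<ominus>\<^sub>WA (dl (u @ [a] @ v) \<oplus>\<^sub>WA dl (u @ [b] @ v))|] ==> P"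
  and "!!u a v k. [|u @ [a] @ v : AW; k : car K;
  r = dl (u @ [wsm k a] @ v) \<ominus>\<^sub>WA k \<odot>\<^sub>WA dl (u @ [a] @ v)|] ==> P"
 shows P
proof -
 from assms(1) show P unfolding tensor_relations_def Let_def single_mon
 proof (elim UnE CollectE exE conjE)
  fix u v x y
  assume "r = dl (u @ [Inl (x \<oplus>\<^sub>E1 y)] @ v) \<ominus>\<^sub>WA (dl (u @ [Inl x] @ v) \<oplus>\<^sub>WA dl (u @ [Inl y] @ v))"
  "u @ [Inl x] @ v : AW" "u @ [Inl y] @ v : AW"
  thus P using assms(2)[of u "Inl x" v "Inl y"] by(simp add:wadd_def)
 next
  fix u v k x
  assume "r = dl (u @ [Inl (k \<odot>\<^sub>E1 x)] @ v) \<ominus>\<^sub>WA k \<odot>\<^sub>WA dl (u @ [Inl x] @ v)"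
  "k : car K" "u @ [Inl x] @ v : AW"
  thus P using assms(3)[of u "Inl x" v k] by(simp add:wsm_def)
 next
  fix u v x y
  assume "r = dl (u @ [Inr (x \<oplus>\<^sub>E2 y)] @ v) \<ominus>\<^sub>WA (dl (u @ [Inr x] @ v) \<oplus>\<^sub>WA dl (u @ [Inr y] @ v))"
  "u @ [Inr x] @ v : AW" "u @ [Inr y] @ v : AW"
  thus P using assms(2)[of u "Inr x" v "Inr y"] by(simp add:wadd_def)
 next
  fix u v k x
  assume "r = dl (u @ [Inr (k \<odot>\<^sub>E2 x)] @ v) \<ominus>\<^sub>WA k \<odot>\<^sub>WA dl (u @ [Inr x] @ v)"
  "k : car K" "u @ [Inr x] @ v : AW"
  thus P using assms(3)[of u "Inr x" v k] by(simp add:wsm_def)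
 qed
qed

lemma kal_ladd:
 assumes "p : ZB" "q : ZB" "isl p = isl q"
 shows "ladd p q : ZB" "kal (ladd p q) = wadd (kal p) (kal q)"
 using assms by(cases p; cases q; auto simp:ladd_def kal_def wadd_def M1.ZZ_add M2.ZZ_add ffun_add
  M1.ka_add[OF M1.ZZ_fin M1.ZZ_d M1.ZZ_fin M1.ZZ_d] M2.ka_add[OF M2.ZZ_fin M2.ZZ_d M2.ZZ_fin M2.ZZ_d])+

lemma kal_lsm:
 assumes "p : ZB" "k : car K"
 shows "lsm k p : ZB" "kal (lsm k p) = wsm k (kal p)"
 using assms by(cases p; auto simp:lsm_def kal_def wsm_def M1.ZZ_smult M2.ZZ_smult ffun_smult
  M1.ka_smult[OF _ M1.ZZ_fin M1.ZZ_d] M2.ka_smult[OF _ M2.ZZ_fin M2.ZZ_d])+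

lemma wadd_LS: assumes "a : LS" "b : LS" "isl a = isl b"
 shows "wadd a b : LS" "wadd a b = kal (ladd (lf a) (lf b))"
proof -
 show "wadd a b = kal (ladd (lf a) (lf b))"
  using kal_ladd(2)[of "lf a" "lf b"] assms by(simp add:lf_ZB kal_lf)
 thus "wadd a b : LS" using kal_LS[OF kal_ladd(1)[of "lf a" "lf b"]] assms by(simp add:lf_ZB)
qed

lemma wsm_LS: assumes "a : LS" "k : car K"
 shows "wsm k a : LS" "wsm k a = kal (lsm k (lf a))"
proof -
 show "wsm k a = kal (lsm k (lf a))"
  using kal_lsm(2)[of "lf a" k] assms by(simp add:lf_ZB kal_lf)
 thus "wsm k a : LS" using kal_LS[OF kal_lsm(1)[of "lf a" k]] assms by(simp add:lf_ZB)
qed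

lemma w_isl [simp]: "isl (wadd a b) = isl a" "isl (wsm k a) = isl a"
 by(cases a; cases b; simp add:wadd_def wsm_def)+

lemma AW_replace: "u @ [a] @ v : AW ==> b : LS ==> isl b = isl a ==> u @ [b] @ v : AW"
 by(auto simp:AW_iff successively_append_iff successively_Cons)

lemma AW_mid: "u @ [a] @ v : AW ==> a : LS & set u \<subseteq> LS & set v \<subseteq> LS"
 by(auto simp:AW_iff)

lemma AL_lf: "w : AW ==> AL (map lf w)"
 using lf_ZB ZB_CB by(auto simp:AW_iff AL_def successively_map)

text \<open>The chosen lift of a sum of classes is cohomologous to the sum of the lifts, and a
  product of letters is exactly linear in each of them. A relation therefore goes to a
  coboundary.\<close>

lemma rel_Psi:
 assumes "r : tensor_relations K E1 E2" shows "r : car WA & Psi r : BD"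
 using assms
proof (cases rule:rel_cases)
 case (add u a b v)
 have m: "a : LS" "b : LS" "set u \<subseteq> LS" "set v \<subseteq> LS" using AW_mid add by blast+
 have w: "u @ [wadd a b] @ v : AW" by(rule AW_replace[OF add(1)]) (use wadd_LS m add(3) in auto)
 have c: "dl (u @ [wadd a b] @ v) : car WA" "dl (u @ [a] @ v) : car WA" "dl (u @ [b] @ v) : car WA"
  using w add by auto
 let ?p = "prodl (map lf (u @ [wadd a b] @ v))" and ?q = "prodl (map lf (u @ [a] @ v))"
  and ?r = "prodl (map lf (u @ [b] @ v))" and ?s = "prodl (map lf u @ [ladd (lf a) (lf b)] @ map lf v)"
 have pv: "vals ?p" "vals ?q" "vals ?r" using prodl_lf w add(1,2) M.ZZ_fin M.CC_vals by blast+
 have s: "?s = (%w. ?q w \<oplus> ?r w)"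
  using prodl_multilinear[of id] AL_lf[OF add(1)] lf_ZB[OF m(2)] ZB_CB add(3)
  unfolding multilinear_def by(simp add:T.add_eq)
 have "cng ?p ?s"
  using lf_ZB m wadd_LS[OF m(1,2) add(3)] kal_ladd(1)[of "lf a" "lf b"] add(3)
  by(intro prodl_cng) (auto simp:kal_lf)
 moreover have "Psi r = (%w. ?p w \<ominus> (?q w \<oplus> ?r w))"
  unfolding add(4) using c pv w add(1,2) by(simp add:Psi_diff Psi_add Psi_mon)
 ultimately show ?thesis using c s unfolding cng_def add(4) by simp
next
 case (smult u a v k)
 have m: "a : LS" "set u \<subseteq> LS" "set v \<subseteq> LS" using AW_mid smult by blast+
 have w: "u @ [wsm k a] @ v : AW" by(rule AW_replace[OF smult(1)]) (use wsm_LS m smult(2) in auto)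
 have c: "dl (u @ [wsm k a] @ v) : car WA" "dl (u @ [a] @ v) : car WA" using w smult by auto
 let ?p = "prodl (map lf (u @ [wsm k a] @ v))" and ?q = "prodl (map lf (u @ [a] @ v))"
  and ?s = "prodl (map lf u @ [lsm k (lf a)] @ map lf v)"
 have pv: "vals ?p" "vals ?q" using prodl_lf w smult(1) M.ZZ_fin M.CC_vals by blast+
 have s: "?s = (%w. k \<otimes> ?q w)"
  using prodl_multilinear[of id] AL_lf[OF smult(1)] smult(2)
  unfolding multilinear_def by(simp add:T.smult_eq)
 have "cng ?p ?s"
  using lf_ZB m wsm_LS[OF m(1) smult(2)] kal_lsm(1)[of "lf a" k] smult(2)
  by(intro prodl_cng) (auto simp:kal_lf)
 moreover have "Psi r = (%w. ?p w \<ominus> k \<otimes> ?q w)"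
  unfolding smult(3) using c pv w smult(1,2) by(simp add:Psi_diff Psi_smult Psi_mon W.left_smult_closed)
 ultimately show ?thesis using c s smult(2) unfolding cng_def smult(3) by(simp add:W.left_smult_closed)
qed

lemma NN_eq: "NN = \<Inter>{N. subspace K WA N & tensor_relations K E1 E2 \<subseteq> N}"
 unfolding tensor_ideal_def WV.submodule_iff ..

lemma NN_rel: "tensor_relations K E1 E2 \<subseteq> NN"
 unfolding NN_eq by blast

lemma NN_least: "subspace K WA S ==> tensor_relations K E1 E2 \<subseteq> S ==> NN \<subseteq> S"
 unfolding NN_eq by blast

lemma NN_subspace: "subspace K WA NN"
proof -
 have c: "subspace K WA (car WA)" by(auto simp:subspace_def W.left_smult_closed)
 have "tensor_relations K E1 E2 \<subseteq> car WA" using rel_Psi by blast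
 hence "NN \<subseteq> car WA" by(rule NN_least[OF c])
 thus ?thesis unfolding subspace_def NN_eq by blast
qed

lemma NN_Psi: "f : NN ==> Psi f : BD"
proof -
 have "subspace K WA {f : car WA. Psi f : BD}"
  unfolding subspace_def
  by(auto simp:Psi_zero BD_zero Psi_add BD_add Psi_smult BD_smult W.left_smult_closed)
 from NN_least[OF this] rel_Psi have "NN \<subseteq> {f : car WA. Psi f : BD}" by blast
 thus "f : NN ==> Psi f : BD" by blast
qed

text \<open>Let \<open>rh\<close> be a linear map with kernel \<open>NN\<close>. The map
  \<open>?\<Phi>\<close> is defined on all cochains, kills coboundaries, and satisfies
  \<open>?\<Phi> (Psi f) = rh f\<close>. If \<open>Psi f\<close> is a coboundary then
  \<open>rh f\<close> vanishes, so f lies in \<open>NN\<close>.\<close>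

lemma Psi_NN:
 assumes f: "f : car WA" and Pf: "Psi f : BD" shows "f : NN"
proof -
 obtain rh where rh: "rh : lmaps K WA WA" "!!x. x : car WA ==> rh x = \<zero>\<^sub>WA \<longleftrightarrow> x : NN"
  "!!x. x : car WA ==> x \<ominus>\<^sub>WA rh x : NN"
  by(fact WV.projection_exists[OF NN_subspace])
 note ab = W.M.ab
 \<comment> \<open>\<open>lp\<close> turns an arbitrary letter into a cocycle letter, so each letter
   has a class depending linearly on it. After \<open>rh\<close> the word of these classes is
   multilinear, since \<open>rh\<close> kills the tensor relations.\<close>
 define G where "G cs = rh (dl (map (%a. kal (lp a)) cs))" for cs
 have wAW: "map (%a. kal (lp a)) cs : AW" if "AL cs" for cs
  using that kal_LS[OF lp_ZB] by(auto simp:AL_def AW_iff successively_map)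
 have G: "multilinear WA G" unfolding multilinear_def
 proof (intro conjI allI impI)
  show "G cs : car WA" if "AL cs" for cs unfolding G_def using wAW[OF that] by(intro linear_closed[OF rh(1)]) simp
 next
  fix ps a b cs assume al: "AL (ps @ [a] @ cs)" and b: "b : CB" "isl a = isl b"
  have a: "a : CB" using al by(auto simp:AL_def)
  let ?u = "map (%a. kal (lp a)) ps" and ?v = "map (%a. kal (lp a)) cs"
  have w1: "?u @ [kal (lp a)] @ ?v : AW" using wAW[OF al] by simp
  have w2: "?u @ [kal (lp b)] @ ?v : AW" using wAW[OF AL_cong[OF al b(1)]] b by simp
  have e: "kal (lp (ladd a b)) = wadd (kal (lp a)) (kal (lp b))"
  using op_lin(1)[of lp a b \<one>] a b kal_ladd(2)[OF lp_ZB lp_ZB, of a b] by simp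
  have w3: "?u @ [wadd (kal (lp a)) (kal (lp b))] @ ?v : AW"
  using wAW[of "ps @ [ladd a b] @ cs"] AL_cong[OF al CB_ops(6)[OF a b(1)]] e by simp
  have "dl (?u @ [wadd (kal (lp a)) (kal (lp b))] @ ?v) \<ominus>\<^sub>WA (dl (?u @ [kal (lp a)] @ ?v) \<oplus>\<^sub>WA dl (?u @ [kal (lp b)] @ ?v)) : NN"
  using rel_add[OF w1 w2] b(2) NN_rel by auto
  hence "rh (dl (?u @ [wadd (kal (lp a)) (kal (lp b))] @ ?v) \<ominus>\<^sub>WA (dl (?u @ [kal (lp a)] @ ?v) \<oplus>\<^sub>WA dl (?u @ [kal (lp b)] @ ?v))) = \<zero>\<^sub>WA"
  using w1 w2 w3 by(subst rh(2)) auto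
  thus "G (ps @ [ladd a b] @ cs) = G (ps @ [a] @ cs) \<oplus>\<^sub>WA G (ps @ [b] @ cs)"
  unfolding G_def using w1 w2 w3 e linear_closed[OF rh(1)]
  by(simp add:linear_diff[OF ab ab rh(1)] linear_add[OF rh(1)] W.M.diff_zero_iff)
 next
  fix ps k a cs assume al: "AL (ps @ [a] @ cs)" and k: "k : car K"
  have a: "a : CB" using al by(auto simp:AL_def)
  let ?u = "map (%a. kal (lp a)) ps" and ?v = "map (%a. kal (lp a)) cs"
  have w1: "?u @ [kal (lp a)] @ ?v : AW" using wAW[OF al] by simp
  have e: "kal (lp (lsm k a)) = wsm k (kal (lp a))"
  using op_lin(2)[of lp a a k] a k kal_lsm(2)[OF lp_ZB, of a k] by simp
  have w3: "?u @ [wsm k (kal (lp a))] @ ?v : AW"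
  using wAW[of "ps @ [lsm k a] @ cs"] AL_cong[OF al CB_ops(5)[OF a k]] e by simp
  have "dl (?u @ [wsm k (kal (lp a))] @ ?v) \<ominus>\<^sub>WA k \<odot>\<^sub>WA dl (?u @ [kal (lp a)] @ ?v) : NN"
  using rel_smult[OF w1 k] NN_rel by auto
  hence "rh (dl (?u @ [wsm k (kal (lp a))] @ ?v) \<ominus>\<^sub>WA k \<odot>\<^sub>WA dl (?u @ [kal (lp a)] @ ?v)) = \<zero>\<^sub>WA"
  using w1 w3 k by(subst rh(2)) (auto simp:W.left_smult_closed)
  thus "G (ps @ [lsm k a] @ cs) = k \<odot>\<^sub>WA G (ps @ [a] @ cs)"
  unfolding G_def using w1 w3 e k linear_closed[OF rh(1)]
  by(simp add:linear_diff[OF ab ab rh(1)] linear_smult[OF rh(1)] W.M.diff_zero_iff W.left_smult_closed)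
 qed
 let ?\<Phi> = "mext WA G"
 note ml = mext_lin[OF W.lm G]
 note ab' = T.M.ab W.M.ab
 have z: "?\<Phi> zf. = \<zero>\<^sub>WA" using linear_zero[OF ab' ml] by(simp add:T.zero_eq)
 \<comment> \<open>Every term of the Leibniz expansion contains some d a among its letters, and p d
   a = 0. The list \<open>ps\<close> holds the letters already passed, twisted by the rule, so that
   the induction can proceed along \<open>cs\<close>.\<close>
 have bd: "?\<Phi> (conv K (prodl ps) (D (prodl cs))) = \<zero>\<^sub>WA" if "AL (ps @ cs)" for ps cs
  using that
 proof (induct cs arbitrary: ps)
  case Nil
  have "vals (prodl ps)" using Nil prodl_vals by(simp add:AL_def)
  thus ?case using z M.ZZ_d[OF M.ZZ_one] by simp
 next
  case (Cons a cs)
  have sub: "set ps \<subseteq> CB" "a : CB" "set cs \<subseteq> CB" using Cons.prems by(auto simp:AL_def)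
  have al1: "AL (ps @ [ld a] @ cs)" using AL_cong[of ps a cs "ld a"] Cons.prems sub CB_ops(1) by simp
  have al2: "AL (ps @ [lt a] @ cs)" using AL_cong[of ps a cs "lt a"] Cons.prems sub CB_ops(4) by simp
  have al3: "AL (ps @ [lz (isl a)] @ cs)" using AL_cong[of ps a cs "lz (isl a)"] Cons.prems CB_ops(8) by simp
  have DC: "D (prodl cs) : M.CC" by(rule M.d_fin[OF prodl_CC[OF sub(3)]])
  note v = prodl_vals[OF sub(1)] prodl_vals[OF sub(3)] emb_vals[OF sub(2)] emb_vals[OF CB_ops(1)[OF sub(2)]]
  emb_vals[OF CB_ops(4)[OF sub(2)]] M.CC_vals[OF DC]
  have "D (prodl (a # cs)) = (%w. conv K (emb (ld a)) (prodl cs) w \<oplus> conv K (emb (lt a)) (D (prodl cs)) w)"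
  using v by(simp add:cobd_leibniz[OF M.sc] emb_ld[OF sub(2)] emb_lt)
  hence "conv K (prodl ps) (D (prodl (a # cs)))
  = (%w. conv K (prodl ps) (conv K (emb (ld a)) (prodl cs)) w
  \<oplus> conv K (prodl ps) (conv K (emb (lt a)) (D (prodl cs))) w)"
  using v by(simp add:conv_add_r)
  also have "conv K (prodl ps) (conv K (emb (ld a)) (prodl cs)) = prodl (ps @ [ld a] @ cs)"
  using sub CB_ops(1) by(simp add:prodl_append)
  also have "conv K (prodl ps) (conv K (emb (lt a)) (D (prodl cs))) = conv K (prodl (ps @ [lt a])) (D (prodl cs))"
  using sub CB_ops(4) v by(simp add:prodl_append conv_one_r conv_assoc)
  finally have eq: "conv K (prodl ps) (D (prodl (a # cs))) =
  prodl (ps @ [ld a] @ cs) \<oplus>\<^sub>TT conv K (prodl (ps @ [lt a])) (D (prodl cs))"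
  by(simp add:T.add_eq)
  have "lp (lz (isl a)) = lz (isl a)"
  by(cases "isl a") (auto simp:lz_def lp_def M1.prj_free(6) M2.prj_free(6))
  hence "G (ps @ [ld a] @ cs) = G (ps @ [lz (isl a)] @ cs)" by(simp add:G_def lp_ld[OF sub(2)])
  hence g1: "?\<Phi> (prodl (ps @ [ld a] @ cs)) = \<zero>\<^sub>WA"
  using mext_prodl[OF W.lm G al1] G_zero[OF W.lm G al3] by simp
  have g2: "?\<Phi> (conv K (prodl (ps @ [lt a])) (D (prodl cs))) = \<zero>\<^sub>WA"
  using Cons.hyps[of "ps @ [lt a]"] al2 by simp
  have c: "prodl (ps @ [ld a] @ cs) : car TT" "conv K (prodl (ps @ [lt a])) (D (prodl cs)) : car TT"
  using al1 al2 DC unfolding T.carrier_eq by(auto simp:AL_def intro!: prodl_CC conv_fin)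
  show ?case unfolding eq linear_add[OF ml c] g1 g2 by simp
 qed
 have \<Phi>D: "?\<Phi> (D b) = \<zero>\<^sub>WA" if "b : M.CC" for b
  using that
 proof (induct rule:ffun_induct)
  case zero
  thus ?case using z M.sc by simp
 next
  case (add f g)
  have "D (%w. f w \<oplus> g w) = D f \<oplus>\<^sub>TT D g"
  using add M.CC_vals by(simp add:cobd_add[OF M.sc] T.add_eq)
  thus ?case using add linear_add[OF ml, of "D f" "D g"] M.d_fin by(simp add:T.carrier_eq)
 next
  case (mon k w)
  let ?cs = "map (lmon \<one>) (blocks w)"
  have al: "AL ?cs" by(rule AL_blocks[OF mon(2)])
  have p: "prodl ?cs : M.CC" by(rule prodl_CC[OF AL_sub[OF al]])
  have "?\<Phi> (D (prodl ?cs)) = \<zero>\<^sub>WA" using bd[of "[]" ?cs] al M.CC_vals[OF M.d_fin[OF p]] by simp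
  moreover have "D (mon K k w) = k \<odot>\<^sub>TT D (prodl ?cs)"
  unfolding mon_word[OF mon] using mon(1) M.CC_vals[OF p] by(simp add:cobd_smult[OF M.sc] T.smult_eq)
  ultimately show ?case using linear_smult[OF ml mon(1), of "D (prodl ?cs)"] M.d_fin[OF p] mon(1)
  by(simp add:T.carrier_eq)
 qed
 \<comment> \<open>p does not change the class of a cocycle, so on the representatives chosen by
   \<open>lf\<close> the function G recovers the original word.\<close>
 have "?\<Phi> (Psi f) = rh f"
 proof (rule W.linear_eqI[OF W.lm linear_comp[OF ml Psi_linear] rh(1) _ f])
  fix w assume w: "w : AW"
  have "Psi (dl w) = prodl (map lf w)"
  using Psi_mon[OF one_closed w] M.CC_vals[OF M.ZZ_fin[OF prodl_lf[OF w]]] by simp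
  moreover have "map (%a. kal (lp a)) (map lf w) = w"
  using w by(auto simp:AW_iff kal_lp lf_ZB kal_lf subset_iff intro!: map_idI)
  ultimately show "?\<Phi> (Psi (dl w)) = rh (dl w)"
  using mext_prodl[OF W.lm G AL_lf[OF w]] by(simp add:G_def)
 qed
 moreover have "?\<Phi> (Psi f) = \<zero>\<^sub>WA" using Pf \<Phi>D by(auto simp:BD_def)
 ultimately show ?thesis using rh(2)[OF f] by simp
qed

text \<open>A cocycle z differs from \<open>PP z\<close> by a coboundary, as the homotopy term with
  D z vanishes. And \<open>PP z\<close> is a combination of products of cocycle letters, each
  cohomologous to the product of the chosen lifts of its classes.\<close>

lemma Psi_surj:
 assumes z: "z : M.ZZ" obtains f where "f : car WA" "cng (Psi f) z"
proof -
 \<comment> \<open>The word of classes of the projected blocks of w; it is a preimage of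
   \<open>PP\<close> of the monomial at w, up to coboundaries.\<close>
 define q where "q w = map kal (map lp (map (lmon \<one>) (blocks w)))" for w
 have qAW: "q w : AW" if "w : lists (Sum_Type.Plus X Y)" for w
  using AL_blocks[OF that] kal_LS[OF lp_ZB] unfolding q_def by(auto simp:AL_def AW_iff successively_map)
 have qf: "(%w. dl (q w)) : lists (Sum_Type.Plus X Y) \<rightarrow> car WA" using qAW by auto
 let ?Q = "lin_ext K WA (%w. dl (q w))"
 have Ql: "?Q : lmaps K TT WA" by(rule T.lin_ext_linear[OF W.lm qf])
 have cg: "cng (Psi (?Q f)) (PP f) & ?Q f : car WA" if "f : car TT" for f
  using that
 proof (induct rule:T.induct)
  case zero
  have "?Q \<zero>\<^sub>TT = \<zero>\<^sub>WA" by(rule linear_zero[OF T.M.ab W.M.ab Ql])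
  thus ?case using PP_free(6) by(simp add:Psi_zero cng_refl T.zero_eq)
 next
  case (add f g)
  have "PP (f \<oplus>\<^sub>TT g) = (%w. PP f w \<oplus> PP g w)"
  using add PP_free(2)[of f g] by(simp add:T.carrier_eq T.add_eq)
  moreover have "vals (PP f)" "vals (PP g)" using add PP_free(1) M.CC_vals by(auto simp:T.carrier_eq)
  ultimately show ?case using add Psi_vals by(simp add:linear_add[OF Ql] Psi_add cng_add)
 next
  case (mon k w)
  let ?cs = "map (lmon \<one>) (blocks w)"
  have al: "AL ?cs" by(rule AL_blocks[OF mon(2)])
  have Q: "?Q (mon K k w) = k \<odot>\<^sub>WA dl (q w)" by(rule T.lin_ext_mon[OF W.lm qf mon])
  have P: "PP (mon K k w) = (%v. k \<otimes> prodl (map lp ?cs) v)"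
  unfolding mon_word[OF mon] using PP_free(3)[OF mon(1) prodl_CC[OF AL_sub[OF al]]] PP_prodl[OF al] by simp
  have qw: "q w : AW" by(rule qAW[OF mon(2)])
  have lpz: "set (map lp ?cs) \<subseteq> ZB" using AL_sub[OF al] lp_ZB by auto
  have "cng (prodl (map lf (q w))) (prodl (map lp ?cs))"
  proof (rule prodl_cng[OF _ lpz])
  show "set (map lf (q w)) \<subseteq> ZB" using qw lf_ZB by(auto simp:AW_iff)
  have "map kal (map lf (q w)) = q w" using qw by(auto simp:AW_iff kal_lf subset_iff intro!: map_idI)
  thus "map kal (map lf (q w)) = map kal (map lp ?cs)" by(simp add:q_def)
  qed
  hence "cng (%v. k \<otimes> prodl (map lf (q w)) v) (%v. k \<otimes> prodl (map lp ?cs) v)"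
  using mon(1) M.CC_vals[OF M.ZZ_fin[OF prodl_lf[OF qw]]] M.CC_vals[OF M.ZZ_fin[OF prodl_ZZ[OF lpz]]]
  by(intro cng_smult)
  thus ?case using mon(1) qw M.CC_vals[OF M.ZZ_fin[OF prodl_lf[OF qw]]]
  unfolding P Q by(simp add:Psi_smult Psi_mon W.left_smult_closed)
 qed
 have zC: "z : M.CC" by(rule M.ZZ_fin[OF z])
 have v: "vals z" "vals (PP z)" "vals (D (SS z))"
  using zC PP_free(1) SS_free(1) M.d_fin M.CC_vals by blast+
 have "cng z (PP z)"
 proof -
  have "(%w. z w \<ominus> PP z w) = D (SS z)"
  using homotopy[OF zC] M.ZZ_d[OF z] SS_free(6) v by simp
  thus ?thesis unfolding cng_def BD_def using SS_free(1)[OF zC] by simp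
 qed
 hence "cng (PP z) z" using v cng_sym by blast
 moreover have "cng (Psi (?Q z)) (PP z)" "?Q z : car WA" using cg zC by(auto simp:T.carrier_eq)
 ultimately show ?thesis using that cng_trans Psi_vals v by blast
qed

section \<open>The isomorphism on cohomology\<close>

definition "psi f = ka (Psi f)"
text \<open>Elements of the quotient are cosets, and the fibre of \<open>psi\<close> over e is such
  a coset. Taking fibres gives the inverse of the induced map without choosing
  representatives.\<close>

definition "cop_iso e = {f : car WA. psi f = e}"

lemma psi_surj: assumes "e : car E" obtains f where "f : car WA" "psi f = e"
proof -
 have l: "M.lift e : M.ZZ" "ka (M.lift e) = e" using M.lift assms by auto
 obtain f where f: "f : car WA" "cng (Psi f) (M.lift e)" by(rule Psi_surj[OF l(1)])
 hence "psi f = e" unfolding psi_def using ka_cng[OF Psi_ZZ l(1)] l(2) by simp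
 thus ?thesis using that f(1) by blast
qed

lemma psi_eq_iff:
 assumes "f : car WA" "g : car WA" shows "psi f = psi g \<longleftrightarrow> f \<ominus>\<^sub>WA g : NN"
proof -
 have "psi f = psi g \<longleftrightarrow> Psi (f \<ominus>\<^sub>WA g) : BD"
  unfolding psi_def using ka_cng[OF Psi_ZZ Psi_ZZ] assms by(simp add:cng_def Psi_diff)
 thus ?thesis using NN_Psi Psi_NN[of "f \<ominus>\<^sub>WA g"] assms by auto
qed

lemma cop_iso_psi: assumes "f : car WA" shows "cop_iso (psi f) = NN +>\<^sub>WA f"
 using WV.coset_mem[OF NN_subspace assms] psi_eq_iff[OF _ assms] unfolding cop_iso_def by blast

lemma psi_closed: "f : car WA ==> psi f : car E"
 unfolding psi_def by(rule M.ka_closed[OF Psi_ZZ])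

lemma psi_add: "f : car WA ==> g : car WA ==> psi (f \<oplus>\<^sub>WA g) = psi f \<oplus>\<^sub>E psi g"
 unfolding psi_def using Psi_ZZ[of f] Psi_ZZ[of g] M.ka_add[of "Psi f" "Psi g"]
 by(simp add:Psi_add M.ZZ_def)

lemma psi_smult: "k : car K ==> f : car WA ==> psi (k \<odot>\<^sub>WA f) = k \<odot>\<^sub>E psi f"
 unfolding psi_def using Psi_ZZ[of f] M.ka_smult[of k "Psi f"] by(simp add:Psi_smult M.ZZ_def)

lemma psi_mult:
 assumes "f : car WA" "g : car WA" shows "psi (f \<otimes>\<^sub>WA g) = psi f \<otimes>\<^sub>E psi g"
proof -
 have z: "Psi f : M.ZZ" "Psi g : M.ZZ" using Psi_ZZ assms by auto
 have "ka (Psi (f \<otimes>\<^sub>WA g)) = ka (conv K (Psi f) (Psi g))"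
  using ka_cng[OF Psi_ZZ M.ZZ_conv[OF z]] Psi_mult[OF assms] by simp
 also have "... = ka (Psi f) \<otimes>\<^sub>E ka (Psi g)" using M.ka_mult z by(simp add:M.ZZ_def)
 finally show ?thesis by(simp add:psi_def)
qed

lemma one_WA: "\<one>\<^sub>WA = dl []" "dl [] : car WA"
 by(simp add:word_algebra_def single_mon) (simp add:AW_iff)

lemma psi_one: "psi (dl []) = \<one>\<^sub>E"
 unfolding psi_def using Psi_mon[of \<one> "[]"] M.ka_one by(simp add:AW_iff)

lemma psi_aug: "f : car WA ==> aug E (psi f) = f []"
 unfolding psi_def using M.ka_aug[of "Psi f"] Psi_ZZ[of f] Psi_Nil by(simp add:M.ZZ_def)

theorem coproduct_iso: "cop_iso : aug_algebra_isos K E (aug_coproduct K E1 E2)"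
proof -
 let ?Q = "aug_coproduct K E1 E2"
 have Q: "car ?Q = (%f. NN +>\<^sub>WA f) ` car WA" "add ?Q = set_add WA"
  "mult ?Q = rcoset_mult WA NN" "one ?Q = NN +>\<^sub>WA \<one>\<^sub>WA" "smult ?Q = coset_smult WA NN"
  "aug ?Q = (%X. the_elem (aug WA ` X))"
  by(simp_all add:aug_coproduct_def Let_def WV.rcosets_eq[OF NN_subspace])
 have self: "f : NN +>\<^sub>WA f" if "f : car WA" for f
  using WV.coset_mem[OF NN_subspace that] that NN_subspace by(simp add:W.M.diff_self subspace_def)
 \<comment> \<open>That products of cosets are independent of representatives follows from
   \<open>psi\<close> being multiplicative with these cosets as fibres; no computation with tensor
   relations is involved.\<close>
 have mult: "rcoset_mult WA NN (NN +>\<^sub>WA f) (NN +>\<^sub>WA g) = NN +>\<^sub>WA (f \<otimes>\<^sub>WA g)"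
  if fg: "f : car WA" "g : car WA" for f g
 proof -
  have "NN +>\<^sub>WA (f' \<otimes>\<^sub>WA g') = NN +>\<^sub>WA (f \<otimes>\<^sub>WA g)"
  if "f' : NN +>\<^sub>WA f" "g' : NN +>\<^sub>WA g" for f' g'
  proof -
  have c: "f' : car WA" "psi f' = psi f" "g' : car WA" "psi g' = psi g"
  using that cop_iso_psi[OF fg(1)] cop_iso_psi[OF fg(2)] by(auto simp:cop_iso_def)
  have "psi (f' \<otimes>\<^sub>WA g') = psi (f \<otimes>\<^sub>WA g)" using c fg by(simp add:psi_mult)
  thus ?thesis
  using cop_iso_psi[OF Psi_mult(1)[OF c(1,3)]] cop_iso_psi[OF Psi_mult(1)[OF fg]] by simp
  qed
  hence "rcoset_mult WA NN (NN +>\<^sub>WA f) (NN +>\<^sub>WA g)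
  = (\<Union>a\<in>NN +>\<^sub>WA f. \<Union>b\<in>NN +>\<^sub>WA g. NN +>\<^sub>WA (f \<otimes>\<^sub>WA g))"
  unfolding rcoset_mult_def by(intro SUP_cong refl) blast
  moreover have "NN +>\<^sub>WA f ~= {}" "NN +>\<^sub>WA g ~= {}" using self fg by blast+
  ultimately show ?thesis by(simp only: UN_constant if_False)
 qed
 have hom: "cop_iso : ring_hom E ?Q"
 proof (rule ring_hom_memI)
  fix x assume x: "x : car E"
  obtain f where f: "f : car WA" "psi f = x" by(rule psi_surj[OF x])
  show "cop_iso x : car ?Q" unfolding Q using cop_iso_psi[OF f(1)] f by auto
  fix y assume y: "y : car E"
  obtain g where g: "g : car WA" "psi g = y" by(rule psi_surj[OF y])
  show "cop_iso (x \<otimes>\<^sub>E y) = cop_iso x \<otimes>\<^bsub>?Q\<^esub> cop_iso y"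
  unfolding Q f(2)[symmetric] g(2)[symmetric] psi_mult[OF f(1) g(1), symmetric]
  cop_iso_psi[OF f(1)] cop_iso_psi[OF g(1)] cop_iso_psi[OF Psi_mult(1)[OF f(1) g(1)]]
  using mult[OF f(1) g(1)] by simp
  show "cop_iso (x \<oplus>\<^sub>E y) = cop_iso x \<oplus>\<^bsub>?Q\<^esub> cop_iso y"
  unfolding Q f(2)[symmetric] g(2)[symmetric] psi_add[OF f(1) g(1), symmetric]
  cop_iso_psi[OF f(1)] cop_iso_psi[OF g(1)] cop_iso_psi[OF W.M.a_closed[OF f(1) g(1)]]
  using WV.coset_add[OF NN_subspace f(1) g(1)] by simp
 next
  show "cop_iso \<one>\<^sub>E = \<one>\<^bsub>?Q\<^esub>" unfolding Q one_WA(1) psi_one[symmetric] by(rule cop_iso_psi[OF one_WA(2)])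
 qed
 moreover have "bij_betw cop_iso (car E) (car ?Q)"
 proof (rule bij_betw_imageI)
  show "inj_on cop_iso (car E)"
  proof (rule inj_onI)
  fix x y assume xy: "x : car E" "y : car E" "cop_iso x = cop_iso y"
  obtain f where f: "f : car WA" "psi f = x" by(rule psi_surj[OF xy(1)])
  hence "f : cop_iso y" unfolding xy(3)[symmetric] by(simp add:cop_iso_def)
  thus "x = y" using f(2) by(simp add:cop_iso_def)
  qed
  show "cop_iso ` car E = car ?Q"
  proof
  show "cop_iso ` car E \<subseteq> car ?Q" using ring_hom_closed[OF hom] by blast
  show "car ?Q \<subseteq> cop_iso ` car E"
  unfolding Q using cop_iso_psi psi_closed by(metis (no_types, lifting) image_eqI image_subsetI)
  qed
 qed
 moreover have "cop_iso (k \<odot>\<^sub>E x) = k \<odot>\<^bsub>?Q\<^esub> cop_iso x" if k: "k : car K" and x: "x : car E" for k x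
 proof -
  obtain f where f: "f : car WA" "psi f = x" by(rule psi_surj[OF x])
  show ?thesis unfolding Q f(2)[symmetric] psi_smult[OF k f(1), symmetric] cop_iso_psi[OF f(1)]
  cop_iso_psi[OF W.left_smult_closed[OF k f(1)]]
  using WV.coset_smult_eq[OF NN_subspace k f(1)] by simp
 qed
 moreover have "aug ?Q (cop_iso x) = aug E x" if x: "x : car E" for x
 proof -
  obtain f where f: "f : car WA" "psi f = x" by(rule psi_surj[OF x])
  have au: "aug WA g = aug E x" if "g : cop_iso x" for g
  using that psi_aug[of g] by(auto simp:cop_iso_def word_algebra_def)
  have "f : cop_iso x" using f by(simp add:cop_iso_def)
  hence "aug WA ` cop_iso x = {aug E x}" using au[OF \<open>f : cop_iso x\<close>] by(auto simp:au)
  thus ?thesis unfolding Q by simp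
 qed
 ultimately show ?thesis unfolding aug_algebra_isos_def ring_iso_def by blast
qed

end

section \<open>Yoneda products of classes\<close>

context graded_augmented_algebra
begin

context
 fixes P :: "('a, 'p, 'k) resolution"
 assumes P: "graded_free_resolution K A P"
begin

lemma lift_cocyc:
 fixes T :: "('a, 't, 'k) resolution"
 assumes T: "graded_free_resolution K A T" and z: "z : cocyc T n"
  and u: "u n : ghoms A P$(m + n) T$n"
  "u (Suc n) : ghoms A (res_mod P (Suc (m + n))) T$(Suc n)"
  and ud: "!!x. x : car (res_mod P (Suc (m + n))) ==> res_diff T n (u (Suc n) x) = u n (res_diff P (m + n) x)"
 shows "(%x. z (u n x)) : cocyc P (m + n)"
proof -
 have zg: "z : ghoms A T$n triv" using z by(simp add:cocyc_def)
 have "z (u n (res_diff P (m + n) x)) = \<zero>\<^sub>K" if "x : car (res_mod P (Suc (m + n)))" for x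
  using z gh_closed[OF u(2) that] ud[OF that] by(simp add:cocyc_def flip: ud[OF that])
 thus ?thesis unfolding cocyc_def
  using gh_comp[OF res_mods[OF P] res_mods[OF T] triv_mods zg u(1)] by simp
qed

lemma gh_eval_diff:
 fixes T :: "('a, 't, 'k) resolution"
 assumes T: "graded_free_resolution K A T" and z: "z : ghoms A T$n triv"
  "x : car T$n" "y : car T$n"
 shows "z (x \<ominus>\<^bsub>T$n\<^esub> y) = z x \<ominus>\<^sub>K z y"
 using linear_diff[OF res_ab[OF T] triv_ab gh_linear[OF z(1)] z(2,3)] by simp

text \<open>The difference of the two chain maps has a coboundary as augmentation, which is the
  situation of \<open>homotopy_bdry\<close>.\<close>

lemma lifts_homotopic:
 fixes T :: "('a, 't, 'k) resolution"
 assumes T: "graded_free_resolution K A T" and z: "z : cocyc T n"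
  and t: "!!i. t i : ghoms A P$(m + i) T$i"
  "!!i x. x : car (res_mod P (Suc (m + i))) ==> res_diff T i (t (Suc i) x) = t i (res_diff P (m + i) x)"
  and t': "!!i. t' i : ghoms A P$(m + i) T$i"
  "!!i x. x : car (res_mod P (Suc (m + i))) ==> res_diff T i (t' (Suc i) x) = t' i (res_diff P (m + i) x)"
  and b: "bdry P m (%x. res_aug T (t 0 x) \<ominus>\<^sub>K res_aug T (t' 0 x))"
 shows "bdry P (m + n) (%x. z (t n x) \<ominus>\<^sub>K z (t' n x))"
proof -
 let ?u = "%i x. t i x \<ominus>\<^bsub>T$i\<^esub> t' i x"
 have cl: "t i x : car T$i" "t' i x : car T$i"
  if "x : car P$(m + i)" for i x
  using gh_closed[OF t(1) that] gh_closed[OF t'(1) that] .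
 have zg: "z : ghoms A T$n triv" using z by(simp add:cocyc_def)
 have "bdry P (m + n) (%x. z (?u n x))"
 proof (rule homotopy_bdry[OF P T z])
  show "?u i : ghoms A P$(m + i) T$i" for i
  by(rule gh_diff[OF res_mods[OF P] res_mods[OF T] t(1) t'(1)])
  show "res_diff T i (?u (Suc i) x) = ?u i (res_diff P (m + i) x)"
  if x: "x : car (res_mod P (Suc (m + i)))" for i x
  using res_diff_diff[OF T cl(1)[of x "Suc i"] cl(2)[of x "Suc i"]] x t(2)[OF x] t'(2)[OF x] by simp
  have "res_aug T (?u 0 x) = res_aug T (t 0 x) \<ominus>\<^sub>K res_aug T (t' 0 x)" if "x : car P$m" for x
  using linear_diff[OF res_ab[OF T] triv_ab hd_linear[OF aug_hd[OF T]]] cl[of x 0] that by simp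
  thus "bdry P m (%x. res_aug T (?u 0 x))" using b bdry_cong[OF P] by(metis (no_types, lifting))
 qed
 thus ?thesis
  using bdry_cong[OF P, of "m + n" "%x. z (?u n x)" "%x. z (t n x) \<ominus>\<^sub>K z (t' n x)"]
  gh_eval_diff[OF T zg cl(1) cl(2)] by simp
qed

lemma bdry_pull:
 fixes T :: "('a, 't, 'k) resolution"
 assumes T: "graded_free_resolution K A T" and F: "bdry T n F"
  and t: "!!i. t i : ghoms A P$(m + i) T$i"
  "!!i x. x : car (res_mod P (Suc (m + i))) ==> res_diff T i (t (Suc i) x) = t i (res_diff P (m + i) x)"
 shows "bdry P (m + n) (%x. F (t n x))"
proof (cases n)
 case 0
 have "F (t n x) = \<zero>\<^sub>K" if "x : car P$(m + n)" for x
  using F gh_closed[OF t(1)[of n] that] 0 by(simp add:bdry_def)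
 thus ?thesis using bdry_zero[OF P, of "m + n"] bdry_cong[OF P, of "m + n" "%x. F (t n x)" "%x. \<zero>\<^sub>K"] by simp
next
 case (Suc k)
 then obtain y where y: "y : ghoms A T$k triv"
  "ALL x:car T$n. F x = y (res_diff T k x)" using F unfolding bdry_def by auto
 have "(%x. y (t k x)) : ghoms A P$(m + k) triv"
  by(rule gh_comp[OF res_mods[OF P] res_mods[OF T] triv_mods y(1) t(1)])
 moreover have "F (t n x) = y (t k (res_diff P (m + k) x))" if "x : car (res_mod P (Suc (m + k)))" for x
  using y(2) gh_closed[OF t(1)[of n]] that t(2)[OF that] Suc by simp
 ultimately show ?thesis unfolding bdry_def Suc add_Suc_right nat.case
  by(intro bexI[of _ "%x. y (t k x)"]) (auto simp:Suc)
qed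

text \<open>\<open>yoneda\<close> is a union over all representatives and all lifts. Changing f is
  harmless by \<open>bdry_pull\<close>, changing g or the lift by \<open>lifts_homotopic\<close>; so
  the union consists of one coset, and t shows that it is not empty.\<close>

lemma yoneda_cls:
 assumes f: "f : cocyc P n" and g: "g : cocyc P m"
  and t: "!!i. t i : ghoms A P$(m + i) P$i"
  "!!x. x : car P$m ==> res_aug P (t 0 x) = g x"
  "!!i x. x : car (res_mod P (Suc (m + i))) ==> res_diff P i (t (Suc i) x) = t i (res_diff P (m + i) x)"
 shows "yoneda K A P n m (Ext_class K A P n f) (Ext_class K A P m g) = Ext_class K A P (m + n) (%x. f (t n x))"
proof -
 let ?X = "Ext_class K A P n f" and ?Y = "Ext_class K A P m g"
 have tc: "t i x : car P$i" if "x : car P$(m + i)" for i x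
  using gh_closed[OF t(1) that] .
 have eq: "Ext_class K A P (m + n) (%x. f' (t' n x)) = Ext_class K A P (m + n) (%x. f (t n x))"
  if f': "f' : ?X" and g': "g' : ?Y" and t': "t' : chain_lifts K A P m g'" for f' g' t'
 proof -
  have fc: "f' : cocyc P n" "bdry P n (%x. f' x \<ominus>\<^sub>K f x)" using cls_mem[OF P f f'] .
  have gc: "g' : cocyc P m" "bdry P m (%x. g' x \<ominus>\<^sub>K g x)" using cls_mem[OF P g g'] .
  have t'p: "!!i. t' i : ghoms A P$(m + i) P$i"
  "!!x. x : car P$m ==> res_aug P (t' 0 x) = g' x"
  "!!i x. x : car (res_mod P (Suc (m + i))) ==> res_diff P i (t' (Suc i) x) = t' i (res_diff P (m + i) x)"
  using t' by(auto simp:chain_lifts_def)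
  have "bdry P m (%x. res_aug P (t' 0 x) \<ominus>\<^sub>K res_aug P (t 0 x))"
  using gc(2) bdry_cong[OF P, of m "%x. res_aug P (t' 0 x) \<ominus>\<^sub>K res_aug P (t 0 x)" "%x. g' x \<ominus>\<^sub>K g x"]
  t(2) t'p(2) by simp
  from lifts_homotopic[OF P f t'p(1,3) t(1,3) this]
  have b1: "bdry P (m + n) (%x. f (t' n x) \<ominus>\<^sub>K f (t n x))" by blast
  have b2: "bdry P (m + n) (%x. f' (t' n x) \<ominus>\<^sub>K f (t' n x))"
  using bdry_pull[OF P fc(2) t'p(1,3)] by simp
  have t'c: "t' n x : car P$n" if "x : car P$(m + n)" for x
  using gh_closed[OF t'p(1) that] .
  have "bdry P (m + n) (%x. (f' (t' n x) \<ominus>\<^sub>K f (t' n x)) \<oplus>\<^sub>K (f (t' n x) \<ominus>\<^sub>K f (t n x)))"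
  by(rule bdry_add[OF P b2 b1])
  moreover have "(f' (t' n x) \<ominus>\<^sub>K f (t' n x)) \<oplus>\<^sub>K (f (t' n x) \<ominus>\<^sub>K f (t n x)) = f' (t' n x) \<ominus>\<^sub>K f (t n x)"
  if "x : car P$(m + n)" for x
  using cocyc_closed[OF P f t'c[OF that]] cocyc_closed[OF P fc(1) t'c[OF that]] cocyc_closed[OF P f tc[OF that]]
  by(simp add:a_minus_def K.a_assoc K.r_neg1)
  ultimately have "bdry P (m + n) (%x. f' (t' n x) \<ominus>\<^sub>K f (t n x))"
  using bdry_cong[OF P, of "m + n" "%x. (f' (t' n x) \<ominus>\<^sub>K f (t' n x)) \<oplus>\<^sub>K (f (t' n x) \<ominus>\<^sub>K f (t n x))"
  "%x. f' (t' n x) \<ominus>\<^sub>K f (t n x)"] by simp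
  moreover have "(%x. f' (t' n x)) : cocyc P (m + n)"
  using lift_cocyc[OF P fc(1), of t' m] t'p(1)[of n] t'p(1)[of "Suc n"] t'p(3) by simp
  moreover have "(%x. f (t n x)) : cocyc P (m + n)"
  using lift_cocyc[OF P f, of t m] t(1)[of n] t(1)[of "Suc n"] t(3) by simp
  ultimately show ?thesis using cls_eq_iff[OF P] by simp
 qed
 have ne: "restrict f (car P$n) : ?X" "restrict g (car P$m) : ?Y"
  "t : chain_lifts K A P m (restrict g (car P$m))"
  using cls_self[OF P f] cls_self[OF P g] t by(auto simp:chain_lifts_def)
 show ?thesis
 proof
  show "yoneda K A P n m ?X ?Y \<subseteq> Ext_class K A P (m + n) (%x. f (t n x))"
  unfolding yoneda_def using eq by(intro UN_least) simp
  have "Ext_class K A P (m + n) (%x. f (t n x)) =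
  Ext_class K A P (m + n) (%x. restrict f (car P$n) (t n x))"
  by(rule eq[OF ne, symmetric])
  also have "... \<subseteq> yoneda K A P n m ?X ?Y"
  unfolding yoneda_def using ne by(intro UN_upper[THEN order_trans[rotated]] UN_I subsetI)
  finally show "Ext_class K A P (m + n) (%x. f (t n x)) \<subseteq> yoneda K A P n m ?X ?Y" .
 qed
qed

end

end

section \<open>The bar resolution\<close>

text \<open>The coordinates \<open>co\<close> ignore the scalar part of an element, whence
  \<open>co_one\<close>; \<open>aug A a\<close> and \<open>co a\<close> together determine a. The
  index set is separate from the basis elements so that the alphabets of two algebras can be
  joined.\<close>

locale based_algebra = graded_augmented_algebra K A
 for K :: "'k ring" and A :: "('k, 'a, 'r) gr_aug_algebra_scheme" (structure) +
 fixes X :: "'x set" and e :: "'x => 'a" and deg :: "'x => int" and co :: "'a => 'x => 'k"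
 assumes e_gr: "x : X ==> e x : alg_gr A (deg x)"
  and e_aug: "x : X ==> aug A (e x) = \<zero>\<^sub>K"
  and deg_nonneg: "x : X ==> 0 \<le> deg x"
  and finite_deg: "finite {x : X. deg x = j}"
  and co_fin: "a : car A ==> co a : ffun K X"
  and co_add: "[|a : car A; b : car A|] ==> co (a \<oplus> b) = (%x. co a x \<oplus>\<^sub>K co b x)"
  and co_smult: "[|k : car K; a : car A|] ==> co (k \<odot> a) = (%x. k \<otimes>\<^sub>K co a x)"
  and co_one: "co \<one> = zf.\<^sub>K"
  and co_e: "x : X ==> co (e x) = mon K \<one>\<^sub>K x"
  and co_expand: "a : car A ==>
  a = aug A a \<odot> \<one> \<oplus> (\<Oplus> x\<in>{x. co a x ~= \<zero>\<^sub>K}. co a x \<odot> e x)"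
  and co_gr: "[|a : alg_gr A j; co a x ~= \<zero>\<^sub>K|] ==> deg x = j"
begin

definition sc :: "'k => 'a" where "sc k = k \<odot> \<one>"

lemma e_closed [simp]: "x : X ==> e x : car A"
 using e_gr AG.piece_closed by blast

lemma sc_closed [simp]: "k : car K ==> sc k : car A"
 by(simp add:sc_def)

lemma ksmult_closed [simp]: "k : car K ==> a : car A ==> k \<odot> a : car A"
 by(rule V.smult_closed)

lemma sc_mult: "k : car K ==> a : car A ==> sc k \<otimes> a = k \<odot> a"
 "k : car K ==> a : car A ==> a \<otimes> sc k = k \<odot> a"
 by(simp_all add:sc_def smult_mult_left smult_mult_right)

lemma sc_sc: "k : car K ==> l : car K ==> sc (k \<otimes>\<^sub>K l) = k \<odot> sc l"
 by(simp add:sc_def V.smult_assoc1)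

lemma sc_add: "k : car K ==> l : car K ==> sc (k \<oplus>\<^sub>K l) = sc k \<oplus> sc l"
 by(simp add:sc_def V.smult_l_distr)

lemma sc_additive: "sc : additive_maps K A"
 by(intro additive_mapsI) (auto simp:sc_add)

lemma sc_zero [simp]: "sc \<zero>\<^sub>K = \<zero>"
 by(rule additive_zero[OF K.ab A.ab sc_additive])

lemma sc_one [simp]: "sc \<one>\<^sub>K = \<one>"
 by(simp add:sc_def V.smult_one)

lemma ksmult_zero [simp]: "k : car K ==> k \<odot> \<zero> = \<zero>" "a : car A ==> \<zero>\<^sub>K \<odot> a = \<zero>"
 by(rule V.smult_r_null, assumption, rule V.smult_l_null)

lemma aug_sc [simp]: "k : car K ==> aug A (sc k) = k"
 by(simp add:sc_def aug_smult)

lemma sc_gr: "k : car K ==> sc k : alg_gr A 0"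
 unfolding sc_def by(rule gr_smult[OF _ one_homogeneous])

lemma co_closed [simp]: "a : car A ==> co a x : car K"
 using co_fin ffun_closed by metis

lemma co_supp: "a : car A ==> co a x ~= \<zero>\<^sub>K ==> x : X"
 using co_fin ffun_supp by metis

lemma co_sc [simp]: "k : car K ==> co (sc k) = zf.\<^sub>K"
 by(simp add:sc_def co_smult co_one)

lemma co_zero [simp]: "co \<zero> = zf.\<^sub>K"
 using co_sc[of "\<zero>\<^sub>K"] by simp

lemma A_induct [consumes 1, case_names add sc gen]:
 assumes a: "a : car A"
  and add:"!!a b. [|a : car A; b : car A; Q a; Q b|] ==> Q (a \<oplus> b)"
  and s: "!!k. k : car K ==> Q (sc k)"
  and g: "!!k x. [|k : car K; x : X|] ==> Q (k \<odot> e x)"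
 shows "Q a"
proof -
 let ?S = "{x. co a x ~= \<zero>\<^sub>K}"
 have cc: "co a x \<odot> e x : car A" if "x : ?S" for x using co_supp[OF a] that a by simp
 have "Q (\<Oplus> x\<in>S. co a x \<odot> e x)" if "finite S" "S \<subseteq> ?S" for S
  using that
 proof (induct S)
  case empty
  thus ?case using s[of "\<zero>\<^sub>K"] by simp
 next
  case (insert x S)
  hence "Q (co a x \<odot> e x)" using g a co_supp[OF a] by simp
  thus ?case using insert cc by(simp add:Pi_iff subset_iff add)
 qed
 moreover have "finite ?S" using ffun_finite[OF co_fin[OF a]] .
 ultimately have "Q (\<Oplus> x\<in>?S. co a x \<odot> e x)" by blast
 moreover have "Q (aug A a \<odot> \<one>)" using s[of "aug A a"] a by(simp add:sc_def)
 moreover have "(\<Oplus> x\<in>?S. co a x \<odot> e x) : car A" using cc by(intro A.finsum_closed) auto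
 ultimately have "Q (aug A a \<odot> \<one> \<oplus> (\<Oplus> x\<in>?S. co a x \<odot> e x))"
  using a by(intro add) auto
 thus ?thesis using co_expand[OF a] by simp
qed

abbreviation "BT \<equiv> free_mod A (lists X)"

sublocale BT: fun_module A "lists X" BT
 by(rule fun_module_free_mod[OF A.ring_axioms])

abbreviation (input) "BC \<equiv> ffun A (lists X)"

text \<open>The contraction of the normalised bar complex: the coefficient, freed of its scalar
  part, becomes a new first letter. It is linear over K but not over A.\<close>

definition hh :: "('x list => 'a) => 'x list => 'a" where
 "hh f = (%v. case v of [] => \<zero> | y # w => sc (co (f w) y))"

text \<open>The bar differential is determined by the requirement that \<open>hh\<close> be a contracting homotopy.\<close>

fun bd :: "'x list => 'x list => 'a" where
 "bd [] = zf."
| "bd (x # w) = (%v. mon A (e x) w v \<ominus> hh (%u. e x \<otimes> bd w u) v)"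

definition bD :: "('x list => 'a) => 'x list => 'a" where "bD = lin_ext A BT bd"

lemma hh_simps [simp]: "hh f [] = \<zero>" "hh f (y # w) = sc (co (f w) y)"
 by(simp_all add:hh_def)

lemma BCv: "f : BC ==> f w : car A" by(simp add:ffun_closed)

lemma hh_fin_gen:
 assumes f: "f : ffun A U" and U: "!!y w. y : X ==> w : U ==> y # w : V"
 shows "hh f : ffun A V"
proof -
 have fv: "f w : car A" for w using f by(simp add:ffun_closed)
 have nz: "EX y u. w = y # u & f u ~= \<zero> & co (f u) y ~= \<zero>\<^sub>K" if "hh f w ~= \<zero>" for w
 proof (cases w)
  case (Cons y u)
  have "co (f u) y ~= \<zero>\<^sub>K" using that Cons by auto
  moreover have "f u ~= \<zero>" using calculation by auto
  ultimately show ?thesis using Cons by blast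
 qed (use that in simp)
 show ?thesis
 proof (rule ffunI[where S = "\<Union>u\<in>(supp. f). (%y. y # u) ` {y. co (f u) y ~= \<zero>\<^sub>K}"])
  show "hh f w : car A" for w using fv by(cases w) auto
  show "finite (\<Union>u\<in>(supp. f). (%y. y # u) ` {y. co (f u) y ~= \<zero>\<^sub>K})"
  using ffun_finite[OF f] ffun_finite[OF co_fin[OF fv]] by auto
  fix w assume "hh f w ~= \<zero>"
  then obtain y u where w: "w = y # u" "f u ~= \<zero>" "co (f u) y ~= \<zero>\<^sub>K" using nz by blast
  thus "w : (\<Union>u\<in>(supp. f). (%y. y # u) ` {y. co (f u) y ~= \<zero>\<^sub>K})" by auto
  show "w : V" unfolding w(1) using ffun_supp[OF f w(2)] co_supp[OF fv w(3)] by(intro U)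
 qed
qed

lemma hh_fin: "f : BC ==> hh f : BC"
 by(rule hh_fin_gen) auto

lemma hh_add: "f : BC ==> g : BC ==> hh (%w. f w \<oplus> g w) = (%w. hh f w \<oplus> hh g w)"
proof
 fix v assume "f : BC" "g : BC"
 thus "hh (%w. f w \<oplus> g w) v = hh f v \<oplus> hh g v"
  by(cases v) (auto simp:BCv co_add sc_add)
qed

lemma hh_additive: "hh : additive_maps BT BT"
 by(intro additive_mapsI) (auto simp:BT.carrier_eq BT.add_eq hh_fin hh_add)

lemma hh_zero [simp]: "hh zf. = zf."
 using additive_zero[OF BT.M.ab BT.M.ab hh_additive] by(simp add:BT.zero_eq)

lemma hh_diff: "f : BC ==> g : BC ==> hh (%w. f w \<ominus> g w) = (%w. hh f w \<ominus> hh g w)"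
 using additive_diff[OF BT.M.ab BT.M.ab hh_additive, of f g]
  BT.diff_eq[of f g] BT.diff_eq[of "hh f" "hh g"] by(simp add:BT.carrier_eq hh_fin)

lemma hh_sc: "k : car K ==> f : BC ==> hh (%w. sc k \<otimes> f w) = (%w. sc k \<otimes> hh f w)"
proof
 fix v assume "k : car K" "f : BC"
 thus "hh (%w. sc k \<otimes> f w) v = sc k \<otimes> hh f v"
  using sc_sc[of k "co (f (tl v)) (hd v)"] by(cases v) (auto simp:BCv sc_mult(1) co_smult)
qed

text \<open>All coefficients of \<open>hh f\<close> are scalars, and scalars have zero
  coordinates.\<close>

lemma hh_hh: "f : BC ==> hh (hh f) = zf."
proof
 fix v assume "f : BC"
 thus "hh (hh f) v = \<zero>"
 proof (cases v)
  case (Cons y w)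
  thus ?thesis using \<open>f : BC\<close> by(cases w) (auto simp:BCv)
 qed simp
qed

lemma hh_mon_gen: "x : X ==> k : car K ==> hh (mon A (k \<odot> e x) w) = mon A (sc k) (x # w)"
proof
 fix v assume "x : X" "k : car K"
 thus "hh (mon A (k \<odot> e x) w) v = mon A (sc k) (x # w) v"
  by(cases v) (auto simp:mon_def co_smult co_e)
qed

lemma hh_mon_sc: "k : car K ==> hh (mon A (sc k) w) = zf."
proof
 fix v assume "k : car K"
 thus "hh (mon A (sc k) w) v = \<zero>" by(cases v) (auto simp:mon_def)
qed

lemma bd_fin: "w : lists X ==> bd w : ffun A {u : lists X. Suc (length u) = length w}"
proof (induct w)
 case Nil
 thus ?case by(simp add:A.ffun_zero)
next
 case (Cons x w)
 have "(%u. e x \<otimes> bd w u) : ffun A {u : lists X. Suc (length u) = length w}"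
  using Cons by(intro A.ffun_smult) auto
 hence "hh (%u. e x \<otimes> bd w u) : ffun A {u : lists X. Suc (length u) = length (x # w)}"
  by(rule hh_fin_gen) auto
 moreover have "mon A (e x) w : ffun A {u : lists X. Suc (length u) = length (x # w)}"
  using Cons.prems by(intro A.ffun_mon) auto
 ultimately show ?case unfolding bd.simps by(intro A.ffun_diff)
qed

lemma bd_BC: "w : lists X ==> bd w : BC"
 by(rule ffun_mono[OF bd_fin]) auto

lemma bd_Pi: "bd : lists X \<rightarrow> car BT"
 using bd_BC by(auto simp:BT.carrier_eq)

lemma bD_linear: "bD : lmaps A BT BT"
 unfolding bD_def by(rule BT.lin_ext_linear[OF BT.lm bd_Pi])

lemmas bD_free = A.free_lin[OF bD_linear]

lemma bD_mon: "a : car A ==> w : lists X ==> bD (mon A a w) = (%v. a \<otimes> bd w v)"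
 unfolding bD_def by(subst BT.lin_ext_mon[OF BT.lm bd_Pi]) (auto simp:BT.smult_eq)

text \<open>Since \<open>hh\<close> squares to zero, only the leading term of \<open>bd\<close>
  matters, and its coefficient e x turns back into the first letter.\<close>

lemma hh_bd: "w : lists X ==> w ~= [] ==> hh (bd w) = mon A \<one> w"
proof (cases w)
 case (Cons x v)
 assume "w : lists X"
 hence x: "x : X" "v : lists X" using Cons by auto
 let ?g = "%u. e x \<otimes> bd v u"
 have g: "?g : BC" using x by(intro A.ffun_smult bd_BC) auto
 have m: "mon A (e x) v : BC" using x by(intro A.ffun_mon) auto
 have "hh (mon A (\<one>\<^sub>K \<odot> e x) v) = mon A \<one> (x # v)" using hh_mon_gen[OF x(1), of "\<one>\<^sub>K" v] by simp
 hence "hh (mon A (e x) v) = mon A \<one> (x # v)" using x by(simp add:V.smult_one)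
 moreover have "mon A \<one> (x # v) u : car A" for u by(simp add:mon_def)
 ultimately show ?thesis unfolding Cons bd.simps
  using hh_diff[OF m hh_fin[OF g]] by(simp add:hh_hh[OF g] A.diff_zero)
qed simp

lemma mon_add: "a : car A ==> b : car A ==> mon A (a \<oplus> b) w = (%v. mon A a w v \<oplus> mon A b w v)"
 by(auto simp:mon_def)

text \<open>Additivity in the coefficient leaves two cases. For a scalar the claim is
  \<open>hh_bd\<close>, or trivial at the empty word; for a multiple of e x it is the definition of
  \<open>bd\<close> on the word with x in front. As \<open>hh\<close> is not linear over A, checking
  coefficient one would not suffice.\<close>

lemma bar_homotopy_mon:
 assumes a: "a : car A" and w: "w : lists X"
 shows "(%v. bD (hh (mon A a w)) v \<oplus> hh (bD (mon A a w)) v)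
  = (%v. mon A a w v \<ominus> mon A (sc (aug A (mon A a w []))) [] v)"
 using a
proof (induct rule:A_induct)
 case (add a b)
 have m: "mon A a w : BC" "mon A b w : BC" using add w by(auto intro:A.ffun_mon)
 note c = m bD_free(1)[OF m(1)] bD_free(1)[OF m(2)] hh_fin[OF m(1)] hh_fin[OF m(2)]
  bD_free(1)[OF hh_fin[OF m(1)]] bD_free(1)[OF hh_fin[OF m(2)]] hh_fin[OF bD_free(1)[OF m(1)]] hh_fin[OF bD_free(1)[OF m(2)]]
 note v = c[THEN BCv]
 let ?s = "%a. mon A (sc (aug A (mon A a w []))) []"
 have s: "?s (a \<oplus> b) = (%v. ?s a v \<oplus> ?s b v)"
  using add by(auto simp:mon_def aug_add sc_add)
 have sv: "?s a v : car A" "?s b v : car A" for v using add by(auto simp:mon_def)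
 have "(%v. bD (hh (mon A (a \<oplus> b) w)) v \<oplus> hh (bD (mon A (a \<oplus> b) w)) v)
  = (%v. (bD (hh (mon A a w)) v \<oplus> hh (bD (mon A a w)) v) \<oplus> (bD (hh (mon A b w)) v \<oplus> hh (bD (mon A b w)) v))"
  unfolding mon_add[OF add(1,2)] hh_add[OF m] bD_free(2)[OF m] bD_free(2)[OF hh_fin[OF m(1)] hh_fin[OF m(2)]]
  hh_add[OF bD_free(1)[OF m(1)] bD_free(1)[OF m(2)]]
  using v by(simp add:A.add4)
 also have "... = (%v. (mon A a w v \<ominus> ?s a v) \<oplus> (mon A b w v \<ominus> ?s b v))"
  using fun_cong[OF add(3)] fun_cong[OF add(4)] by simp
 also have "... = (%v. (mon A a w v \<oplus> mon A b w v) \<ominus> (?s a v \<oplus> ?s b v))"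
  by(intro ext A.minus_add4[symmetric] v sv)
 also have "... = (%v. mon A (a \<oplus> b) w v \<ominus> ?s (a \<oplus> b) v)"
  unfolding s by(simp only: mon_add[OF add(1,2)])
 finally show ?case .
next
 case (sc k)
 have "bD (mon A (sc k) w) = (%v. sc k \<otimes> bd w v)" using sc w by(simp add:bD_mon)
 hence h: "hh (bD (mon A (sc k) w)) = (%v. sc k \<otimes> hh (bd w) v)"
  using hh_sc[OF sc bd_BC[OF w]] by simp
 have z: "bD (hh (mon A (sc k) w)) = zf." using sc bD_free(6) by(simp add:hh_mon_sc)
 show ?case
 proof (cases "w = []")
  case True
  thus ?thesis unfolding z h using sc by(auto simp:mon_def A.diff_self)
 next
  case False
  thus ?thesis unfolding z h hh_bd[OF w False] using sc by(auto simp:mon_def A.diff_zero)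
 qed
next
 case (gen k x)
 let ?g = "%u. e x \<otimes> bd w u"
 have g: "?g : BC" using gen w by(intro A.ffun_smult bd_BC) auto
 have 1: "bD (hh (mon A (k \<odot> e x) w)) = (%v. sc k \<otimes> (mon A (e x) w v \<ominus> hh ?g v))"
  using gen w by(simp add:hh_mon_gen bD_mon)
 have "bD (mon A (k \<odot> e x) w) = (%v. sc k \<otimes> ?g v)"
  using gen w BCv[OF bd_BC[OF w]] by(auto simp:bD_mon sc_mult smult_mult_left)
 hence 2: "hh (bD (mon A (k \<odot> e x) w)) = (%v. sc k \<otimes> hh ?g v)" using hh_sc[OF gen(1) g] by simp
 have hg: "hh ?g v : car A" "mon A (e x) w v : car A" for v using BCv[OF hh_fin[OF g]] gen by(auto simp:mon_def)
 have 3: "sc k \<otimes> (mon A (e x) w v \<ominus> hh ?g v) \<oplus> sc k \<otimes> hh ?g v = mon A (k \<odot> e x) w v" for v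
 proof -
  have "sc k \<otimes> (mon A (e x) w v \<ominus> hh ?g v) \<oplus> sc k \<otimes> hh ?g v
  = sc k \<otimes> ((mon A (e x) w v \<ominus> hh ?g v) \<oplus> hh ?g v)" using hg gen by(simp add:A.r_distr)
  also have "... = sc k \<otimes> mon A (e x) w v" using hg by(simp add:A.minus_minus_add)
  also have "... = mon A (k \<odot> e x) w v" using gen by(auto simp:mon_def sc_mult)
  finally show ?thesis .
 qed
 have "aug A (mon A (k \<odot> e x) w []) = \<zero>\<^sub>K" using gen by(auto simp:mon_def aug_smult e_aug)
 hence 4: "mon A (sc (aug A (mon A (k \<odot> e x) w []))) [] = zf." by(auto simp:mon_def)
 have "mon A (k \<odot> e x) w v : car A" for v using gen by(simp add:mon_def)
 thus ?case unfolding 1 2 3 4 by(simp add:A.diff_zero)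
qed

lemma bar_homotopy:
 assumes "f : BC"
 shows "(%v. bD (hh f) v \<oplus> hh (bD f) v) = (%v. f v \<ominus> mon A (sc (aug A (f []))) [] v)"
 using assms
proof (induct rule:A.ffun_induct)
 case zero
 thus ?case using bD_free(6) by(auto simp:mon_def A.diff_self)
next
 case (add f g)
 note m = add(1,2)
 note c = m bD_free(1)[OF m(1)] bD_free(1)[OF m(2)] hh_fin[OF m(1)] hh_fin[OF m(2)]
  bD_free(1)[OF hh_fin[OF m(1)]] bD_free(1)[OF hh_fin[OF m(2)]] hh_fin[OF bD_free(1)[OF m(1)]] hh_fin[OF bD_free(1)[OF m(2)]]
 note v = c[THEN BCv]
 let ?s = "%f. mon A (sc (aug A (f []))) []"
 have s: "?s (%w. f w \<oplus> g w) = (%v. ?s f v \<oplus> ?s g v)"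
  using v by(auto simp:mon_def aug_add sc_add)
 have sv: "?s f v : car A" "?s g v : car A" for v using BCv[OF m(1)] BCv[OF m(2)] by(auto simp:mon_def)
 have "(%v. bD (hh (%w. f w \<oplus> g w)) v \<oplus> hh (bD (%w. f w \<oplus> g w)) v)
  = (%v. (bD (hh f) v \<oplus> hh (bD f) v) \<oplus> (bD (hh g) v \<oplus> hh (bD g) v))"
  unfolding hh_add[OF m] bD_free(2)[OF m] bD_free(2)[OF hh_fin[OF m(1)] hh_fin[OF m(2)]]
  hh_add[OF bD_free(1)[OF m(1)] bD_free(1)[OF m(2)]]
  using v by(simp add:A.add4)
 also have "... = (%v. (f v \<ominus> ?s f v) \<oplus> (g v \<ominus> ?s g v))"
  using fun_cong[OF add(3)] fun_cong[OF add(4)] by simp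
 also have "... = (%v. (f v \<oplus> g v) \<ominus> ?s (%w. f w \<oplus> g w) v)"
  unfolding s by(intro ext A.minus_add4[symmetric] v sv)
 finally show ?case .
next
 case (mon a w)
 thus ?case by(rule bar_homotopy_mon)
qed

text \<open>The chain g = e x times \<open>bd w\<close> is a cycle by induction and has augmentation
  zero, so the homotopy formula gives \<open>bD (hh g) = g\<close>. This cancels the differential of
  the leading term, which is also g.\<close>

lemma bD_bd: "w : lists X ==> bD (bd w) = zf."
proof (induct w)
 case Nil
 thus ?case using bD_free(6) by simp
next
 case (Cons x w)
 let ?g = "%u. e x \<otimes> bd w u"
 have x: "x : X" "w : lists X" using Cons.prems by auto
 have g: "?g : BC" using x by(intro A.ffun_smult bd_BC) auto
 have m: "mon A (e x) w : BC" using x by(intro A.ffun_mon) auto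
 have "bD ?g = zf." using bD_free(3)[OF e_closed[OF x(1)] bd_BC[OF x(2)]] Cons x by simp
 hence "hh (bD ?g) = zf." by simp
 moreover have "aug A (?g []) = \<zero>\<^sub>K" using x BCv[OF bd_BC[OF x(2)]] by(simp add:aug_mult e_aug)
 ultimately have "(%v. bD (hh ?g) v \<oplus> \<zero>) = (%v. ?g v \<ominus> mon A \<zero> [] v)"
  using bar_homotopy[OF g] by simp
 hence "bD (hh ?g) = ?g"
  using BCv[OF g] BCv[OF bD_free(1)[OF hh_fin[OF g]]] by(auto simp:fun_eq_iff mon_def A.diff_zero)
 thus ?case unfolding bd.simps
  using bD_free(5)[OF m hh_fin[OF g]] bD_mon[OF e_closed[OF x(1)] x(2)] BCv[OF g] by(simp add:A.diff_self)
qed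

lemma bD_bD: "f : BC ==> bD (bD f) = zf."
proof (induct rule:A.ffun_induct)
 case zero
 thus ?case using bD_free(6) by simp
next
 case (add f g)
 thus ?case using bD_free(1,2) by simp
next
 case (mon a w)
 thus ?case using bD_free(3)[OF mon(1) bd_BC[OF mon(2)]] bD_bd by(simp add:bD_mon)
qed

end

section \<open>Degrees of words, graded bar modules and exactness\<close>

context based_algebra
begin

definition wdeg :: "'x list => int" where "wdeg w = sum_list (map deg w)"

definition words :: "nat => 'x list set" where "words n = {w : lists X. length w = n}"

lemma wdeg_simps [simp]: "wdeg [] = 0" "wdeg (x # w) = deg x + wdeg w"
 by(simp_all add:wdeg_def)

lemma wdeg_nonneg: "w : lists X ==> 0 \<le> wdeg w"
 by(induct w) (auto intro:deg_nonneg add_nonneg_nonneg)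

text \<open>Since degrees are nonnegative, the first letter has one of the degrees 0 to j, and each
  of these occurs for finitely many letters.\<close>

lemma finite_words: "finite {w : words n. wdeg w = j}"
proof (induct n arbitrary: j)
 case 0
 have "{w : words 0. wdeg w = j} \<subseteq> {[]}" by(auto simp:words_def)
 thus ?case using finite_subset by blast
next
 case (Suc n)
 let ?S = "\<Union>i\<in>{0..j}. (%(x, w). x # w) ` ({x : X. deg x = i} \<times> {w : words n. wdeg w = j - i})"
 have "{w : words (Suc n). wdeg w = j} \<subseteq> ?S"
 proof
  fix w assume w: "w : {w : words (Suc n). wdeg w = j}"
  then obtain x v where xv: "w = x # v" "x : X" "v : words n" "deg x + wdeg v = j"
  by(cases w) (auto simp:words_def)
  have "deg x : {0..j}" using xv deg_nonneg[OF xv(2)] wdeg_nonneg[of v] by(auto simp:words_def)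
  moreover have "w : (%(x, w). x # w) ` ({y : X. deg y = deg x} \<times> {w : words n. wdeg w = j - deg x})"
  using xv by(intro image_eqI[of _ _ "(x, v)"]) auto
  ultimately show "w : ?S" by(rule UN_I)
 qed
 moreover have "finite ?S" using finite_deg Suc by auto
 ultimately show ?case by(rule finite_subset)
qed

definition bar :: "nat => ('a, 'x list => 'a) gr_module" where
 "bar n = \<lparr>carrier = ffun A (words n), mult = undefined, one = undefined,
  zero = zf., add = (%f g w. f w \<oplus> g w), smult = (%a f w. a \<otimes> f w),
  mod_gr = (%j. {f : ffun A (words n). ALL w. f w : alg_gr A (j - wdeg w)})\<rparr>"

definition bar_res :: "('a, 'x list => 'a, 'k) resolution" where
 "bar_res = \<lparr>res_mod = bar, res_diff = (%n. bD), res_aug = (%f. aug A (f []))\<rparr>"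

lemma bar_res_simps [simp]: "res_mod bar_res = bar" "res_diff bar_res n = bD" "res_aug bar_res f = aug A (f [])"
 by(simp_all add:bar_res_def)

lemma bar_fun: "fun_module A (words n) (bar n)"
 by unfold_locales (simp_all add:bar_def)

lemma bar_carrier: "car (bar n) = ffun A (words n)"
 by(simp add:bar_def)

lemma bar_gr: "mod_gr (bar n) j = {f : ffun A (words n). ALL w. f w : alg_gr A (j - wdeg w)}"
 by(simp add:bar_def)

lemma bar_ops: "f \<oplus>\<^bsub>bar n\<^esub> g = (%w. f w \<oplus> g w)" "a \<odot>\<^bsub>bar n\<^esub> f = (%w. a \<otimes> f w)" "\<zero>\<^bsub>bar n\<^esub> = zf."
 by(simp_all add:bar_def)

lemma words_lists: "f : ffun A (words n) ==> f : ffun A (lists X)"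
 by(erule ffun_mono) (auto simp:words_def)

lemma bar_left: "left_module A (bar n)"
 by(rule fun_module.lm[OF bar_fun])

lemma bar_graded: "graded_left_module A (bar n)"
proof -
 interpret B: fun_module A "words n" "bar n" by(rule bar_fun)
 have gz: "gcomp A (alg_gr A) \<zero> j = \<zero>" for j using AG.gcomp_homog[OF AG.piece_zero] by auto
 define p where "p f j = (%w. gcomp A (alg_gr A) (f w) (j - wdeg w))" for f :: "'x list => 'a" and j
 have pfin: "p f j : ffun A (words n)" if "f : ffun A (words n)" for f j
  by(rule ffunI[OF _ ffun_finite[OF that]])
  (use that gz in "auto simp:p_def ffun_closed dest:ffun_supp", metis ffun_supp)
 have "is_grading (bar n) (mod_gr (bar n))"
 proof (rule is_gradingI[where p = p])
  show "abelian_group (bar n)" by(rule B.M.ab)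
  show "additive_subgroup (mod_gr (bar n) j) (bar n)" for j
  proof (rule B.M.additive_subgroup_intro)
  show "mod_gr (bar n) j \<subseteq> car (bar n)" by(auto simp:bar_gr bar_carrier)
  show "\<zero>\<^bsub>bar n\<^esub> : mod_gr (bar n) j" by(auto simp:bar_gr bar_ops A.ffun_zero)
  show "x \<oplus>\<^bsub>bar n\<^esub> y : mod_gr (bar n) j" if "x : mod_gr (bar n) j" "y : mod_gr (bar n) j" for x y
  using that by(auto simp:bar_gr bar_ops A.ffun_add AG.piece_add)
  show "\<ominus>\<^bsub>bar n\<^esub> x : mod_gr (bar n) j" if "x : mod_gr (bar n) j" for x
  using that B.minus_eq[of x] by(auto simp:bar_gr bar_carrier A.ffun_neg AG.piece_neg)
  qed
 next
  fix f j assume f: "f : car (bar n)"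
  hence ff: "f : ffun A (words n)" by(simp add:bar_carrier)
  hence fc: "f w : car A" for w by(simp add:ffun_closed)
  show "p f j : mod_gr (bar n) j" using pfin[OF ff] AG.gcomp_props(1)[OF fc] by(auto simp:bar_gr p_def)
 next
  fix f assume f: "f : car (bar n)"
  hence ff: "f : ffun A (words n)" by(simp add:bar_carrier)
  hence fc: "f w : car A" for w by(simp add:ffun_closed)
  let ?T = "\<Union>w\<in>(supp. f). (%i. i + wdeg w) ` {i. gcomp A (alg_gr A) (f w) i ~= \<zero>}"
  let ?S = "{j. p f j ~= \<zero>\<^bsub>bar n\<^esub>}"
  have "?S \<subseteq> ?T"
  proof
  fix j assume "j : ?S"
  then obtain w where w: "gcomp A (alg_gr A) (f w) (j - wdeg w) ~= \<zero>" by(auto simp:p_def bar_ops)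
  hence "f w ~= \<zero>" using gz by auto
  thus "j : ?T" using w by(intro UN_I[of w] image_eqI[of _ _ "j - wdeg w"]) auto
  qed
  moreover have "finite ?T" using ffun_finite[OF ff] AG.gcomp_props(2)[OF fc] by auto
  ultimately show S: "finite ?S" by(rule finite_subset)
  show "f = (\<Oplus>\<^bsub>bar n\<^esub>j\<in>?S. p f j)"
  proof
  fix w
  have "(\<Oplus>\<^bsub>bar n\<^esub>j\<in>?S. p f j) w = (\<Oplus> j\<in>?S. p f j w)"
  using pfin[OF ff] by(intro B.finsum_apply) (auto simp:bar_carrier)
  also have "... = (\<Oplus> j\<in>?S. gcomp A (alg_gr A) (f w) (j - wdeg w))" by(simp add:p_def)
  also have "... = (\<Oplus> i\<in>(%j. j - wdeg w) ` ?S. gcomp A (alg_gr A) (f w) i)"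
  using fc by(intro A.finsum_reindex[symmetric]) (auto simp:inj_on_def)
  also have "... = f w"
  proof (rule AG.gcomp_sum[symmetric, OF fc])
  show "finite ((%j. j - wdeg w) ` ?S)" using S by simp
  show "gcomp A (alg_gr A) (f w) i = \<zero>" if "i \<notin> (%j. j - wdeg w) ` ?S" for i
  proof (rule ccontr)
  assume "gcomp A (alg_gr A) (f w) i ~= \<zero>"
  hence "p f (i + wdeg w) w ~= \<zero>" by(simp add:p_def)
  hence "i + wdeg w : ?S" by(auto simp:bar_ops)
  thus False using that by(metis add_diff_cancel_right' image_eqI)
  qed
  qed
  finally show "f w = (\<Oplus>\<^bsub>bar n\<^esub>j\<in>?S. p f j) w" by simp
  qed
 next
  fix f g j assume "f : car (bar n)" "g : car (bar n)"
  thus "p (f \<oplus>\<^bsub>bar n\<^esub> g) j = p f j \<oplus>\<^bsub>bar n\<^esub> p g j"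
  by(auto simp:p_def bar_ops bar_carrier ffun_closed AG.gcomp_add)
 next
  fix f and i j :: int assume "f : mod_gr (bar n) i"
  hence "f w : alg_gr A (i - wdeg w)" for w by(simp add:bar_gr)
  from AG.gcomp_homog[OF this] have "p f j w = (if j = i then f w else \<zero>)" for w
  by(simp add:p_def)
  thus "p f j = (if j = i then f else \<zero>\<^bsub>bar n\<^esub>)" by(auto simp:bar_ops)
 qed
 moreover have "a \<odot>\<^bsub>bar n\<^esub> f : mod_gr (bar n) (i + j)"
  if "a : alg_gr A i" "f : mod_gr (bar n) j" for a f i j
  using that gr_mult[OF that(1)] AG.piece_closed[OF that(1)]
  by(auto simp:bar_gr bar_ops A.ffun_smult add_diff_eq[symmetric])
 ultimately show ?thesis
  by(intro graded_left_module.intro bar_left graded_left_module_axioms.intro)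
qed

lemma one_neq_zero: "\<one> ~= \<zero>"
proof
 assume "\<one> = \<zero>"
 hence "aug A \<one> = aug A \<zero>" by simp
 thus False using K.zero_not_one by simp
qed

lemma mon_inj: "mon A \<one> w = mon A \<one> v ==> w = v"
proof -
 assume "mon A \<one> w = mon A \<one> v"
 hence "mon A \<one> w w = mon A \<one> v w" by simp
 thus "w = v" using one_neq_zero by(simp add:mon_def split:if_splits)
qed

text \<open>The words, viewed as monomials with coefficient one, form the basis.
  \<open>graded_free\<close> indexes coordinates by the basis elements themselves, so distinct words
  must give distinct monomials; this holds because the augmentation makes the ring nonzero.\<close>

lemma bar_free: "graded_free A (bar n)"
proof -
 interpret B: fun_module A "words n" "bar n" by(rule bar_fun)
 let ?m = "mon A \<one> :: 'x list => 'x list => 'a"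
 let ?X = "?m ` words n"
 have inj: "inj_on ?m S" for S using mon_inj by(auto simp:inj_on_def)
 have mc: "w : words n ==> ?m w : car (bar n)" for w by simp
 have "?X \<subseteq> (\<Union>j. mod_gr (bar n) j)"
 proof
  fix b assume "b : ?X"
  then obtain w where w: "w : words n" "b = ?m w" by auto
  have "b : mod_gr (bar n) (wdeg w)"
  using w one_homogeneous by(auto simp:bar_gr A.ffun_mon) (simp add:mon_def)
  thus "b : (\<Union>j. mod_gr (bar n) j)" by blast
 qed
 moreover have "EX! c. (ALL x. c x : car A) & (supp. c) \<subseteq> ?X & finite (supp. c) &
  f = (\<Oplus>\<^bsub>bar n\<^esub> x\<in>(supp. c). c x \<odot>\<^bsub>bar n\<^esub> x)" if f: "f : car (bar n)" for f
 proof -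
  have key: "(\<Oplus>\<^bsub>bar n\<^esub> x\<in>(supp. c). c x \<odot>\<^bsub>bar n\<^esub> x) w = c (?m w)"
  if c: "ALL x. c x : car A" "(supp. c) \<subseteq> ?X" "finite (supp. c)" for c w
  proof -
  let ?C = "(supp. c)"
  have cx: "c x \<odot>\<^bsub>bar n\<^esub> x : car (bar n)" if "x : ?C" for x
  using c that mc by(intro B.left_smult_closed) auto
  have "(\<Oplus>\<^bsub>bar n\<^esub> x\<in>?C. c x \<odot>\<^bsub>bar n\<^esub> x) w = (\<Oplus> x\<in>?C. (c x \<odot>\<^bsub>bar n\<^esub> x) w)"
  using cx by(intro B.finsum_apply) auto
  also have "... = c (?m w)"
  proof (cases "?m w : ?C")
  case True
  have "(\<Oplus> x\<in>?C. (c x \<odot>\<^bsub>bar n\<^esub> x) w) = (c (?m w) \<odot>\<^bsub>bar n\<^esub> ?m w) w"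
  proof (rule A.finsum_single[OF c(3) True])
  show "(c (?m w) \<odot>\<^bsub>bar n\<^esub> ?m w) w : car A" using c(1) by(simp add:bar_ops mon_def)
  fix x assume x: "x : ?C" "x ~= ?m w"
  then obtain v where v: "x = ?m v" using c(2) by blast
  thus "(c x \<odot>\<^bsub>bar n\<^esub> x) w = \<zero>" using x(2) c(1) by(auto simp:bar_ops mon_def)
  qed
  thus ?thesis using c(1) by(simp add:bar_ops mon_def)
  next
  case False
  have "(c x \<odot>\<^bsub>bar n\<^esub> x) w = \<zero>" if x: "x : ?C" for x
  proof -
  obtain v where v: "x = ?m v" using c(2) x by blast
  hence "v ~= w" using False x by auto
  thus ?thesis using v c(1) by(simp add:bar_ops mon_def)
  qed
  hence "(\<Oplus> x\<in>?C. (c x \<odot>\<^bsub>bar n\<^esub> x) w) = \<zero>" by(rule A.finsum_zeroI)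
  thus ?thesis using False by simp
  qed
  finally show ?thesis .
  qed
  define c0 where "c0 x = (if x : ?X then f (the_inv_into UNIV ?m x) else \<zero>)" for x
  have inv: "the_inv_into UNIV ?m (?m w) = w" for w by(rule the_inv_into_f_f[OF inj]) simp
  have ff: "f : ffun A (words n)" using f by(simp add:bar_carrier)
  have c0m: "c0 (?m w) = f w" for w
  proof (cases "w : words n")
  case True
  thus ?thesis using inv by(simp add:c0_def)
  next
  case False
  have "?m w \<notin> ?X"
  proof
  assume "?m w : ?X"
  then obtain v where "v : words n" "?m w = ?m v" by auto
  thus False using mon_inj[of w v] False by simp
  qed
  moreover have "f w = \<zero>" using False ffun_supp[OF ff] by blast
  ultimately show ?thesis by(simp add:c0_def)
  qed
  have c0: "ALL x. c0 x : car A" "(supp. c0) \<subseteq> ?X" "finite (supp. c0)"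
  proof -
  show "ALL x. c0 x : car A" using ff by(simp add:c0_def ffun_closed)
  show s: "(supp. c0) \<subseteq> ?X" by(auto simp:c0_def)
  have "(supp. c0) \<subseteq> ?m ` (supp. f)"
  proof
  fix x assume x: "x : (supp. c0)"
  then obtain w where w: "x = ?m w" using s by blast
  thus "x : ?m ` (supp. f)" using x c0m by simp
  qed
  thus "finite (supp. c0)" using ffun_finite[OF ff] finite_subset by blast
  qed
  show ?thesis
  proof (rule ex1I[of _ c0])
  have "f = (\<Oplus>\<^bsub>bar n\<^esub> x\<in>(supp. c0). c0 x \<odot>\<^bsub>bar n\<^esub> x)"
  by(rule ext) (simp only: key[OF c0] c0m)
  thus "(ALL x. c0 x : car A) & (supp. c0) \<subseteq> ?X & finite (supp. c0) &
  f = (\<Oplus>\<^bsub>bar n\<^esub> x\<in>(supp. c0). c0 x \<odot>\<^bsub>bar n\<^esub> x)" using c0 by blast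
  next
  fix c assume c: "(ALL x. c x : car A) & (supp. c) \<subseteq> ?X & finite (supp. c) &
  f = (\<Oplus>\<^bsub>bar n\<^esub> x\<in>(supp. c). c x \<odot>\<^bsub>bar n\<^esub> x)"
  hence k: "c (?m w) = f w" for w using key[of c w] by simp
  show "c = c0"
  proof
  fix x
  show "c x = c0 x"
  proof (cases "x : ?X")
  case True
  thus ?thesis using k c0m by auto
  next
  case False
  hence "c x = \<zero>" using c by blast
  thus ?thesis using False by(simp add:c0_def)
  qed
  qed
  qed
 qed
 ultimately show ?thesis unfolding graded_free_def by(intro exI[of _ ?X] conjI ballI)
qed

lemma hh_words: "f : ffun A (words n) ==> hh f : ffun A (words (Suc n))"
 by(rule hh_fin_gen) (auto simp:words_def)

lemma bD_eq: "f : ffun A (words (Suc n)) ==> bD f = (\<Oplus>\<^bsub>bar n\<^esub> w\<in>(supp. f). f w \<odot>\<^bsub>bar n\<^esub> bd w)"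
 and bD_words: "f : ffun A (words (Suc n)) ==> bD f : ffun A (words n)"
proof -
 interpret B: fun_module A "words n" "bar n" by(rule bar_fun)
 assume f: "f : ffun A (words (Suc n))"
 let ?S = "(supp. f)"
 have S: "w : lists X" "length w = Suc n" if "w : ?S" for w
  using ffun_supp[OF f, of w] that by(auto simp:words_def)
 have bdw: "bd w : car (bar n)" if "w : ?S" for w
  unfolding bar_carrier using S[OF that] by(intro ffun_mono[OF bd_fin]) (auto simp:words_def)
 have fc: "f w : car A" for w using f by(simp add:ffun_closed)
 have c1: "(%w. f w \<odot>\<^bsub>bar n\<^esub> bd w) : ?S \<rightarrow> car (bar n)" using bdw fc by(auto intro:B.left_smult_closed)
 have c2: "(%w. f w \<odot>\<^sub>BT bd w) : ?S \<rightarrow> car BT"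
  using bd_BC S(1) fc by(auto simp:BT.carrier_eq BT.smult_eq intro!: A.ffun_smult)
 have "bD f v = (\<Oplus>\<^bsub>bar n\<^esub> w\<in>?S. f w \<odot>\<^bsub>bar n\<^esub> bd w) v" for v
  unfolding bD_def lin_ext_def B.finsum_apply[OF c1] BT.finsum_apply[OF c2] by(simp add:bar_ops BT.smult_eq)
 thus eq: "bD f = (\<Oplus>\<^bsub>bar n\<^esub> w\<in>?S. f w \<odot>\<^bsub>bar n\<^esub> bd w)" by(rule ext)
 show "bD f : ffun A (words n)" using B.M.finsum_closed[OF c1] unfolding eq by(simp add:bar_carrier)
qed

lemma bd_gr: "w : lists X ==> bd w v : alg_gr A (wdeg w - wdeg v)"
proof (induct w arbitrary: v)
 case (Cons x w)
 hence x: "x : X" "w : lists X" by auto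
 have m: "mon A (e x) w v : alg_gr A (deg x + wdeg w - wdeg v)"
  using e_gr[OF x(1)] by(auto simp:mon_def)
 have h: "hh (%u. e x \<otimes> bd w u) v : alg_gr A (deg x + wdeg w - wdeg v)"
 proof (cases v)
  case (Cons y u)
  let ?a = "e x \<otimes> bd w u"
  have ag: "?a : alg_gr A (deg x + (wdeg w - wdeg u))" using gr_mult[OF e_gr[OF x(1)] Cons.hyps[OF x(2)]] .
  have ac: "?a : car A" using AG.piece_closed[OF ag] .
  show ?thesis
  proof (cases "co ?a y = \<zero>\<^sub>K")
  case True
  thus ?thesis using Cons by simp
  next
  case False
  hence "deg y = deg x + (wdeg w - wdeg u)" using co_gr[OF ag] by blast
  thus ?thesis using Cons sc_gr[OF co_closed[OF ac, of y]] by simp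
  qed
 qed simp
 show ?case using AG.piece_add[OF m AG.piece_neg[OF h]] by(simp add:a_minus_def)
qed simp

text \<open>Exactness is read off the homotopy: a cycle f of augmentation zero equals
  \<open>bD (hh f)\<close>. Beyond length zero the value at the empty word vanishes, so every cycle
  there qualifies.\<close>

lemma bar_resolution: "graded_free_resolution K A bar_res"
proof -
 have bl: "bD : lmaps A (bar (Suc n)) (bar n)" for n
 proof (rule linear_mapsI)
  show "bD f : car (bar n)" if "f : car (bar (Suc n))" for f using bD_words that by(simp add:bar_carrier)
  show "bD (f \<oplus>\<^bsub>bar (Suc n)\<^esub> g) = bD f \<oplus>\<^bsub>bar n\<^esub> bD g" if "f : car (bar (Suc n))" "g : car (bar (Suc n))" for f g
  using bD_free(2)[OF words_lists words_lists] that by(simp add:bar_carrier bar_ops)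
  show "bD (a \<odot>\<^bsub>bar (Suc n)\<^esub> f) = a \<odot>\<^bsub>bar n\<^esub> bD f" if "a : car A" "f : car (bar (Suc n))" for a f
  using bD_free(3)[OF _ words_lists] that by(simp add:bar_carrier bar_ops)
 qed
 have gd: "bD : dhoms A (bar (Suc n)) (bar n) 0" for n
 proof (rule hdI[OF bl])
  fix j f assume f: "f : mod_gr (bar (Suc n)) j"
  hence ff: "f : ffun A (words (Suc n))" and fg: "f w : alg_gr A (j - wdeg w)" for w by(auto simp:bar_gr)
  interpret G: graded_group "bar n" "mod_gr (bar n)" by(rule glm_group[OF bar_graded])
  interpret L: graded_left_module A "bar n" by(rule bar_graded)
  have "bD f : mod_gr (bar n) j" unfolding bD_eq[OF ff]
  proof (rule G.piece_finsum, rule)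
  fix w assume "w : (supp. f)"
  hence w: "w : words (Suc n)" using ffun_supp[OF ff] by blast
  hence "bd w : mod_gr (bar n) (wdeg w)"
  using bd_gr[of w] bd_fin[of w] by(auto simp:bar_gr words_def elim: ffun_mono)
  from L.mod_gr_smult[OF fg[of w] this] show "f w \<odot>\<^bsub>bar n\<^esub> bd w : mod_gr (bar n) j" by simp
  qed
  thus "bD f : mod_gr (bar n) (j + 0)" by simp
 qed
 have al: "(%f. aug A (f [])) : dhoms A (bar 0) triv 0"
 proof (rule hdI)
  show "(%f. aug A (f [])) : lmaps A (bar 0) triv"
  by(rule linear_mapsI) (auto simp:bar_carrier bar_ops ffun_closed aug_add aug_mult)
  show "aug A (f []) : mod_gr triv (j + 0)" if "f : mod_gr (bar 0) j" for f j
  proof (cases "j = 0")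
  case True
  thus ?thesis using that by(auto simp:bar_gr ffun_closed)
  next
  case False
  have "f [] : alg_gr A (j - wdeg [])" using that unfolding bar_gr by blast
  thus ?thesis using gr_aug[OF False, of "f []"] False by simp
  qed
 qed
 have hom: "f = bD (hh f)" if "f : ffun A (lists X)" "bD f = zf." "aug A (f []) = \<zero>\<^sub>K" for f
 proof
  fix v
  have "bD (hh f) v \<oplus> hh (bD f) v = f v \<ominus> mon A (sc (aug A (f []))) [] v"
  using fun_cong[OF bar_homotopy[OF that(1)]] .
  thus "f v = bD (hh f) v"
  unfolding that(2,3) using BCv[OF that(1)] BCv[OF bD_free(1)[OF hh_fin[OF that(1)]]]
  by(simp add:mon_def A.diff_zero)
 qed
 have f0: "f [] = \<zero>" if "f : ffun A (words (Suc n))" for f n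
  using ffun_supp[OF that, of "[]"] by(auto simp:words_def)
 show ?thesis unfolding graded_free_resolution_def bar_res_simps
 proof (intro conjI allI bar_graded bar_free gd)
  show "(%f. aug A (f [])) : dhoms A (bar 0) triv 0" by(rule al)
  show "{x : car (bar (Suc n)). bD x = \<zero>\<^bsub>bar n\<^esub>} = bD ` car (bar (Suc (Suc n)))" for n
  proof
  show "{x : car (bar (Suc n)). bD x = \<zero>\<^bsub>bar n\<^esub>} \<subseteq> bD ` car (bar (Suc (Suc n)))"
  proof
  fix x assume "x : {x : car (bar (Suc n)). bD x = \<zero>\<^bsub>bar n\<^esub>}"
  hence x: "x : ffun A (words (Suc n))" "bD x = zf." by(auto simp:bar_carrier bar_ops)
  show "x : bD ` car (bar (Suc (Suc n)))"
  proof (rule image_eqI)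
  show "x = bD (hh x)" using hom[OF words_lists[OF x(1)] x(2)] f0[OF x(1)] by simp
  show "hh x : car (bar (Suc (Suc n)))" using hh_words[OF x(1)] by(simp add:bar_carrier)
  qed
  qed
  show "bD ` car (bar (Suc (Suc n))) \<subseteq> {x : car (bar (Suc n)). bD x = \<zero>\<^bsub>bar n\<^esub>}"
  using bD_words bD_bD[OF words_lists] by(auto simp:bar_carrier bar_ops)
  qed
  show "{x : car (bar 0). aug A (x []) = \<zero>\<^sub>K} = bD ` car (bar 1)"
  proof
  show "{x : car (bar 0). aug A (x []) = \<zero>\<^sub>K} \<subseteq> bD ` car (bar 1)"
  proof
  fix x assume "x : {x : car (bar 0). aug A (x []) = \<zero>\<^sub>K}"
  hence x: "x : ffun A (words 0)" "aug A (x []) = \<zero>\<^sub>K" by(auto simp:bar_carrier)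
  have "x = mon A (x []) []"
  using ffun_supp[OF x(1)] by(fastforce simp:mon_def words_def)
  moreover have "bD (mon A (x []) []) = zf."
  using x(1) by(simp add:bD_mon ffun_closed)
  ultimately have b: "bD x = zf." by simp
  show "x : bD ` car (bar 1)"
  proof (rule image_eqI)
  show "x = bD (hh x)" using hom[OF words_lists[OF x(1)] b x(2)] .
  show "hh x : car (bar 1)" using hh_words[OF x(1)] by(simp add:bar_carrier)
  qed
  qed
  show "bD ` car (bar 1) \<subseteq> {x : car (bar 0). aug A (x []) = \<zero>\<^sub>K}"
  proof
  fix y assume "y : bD ` car (bar 1)"
  then obtain f where f: "f : ffun A (words (Suc 0))" "y = bD f" by(auto simp:bar_carrier)
  have y0: "y : ffun A (words 0)" using bD_words[OF f(1)] f(2) by simp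
  have fB: "f : ffun A (lists X)" by(rule words_lists[OF f(1)])
  have c2: "(%w. f w \<odot>\<^sub>BT bd w) : (supp. f) \<rightarrow> car BT"
  using bd_BC ffun_supp[OF fB] BCv[OF fB] by(auto simp:BT.carrier_eq BT.smult_eq intro!: A.ffun_smult)
  have "aug A (y []) = (\<Oplus>\<^sub>K w\<in>(supp. f). aug A (f w \<otimes> bd w []))"
  proof -
  have "y [] = (\<Oplus> w\<in>(supp. f). f w \<otimes> bd w [])"
  unfolding f(2) bD_def lin_ext_def BT.finsum_apply[OF c2] by(simp add:BT.smult_eq)
  thus ?thesis
  using additive_finsum[OF A.ab K.ab aug_additive, of "%w. f w \<otimes> bd w []" "(supp. f)"]
  BCv[OF fB] BCv[OF bd_BC] ffun_supp[OF fB] by(simp add:Pi_iff)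
  qed
  also have "... = \<zero>\<^sub>K"
  proof (rule K.finsum_zeroI)
  fix w assume "w : (supp. f)"
  hence "w : words (Suc 0)" using ffun_supp[OF f(1)] by blast
  then obtain x where x: "w = [x]" "x : X" by(auto simp:words_def length_Suc_conv)
  have "bd [x] [] = e x" using x by(simp add:mon_def A.diff_zero)
  thus "aug A (f w \<otimes> bd w []) = \<zero>\<^sub>K" using x BCv[OF fB] by(simp only: x(1)) (simp add:aug_mult e_aug)
  qed
  finally show "y : {x : car (bar 0). aug A (x []) = \<zero>\<^sub>K}" using y0 by(simp add:bar_carrier)
  qed
  qed
  show "(%f. aug A (f [])) ` car (bar 0) = car K"
  proof
  show "(%f. aug A (f [])) ` car (bar 0) \<subseteq> car K" by(auto simp:bar_carrier ffun_closed)
  show "car K \<subseteq> (%f. aug A (f [])) ` car (bar 0)"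
  proof
  fix k assume k: "k : car K"
  show "k : (%f. aug A (f [])) ` car (bar 0)"
  proof (rule image_eqI[of _ _ "mon A (sc k) []"])
  show "k = aug A (mon A (sc k) [] [])" using k by(simp add:mon_def)
  show "mon A (sc k) [] : car (bar 0)" using k by(simp add:bar_carrier A.ffun_mon words_def)
  qed
  qed
  qed
 qed
qed

end

section \<open>Cochains on the bar resolution\<close>

text \<open>If f lives on words of length n, only the factorisation after n letters
  contributes.\<close>

lemma (in field) conv_homog:
 assumes "ALL w. f w : car R" "ALL w. g w : car R" "!!u. f u ~= \<zero> ==> length u = n" "n \<le> length w"
 shows "conv R f g w = f (take n w) \<otimes> g (drop n w)"
 using assms
proof (induct n arbitrary: f w)
 case 0
 have "f = mon R (f []) []"
 proof
  fix u show "f u = mon R (f []) [] u" using 0(3)[of u] by(cases "u = []") (auto simp:mon_def)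
 qed
 thus ?case using conv_mon_Nil[of "f []" g] 0 by(metis drop0 take0)
next
 case (Suc n)
 then obtain x v where w: "w = x # v" "n \<le> length v" by(cases w) auto
 have "conv R (%u. f (x # u)) g v = f (x # take n v) \<otimes> g (drop n v)"
 proof (rule Suc(1))
  show "length u = n" if "f (x # u) ~= \<zero>" for u using Suc(4)[OF that] by simp
 qed (use Suc(2,3) w(2) in auto)
 moreover have "f [] = \<zero>" using Suc(4)[of "[]"] by auto
 ultimately show ?case using Suc(2,3) w by simp
qed

lemma (in field) conv_sum:
 assumes "ALL w. f w : car R" "ALL w. g w : car R"
 shows "conv R f g w = (\<Oplus>i\<in>{..length w}. f (take i w) \<otimes> g (drop i w))"
 using assms(1)
proof (induct w arbitrary: f)
 case Nil
 thus ?case using assms(2) by simp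
next
 case (Cons x w)
 have "{..Suc (length w)} = insert 0 (Suc ` {..length w})" by(rule atMost_Suc_eq_insert_0)
 hence "(\<Oplus>i\<in>{..Suc (length w)}. f (take i (x # w)) \<otimes> g (drop i (x # w)))
  = f [] \<otimes> g (x # w) \<oplus> (\<Oplus>i\<in>Suc ` {..length w}. f (take i (x # w)) \<otimes> g (drop i (x # w)))"
  using Cons(2) assms(2) by simp
 also have "(\<Oplus>i\<in>Suc ` {..length w}. f (take i (x # w)) \<otimes> g (drop i (x # w)))
  = (\<Oplus>i\<in>{..length w}. f (x # take i w) \<otimes> g (drop i w))"
  using Cons(2) assms(2) by(subst finsum_reindex) auto
 also have "... = conv R (%u. f (x # u)) g w" using Cons(1)[of "%u. f (x # u)"] Cons(2) by simp
 finally show ?case by simp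
qed

context based_algebra
begin

text \<open>Zero off X, because \<open>struct_consts\<close> speaks about all letters of the
  type.\<close>

definition cst :: "'x => 'x => 'x => 'k" where
 "cst x y q = (if x : X & y : X then co (e x \<otimes> e y) q else \<zero>\<^sub>K)"

lemma cst_sc: "struct_consts K cst"
 unfolding struct_consts_def
proof (intro conjI allI)
 show "cst x y z : car K" for x y z by(simp add:cst_def)
 show "finite {z. cst x y z ~= \<zero>\<^sub>K}" for x y
  using ffun_finite[OF co_fin, of "e x \<otimes> e y"] by(cases "x : X & y : X") (auto simp:cst_def)
qed

abbreviation "kvals z \<equiv> ALL w :: 'x list. z w : car K"

text \<open>The A-linear map to the ground field with value z w on the basis word w. One function z
  serves the bar modules of all lengths at once.\<close>

definition zt :: "('x list => 'k) => ('x list => 'a) => 'k" where "zt z = lin_ext A triv z"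

lemma zt_linear: "kvals z ==> zt z : lmaps A BT triv"
 unfolding zt_def by(rule BT.lin_ext_linear[OF triv_left_module]) simp

lemma zt_bar_linear: "kvals z ==> zt z : lmaps A (bar n) triv"
 unfolding zt_def by(rule fun_module.lin_ext_linear[OF bar_fun triv_left_module]) simp

lemma zt_mon: "kvals z ==> a : car A ==> w : lists X ==> zt z (mon A a w) = aug A a \<otimes>\<^sub>K z w"
 unfolding zt_def by(subst BT.lin_ext_mon[OF triv_left_module]) auto

lemma zt_closed [simp]: "kvals z ==> f : BC ==> zt z f : car K"
 using linear_closed[OF zt_linear, of z f] by(simp add:BT.carrier_eq)

lemma zt_add: "kvals z ==> f : BC ==> g : BC ==> zt z (%w. f w \<oplus> g w) = zt z f \<oplus>\<^sub>K zt z g"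
 using linear_add[OF zt_linear, of z f g] by(simp add:BT.carrier_eq BT.add_eq)

lemma zt_diff: "kvals z ==> f : BC ==> g : BC ==> zt z (%w. f w \<ominus> g w) = zt z f \<ominus>\<^sub>K zt z g"
 using linear_diff[OF BT.M.ab triv_ab zt_linear, of z f g] BT.diff_eq[of f g]
 by(simp add:BT.carrier_eq)

lemma zt_zero [simp]: "zt z zf. = \<zero>\<^sub>K"
 by(simp add:zt_def lin_ext_def)

lemma zt_eqI:
 assumes "F : lmaps A (bar n) triv" "G : lmaps A (bar n) triv"
  "!!w. w : words n ==> F (mon A \<one> w) = G (mon A \<one> w)" "f : car (bar n)"
 shows "F f = G f"
 by(rule fun_module.linear_eqI[OF bar_fun triv_left_module assms])

lemma zt_cong:
 assumes "kvals z" "kvals z'" "!!w. w : words n ==> z w = z' w" "f : car (bar n)"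
 shows "zt z f = zt z' f"
 using zt_eqI[OF zt_bar_linear[OF assms(1)] zt_bar_linear[OF assms(2)] _ assms(4)] assms
 by(simp add:zt_mon words_def)

text \<open>The summation set may be taken from z instead of f, which presents \<open>zt z\<close>
  as a fixed finite sum of homogeneous maps.\<close>

lemma zt_alt:
 assumes z: "kvals z" and f: "f : BC" and S: "finite S" "!!w. f w ~= \<zero> ==> z w ~= \<zero>\<^sub>K ==> w : S"
 shows "zt z f = (\<Oplus>\<^sub>K w\<in>S. aug A (f w) \<otimes>\<^sub>K z w)"
proof -
 let ?g = "%w. aug A (f w) \<otimes>\<^sub>K z w" and ?F = "(supp. f)"
 have g: "?g w : car K" for w using z BCv[OF f] by simp
 have fF: "finite ?F" by(rule ffun_finite[OF f])
 have "zt z f = (\<Oplus>\<^sub>K w\<in>?F. ?g w)" by(simp add:zt_def lin_ext_def)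
 also have "... = (\<Oplus>\<^sub>K w\<in>?F \<inter> S. ?g w)"
 proof (intro K.finsum_superset[symmetric])
  show "?g w = \<zero>\<^sub>K" if "w : ?F - ?F \<inter> S" for w
  proof -
  have "z w = \<zero>\<^sub>K" using S(2)[of w] that by blast
  thus ?thesis using BCv[OF f] by simp
  qed
 qed (use fF g in auto)
 also have "... = (\<Oplus>\<^sub>K w\<in>S. ?g w)"
  using S(1) g z by(intro K.finsum_superset) auto
 finally show ?thesis .
qed

text \<open>A comparison principle for maps involving \<open>hh\<close>, which are not linear over
  A: the coefficients to be tested are the scalars and the scalar multiples of the basis elements e
  x.\<close>

lemma BT_additive_eqI:
 assumes N: "abelian_group N" and F: "F : additive_maps BT N" and G: "G : additive_maps BT N"
  and s: "!!k w. k : car K ==> w : lists X ==> F (mon A (sc k) w) = G (mon A (sc k) w)"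
  and g: "!!k x w. k : car K ==> x : X ==> w : lists X ==> F (mon A (k \<odot> e x) w) = G (mon A (k \<odot> e x) w)"
  and f: "f : BC"
 shows "F f = G f"
proof (rule BT.additive_eqI[OF N F G])
 fix a w assume a: "a : car A" and w: "w : lists X"
 show "F (mon A a w) = G (mon A a w)" using a
 proof (induct rule:A_induct)
  case (add a b)
  have m: "mon A a w : car BT" "mon A b w : car BT" using add w by auto
  have "mon A (a \<oplus> b) w = mon A a w \<oplus>\<^sub>BT mon A b w" using add by(simp add:BT.add_eq mon_add)
  thus ?case using additive_add[OF F m] additive_add[OF G m] add by simp
 qed (use s g w in auto)
qed (use f in "simp add:BT.carrier_eq")

lemma zt_hh_mon:
 assumes z: "kvals z" and a: "a : car A" and v: "v : lists X"
 shows "zt z (hh (mon A a v)) = (\<Oplus>\<^sub>K q\<in>{q. co a q ~= \<zero>\<^sub>K}. co a q \<otimes>\<^sub>K z (q # v))"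
proof -
 have m: "mon A a v : BC" using a v by(rule A.ffun_mon)
 let ?S = "{q. co a q ~= \<zero>\<^sub>K}"
 have "zt z (hh (mon A a v)) = (\<Oplus>\<^sub>K w\<in>(%q. q # v) ` ?S. aug A (hh (mon A a v) w) \<otimes>\<^sub>K z w)"
 proof (rule zt_alt[OF z hh_fin[OF m]])
  show "finite ((%q. q # v) ` ?S)" using ffun_finite[OF co_fin[OF a]] by simp
  show "w : (%q. q # v) ` ?S" if "hh (mon A a v) w ~= \<zero>" for w
  using that by(cases w) (auto simp:mon_def split:if_splits)
 qed
 also have "... = (\<Oplus>\<^sub>K q\<in>?S. aug A (hh (mon A a v) (q # v)) \<otimes>\<^sub>K z (q # v))"
  using z BCv[OF hh_fin[OF m]] by(subst K.finsum_reindex) (auto simp:inj_on_def)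
 also have "... = (\<Oplus>\<^sub>K q\<in>?S. co a q \<otimes>\<^sub>K z (q # v))" using a by(simp add:mon_def)
 finally show ?thesis .
qed

text \<open>\<open>hh g\<close> has scalar coefficients, so multiplying by e x and applying
  \<open>hh\<close> again only puts the letter x in front.\<close>

lemma zt_hh_e:
 assumes z: "kvals z" and x: "x : X" and g: "g : BC"
 shows "zt z (hh (%u. e x \<otimes> hh g u)) = zt (%u. z (x # u)) (hh g)"
proof (rule BT_additive_eqI[where F = "%g. zt z (hh (%u. e x \<otimes> hh g u))" and G = "%g. zt (%u. z (x # u)) (hh g)", OF K.ab _ _ _ _ g])
 have z': "kvals (%u. z (x # u))" using z by simp
 have ex: "(%u. e x \<otimes> hh g u) : BC" if "g : BC" for g using x hh_fin[OF that] by(intro A.ffun_smult) auto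
 show "(%g. zt z (hh (%u. e x \<otimes> hh g u))) : additive_maps BT K"
 proof (rule additive_mapsI)
  fix f g assume "f : car BT" "g : car BT"
  hence f: "f : BC" "g : BC" by(simp_all add:BT.carrier_eq)
  have "(%u. e x \<otimes> hh (f \<oplus>\<^sub>BT g) u) = (%u. e x \<otimes> hh f u \<oplus> e x \<otimes> hh g u)"
  using x BCv[OF hh_fin[OF f(1)]] BCv[OF hh_fin[OF f(2)]] by(simp add:BT.add_eq hh_add[OF f] A.r_distr)
  thus "zt z (hh (%u. e x \<otimes> hh (f \<oplus>\<^sub>BT g) u)) = zt z (hh (%u. e x \<otimes> hh f u)) \<oplus>\<^sub>K zt z (hh (%u. e x \<otimes> hh g u))"
  using hh_add[OF ex[OF f(1)] ex[OF f(2)]] zt_add[OF z hh_fin[OF ex[OF f(1)]] hh_fin[OF ex[OF f(2)]]] by simp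
 qed (use z hh_fin ex in "auto simp:BT.carrier_eq")
 show "(%g. zt (%u. z (x # u)) (hh g)) : additive_maps BT K"
  by(rule additive_mapsI) (use z' hh_fin in "auto simp:BT.carrier_eq BT.add_eq hh_add zt_add")
 show "zt z (hh (%u. e x \<otimes> hh (mon A (sc k) w) u)) = zt (%u. z (x # u)) (hh (mon A (sc k) w))"
  if "k : car K" for k w using that x by(simp add:hh_mon_sc)
 show "zt z (hh (%u. e x \<otimes> hh (mon A (k \<odot> e y) w) u)) = zt (%u. z (x # u)) (hh (mon A (k \<odot> e y) w))"
  if k: "k : car K" and y: "y : X" and w: "w : lists X" for k y w
 proof -
  have "(%u. e x \<otimes> mon A (sc k) (y # w) u) = mon A (k \<odot> e x) (y # w)"
  using k x by(auto simp:mon_def sc_mult)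
  thus ?thesis using k x y w z z' by(simp add:hh_mon_gen zt_mon)
 qed
qed

text \<open>The recursions match term by term. The leading term has coefficient e x, which the
  augmentation kills. In the remaining term the product e x e y gives the sum over structure
  constants, and the rest prefixes x, giving the shifted differential after two sign
  changes.\<close>

lemma zt_bd: "kvals z ==> w : lists X ==> zt z (bd w) = cobd K cst z w"
proof (induct w arbitrary: z)
 case (Cons x w)
 hence x: "x : X" and w: "w : lists X" by auto
 note z = Cons.prems(1)
 have z': "kvals (%u. z (x # u))" using z by simp
 have ebd: "(%u. e y \<otimes> bd v u) : BC" if "y : X" "v : lists X" for y v
  using that by(intro A.ffun_smult bd_BC) auto
 have step: "zt z (bd (y # v)) = \<ominus>\<^sub>K zt z (hh (%u. e y \<otimes> bd v u))" if "kvals z" "y : X" "v : lists X" for z y v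
  unfolding bd.simps
  using that zt_diff[OF that(1) A.ffun_mon hh_fin[OF ebd[OF that(2,3)]], of "e y" v]
  zt_closed[OF that(1) hh_fin[OF ebd[OF that(2,3)]]]
  by(simp add:zt_mon e_aug K.zero_diff)
 show ?case
 proof (cases w)
  case Nil
  thus ?thesis using step[OF z x w] x by simp
 next
  case (Cons y v)
  hence y: "y : X" "v : lists X" using w by auto
  let ?G = "%u. e y \<otimes> bd v u"
  note G = ebd[OF y]
  have exy: "e x \<otimes> e y : car A" using x y by simp
  have m: "mon A (e x \<otimes> e y) v : BC" by(rule A.ffun_mon[OF exy y(2)])
  have exG: "(%u. e x \<otimes> hh ?G u) : BC" using x hh_fin[OF G] by(intro A.ffun_smult) auto
  have "(%u. e x \<otimes> bd w u) = (%u. mon A (e x \<otimes> e y) v u \<ominus> e x \<otimes> hh ?G u)"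
  proof
  fix u
  have "e x \<otimes> (mon A (e y) v u \<ominus> hh ?G u) = e x \<otimes> mon A (e y) v u \<ominus> e x \<otimes> hh ?G u"
  using x y BCv[OF hh_fin[OF G], of u] by(simp add:mon_def a_minus_def A.r_distr A.r_minus)
  thus "e x \<otimes> bd w u = mon A (e x \<otimes> e y) v u \<ominus> e x \<otimes> hh ?G u"
  using x by(simp add:Cons mon_def)
  qed
  hence "hh (%u. e x \<otimes> bd w u) = (%u. hh (mon A (e x \<otimes> e y) v) u \<ominus> hh (%u. e x \<otimes> hh ?G u) u)"
  using hh_diff[OF m exG] by simp
  hence "zt z (hh (%u. e x \<otimes> bd w u)) = zt z (hh (mon A (e x \<otimes> e y) v)) \<ominus>\<^sub>K zt (%u. z (x # u)) (hh ?G)"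
  using zt_diff[OF z hh_fin[OF m] hh_fin[OF exG]] zt_hh_e[OF z x G] by simp
  moreover have "zt z (hh (mon A (e x \<otimes> e y) v)) = (\<Oplus>\<^sub>K q\<in>{q. cst x y q ~= \<zero>\<^sub>K}. cst x y q \<otimes>\<^sub>K z (q # v))"
  using zt_hh_mon[OF z exy y(2)] x y by(simp add:cst_def)
  moreover have "zt (%u. z (x # u)) (hh ?G) = \<ominus>\<^sub>K cobd K cst (%u. z (x # u)) w"
  proof -
  have "\<ominus>\<^sub>K zt (%u. z (x # u)) (hh ?G) = cobd K cst (%u. z (x # u)) w"
  using step[OF z' y] Cons.hyps[OF z' w] unfolding Cons by(simp only:)
  thus ?thesis using K.minus_minus[OF zt_closed[OF z' hh_fin[OF G]]] by simp
  qed
  moreover have "cobd K cst (%u. z (x # u)) w : car K" by(rule K.cobd_closed[OF cst_sc z'])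
  moreover have "(\<Oplus>\<^sub>K q\<in>{q. cst x y q ~= \<zero>\<^sub>K}. cst x y q \<otimes>\<^sub>K z (q # v)) : car K"
  using z K.sc_closed[OF cst_sc] by(intro K.finsum_closed) auto
  ultimately have "zt z (bd (x # w)) = \<ominus>\<^sub>K ((\<Oplus>\<^sub>K q\<in>{q. cst x y q ~= \<zero>\<^sub>K}. cst x y q \<otimes>\<^sub>K z (q # v)) \<ominus>\<^sub>K \<ominus>\<^sub>K cobd K cst (%u. z (x # u)) w)"
  and "cobd K cst (%u. z (x # u)) w : car K"
  "(\<Oplus>\<^sub>K q\<in>{q. cst x y q ~= \<zero>\<^sub>K}. cst x y q \<otimes>\<^sub>K z (q # v)) : car K"
  using step[OF z x w] by simp_all
  thus ?thesis using Cons by(simp add:a_minus_def K.minus_add)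
 qed
qed simp

lemma zt_bD:
 assumes z: "kvals z" and f: "f : BC" shows "zt z (bD f) = zt (cobd K cst z) f"
proof -
 have c: "kvals (cobd K cst z)" by(rule allI) (rule K.cobd_closed[OF cst_sc z])
 have "(%f. zt z (bD f)) : lmaps A BT triv"
  by(rule linear_comp[OF zt_linear[OF z] bD_linear])
 thus ?thesis
 proof (rule BT.linear_eqI[OF triv_left_module _ zt_linear[OF c]])
  fix w assume w: "w : lists X"
  thus "zt z (bD (mon A \<one> w)) = zt (cobd K cst z) (mon A \<one> w)"
  using zt_bd[OF z w] BCv[OF bd_BC[OF w]] c by(simp add:bD_mon zt_mon)
 qed (use f in "simp add:BT.carrier_eq")
qed

abbreviation "KC \<equiv> ffun K (lists X)"

lemma KC_vals: "z : ffun K W ==> kvals z" by(simp add:ffun_closed)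

text \<open>Multiplication respects internal degree, so a nonzero value at w comes from a word of
  the support with the same degree and one letter less. With \<open>finite_words\<close> the support
  stays finite.\<close>

lemma cobd_supp:
 "kvals z ==> cobd K cst z w ~= \<zero>\<^sub>K ==>
  EX u. z u ~= \<zero>\<^sub>K & length w = Suc (length u) & wdeg w = wdeg u & (u : lists X --> w : lists X)"
proof (induct w arbitrary: z)
 case (Cons x w)
 note z = Cons.prems(1)
 show ?case
 proof (cases w)
  case Nil
  thus ?thesis using Cons.prems by simp
 next
  case (Cons y v)
  let ?S = "\<Oplus>\<^sub>K q\<in>{q. cst x y q ~= \<zero>\<^sub>K}. cst x y q \<otimes>\<^sub>K z (q # v)"
  show ?thesis
  proof (cases "cobd K cst (%u. z (x # u)) w = \<zero>\<^sub>K")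
  case True
  hence "?S ~= \<zero>\<^sub>K" using Cons.prems(2) Cons by(auto simp:a_minus_def)
  then obtain q where q: "cst x y q ~= \<zero>\<^sub>K" "cst x y q \<otimes>\<^sub>K z (q # v) ~= \<zero>\<^sub>K"
  using K.finsum_zeroI[of "{q. cst x y q ~= \<zero>\<^sub>K}" "%q. cst x y q \<otimes>\<^sub>K z (q # v)"] by blast
  hence xy: "x : X" "y : X" "co (e x \<otimes> e y) q ~= \<zero>\<^sub>K" by(auto simp:cst_def split:if_splits)
  have "z (q # v) ~= \<zero>\<^sub>K" using q K.sc_closed[OF cst_sc] by auto
  moreover have "deg q = deg x + deg y" using co_gr[OF gr_mult[OF e_gr[OF xy(1)] e_gr[OF xy(2)]] xy(3)] .
  ultimately show ?thesis using Cons xy by(intro exI[of _ "q # v"]) auto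
  next
  case False
  then obtain u where "z (x # u) ~= \<zero>\<^sub>K" "length w = Suc (length u)" "wdeg w = wdeg u" "u : lists X --> w : lists X"
  using Cons.hyps[of "%u. z (x # u)"] z by auto
  thus ?thesis by(intro exI[of _ "x # u"]) auto
  qed
 qed
qed simp

lemma cobd_fin: assumes z: "z : KC" shows "cobd K cst z : KC"
proof (rule ffunI)
 show "cobd K cst z w : car K" for w by(rule K.cobd_closed[OF cst_sc KC_vals[OF z]])
 let ?S = "\<Union>u\<in>(supp.\<^sub>K z). {w : words (Suc (length u)). wdeg w = wdeg u}"
 show "finite ?S" using ffun_finite[OF z] finite_words by blast
 fix w assume "cobd K cst z w ~= \<zero>\<^sub>K"
 then obtain u where u: "z u ~= \<zero>\<^sub>K" "length w = Suc (length u)" "wdeg w = wdeg u" "u : lists X --> w : lists X"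
  using cobd_supp[OF KC_vals[OF z]] by blast
 thus wl: "w : lists X" using ffun_supp[OF z] by blast
 thus "w : ?S" using u by(auto simp:words_def)
qed

text \<open>Dual to the vanishing of the square of the bar differential, so associativity need not
  be expressed through the structure constants.\<close>

lemma cobd_cobd: assumes z: "z : KC" shows "cobd K cst (cobd K cst z) = zf.\<^sub>K"
proof
 fix w
 show "cobd K cst (cobd K cst z) w = \<zero>\<^sub>K"
 proof (cases "w : lists X")
  case True
  hence "cobd K cst (cobd K cst z) w = zt (cobd K cst z) (bd w)"
  using zt_bd[OF KC_vals[OF cobd_fin[OF z]]] by simp
  also have "... = zt z (bD (bd w))" using zt_bD[OF KC_vals[OF z] bd_BC[OF True]] by simp
  finally show ?thesis using bD_bd[OF True] by simp
 next
  case False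
  thus ?thesis using ffun_supp[OF cobd_fin[OF cobd_fin[OF z]]] by blast
 qed
qed

lemma bar_mods: "left_module A (bar n)" "graded_group (bar n) (mod_gr (bar n))"
 by(rule bar_left, rule glm_group[OF bar_graded])

lemma bar_BC: "f : car (bar n) ==> f : BC"
 using words_lists by(simp add:bar_carrier)

lemma zt_graded:
 assumes z: "z : KC" shows "zt z : ghoms A (bar n) triv"
proof -
 let ?S = "(supp.\<^sub>K z)"
 note zv = KC_vals[OF z]
 have "(%f. aug A (f w) \<otimes>\<^sub>K z w) : dhoms A (bar n) triv (- wdeg w)" for w
 proof (rule hdI)
  show "(%f. aug A (f w) \<otimes>\<^sub>K z w) : lmaps A (bar n) triv"
  by(rule linear_mapsI)
  (use zv in "auto simp:bar_carrier bar_ops ffun_closed aug_add aug_mult K.l_distr K.m_assoc")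
  fix i f assume "f : mod_gr (bar n) i"
  hence f: "f w : alg_gr A (i - wdeg w)" by(simp add:bar_gr)
  show "aug A (f w) \<otimes>\<^sub>K z w : mod_gr triv (i + - wdeg w)"
  using gr_aug[OF _ f] zv AG.piece_closed[OF f] by auto
 qed
 hence "(%f. \<Oplus>\<^sub>triv w\<in>?S. aug A (f w) \<otimes>\<^sub>K z w) : ghoms A (bar n) triv"
  using ffun_finite[OF z]
  by(intro gh_finsum[OF bar_mods triv_mods] hd_graded[OF bar_mods triv_mods])
 thus ?thesis
  by(rule gh_cong) (use zt_alt[OF zv bar_BC ffun_finite[OF z]] in "auto simp:bar_left")
qed

text \<open>The target sits in degree zero, so a finite sum of homogeneous maps is nonzero only on
  words of finitely many degrees. For a fixed length these are finitely many words, whence the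
  finite support.\<close>

lemma graded_zt:
 assumes F: "F : ghoms A (bar n) triv"
 obtains z where "z : ffun K (words n)" "!!f. f : car (bar n) ==> F f = zt z f"
proof -
 define z where "z w = (if w : words n then F (mon A \<one> w) else \<zero>\<^sub>K)" for w
 have mc: "mon A \<one> w : car (bar n)" if "w : words n" for w
  using that by(simp add:bar_carrier A.ffun_mon)
 obtain J h where J: "finite J" "ALL j:J. h j : dhoms A (bar n) triv j"
  "ALL f:car (bar n). F f = (\<Oplus>\<^sub>triv j\<in>J. h j f)"
  using F unfolding graded_homs_def mem_Collect_eq by(elim conjE exE) (rule that)
 have zv: "kvals z" using gh_closed[OF F mc] by(simp add:z_def)
 have "z : ffun K (words n)"
 proof (rule ffunI)
  show "z w : car K" for w using zv by simp
  show "finite (\<Union>j\<in>J. {w : words n. wdeg w = - j})" using J(1) finite_words by blast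
  fix w assume w: "z w ~= \<zero>\<^sub>K"
  thus wn: "w : words n" by(auto simp:z_def split:if_splits)
  have "mon A \<one> w : mod_gr (bar n) (wdeg w)"
  using wn one_homogeneous by(auto simp:bar_gr A.ffun_mon) (simp add:mon_def)
  hence hz: "h j (mon A \<one> w) = \<zero>\<^sub>K" if "j : J" "wdeg w ~= - j" for j
  using hd_piece[OF bspec[OF J(2) that(1)], of "mon A \<one> w" "wdeg w"] that(2) by(auto split:if_splits)
  show "w : (\<Union>j\<in>J. {w : words n. wdeg w = - j})"
  proof (rule ccontr)
  assume c: "w \<notin> (\<Union>j\<in>J. {w : words n. wdeg w = - j})"
  have "(\<Oplus>\<^sub>K j\<in>J. h j (mon A \<one> w)) = \<zero>\<^sub>K"
  by(rule K.finsum_zeroI, rule hz) (use c wn in auto)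
  thus False using w wn J(3) mc[OF wn] by(simp add:z_def)
  qed
 qed
 moreover have "F f = zt z f" if "f : car (bar n)" for f
  by(rule zt_eqI[OF gh_linear[OF F] zt_bar_linear[OF zv] _ that])
  (use zv gh_closed[OF F mc] in "auto simp:zt_mon words_def z_def")
 ultimately show ?thesis using that by blast
qed

section \<open>Lifting cocycles of the bar resolution\<close>

text \<open>Evaluates z on the last m letters and keeps the letters before them. For a cocycle z on
  words of length m this is an explicit lifting of z to a chain map.\<close>

definition tl :: "('x list => 'k) => ('x list => 'a) => 'x list => 'a" where
 "tl z f = (%u. \<Oplus> v\<in>(supp.\<^sub>K z). f (u @ v) \<otimes> sc (z v))"

lemma sc_comm: "k : car K ==> a : car A ==> a \<otimes> sc k = sc k \<otimes> a"
 by(simp add:sc_mult)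

context
 fixes z m assumes z: "z : ffun K (words m)"
begin

lemma zvals: "kvals z" by(rule KC_vals[OF z])

lemma tl_graded: "tl z : ghoms A (bar (m + i)) (bar i)"
proof -
 let ?S = "(supp.\<^sub>K z)"
 interpret B: fun_module A "words i" "bar i" by(rule bar_fun)
 let ?g = "%v f u. f (u @ v) \<otimes> sc (z v)"
 have gc: "?g v f : ffun A (words i)" if f: "f : ffun A (words (m + i))" and v: "v : ?S" for f v
 proof (rule ffunI)
  have vw: "v : words m" using ffun_supp[OF z] v by blast
  show "?g v f u : car A" for u using zvals f by(simp add:ffun_closed)
  show "finite ((%w. take (length w - m) w) ` (supp. f))" using ffun_finite[OF f] by simp
  fix u assume "?g v f u ~= \<zero>"
  hence fu: "f (u @ v) ~= \<zero>" using zvals by auto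
  show "u : words i" using ffun_supp[OF f fu] vw by(auto simp:words_def)
  show "u : (%w. take (length w - m) w) ` (supp. f)"
  using fu vw by(intro image_eqI[of _ _ "u @ v"]) (auto simp:words_def)
 qed
 have "?g v : dhoms A (bar (m + i)) (bar i) (- wdeg v)" if v: "v : ?S" for v
 proof (rule hdI)
  show "?g v : lmaps A (bar (m + i)) (bar i)"
  by(rule linear_mapsI)
  (use gc[OF _ v] zvals in "auto simp:bar_carrier bar_ops ffun_closed A.l_distr A.m_assoc")
  fix j f assume f: "f : mod_gr (bar (m + i)) j"
  have "f (u @ v) \<otimes> sc (z v) : alg_gr A (j - wdeg (u @ v) + 0)" for u
  using f zvals by(intro gr_mult sc_gr) (auto simp:bar_gr)
  thus "?g v f : mod_gr (bar i) (j + - wdeg v)"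
  using f gc[OF _ v, of f] by(auto simp:bar_gr wdeg_def algebra_simps)
 qed
 hence "(%f. \<Oplus>\<^bsub>bar i\<^esub> v\<in>?S. ?g v f) : ghoms A (bar (m + i)) (bar i)"
  using ffun_finite[OF z]
  by(intro gh_finsum[OF bar_mods bar_mods] hd_graded[OF bar_mods bar_mods]) auto
 thus ?thesis
 proof (rule gh_cong)
  fix f assume f: "f : car (bar (m + i))"
  have "(\<Oplus>\<^bsub>bar i\<^esub> v\<in>?S. ?g v f) u = tl z f u" for u
  unfolding tl_def using gc f by(intro B.finsum_apply) (auto simp:bar_carrier)
  thus "tl z f = (\<Oplus>\<^bsub>bar i\<^esub> v\<in>?S. ?g v f)" by auto
 qed (rule bar_left)
qed

lemma tl_fin: assumes f: "f : BC" shows "tl z f : BC"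
proof (rule ffunI)
 show "tl z f u : car A" for u unfolding tl_def using BCv[OF f] zvals by(intro A.finsum_closed) auto
 show "finite ((%w. take (length w - m) w) ` (supp. f))" using ffun_finite[OF f] by simp
 fix u assume "tl z f u ~= \<zero>"
 then obtain v where v: "z v ~= \<zero>\<^sub>K" "f (u @ v) \<otimes> sc (z v) ~= \<zero>"
  unfolding tl_def using A.finsum_zeroI[of "(supp.\<^sub>K z)" "%v. f (u @ v) \<otimes> sc (z v)"] by blast
 have fu: "f (u @ v) ~= \<zero>" using v(2) zvals by auto
 have vw: "v : words m" using ffun_supp[OF z v(1)] .
 show "u : lists X" using ffun_supp[OF f fu] by auto
 show "u : (%w. take (length w - m) w) ` (supp. f)"
  using fu vw by(intro image_eqI[of _ _ "u @ v"]) (auto simp:words_def)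
qed

lemma tl_linear: "tl z : lmaps A BT BT"
proof (rule A.free_linI[OF tl_fin])
 fix f g assume "f : BC" "g : BC"
 thus "tl z (%w. f w \<oplus> g w) = (%w. tl z f w \<oplus> tl z g w)"
  unfolding tl_def using zvals BCv by(subst A.finsum_addf[symmetric]) (auto simp:A.l_distr)
next
 fix a f assume a: "a : car A" and f: "f : BC"
 show "tl z (%w. a \<otimes> f w) = (%w. a \<otimes> tl z f w)"
  unfolding tl_def using a zvals BCv[OF f] ffun_finite[OF z]
  by(subst A.finsum_rdistr) (auto simp:A.m_assoc)
qed

lemmas tl_free = A.free_lin[OF tl_linear]

lemma tl_mon:
 assumes a: "a : car A" and i: "length w = m + i"
 shows "tl z (mon A a w) = mon A (a \<otimes> sc (z (drop i w))) (take i w)"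
proof
 fix u
 let ?S = "(supp.\<^sub>K z)"
 let ?h = "%v. mon A a w (u @ v) \<otimes> sc (z v)"
 have h: "?h v : car A" for v using a zvals by(simp add:mon_def)
 have len: "v : ?S ==> length v = m" for v using ffun_supp[OF z] by(auto simp:words_def)
 show "tl z (mon A a w) u = mon A (a \<otimes> sc (z (drop i w))) (take i w) u"
 proof (cases "u = take i w & drop i w : ?S")
  case True
  have "tl z (mon A a w) u = ?h (drop i w)" unfolding tl_def
  proof (rule A.finsum_single[OF ffun_finite[OF z]])
  show "?h v = \<zero>" if "v : ?S" "v ~= drop i w" for v
  proof -
  have "u @ v ~= w" using that(2) True append_take_drop_id[of i w] same_append_eq by metis
  thus ?thesis using zvals by(simp add:mon_def)
  qed
  qed (use True h[of "drop i w"] ffun_finite[OF z] in auto)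
  thus ?thesis using True by(simp add:mon_def)
 next
  case False
  have "?h v = \<zero>" if "v : ?S" for v
  proof (cases "u @ v = w")
  case True
  hence "u = take i w" "v = drop i w" using len[OF that] i by auto
  thus ?thesis using False that by simp
  next
  case False
  thus ?thesis using zvals by(simp add:mon_def)
  qed
  hence "tl z (mon A a w) u = \<zero>" unfolding tl_def by(rule A.finsum_zeroI)
  moreover have "mon A (a \<otimes> sc (z (drop i w))) (take i w) u = \<zero>" using False a by(auto simp:mon_def)
  ultimately show ?thesis by simp
 qed
qed

lemma tl_mon_short: assumes "a : car A" "length w < m" shows "tl z (mon A a w) = zf."
proof
 fix u
 have "mon A a w (u @ v) \<otimes> sc (z v) = \<zero>" if "v : (supp.\<^sub>K z)" for v
  using ffun_supp[OF z, of v] that assms zvals by(auto simp:mon_def words_def)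
 thus "tl z (mon A a w) u = \<zero>" unfolding tl_def by(rule A.finsum_zeroI)
qed

lemma aug_tl: assumes f: "f : BC" shows "aug A (tl z f []) = zt z f"
proof -
 have "aug A (tl z f []) = (\<Oplus>\<^sub>K v\<in>(supp.\<^sub>K z). aug A (f v \<otimes> sc (z v)))"
  unfolding tl_def using BCv[OF f] zvals
  by(subst additive_finsum[OF A.ab K.ab aug_additive]) auto
 thus ?thesis
  using zt_alt[OF zvals f ffun_finite[OF z]] BCv[OF f] zvals by(simp add:aug_mult)
qed

text \<open>Adding a letter in front and stripping letters at the end commute unless the stripping
  consumes the new letter as well. This happens exactly at the empty word and produces the
  correction term.\<close>

lemma tl_hh:
 assumes f: "f : BC" shows "tl z (hh f) = (%u. hh (tl z f) u \<oplus> mon A (sc (zt z (hh f))) [] u)"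
proof
 fix u
 let ?S = "(supp.\<^sub>K z)"
 note fv = BCv[OF f] BCv[OF hh_fin[OF f]]
 have fin: "finite ?S" by(rule ffun_finite[OF z])
 show "tl z (hh f) u = hh (tl z f) u \<oplus> mon A (sc (zt z (hh f))) [] u"
 proof (cases u)
  case Nil
  have s: "hh f v = sc (aug A (hh f v))" for v using fv by(cases v) auto
  have "tl z (hh f) [] = (\<Oplus> v\<in>?S. sc (aug A (hh f v) \<otimes>\<^sub>K z v))"
  unfolding tl_def using zvals fv
  by(intro A.finsum_cong') (auto simp:sc_sc sc_mult[symmetric] s[symmetric])
  also have "... = sc (\<Oplus>\<^sub>K v\<in>?S. aug A (hh f v) \<otimes>\<^sub>K z v)"
  using zvals fv by(subst additive_finsum[OF K.ab A.ab sc_additive]) auto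
  also have "... = sc (zt z (hh f))" using zt_alt[OF zvals hh_fin[OF f] fin] by simp
  finally show ?thesis using Nil zvals f hh_fin by(simp add:mon_def)
 next
  case (Cons q w)
  have co_ad: "(%a. sc (co a q)) : additive_maps A A"
  by(rule additive_mapsI) (auto simp:co_add sc_add)
  have "hh (tl z f) u = sc (co (\<Oplus> v\<in>?S. f (w @ v) \<otimes> sc (z v)) q)"
  using Cons by(simp add:tl_def)
  also have "... = (\<Oplus> v\<in>?S. sc (co (f (w @ v) \<otimes> sc (z v)) q))"
  using fv zvals by(intro additive_finsum[OF A.ab A.ab co_ad]) auto
  also have "... = (\<Oplus> v\<in>?S. sc (co (f (w @ v)) q) \<otimes> sc (z v))"
  using fv zvals by(intro A.finsum_cong') (auto simp:sc_mult co_smult sc_sc)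
  also have "... = tl z (hh f) u" using Cons by(simp add:tl_def)
  finally show ?thesis using Cons BCv[OF hh_fin[OF tl_fin[OF f]]] BCv[OF tl_fin[OF hh_fin[OF f]]] by(simp add:mon_def)
 qed
qed

context
 assumes cz: "cobd K cst z = zf.\<^sub>K"
begin

text \<open>Induction on the word. The correction term of \<open>tl_hh\<close> is, up to sign, the
  value of the cobar differential of z at the whole word, which vanishes for a cocycle. Words too
  short to leave a letter in front are settled separately.\<close>

lemma tl_bd: "w : lists X ==> bD (tl z (mon A \<one> w)) = tl z (bd w)"
proof (induct w)
 case Nil
 have "bD (tl z (mon A \<one> [])) = zf."
 proof (cases m)
  case 0
  thus ?thesis using tl_mon[of "\<one>" "[]" 0] zvals by(simp add:bD_mon)
 next
  case (Suc n)
  thus ?thesis using tl_mon_short[of "\<one>" "[]"] bD_free(6) by simp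
 qed
 thus ?case using tl_free(6) by simp
next
 case (Cons x w)
 hence x: "x : X" and w: "w : lists X" by auto
 let ?G = "%u. e x \<otimes> bd w u"
 have G: "?G : BC" using x w by(intro A.ffun_smult bd_BC) auto
 have mx: "mon A (e x) w : BC" using x w by(intro A.ffun_mon) auto
 \<comment> \<open>This is where the cocycle condition is used.\<close>
 have "zt z (bd (x # w)) = \<zero>\<^sub>K" using zt_bd[OF zvals, of "x # w"] x w cz by simp
 hence zG: "zt z (hh ?G) = \<zero>\<^sub>K"
  unfolding bd.simps using zt_diff[OF zvals mx hh_fin[OF G]] x w zvals zt_closed[OF zvals hh_fin[OF G]]
  by(simp add:zt_mon e_aug K.zero_diff)
 have tG: "tl z ?G = (%u. e x \<otimes> bD (tl z (mon A \<one> w)) u)"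
  using tl_free(3)[OF e_closed[OF x] bd_BC[OF w]] Cons.hyps[OF w] by simp
 have R: "tl z (bd (x # w)) = (%u. tl z (mon A (e x) w) u \<ominus> hh (tl z ?G) u)"
  unfolding bd.simps tl_free(5)[OF mx hh_fin[OF G]] tl_hh[OF G] zG
  using BCv[OF hh_fin[OF tl_fin[OF G]]] by(auto simp:mon_def)
 show ?case
 proof (cases "m \<le> length w")
  case True
  then obtain i where i: "length w = m + i" using le_Suc_ex by blast
  let ?k = "z (drop i w)" and ?u = "take i w"
  have k: "?k : car K" using zvals by simp
  have u: "?u : lists X" using w by(meson in_lists_conv_set in_set_takeD)
  have eb: "(%v. e x \<otimes> bd ?u v) : BC" using x u by(intro A.ffun_smult bd_BC) auto
  have bu: "bd ?u v : car A" for v using BCv[OF bd_BC[OF u]] .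
  have "tl z (mon A \<one> w) = mon A (sc ?k) ?u" using tl_mon[OF _ i] k by simp
  hence "tl z ?G = (%v. sc ?k \<otimes> (e x \<otimes> bd ?u v))"
  unfolding tG using k u x bu by(simp add:bD_mon sc_comm A.m_assoc[symmetric])
  hence "hh (tl z ?G) = (%v. sc ?k \<otimes> hh (%v. e x \<otimes> bd ?u v) v)" using hh_sc[OF k eb] by simp
  moreover have "tl z (mon A (e x) w) = (%v. sc ?k \<otimes> mon A (e x) ?u v)"
  using tl_mon[OF e_closed[OF x] i] k x by(auto simp:mon_def sc_comm)
  moreover have "sc ?k \<otimes> mon A (e x) ?u v \<ominus> sc ?k \<otimes> hh (%v. e x \<otimes> bd ?u v) v
  = sc ?k \<otimes> (mon A (e x) ?u v \<ominus> hh (%v. e x \<otimes> bd ?u v) v)" for v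
  using k x BCv[OF hh_fin[OF eb], of v] by(simp add:mon_def a_minus_def A.r_distr A.r_minus)
  ultimately have "tl z (bd (x # w)) = (%v. sc ?k \<otimes> bd (x # ?u) v)" unfolding R by simp
  moreover have "tl z (mon A \<one> (x # w)) = mon A (sc ?k) (x # ?u)"
  using tl_mon[of "\<one>" "x # w" "Suc i"] i k by simp
  ultimately show ?thesis using bD_mon[of "sc ?k" "x # ?u"] k x u by simp
 next
  case False
  have "bD (tl z (mon A \<one> (x # w))) = zf."
  proof (cases "length (x # w) = m")
  case True
  thus ?thesis using tl_mon[of "\<one>" "x # w" 0] zvals by(simp add:bD_mon)
  next
  case F: False
  thus ?thesis using tl_mon_short[of "\<one>" "x # w"] False bD_free(6) by simp
  qed
  moreover have "tl z ?G = zf." unfolding tG using tl_mon_short[of "\<one>" w] False bD_free(6) x by simp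
  ultimately show ?thesis unfolding R using tl_mon_short[OF e_closed[OF x], of w] False by(simp add:A.diff_self)
 qed
qed

lemma tl_chain: assumes f: "f : BC" shows "bD (tl z f) = tl z (bD f)"
proof (rule BT.linear_eqI[where F = "%f. bD (tl z f)" and G = "%f. tl z (bD f)", OF BT.lm
  linear_comp[OF bD_linear tl_linear] linear_comp[OF tl_linear bD_linear]])
 fix w assume w: "w : lists X"
 thus "bD (tl z (mon A \<one> w)) = tl z (bD (mon A \<one> w))"
  using tl_bd[OF w] BCv[OF bd_BC[OF w]] by(simp add:bD_mon)
qed (use f in "simp add:BT.carrier_eq")

end

text \<open>Here y reads the first n letters and z the last m, which is the concatenation product of
  y and z, in this order and without a sign.\<close>

lemma zt_tl:
 assumes y: "y : ffun K (words n)" and f: "f : car (bar (m + n))"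
 shows "zt y (tl z f) = zt (conv K y z) f"
proof -
 note yv = KC_vals[OF y]
 have cv: "kvals (conv K y z)" using yv zvals by simp
 have "(%f. zt y (tl z f)) : lmaps A (bar (m + n)) triv"
  by(rule linear_comp[OF zt_bar_linear[OF yv] gh_linear[OF tl_graded]])
 thus ?thesis
 proof (rule zt_eqI[OF _ zt_bar_linear[OF cv] _ f])
  fix w assume w: "w : words (m + n)"
  have k: "z (drop n w) : car K" using zvals by simp
  have t: "take n w : lists X" using w by(auto simp:words_def dest:in_set_takeD)
  have wl: "length w = m + n" "w : lists X" using w by(auto simp:words_def)
  have "conv K y z w = y (take n w) \<otimes>\<^sub>K z (drop n w)"
  by(rule K.conv_homog[OF yv zvals]) (use ffun_supp[OF y] wl in "auto simp:words_def")
  thus "zt y (tl z (mon A \<one> w)) = zt (conv K y z) (mon A \<one> w)"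
  using tl_mon[OF A.one_closed wl(1)] k t yv cv wl by(simp add:zt_mon K.m_comm)
 qed
qed

end

end

section \<open>The cobar model of the Ext algebra\<close>

context based_algebra
begin

definition part :: "nat => ('x list => 'k) => 'x list => 'k" where
 "part n z = (%w. if length w = n then z w else \<zero>\<^sub>K)"

definition ZC :: "('x list => 'k) set" where
 "ZC = {z : KC. cobd K cst z = zf.\<^sub>K}"

lemma ZC_KC: "z : ZC ==> z : KC" and ZC_cobd: "z : ZC ==> cobd K cst z = zf.\<^sub>K"
 and ZC_vals: "z : ZC ==> kvals z"
 using KC_vals by(auto simp:ZC_def)

lemma words_KC: "z : ffun K (words n) ==> z : KC"
 by(erule ffun_mono) (auto simp:words_def)

lemma part_fin: "z : KC ==> part n z : ffun K (words n)"
 by(rule ffunI[where S = "(supp.\<^sub>K z)"])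
  (auto simp:part_def ffun_closed ffun_finite words_def dest:ffun_supp split:if_splits)

lemma part_cobd: assumes "cobd K cst z = zf.\<^sub>K" shows "cobd K cst (part n z) = zf.\<^sub>K"
proof
 fix w
 show "cobd K cst (part n z) w = \<zero>\<^sub>K"
 proof (cases "length w = Suc n")
  case True
  hence "cobd K cst (part n z) w = cobd K cst z w"
  by(intro K.cobd_local[OF cst_sc]) (auto simp:part_def)
  thus ?thesis using assms by simp
 next
  case False
  hence "cobd K cst (part n z) w = cobd K cst zf.\<^sub>K w"
  by(intro K.cobd_local[OF cst_sc]) (auto simp:part_def)
  thus ?thesis using K.cobd_zero[OF cst_sc] by simp
 qed
qed

lemma zt_zero_left: "f : BC ==> zt zf.\<^sub>K f = \<zero>\<^sub>K"
 unfolding zt_def lin_ext_def using BCv by(simp add:K.finsum_zeroI)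

lemma zt_zeroI:
 assumes "kvals z" "!!w. w : words n ==> z w = \<zero>\<^sub>K" "f : car (bar n)"
 shows "zt z f = \<zero>\<^sub>K"
proof -
 have "zt z f = zt zf.\<^sub>K f" by(rule zt_cong[OF assms(1) _ _ assms(3)]) (use assms(2) in simp_all)
 thus ?thesis using zt_zero_left[OF bar_BC[OF assms(3)]] by simp
qed

lemma zt_part: "kvals z ==> f : car (bar n) ==> zt (part n z) f = zt z f"
 by(rule zt_cong[where n = n]) (auto simp:part_def words_def)

lemma zt_add_left:
 assumes "kvals y" "kvals z" "f : BC" shows "zt (%w. y w \<oplus>\<^sub>K z w) f = zt y f \<oplus>\<^sub>K zt z f"
 unfolding zt_def lin_ext_def using assms BCv[OF assms(3)]
 by(simp add:K.r_distr K.finsum_addf)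

lemma zt_smult_left:
 assumes "a : car K" "kvals z" "f : BC" shows "zt (%w. a \<otimes>\<^sub>K z w) f = a \<otimes>\<^sub>K zt z f"
 unfolding zt_def lin_ext_def using assms BCv[OF assms(3)] ffun_finite[OF assms(3)]
 by(simp add:K.m_lcomm) (subst K.finsum_rdistr, auto)

lemma zt_diff_left:
 assumes "kvals y" "kvals z" "f : BC" shows "zt (%w. y w \<ominus>\<^sub>K z w) f = zt y f \<ominus>\<^sub>K zt z f"
 using zt_add_left[of "%w. y w \<ominus>\<^sub>K z w" z f] assms
 by(simp add:K.minus_minus_add K.add_minus_cancel)

lemma zt_cocyc: assumes "z : ZC" shows "zt z : cocyc bar_res n"
 unfolding cocyc_def using zt_graded[OF ZC_KC[OF assms]] zt_bD[OF ZC_vals[OF assms] bar_BC]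
  zt_zero_left[OF bar_BC] by(simp add:ZC_cobd[OF assms])

lemma glue_fin:
 assumes zs: "!!n. zs n : ffun K (words n)" and fin: "finite {n. zs n ~= zf.\<^sub>K}"
 shows "(%w. zs (length w) w) : KC"
proof (rule ffunI)
 show "finite (\<Union>n\<in>{n. zs n ~= zf.\<^sub>K}. {w. zs n w ~= \<zero>\<^sub>K})"
  using fin ffun_finite[OF zs] by blast
 fix w assume w: "zs (length w) w ~= \<zero>\<^sub>K"
 hence "zs (length w) ~= zf.\<^sub>K" by auto
 thus "w : (\<Union>n\<in>{n. zs n ~= zf.\<^sub>K}. {w. zs n w ~= \<zero>\<^sub>K})" using w by blast
 show "w : lists X" using ffun_supp[OF zs w] by(simp add:words_def)
qed (rule ffun_closed[OF zs])

lemma bdry_cobd: assumes b: "b : KC" shows "bdry bar_res n (zt (cobd K cst b))"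
proof (cases n)
 case 0
 thus ?thesis
  using zt_zeroI[OF KC_vals[OF cobd_fin[OF b]], of 0] by(simp add:bdry_def words_def)
next
 case (Suc k)
 thus ?thesis
  using zt_graded[OF b] zt_bD[OF KC_vals[OF b] bar_BC] by(auto simp:bdry_def intro!: bexI[of _ "zt b"])
qed

lemma mon_bar: "w : words n ==> mon A \<one> w : car (bar n)"
 by(simp add:bar_carrier A.ffun_mon)

lemma zt_mon_one: "kvals z ==> w : words n ==> zt z (mon A \<one> w) = z w"
 by(simp add:zt_mon words_def)

text \<open>The bounding cochains found for the separate lengths are glued to one function. To keep
  its support finite, the zero function is taken wherever the corresponding component of z vanishes;
  \<open>part\<close> tests length n + 1 because the differential raises the length by one.\<close>

lemma bdry_bar:
 assumes z: "z : KC" and b: "!!n. bdry bar_res n (zt z)"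
 shows "EX b:KC. z = cobd K cst b"
proof -
 note zv = KC_vals[OF z]
 have "EX b. b : ffun K (words n) & (ALL w:words (Suc n). z w = cobd K cst b w) &
  (part (Suc n) z = zf.\<^sub>K --> b = zf.\<^sub>K)" for n
 proof (cases "part (Suc n) z = zf.\<^sub>K")
  case True
  have "z w = \<zero>\<^sub>K" if "w : words (Suc n)" for w
  using fun_cong[OF True, of w] that by(simp add:part_def words_def)
  thus ?thesis using K.ffun_zero K.cobd_zero[OF cst_sc] by(intro exI[of _ "%w. \<zero>\<^sub>K"]) simp
 next
  case False
  obtain y where y: "y : ghoms A (bar n) triv" "ALL f:car (bar (Suc n)). zt z f = y (bD f)"
  using b[of "Suc n"] by(auto simp:bdry_def)
  obtain b where b: "b : ffun K (words n)" "!!f. f : car (bar n) ==> y f = zt b f"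
  by(rule graded_zt[OF y(1)]) (rule that)
  note bK = words_KC[OF b(1)]
  have "z w = cobd K cst b w" if w: "w : words (Suc n)" for w
  proof -
  have "z w = y (bD (mon A \<one> w))" using y(2) mon_bar[OF w] zt_mon_one[OF zv w] by simp
  also have "... = zt b (bD (mon A \<one> w))"
  using b(2) bD_words mon_bar[OF w] by(simp add:bar_carrier)
  also have "... = cobd K cst b w"
  using zt_bD[OF KC_vals[OF bK] bar_BC[OF mon_bar[OF w]]] zt_mon_one[OF KC_vals[OF cobd_fin[OF bK]] w] by simp
  finally show ?thesis .
  qed
  thus ?thesis using b(1) False by blast
 qed
 hence "ALL n. EX b. b : ffun K (words n) & (ALL w:words (Suc n). z w = cobd K cst b w) &
  (part (Suc n) z = zf.\<^sub>K --> b = zf.\<^sub>K)" by(rule allI)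
 from choice[OF this] obtain bs where bs: "!!n. bs n : ffun K (words n)"
  "!!n w. w : words (Suc n) ==> z w = cobd K cst (bs n) w"
  "!!n. part (Suc n) z = zf.\<^sub>K ==> bs n = zf.\<^sub>K" by blast
 let ?b = "%w. bs (length w) w"
 have "{n. bs n ~= zf.\<^sub>K} \<subseteq> (%w. length w - 1) ` (supp.\<^sub>K z)"
 proof
  fix n assume "n : {n. bs n ~= zf.\<^sub>K}"
  hence "part (Suc n) z ~= zf.\<^sub>K" using bs(3) by blast
  then obtain w where "part (Suc n) z w ~= \<zero>\<^sub>K" by auto
  thus "n : (%w. length w - 1) ` (supp.\<^sub>K z)"
  by(intro image_eqI[of _ _ w]) (auto simp:part_def split:if_splits)
 qed
 hence "finite {n. bs n ~= zf.\<^sub>K}" using ffun_finite[OF z] finite_surj by blast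
 hence bK: "?b : KC" using glue_fin[of bs] bs(1) by blast
 have "z w = cobd K cst ?b w" for w
 proof (cases "w : lists X")
  case False
  thus ?thesis using ffun_supp[OF z, of w] ffun_supp[OF cobd_fin[OF bK], of w] by metis
 next
  case True
  show ?thesis
  proof (cases "length w")
  case 0
  have "z [] = zt z (mon A \<one> [])" using zt_mon_one[OF zv, of "[]" 0] by(simp add:words_def)
  also have "... = \<zero>\<^sub>K" using b[of 0] mon_bar[of "[]" 0] by(simp add:bdry_def words_def)
  finally show ?thesis using 0 by simp
  next
  case (Suc n)
  hence "z w = cobd K cst (bs n) w" using bs(2) True by(simp add:words_def)
  also have "... = cobd K cst ?b w" by(rule K.cobd_local[OF cst_sc]) (use Suc in auto)
  finally show ?thesis .
  qed
 qed
 thus ?thesis using bK by blast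
qed

lemma gh_id: "(%f. f) : ghoms A (bar n) (bar n)"
proof -
 have "(%f. f) : dhoms A (bar n) (bar n) 0" by(rule hdI[OF linear_id]) simp
 thus ?thesis by(rule hd_graded[OF bar_mods bar_mods])
qed

section \<open>Comparison of the bar resolution with an arbitrary free resolution\<close>

context
 fixes P :: "('a, 'p, 'k) resolution" and et th
 assumes P: "graded_free_resolution K A P"
  and et: "!!i. et i : ghoms A P$i (bar i)"
  and et_aug: "!!p. p : car P$0 ==> aug A (et 0 p []) = res_aug P p"
  and et_d: "!!i p. p : car P$(Suc i) ==> bD (et (Suc i) p) = et i (res_diff P i p)"
  and th: "!!i. th i : ghoms A (bar i) P$i"
  and th_aug: "!!f. f : car (bar 0) ==> res_aug P (th 0 f) = aug A (f [])"
  and th_d: "!!i f. f : car (bar (Suc i)) ==> res_diff P i (th (Suc i) f) = th i (bD f)"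
begin

lemmas et_closed = gh_closed[OF et]
lemmas th_closed = gh_closed[OF th]
lemmas et_BC = bar_BC[OF et_closed]

lemma pull_et: assumes "bdry bar_res n F" shows "bdry P n (%p. F (et n p))"
proof -
 have "bdry P (0 + n) (%p. F (et n p))"
  by(rule bdry_pull[OF P bar_resolution assms]) (use et et_d in simp_all)
 thus ?thesis by simp
qed

lemma pull_th: assumes "bdry P n F" shows "bdry bar_res n (%f. F (th n f))"
proof -
 have "bdry bar_res (0 + n) (%f. F (th n f))"
  by(rule bdry_pull[OF bar_resolution P assms]) (use th th_d in simp_all)
 thus ?thesis by simp
qed

text \<open>The composite of \<open>th\<close> and \<open>et\<close> and the identity are two
  liftings of the same augmentation.\<close>

lemma bar_comparison: assumes z: "z : ZC" shows "bdry bar_res n (%f. zt z f \<ominus>\<^sub>K zt z (et n (th n f)))"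
proof -
 have "bdry bar_res (0 + n) (%f. zt z f \<ominus>\<^sub>K zt z (et n (th n f)))"
 proof (rule lifts_homotopic[OF bar_resolution bar_resolution zt_cocyc[OF z], where t = "%i f. f" and t' = "%i f. et i (th i f)"])
  show "(%f. et i (th i f)) : ghoms A bar_res$(0 + i) bar_res$i" for i
  using gh_comp[OF bar_mods res_mods[OF P] bar_mods et th] by simp
  show "bdry bar_res 0 (%f. res_aug bar_res f \<ominus>\<^sub>K res_aug bar_res (et 0 (th 0 f)))"
  using et_aug[OF th_closed] th_aug by(simp add:bdry_def K.diff_self bar_carrier ffun_closed)
  show "res_diff bar_res i (et (Suc i) (th (Suc i) f)) = et i (th i (res_diff bar_res (0 + i) f))"
  if "f : car (res_mod bar_res (Suc (0 + i)))" for i f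
  using that et_d[OF th_closed] th_d by simp
 qed (use gh_id in simp_all)
 thus ?thesis by simp
qed

lemma res_comparison:
 assumes F: "F : cocyc P n" shows "bdry P n (%p. F (th n (et n p)) \<ominus>\<^sub>K F p)"
proof -
 have "bdry P (0 + n) (%p. F (th n (et n p)) \<ominus>\<^sub>K F p)"
 proof (rule lifts_homotopic[OF P P F, where t' = "%i p. p" and t = "%i p. th i (et i p)"])
  show "(%p. th i (et i p)) : ghoms A P$(0 + i) P$i" for i
  using gh_comp[OF res_mods[OF P] bar_mods res_mods[OF P] th et] by simp
  have "(%p. p) : dhoms A P$i P$i 0" for i
  by(rule hdI[OF linear_id]) simp
  from hd_graded[OF res_mods[OF P] res_mods[OF P] this]
  show "(%p. p) : ghoms A P$(0 + i) P$i" for i by simp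
  show "bdry P 0 (%p. res_aug P (th 0 (et 0 p)) \<ominus>\<^sub>K res_aug P p)"
  using th_aug[OF et_closed] et_aug res_aug_closed[OF P] by(simp add:bdry_def K.diff_self)
  show "res_diff P i (th (Suc i) (et (Suc i) p)) = th i (et i (res_diff P (0 + i) p))"
  if "p : car (res_mod P (Suc (0 + i)))" for i p
  using that th_d[OF et_closed] et_d by simp
 qed simp_all
 thus ?thesis by simp
qed

text \<open>A finitely supported cocycle contains components of all lengths; the class in degree n
  sees the component of length n, pulled back along \<open>et\<close>.\<close>

definition kap :: "('x list => 'k) => nat => ('p => 'k) set" where
 "kap z = (%n. Ext_class K A P n (%p. zt z (et n p)))"

lemma et_cocyc: assumes "F : cocyc bar_res n" shows "(%p. F (et n p)) : cocyc P n"
proof -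
 have "(%p. F (et n p)) : cocyc P (0 + n)"
  by(rule lift_cocyc[OF P bar_resolution assms]) (use et et_d in simp_all)
 thus ?thesis by simp
qed

lemma th_cocyc: assumes "F : cocyc P n" shows "(%f. F (th n f)) : cocyc bar_res n"
proof -
 have "(%f. F (th n f)) : cocyc bar_res (0 + n)"
  by(rule lift_cocyc[OF bar_resolution P assms]) (use th th_d in simp_all)
 thus ?thesis by simp
qed

lemmas kap_cocyc = et_cocyc[OF zt_cocyc]

lemma ZC_diff: "f : ZC ==> g : ZC ==> (%w. f w \<ominus>\<^sub>K g w) : ZC"
 using ZC_vals by(simp add:ZC_def K.ffun_diff K.cobd_diff[OF cst_sc] K.diff_self)

text \<open>Coboundaries can be transported along \<open>et\<close> and along \<open>th\<close>. To
  return from P to the bar resolution, the comparison homotopy replaces the composite of both maps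
  by the identity.\<close>

lemma kap_eq:
 assumes f: "f : ZC" and g: "g : ZC"
 shows "kap f = kap g \<longleftrightarrow> (EX b:KC. (%w. f w \<ominus>\<^sub>K g w) = cobd K cst b)"
proof -
 let ?h = "%w. f w \<ominus>\<^sub>K g w"
 note h = ZC_diff[OF f g]
 have "kap f = kap g \<longleftrightarrow> (ALL n. bdry P n (%p. zt f (et n p) \<ominus>\<^sub>K zt g (et n p)))"
  using cls_eq_iff[OF P kap_cocyc[OF f] kap_cocyc[OF g]] by(simp add:kap_def fun_eq_iff)
 also have "... \<longleftrightarrow> (ALL n. bdry P n (%p. zt ?h (et n p)))"
 proof -
  have "bdry P n (%p. zt f (et n p) \<ominus>\<^sub>K zt g (et n p)) = bdry P n (%p. zt ?h (et n p))" for n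
  by(rule bdry_cong[OF P]) (rule zt_diff_left[OF ZC_vals[OF f] ZC_vals[OF g] et_BC, symmetric])
  thus ?thesis by simp
 qed
 also have "... \<longleftrightarrow> (EX b:KC. ?h = cobd K cst b)"
 proof
  assume b: "ALL n. bdry P n (%p. zt ?h (et n p))"
  show "EX b:KC. ?h = cobd K cst b"
  proof (rule bdry_bar[OF ZC_KC[OF h]])
  fix n
  have "bdry bar_res n (%f. (zt ?h f \<ominus>\<^sub>K zt ?h (et n (th n f))) \<oplus>\<^sub>K zt ?h (et n (th n f)))"
  by(rule bdry_add[OF bar_resolution bar_comparison[OF h]]) (rule pull_th[OF b[rule_format]])
  thus "bdry bar_res n (zt ?h)"
  using bdry_cong[OF bar_resolution, of n "%f. (zt ?h f \<ominus>\<^sub>K zt ?h (et n (th n f))) \<oplus>\<^sub>K zt ?h (et n (th n f))" "zt ?h"]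
  zt_closed[OF ZC_vals[OF h] bar_BC] zt_closed[OF ZC_vals[OF h] et_BC[OF th_closed]]
  by(simp add:K.minus_minus_add)
  qed
 next
  assume "EX b:KC. ?h = cobd K cst b"
  then obtain b where b: "b : KC" "?h = cobd K cst b" by blast
  show "ALL n. bdry P n (%p. zt ?h (et n p))" unfolding b(2) using pull_et[OF bdry_cobd[OF b(1)]] by simp
 qed
 finally show ?thesis .
qed

abbreviation "EE \<equiv> Ext_space K A P"

lemma EA_simps:
 "car (Ext_algebra K A P) = {x. (ALL n. x n : car (EE n)) & finite {n. x n ~= \<zero>\<^bsub>EE n\<^esub>}}"
 "mult (Ext_algebra K A P) = (%x y n. \<Oplus>\<^bsub>EE n\<^esub> i\<in>{..n}. yoneda K A P i (n - i) (x i) (y (n - i)))"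
 "one (Ext_algebra K A P) = (%n. if n = 0 then Ext_class K A P 0 (res_aug P) else \<zero>\<^bsub>EE n\<^esub>)"
 "add (Ext_algebra K A P) = (%x y n. x n \<oplus>\<^bsub>EE n\<^esub> y n)"
 "smult (Ext_algebra K A P) = (%c x n. c \<odot>\<^bsub>EE n\<^esub> x n)"
 "aug (Ext_algebra K A P) = (%x. THE c. c : car K & x 0 = c \<odot>\<^bsub>EE 0\<^esub> Ext_class K A P 0 (res_aug P))"
 by(simp_all add:Ext_algebra_def Let_def)

lemma kap_zeroI:
 assumes "kvals z" "!!w. w : words n ==> z w = \<zero>\<^sub>K" shows "kap z n = \<zero>\<^bsub>EE n\<^esub>"
proof -
 have "kap z n = Ext_class K A P n zf.\<^sub>K"
  unfolding kap_def by(rule cls_cong[OF P]) (rule zt_zeroI[OF assms et_closed])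
 thus ?thesis using cls_zero[OF P] by simp
qed

lemma kap_closed: assumes z: "z : ZC" shows "kap z : car (Ext_algebra K A P)"
proof -
 have "{n. kap z n ~= \<zero>\<^bsub>EE n\<^esub>} \<subseteq> length ` (supp.\<^sub>K z)"
 proof
  fix n assume n: "n : {n. kap z n ~= \<zero>\<^bsub>EE n\<^esub>}"
  then obtain w where "w : words n" "z w ~= \<zero>\<^sub>K" using kap_zeroI[OF ZC_vals[OF z], of n] by blast
  thus "n : length ` (supp.\<^sub>K z)" by(auto simp:words_def)
 qed
 hence "finite {n. kap z n ~= \<zero>\<^bsub>EE n\<^esub>}" using ffun_finite[OF ZC_KC[OF z]] finite_surj by blast
 thus ?thesis using cls_closed[OF P kap_cocyc[OF z]] by(simp add:EA_simps kap_def)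
qed

text \<open>A representative is pulled back along \<open>th\<close> and read off on basis words.
  Zero components of Y are represented by the zero function, so the glued cocycle has finite
  support.\<close>

lemma kap_surj: assumes Y: "Y : car (Ext_algebra K A P)" shows "EX z:ZC. kap z = Y"
proof -
 have Yn: "Y n : car (EE n)" for n using Y by(simp add:EA_simps)
 have "EX z. z : ffun K (words n) & cobd K cst z = zf.\<^sub>K &
  kap z n = Y n & (Y n = \<zero>\<^bsub>EE n\<^esub> --> z = zf.\<^sub>K)" for n
 proof (cases "Y n = \<zero>\<^bsub>EE n\<^esub>")
  case True
  thus ?thesis using K.ffun_zero K.cobd_zero[OF cst_sc] kap_zeroI[of "%w. \<zero>\<^sub>K" n]
  by(intro exI[of _ "%w. \<zero>\<^sub>K"]) simp
 next
  case False
  obtain f where f: "f : cocyc P n" "Y n = Ext_class K A P n f" by(rule cls_surj[OF P Yn])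
  have fc: "(%g. f (th n g)) : cocyc bar_res n" by(rule th_cocyc[OF f(1)])
  hence "(%g. f (th n g)) : ghoms A (bar n) triv" by(simp add:cocyc_def)
  then obtain z where z: "z : ffun K (words n)" "!!g. g : car (bar n) ==> f (th n g) = zt z g"
  by(rule graded_zt) (rule that)
  note zK = words_KC[OF z(1)]
  \<comment> \<open>Only words of length n + 1 require the cocycle property of f: at other words the
    differential reads zeros of z or w leaves the alphabet.\<close>
  have zc: "cobd K cst z w = \<zero>\<^sub>K" for w
  proof (cases "w : words (Suc n)")
  case True
  have "cobd K cst z w = zt z (bD (mon A \<one> w))"
  using zt_bD[OF KC_vals[OF zK] bar_BC[OF mon_bar[OF True]]] zt_mon_one[OF KC_vals[OF cobd_fin[OF zK]] True] by simp
  also have "... = f (th n (bD (mon A \<one> w)))"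
  using z(2) bD_words mon_bar[OF True] by(simp add:bar_carrier)
  also have "... = \<zero>\<^sub>K" using fc mon_bar[OF True] by(simp add:cocyc_def)
  finally show ?thesis .
  next
  case False
  show ?thesis
  proof (cases "w : lists X")
  case True
  have zu: "z u = \<zero>\<^sub>K" if "Suc (length u) = length w" for u
  using False True that ffun_supp[OF z(1), of u] by(auto simp:words_def)
  have "cobd K cst z w = cobd K cst zf.\<^sub>K w"
  by(rule K.cobd_local[OF cst_sc]) (rule zu)
  thus ?thesis using K.cobd_zero[OF cst_sc] by simp
  next
  case False
  thus ?thesis using ffun_supp[OF cobd_fin[OF zK], of w] by metis
  qed
  qed
  hence zZ: "z : ZC" using zK by(auto simp:ZC_def)
  have "bdry P n (%p. zt z (et n p) \<ominus>\<^sub>K f p)"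
  using res_comparison[OF f(1)]
  bdry_cong[OF P, of n "%p. zt z (et n p) \<ominus>\<^sub>K f p" "%p. f (th n (et n p)) \<ominus>\<^sub>K f p"] z(2)[OF et_closed] by simp
  hence "kap z n = Y n"
  unfolding kap_def f(2) using cls_eq_iff[OF P kap_cocyc[OF zZ] f(1)] by simp
  thus ?thesis using z(1) zZ False by(auto simp:ZC_def)
 qed
 hence "ALL n. EX z. z : ffun K (words n) & cobd K cst z = zf.\<^sub>K &
  kap z n = Y n & (Y n = \<zero>\<^bsub>EE n\<^esub> --> z = zf.\<^sub>K)" by(rule allI)
 from choice[OF this] obtain zs where zs: "!!n. zs n : ffun K (words n)" "!!n. cobd K cst (zs n) = zf.\<^sub>K"
  "!!n. kap (zs n) n = Y n" "!!n. Y n = \<zero>\<^bsub>EE n\<^esub> ==> zs n = zf.\<^sub>K" by blast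
 let ?z = "%w. zs (length w) w"
 have "{n. zs n ~= zf.\<^sub>K} \<subseteq> {n. Y n ~= \<zero>\<^bsub>EE n\<^esub>}" using zs(4) by blast
 moreover have "finite {n. Y n ~= \<zero>\<^bsub>EE n\<^esub>}" using Y by(simp add:EA_simps)
 ultimately have "finite {n. zs n ~= zf.\<^sub>K}" by(rule finite_subset)
 hence zK: "?z : KC" using glue_fin[of zs] zs(1) by blast
 have "cobd K cst ?z w = \<zero>\<^sub>K" for w
 proof (cases "length w")
  case (Suc n)
  hence "cobd K cst ?z w = cobd K cst (zs n) w" by(intro K.cobd_local[OF cst_sc]) auto
  thus ?thesis using zs(2) by simp
 qed simp
 hence zZ: "?z : ZC" using zK by(auto simp:ZC_def)
 have "kap ?z n = Y n" for n
 proof -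
  have "kap ?z n = kap (zs n) n" unfolding kap_def
  by(rule cls_cong[OF P], rule zt_cong[OF KC_vals[OF zK] KC_vals[OF zs(1)] _ et_closed]) (auto simp:words_def)
  thus ?thesis using zs(3) by simp
 qed
 thus ?thesis using zZ by blast
qed

lemma kap_add: assumes "f : ZC" "g : ZC" shows "kap (%w. f w \<oplus>\<^sub>K g w) = kap f \<oplus>\<^bsub>Ext_algebra K A P\<^esub> kap g"
proof
 fix n
 have "kap f n \<oplus>\<^bsub>EE n\<^esub> kap g n = Ext_class K A P n (%p. zt f (et n p) \<oplus>\<^sub>K zt g (et n p))"
  unfolding kap_def by(rule cls_add[OF P kap_cocyc[OF assms(1)] kap_cocyc[OF assms(2)]])
 also have "... = kap (%w. f w \<oplus>\<^sub>K g w) n" unfolding kap_def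
  by(rule cls_cong[OF P]) (rule zt_add_left[OF ZC_vals[OF assms(1)] ZC_vals[OF assms(2)] et_BC, symmetric])
 finally show "kap (%w. f w \<oplus>\<^sub>K g w) n = (kap f \<oplus>\<^bsub>Ext_algebra K A P\<^esub> kap g) n" by(simp add:EA_simps)
qed

lemma kap_smult:
 assumes "a : car K" "f : ZC" shows "kap (%w. a \<otimes>\<^sub>K f w) = a \<odot>\<^bsub>Ext_algebra K A P\<^esub> kap f"
proof
 fix n
 have "a \<odot>\<^bsub>EE n\<^esub> kap f n = Ext_class K A P n (%p. a \<otimes>\<^sub>K zt f (et n p))"
  unfolding kap_def by(rule cls_smult[OF P kap_cocyc[OF assms(2)] assms(1)])
 also have "... = kap (%w. a \<otimes>\<^sub>K f w) n" unfolding kap_def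
  by(rule cls_cong[OF P]) (rule zt_smult_left[OF assms(1) ZC_vals[OF assms(2)] et_BC, symmetric])
 finally show "kap (%w. a \<otimes>\<^sub>K f w) n = (a \<odot>\<^bsub>Ext_algebra K A P\<^esub> kap f) n" by(simp add:EA_simps)
qed

lemma ZC_conv: "f : ZC ==> g : ZC ==> conv K f g : ZC"
proof -
 assume f: "f : ZC" and g: "g : ZC"
 have "cobd K cst (conv K f g) = zf.\<^sub>K"
  using K.cobd_leibniz[OF cst_sc ZC_vals[OF f] ZC_vals[OF g]] ZC_vals[OF f] ZC_vals[OF g]
  by(simp add:ZC_cobd[OF f] ZC_cobd[OF g])
 thus ?thesis using K.conv_fin[OF ZC_KC[OF f] ZC_KC[OF g]] by(simp add:ZC_def)
qed

lemma ZC_part: "f : ZC ==> part n f : ZC"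
 using words_KC[OF part_fin] part_cobd by(simp add:ZC_def)

text \<open>The maps \<open>et\<close> after t and \<open>tl z\<close> after \<open>et\<close> are
  chain maps from P to the bar resolution with the same augmentation, the pullback of z. They are
  homotopic, so y takes cohomologous values on them, and on the second it gives the concatenation
  product by \<open>zt_tl\<close>.\<close>

lemma yoneda_kap:
 assumes y: "y : ZC" "y : ffun K (words n)" and z: "z : ZC" "z : ffun K (words m)"
 shows "yoneda K A P n m (kap y n) (kap z m) = kap (conv K y z) (m + n)"
proof -
 have zg: "(%p. zt z (et m p)) : ghoms A P$m triv"
  "!!x. x : car P$(Suc m) ==> zt z (et m (res_diff P m x)) = \<zero>\<^sub>K"
  using kap_cocyc[OF z(1), of m] by(auto simp:cocyc_def)
 obtain t where t: "!!i. t i : ghoms A P$(m + i) P$i"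
  "!!x. x : car P$m ==> res_aug P (t 0 x) = zt z (et m x)"
  "!!i x. x : car (res_mod P (Suc (m + i))) ==> res_diff P i (t (Suc i) x) = t i (res_diff P (m + i) x)"
  by(rule lift_exists[OF P P zg]) (assumption | rule that)+
 note tc = gh_closed[OF t(1)]
 have ett: "(%p. et i (t i p)) : ghoms A P$(m + i) (bar i)" for i
  by(rule gh_comp[OF res_mods[OF P] res_mods[OF P] bar_mods et t(1)])
 have ett_d: "bD (et (Suc i) (t (Suc i) x)) = et i (t i (res_diff P (m + i) x))"
  if "x : car (res_mod P (Suc (m + i)))" for i x
  using et_d[OF tc[of x "Suc i"]] t(3)[OF that] that by simp
 have 1: "yoneda K A P n m (kap y n) (kap z m) = Ext_class K A P (m + n) (%p. zt y (et n (t n p)))"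
  unfolding kap_def by(rule yoneda_cls[OF P kap_cocyc[OF y(1)] kap_cocyc[OF z(1)] t])
 have "bdry P (m + n) (%p. zt y (et n (t n p)) \<ominus>\<^sub>K zt y (tl z (et (m + n) p)))"
 proof (rule lifts_homotopic[OF P bar_resolution zt_cocyc[OF y(1)], where t = "%i p. et i (t i p)" and t' = "%i p. tl z (et (m + i) p)"])
  show "(%p. tl z (et (m + i) p)) : ghoms A P$(m + i) bar_res$i" for i
  using gh_comp[OF res_mods[OF P] bar_mods bar_mods tl_graded[OF z(2)] et] by simp
  show "res_diff bar_res i (tl z (et (m + Suc i) x)) = tl z (et (m + i) (res_diff P (m + i) x))"
  if "x : car (res_mod P (Suc (m + i)))" for i x
  using tl_chain[OF z(2) ZC_cobd[OF z(1)] et_BC[OF that]] et_d[OF that] by simp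
  have "res_aug bar_res (et 0 (t 0 x)) \<ominus>\<^sub>K res_aug bar_res (tl z (et (m + 0) x)) = \<zero>\<^sub>K"
  if "x : car P$m" for x
  using et_aug[OF tc[of x 0]] t(2)[OF that] aug_tl[OF z(2) et_BC[OF that]] that
  zt_closed[OF ZC_vals[OF z(1)] et_BC[OF that]] by(simp add:K.diff_self)
  thus "bdry P m (%x. res_aug bar_res (et 0 (t 0 x)) \<ominus>\<^sub>K res_aug bar_res (tl z (et (m + 0) x)))"
  using bdry_zero[OF P, of m] bdry_cong[OF P, of m _ "%x. \<zero>\<^sub>K"] by(metis (no_types, lifting))
 qed (use ett ett_d in simp_all)
 hence "bdry P (m + n) (%p. zt y (et n (t n p)) \<ominus>\<^sub>K zt (conv K y z) (et (m + n) p))"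
  using bdry_cong[OF P, of "m + n" "%p. zt y (et n (t n p)) \<ominus>\<^sub>K zt y (tl z (et (m + n) p))"
  "%p. zt y (et n (t n p)) \<ominus>\<^sub>K zt (conv K y z) (et (m + n) p)"] zt_tl[OF z(2) y(2) et_closed] by simp
 moreover have "(%p. zt y (et n (t n p))) : cocyc P (m + n)"
  by(rule lift_cocyc[OF P bar_resolution zt_cocyc[OF y(1)], where u = "%i p. et i (t i p)"])
  (use ett[of n] ett[of "Suc n"] ett_d in simp_all)
 ultimately show ?thesis unfolding 1 unfolding kap_def
  using cls_eq_iff[OF P _ kap_cocyc[OF ZC_conv[OF y(1) z(1)]]] by simp
qed

lemma cls_finsum:
 assumes "finite I" "!!i. i : I ==> F i : cocyc P n"
 shows "(\<Oplus>\<^bsub>EE n\<^esub> i\<in>I. Ext_class K A P n (F i)) = Ext_class K A P n (%p. \<Oplus>\<^sub>K i\<in>I. F i p)"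
proof -
 interpret ES: abelian_group "EE n" by(rule ES_group[OF P])
 have "(\<Oplus>\<^bsub>EE n\<^esub> i\<in>I. Ext_class K A P n (F i)) = Ext_class K A P n (%p. \<Oplus>\<^sub>K i\<in>I. F i p) &
  (%p. \<Oplus>\<^sub>K i\<in>I. F i p) : cocyc P n"
  using assms
 proof (induct I)
  case empty
  thus ?case using cls_zero[OF P] cocyc_zero[OF P] by simp
 next
  case (insert i I)
  let ?S = "%p. \<Oplus>\<^sub>K i\<in>I. F i p"
  have IH: "(\<Oplus>\<^bsub>EE n\<^esub> i\<in>I. Ext_class K A P n (F i)) = Ext_class K A P n ?S" "?S : cocyc P n"
  using insert by auto
  have Fi: "F i : cocyc P n" using insert by simp
  have eq: "(\<Oplus>\<^sub>K j\<in>insert i I. F j p) = F i p \<oplus>\<^sub>K ?S p" if "p : car P$n" for p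
  using insert.hyps(1,2) cocyc_closed[OF P insert.prems that] by(intro K.finsum_insert) auto
  have "(\<Oplus>\<^bsub>EE n\<^esub> j\<in>insert i I. Ext_class K A P n (F j)) = Ext_class K A P n (F i) \<oplus>\<^bsub>EE n\<^esub> Ext_class K A P n ?S"
  unfolding IH(1)[symmetric] using insert.hyps(1,2) cls_closed[OF P insert.prems] by(intro ES.finsum_insert) auto
  also have "... = Ext_class K A P n (%p. F i p \<oplus>\<^sub>K ?S p)" by(rule cls_add[OF P Fi IH(2)])
  also have "... = Ext_class K A P n (%p. \<Oplus>\<^sub>K j\<in>insert i I. F j p)"
  by(rule cls_cong[OF P]) (rule eq[symmetric])
  finally show ?case using cocyc_cong[OF P cocyc_add[OF P Fi IH(2)] eq] by simp
 qed
 thus ?thesis by blast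
qed

lemma zt_conv:
 assumes f: "kvals f" and g: "kvals g" and x: "x : car (bar n)"
 shows "zt (conv K f g) x = (\<Oplus>\<^sub>K i\<in>{..n}. zt (conv K (part i f) (part (n - i) g)) x)"
proof -
 have pv: "kvals (part i f)" "kvals (part i g)" for i using f g by(auto simp:part_def)
 have cv: "kvals (conv K (part i f) (part j g))" "kvals (conv K f g)" for i j using pv f g by auto
 have l: "(%x. \<Oplus>\<^sub>triv i\<in>{..n}. zt (conv K (part i f) (part (n - i) g)) x) : lmaps A (bar n) triv"
  by(rule linear_finsumf[OF bar_left triv_left_module]) (rule zt_bar_linear[OF cv(1)])
 have "zt (conv K f g) x = (\<Oplus>\<^sub>triv i\<in>{..n}. zt (conv K (part i f) (part (n - i) g)) x)"
 proof (rule zt_eqI[OF zt_bar_linear[OF cv(2)] l _ x])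
  fix w assume w: "w : words n"
  hence len: "length w = n" by(simp add:words_def)
  have "conv K (part i f) (part (n - i) g) w = f (take i w) \<otimes>\<^sub>K g (drop i w)" if "i \<le> n" for i
  proof -
  have "conv K (part i f) (part (n - i) g) w = part i f (take i w) \<otimes>\<^sub>K part (n - i) g (drop i w)"
  by(rule K.conv_homog[OF pv(1) pv(2)]) (use that len in "auto simp:part_def split:if_splits")
  thus ?thesis using that len by(simp add:part_def)
  qed
  hence "conv K f g w = (\<Oplus>\<^sub>K i\<in>{..n}. conv K (part i f) (part (n - i) g) w)"
  unfolding K.conv_sum[OF f g] len using f g cv by(intro K.finsum_cong') auto
  thus "zt (conv K f g) (mon A \<one> w) = (\<Oplus>\<^sub>triv i\<in>{..n}. zt (conv K (part i f) (part (n - i) g)) (mon A \<one> w))"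
  using zt_mon_one[OF cv(1) w] zt_mon_one[OF cv(2) w] by simp
 qed
 thus ?thesis by simp
qed

lemma kap_part: "z : ZC ==> kap (part n z) n = kap z n"
 unfolding kap_def by(rule cls_cong[OF P]) (rule zt_part[OF ZC_vals et_closed])

lemma kap_mult:
 assumes f: "f : ZC" and g: "g : ZC"
 shows "kap (conv K f g) = kap f \<otimes>\<^bsub>Ext_algebra K A P\<^esub> kap g"
proof
 fix n
 interpret ES: abelian_group "EE n" by(rule ES_group[OF P])
 let ?c = "%i. conv K (part i f) (part (n - i) g)"
 have c: "?c i : ZC" for i by(rule ZC_conv[OF ZC_part[OF f] ZC_part[OF g]])
 have "yoneda K A P i (n - i) (kap f i) (kap g (n - i)) = Ext_class K A P n (%p. zt (?c i) (et n p))"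
  if "i \<le> n" for i
  using yoneda_kap[OF ZC_part[OF f] part_fin[OF ZC_KC[OF f]] ZC_part[OF g] part_fin[OF ZC_KC[OF g]], of i "n - i"] that
  by(simp add:kap_part[OF f] kap_part[OF g]) (simp add:kap_def)
 hence "(kap f \<otimes>\<^bsub>Ext_algebra K A P\<^esub> kap g) n = (\<Oplus>\<^bsub>EE n\<^esub> i\<in>{..n}. Ext_class K A P n (%p. zt (?c i) (et n p)))"
  unfolding EA_simps using cls_closed[OF P kap_cocyc[OF c]] by(intro ES.finsum_cong') auto
 also have "... = Ext_class K A P n (%p. \<Oplus>\<^sub>K i\<in>{..n}. zt (?c i) (et n p))"
  by(rule cls_finsum) (auto intro:kap_cocyc[OF c])
 also have "... = kap (conv K f g) n" unfolding kap_def
  by(rule cls_cong[OF P]) (rule zt_conv[OF ZC_vals[OF f] ZC_vals[OF g] et_closed, symmetric])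
 finally show "kap (conv K f g) n = (kap f \<otimes>\<^bsub>Ext_algebra K A P\<^esub> kap g) n" by simp
qed

lemma zt_bar_zero:
 assumes z: "kvals z" and f: "f : car (bar 0)" shows "zt z f = aug A (f []) \<otimes>\<^sub>K z []"
proof -
 have "zt z f = (\<Oplus>\<^sub>K w\<in>{[]}. aug A (f w) \<otimes>\<^sub>K z w)"
 proof (rule zt_alt[OF z bar_BC[OF f]])
  show "w : {[]}" if "f w ~= \<zero>" for w
  using ffun_supp[of f A "words 0" w] f that by(simp add:bar_carrier words_def)
 qed simp
 thus ?thesis using z f by(simp add:bar_carrier ffun_closed)
qed

lemma aug_cocyc: "res_aug P : cocyc P 0"
 using aug_gh[OF P] aug_diff[OF P] by(simp add:cocyc_def)

lemma kap_Nil: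
 assumes z: "z : ZC" shows "kap z 0 = z [] \<odot>\<^bsub>EE 0\<^esub> Ext_class K A P 0 (res_aug P)"
proof -
 have "z [] \<odot>\<^bsub>EE 0\<^esub> Ext_class K A P 0 (res_aug P) = Ext_class K A P 0 (%p. z [] \<otimes>\<^sub>K res_aug P p)"
  using cls_smult[OF P aug_cocyc] ZC_vals[OF z] by blast
 also have "... = kap z 0" unfolding kap_def
  using zt_bar_zero[OF ZC_vals[OF z] et_closed] et_aug ZC_vals[OF z] res_aug_closed[OF P]
  by(intro cls_cong[OF P]) (simp add:K.m_comm)
 finally show ?thesis by simp
qed

lemma kap_one: "kap (mon K \<one>\<^sub>K []) = \<one>\<^bsub>Ext_algebra K A P\<^esub>"
proof
 fix n
 let ?u = "mon K \<one>\<^sub>K [] :: 'x list => 'k"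
 have v: "kvals ?u" by(simp add:mon_def)
 show "kap ?u n = \<one>\<^bsub>Ext_algebra K A P\<^esub> n"
 proof (cases n)
  case 0
  have "kap ?u 0 = Ext_class K A P 0 (res_aug P)" unfolding kap_def
  using zt_bar_zero[OF v et_closed] et_aug res_aug_closed[OF P]
  by(intro cls_cong[OF P]) (simp add:mon_def)
  thus ?thesis using 0 by(simp add:EA_simps)
 next
  case (Suc m)
  hence "?u w = \<zero>\<^sub>K" if "w : words n" for w using that by(auto simp:mon_def words_def)
  thus ?thesis using kap_zeroI[OF v, of n] Suc by(simp add:EA_simps)
 qed
qed

text \<open>The definite description in \<open>Ext_algebra\<close> needs the coefficient of the unit
  class to be unique. In degree zero the only coboundary is zero, and the augmentation of P takes
  the value one.\<close>

lemma kap_aug: assumes z: "z : ZC" shows "aug (Ext_algebra K A P) (kap z) = z []"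
proof -
 let ?u = "Ext_class K A P 0 (res_aug P)"
 show ?thesis unfolding EA_simps
 proof (rule the_equality)
  show "z [] : car K & kap z 0 = z [] \<odot>\<^bsub>EE 0\<^esub> ?u" using kap_Nil[OF z] ZC_vals[OF z] by simp
  fix c assume c: "c : car K & kap z 0 = c \<odot>\<^bsub>EE 0\<^esub> ?u"
  have zc: "z [] : car K" using ZC_vals[OF z] by simp
  have "Ext_class K A P 0 (%p. c \<otimes>\<^sub>K res_aug P p) = Ext_class K A P 0 (%p. z [] \<otimes>\<^sub>K res_aug P p)"
  using c kap_Nil[OF z] cls_smult[OF P aug_cocyc] zc by simp
  hence b: "bdry P 0 (%p. c \<otimes>\<^sub>K res_aug P p \<ominus>\<^sub>K z [] \<otimes>\<^sub>K res_aug P p)"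
  using cls_eq_iff[OF P cocyc_smult[OF P aug_cocyc] cocyc_smult[OF P aug_cocyc]] c zc by simp
  obtain p where p: "p : car P$0" "res_aug P p = \<one>\<^sub>K"
  using res_aug_surj[OF P] K.one_closed by(metis imageE)
  have "c \<otimes>\<^sub>K \<one>\<^sub>K \<ominus>\<^sub>K z [] \<otimes>\<^sub>K \<one>\<^sub>K = \<zero>\<^sub>K" using b p unfolding bdry_def by fastforce
  thus "c = z []" using c zc by(simp add:K.diff_zero_iff)
 qed
qed

lemma kap_model: "cobar_model K X cst (Ext_algebra K A P) kap"
proof (intro cobar_model.intro cobar_model_axioms.intro K.field_axioms cst_sc cobd_fin cobd_cobd kap_one)
 show "kap ` {f : KC. cobd K cst f = zf.\<^sub>K} = car (Ext_algebra K A P)"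
  using kap_closed kap_surj unfolding ZC_def by blast
qed (use kap_eq kap_add kap_smult kap_mult kap_aug in "auto simp:ZC_def")

end

theorem Ext_cobar_model:
 assumes P: "graded_free_resolution K A (P :: ('a, 'p, 'k) resolution)"
 obtains ka where "cobar_model K X cst (Ext_algebra K A P) ka"
proof -
 obtain et where et: "!!i. et i : ghoms A P$(0 + i) bar_res$i"
  "!!x. x : car P$0 ==> res_aug bar_res (et 0 x) = res_aug P x"
  "!!i x. x : car (res_mod P (Suc (0 + i))) ==> res_diff bar_res i (et (Suc i) x) = et i (res_diff P (0 + i) x)"
  by(rule lift_exists[OF P bar_resolution aug_gh[OF P] aug_diff[OF P]]) (assumption | rule that)+
 obtain th where th: "!!i. th i : ghoms A bar_res$(0 + i) P$i"
  "!!x. x : car bar_res$0 ==> res_aug P (th 0 x) = res_aug bar_res x"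
  "!!i x. x : car (res_mod bar_res (Suc (0 + i))) ==> res_diff P i (th (Suc i) x) = th i (res_diff bar_res (0 + i) x)"
  by(rule lift_exists[OF bar_resolution P, where g = "res_aug bar_res" and m = 0])
  (assumption | rule aug_gh[OF bar_resolution] aug_diff[OF bar_resolution] that)+
 have "cobar_model K X cst (Ext_algebra K A P) (kap P et)"
  by(rule kap_model[OF P, where th = th]) (use et th in simp_all)
 thus ?thesis by(rule that)
qed

end

section \<open>Homogeneous bases\<close>

definition basis_of ::
  "('k, 'r) ring_scheme => ('k, 'v, 's) module_scheme => 'v set => 'v set => ('v => 'v => 'k) => bool"
 where "basis_of K V N B cr \<longleftrightarrow> finite B & B \<subseteq> N &
  (ALL x:N. cr x : ffun K B & x = (\<Oplus>\<^sub>V b\<in>B. cr x b \<odot>\<^sub>V b)) &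
  (ALL x:N. ALL y:N. cr (x \<oplus>\<^sub>V y) = (%b. cr x b \<oplus>\<^sub>K cr y b)) &
  (ALL k:car K. ALL x:N. cr (k \<odot>\<^sub>V x) = (%b. k \<otimes>\<^sub>K cr x b)) &
  (ALL b:B. cr b = mon K \<one>\<^sub>K b)"

context vector_space_over
begin

abbreviation "lc B c \<equiv> \<Oplus> b\<in>B. c b \<odot> b"

lemma lc_closed: "B \<subseteq> car V ==> c : B \<rightarrow> car K ==> lc B c : car V"
 by(intro M.finsum_closed) (auto intro!: left_smult_closed)

lemma lc_add_smult:
 assumes "B \<subseteq> car V" "c : B \<rightarrow> car K" "d : B \<rightarrow> car K" "k : car K"
 shows "lc B (%b. c b \<oplus>\<^sub>K k \<otimes>\<^sub>K d b) = lc B c \<oplus> k \<odot> lc B d"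
proof -
 have 1: "(%b. c b \<odot> b) : B \<rightarrow> car V" "(%b. d b \<odot> b) : B \<rightarrow> car V"
  "(%b. k \<odot> (d b \<odot> b)) : B \<rightarrow> car V"
  using assms by(auto intro!: left_smult_closed)
 have "lc B (%b. c b \<oplus>\<^sub>K k \<otimes>\<^sub>K d b) = (\<Oplus> b\<in>B. c b \<odot> b \<oplus> k \<odot> (d b \<odot> b))"
  using assms 1 by(intro M.finsum_cong') (auto simp:left_smult_l_distr left_smult_assoc Pi_iff subset_iff)
 also have "... = lc B c \<oplus> (\<Oplus> b\<in>B. k \<odot> (d b \<odot> b))" by(rule M.finsum_addf[OF 1(1) 1(3)])
 also have "(\<Oplus> b\<in>B. k \<odot> (d b \<odot> b)) = k \<odot> lc B d" by(rule smult_finsum[symmetric, OF assms(4) 1(2)])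
 finally show ?thesis .
qed

lemma lc_mem: "subspace K V M ==> B \<subseteq> M ==> c : B \<rightarrow> car K ==> lc B c : M"
 by(rule subspace_finsum) (auto simp:subspace_def Pi_iff subset_iff)

text \<open>A spanning set of least cardinality is independent, since an element with nonzero
  coefficient in a relation could be dropped. Spanning is expressed by the subspaces containing the
  set, a form that passes easily through linear maps.\<close>

lemma basis_exists:
 assumes N: "subspace K V N" and S: "finite S" "S \<subseteq> N" "!!M. subspace K V M ==> S \<subseteq> M ==> N \<subseteq> M"
 shows "EX B cr. basis_of K V N B cr"
proof -
 let ?P = "%B. finite B & B \<subseteq> N & (ALL M. subspace K V M --> B \<subseteq> M --> N \<subseteq> M)"
 have "?P S" using S by blast
 from ex_has_least_nat[of ?P, OF this, of card] obtain B where
  Bmin: "?P B & (ALL B'. ?P B' --> card B \<le> card B')" by(rule exE)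
 have B: "?P B" by(rule conjunct1[OF Bmin])
 have min: "card B \<le> card B'" if "?P B'" for B' by(rule mp[OF spec[OF conjunct2[OF Bmin]] that])
 have fB: "finite B" and BN: "B \<subseteq> N" using B by auto
 have BV: "B \<subseteq> car V" using BN N by(auto simp:subspace_def)
 have span: "N \<subseteq> {lc B c | c. c : B \<rightarrow> car K}"
 proof -
  let ?L = "{lc B c | c. c : B \<rightarrow> car K}"
  have "subspace K V ?L"
  unfolding subspace_def
  proof (intro conjI ballI)
  show "?L \<subseteq> car V" using lc_closed[OF BV] by auto
  have "lc B zf.\<^sub>K = \<zero>" using BV by(intro M.finsum_zeroI) auto
  thus "\<zero> : ?L" by(intro CollectI exI[of _ "%b. \<zero>\<^sub>K"]) simp
  next
  fix x y assume "x : ?L" "y : ?L"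
  then obtain c d where cd: "c : B \<rightarrow> car K" "d : B \<rightarrow> car K" "x = lc B c" "y = lc B d" by blast
  have "x \<oplus> y = lc B (%b. c b \<oplus>\<^sub>K \<one>\<^sub>K \<otimes>\<^sub>K d b)"
  unfolding lc_add_smult[OF BV cd(1,2) F.one_closed] cd(3,4)
  using lc_closed[OF BV cd(2)] by(simp add:left_smult_one)
  moreover have "(%b. c b \<oplus>\<^sub>K \<one>\<^sub>K \<otimes>\<^sub>K d b) : B \<rightarrow> car K" using cd by auto
  ultimately show "x \<oplus> y : ?L"
  by(intro CollectI exI[of _ "%b. c b \<oplus>\<^sub>K \<one>\<^sub>K \<otimes>\<^sub>K d b"] conjI)
  next
  fix k x assume k: "k : car K" and "x : ?L"
  then obtain c where c: "c : B \<rightarrow> car K" "x = lc B c" by blast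
  have "k \<odot> x = (\<Oplus> b\<in>B. k \<odot> (c b \<odot> b))"
  unfolding c(2) using c(1) BV by(intro smult_finsum[OF k]) (auto intro!: left_smult_closed)
  also have "... = lc B (%b. k \<otimes>\<^sub>K c b)"
  using c(1) BV k by(intro M.finsum_cong') (auto simp:left_smult_assoc Pi_iff subset_iff intro!: left_smult_closed)
  finally show "k \<odot> x : ?L" using c(1) k by(intro CollectI exI[of _ "%b. k \<otimes>\<^sub>K c b"]) auto
  qed
  moreover have "B \<subseteq> ?L"
  proof
  fix b assume b: "b : B"
  have "lc B (mon K \<one>\<^sub>K b) = mon K \<one>\<^sub>K b b \<odot> b"
  by(rule M.finsum_single[OF fB b]) (use BV b in "auto simp:mon_def left_smult_one")
  hence "b = lc B (mon K \<one>\<^sub>K b)" using b BV by(auto simp:mon_def left_smult_one)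
  thus "b : ?L" by(intro CollectI exI[of _ "mon K \<one>\<^sub>K b"]) (auto simp:mon_def)
  qed
  ultimately show ?thesis using B by blast
 qed
 have indep: "c b = \<zero>\<^sub>K" if c: "c : B \<rightarrow> car K" "lc B c = \<zero>" and b: "b : B" for c b
 proof (rule ccontr)
  assume nz: "c b ~= \<zero>\<^sub>K"
  have cb: "c b : car K" "b : car V" using c b BV by auto
  have "?P (B - {b})"
  proof (intro conjI allI impI)
  fix M assume M: "subspace K V M" "B - {b} \<subseteq> M"
  have MV: "M \<subseteq> car V" using M by(simp add:subspace_def)
  have m: "lc (B - {b}) c : M" using c(1) by(intro lc_mem[OF M]) auto
  have "lc (insert b (B - {b})) c = c b \<odot> b \<oplus> lc (B - {b}) c"
  using fB c(1) BV b by(intro M.finsum_insert) (auto intro!: left_smult_closed)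
  hence "c b \<odot> b \<oplus> lc (B - {b}) c = \<zero>" using c(2) b by(simp add:insert_absorb)
  hence "c b \<odot> b = \<ominus> lc (B - {b}) c"
  using m MV cb left_smult_closed by(intro M.minus_equality[symmetric]) auto
  hence "c b \<odot> b : M" using subspace_neg[OF M(1) m] by simp
  hence "inv\<^bsub>K\<^esub> (c b) \<odot> (c b \<odot> b) : M"
  using smult_inverse(1)[OF cb(1) nz cb(2)] M(1) by(simp add:subspace_def)
  hence "b : M" using smult_inverse(2)[OF cb(1) nz cb(2)] by simp
  thus "N \<subseteq> M" using B M by blast
  qed (use fB BN in auto)
  hence "card B \<le> card (B - {b})" by(rule min)
  thus False using card_Diff1_less[OF fB b] by simp
 qed
 have uniq: "c = d" if c: "c : ffun K B" and d: "d : ffun K B" and e: "lc B c = lc B d" for c d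
 proof
  fix b
  have cc: "c : B \<rightarrow> car K" "d : B \<rightarrow> car K" using c d by(auto simp:ffun_closed)
  have m1: "\<ominus>\<^sub>K \<one>\<^sub>K : car K" by simp
  have "lc B (%b. c b \<oplus>\<^sub>K \<ominus>\<^sub>K \<one>\<^sub>K \<otimes>\<^sub>K d b) = \<zero>"
  unfolding lc_add_smult[OF BV cc m1] e using lc_closed[OF BV cc(2)]
  by(simp add:smult_minus_l left_smult_one M.r_neg)
  hence "c b \<oplus>\<^sub>K \<ominus>\<^sub>K \<one>\<^sub>K \<otimes>\<^sub>K d b = \<zero>\<^sub>K" if "b : B"
  using indep[of "%b. c b \<oplus>\<^sub>K \<ominus>\<^sub>K \<one>\<^sub>K \<otimes>\<^sub>K d b" b] that cc by auto
  moreover have "c b = d b" if "b \<notin> B" using ffun_supp[OF c, of b] ffun_supp[OF d, of b] that by metis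
  ultimately show "c b = d b"
  using ffun_closed[OF c, of b] ffun_closed[OF d, of b]
  F.diff_zero_iff[of "c b" "d b"] by(cases "b : B") (simp_all add:a_minus_def F.l_minus)
 qed
 define cr where "cr x = (SOME c. c : ffun K B & x = lc B c)" for x
 have ex: "EX c. c : ffun K B & x = lc B c" if "x : N" for x
 proof -
  have "x : {lc B c | c. c : B \<rightarrow> car K}" by(rule subsetD[OF span that])
  then obtain c where c: "c : B \<rightarrow> car K" "x = lc B c" by blast
  let ?c = "%b. if b : B then c b else \<zero>\<^sub>K"
  have "?c : ffun K B" by(rule ffunI[OF _ fB]) (use c(1) in "auto split:if_splits")
  moreover have "lc B ?c = lc B c" by(rule M.finsum_cong') (use c(1) BV in "auto intro!: left_smult_closed")
  ultimately show ?thesis using c(2) by auto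
 qed
 have cr: "cr x : ffun K B" "x = lc B (cr x)" if "x : N" for x
  unfolding cr_def using someI_ex[OF ex[OF that]] by blast+
 have crI: "cr x = c" if "x : N" "c : ffun K B" "x = lc B c" for x c
  using uniq[OF cr(1)[OF that(1)] that(2)] cr(2)[OF that(1)] that(3) by simp
 have crP: "cr x : B \<rightarrow> car K" if "x : N" for x using cr(1)[OF that] by(auto simp:ffun_closed)
 have "basis_of K V N B cr" unfolding basis_of_def
 proof (intro conjI ballI fB BN)
  fix x assume x: "x : N"
  show "cr x : ffun K B" "x = lc B (cr x)" by(rule cr[OF x])+
  fix y assume y: "y : N"
  have "lc B (%b. cr x b \<oplus>\<^sub>K \<one>\<^sub>K \<otimes>\<^sub>K cr y b) = x \<oplus> y"
  unfolding lc_add_smult[OF BV crP[OF x] crP[OF y] F.one_closed] cr(2)[OF x, symmetric] cr(2)[OF y, symmetric]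
  using y N by(auto simp:subspace_def left_smult_one)
  hence eq: "x \<oplus> y = lc B (%b. cr x b \<oplus>\<^sub>K cr y b)" using cr(1)[OF y] by(simp add:ffun_closed)
  have "x \<oplus> y : N" using N x y by(simp add:subspace_def)
  thus "cr (x \<oplus> y) = (%b. cr x b \<oplus>\<^sub>K cr y b)"
  by(rule crI[OF _ F.ffun_add[OF cr(1)[OF x] cr(1)[OF y]] eq])
 next
  fix k x assume k: "k : car K" and x: "x : N"
  have "k \<odot> lc B (cr x) = (\<Oplus> b\<in>B. k \<odot> (cr x b \<odot> b))"
  using crP[OF x] BV by(intro smult_finsum[OF k]) (auto intro!: left_smult_closed)
  also have "... = lc B (%b. k \<otimes>\<^sub>K cr x b)"
  using crP[OF x] BV k by(intro M.finsum_cong') (auto simp:left_smult_assoc Pi_iff subset_iff intro!: left_smult_closed)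
  finally have eq: "k \<odot> x = lc B (%b. k \<otimes>\<^sub>K cr x b)" unfolding cr(2)[OF x, symmetric] .
  have "k \<odot> x : N" using N k x by(simp add:subspace_def)
  thus "cr (k \<odot> x) = (%b. k \<otimes>\<^sub>K cr x b)"
  by(rule crI[OF _ F.ffun_smult[OF k cr(1)[OF x]] eq])
 next
  fix b assume b: "b : B"
  have "lc B (mon K \<one>\<^sub>K b) = mon K \<one>\<^sub>K b b \<odot> b"
  by(rule M.finsum_single[OF fB b]) (use BV b in "auto simp:mon_def left_smult_one")
  hence eq: "b = lc B (mon K \<one>\<^sub>K b)" using b BV by(auto simp:mon_def left_smult_one)
  show "cr b = mon K \<one>\<^sub>K b"
  by(rule crI[OF subsetD[OF BN b] F.ffun_mon[OF F.one_closed b] eq])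
 qed
 thus ?thesis by blast
qed

end

lemma (in abelian_group) finsum_Sigma:
 assumes "finite I" "!!i. i : I ==> finite (S i)" "!!i j. i : I ==> j : S i ==> f i j : car G"
 shows "(\<Oplus>i\<in>I. \<Oplus>j\<in>S i. f i j) = (\<Oplus>p\<in>Sigma I S. f (fst p) (snd p))"
 using assms
proof (induct I)
 case (insert i I)
 have eq: "Sigma (insert i I) S = Pair i ` S i \<union> Sigma I S" "Pair i ` S i \<inter> Sigma I S = {}" using insert(2) by auto
 have "(\<Oplus>p\<in>Sigma (insert i I) S. f (fst p) (snd p))
  = (\<Oplus>p\<in>Pair i ` S i. f (fst p) (snd p)) \<oplus> (\<Oplus>p\<in>Sigma I S. f (fst p) (snd p))"
  unfolding eq(1) using insert eq(2) by(intro finsum_Un_disjoint) auto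
 also have "(\<Oplus>p\<in>Pair i ` S i. f (fst p) (snd p)) = (\<Oplus>j\<in>S i. f i j)"
  using insert.prems by(subst finsum_reindex) (auto simp:inj_on_def)
 finally show ?case using insert by(simp add:finsum_closed Pi_iff)
qed simp

section \<open>Finite spanning sets in each degree\<close>

context graded_augmented_algebra
begin

lemma vector_space: "vector_space_over K A"
 by(intro vector_space_over.intro K.field_axioms left_module_module V.module_axioms)

lemma aug_gcomp: assumes a: "a : car A" shows "aug A (gcomp A (alg_gr A) a 0) = aug A a"
proof -
 let ?J = "insert 0 {j. gcomp A (alg_gr A) a j ~= \<zero>\<^sub>A}"
 have J: "finite ?J" using AG.gcomp_props(2)[OF a] by simp
 have "a = (\<Oplus>\<^sub>A j\<in>?J. gcomp A (alg_gr A) a j)" by(rule AG.gcomp_sum[OF a J]) auto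
 hence "aug A a = aug A (\<Oplus>\<^sub>A j\<in>?J. gcomp A (alg_gr A) a j)" by simp
 also have "... = (\<Oplus>\<^sub>K j\<in>?J. aug A (gcomp A (alg_gr A) a j))"
  using a by(intro additive_finsum[OF A.ab K.ab aug_additive]) auto
 also have "... = aug A (gcomp A (alg_gr A) a 0)"
  using a gr_aug AG.gcomp_props(1)[OF a] by(intro K.finsum_single[OF J]) auto
 finally show ?thesis by simp
qed

lemma gcomp_smult:
 assumes k: "k : car K" and a: "a : car A"
 shows "gcomp A (alg_gr A) (k \<odot>\<^sub>A a) j = k \<odot>\<^sub>A gcomp A (alg_gr A) a j"
proof -
 have "gcomp A (alg_gr A) (k \<odot>\<^sub>A a) (j + 0) = k \<odot>\<^sub>A gcomp A (alg_gr A) a j"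
  by(rule gcomp_shift[OF AG.graded_group_axioms AG.graded_group_axioms _ _ a])
  (use k gr_smult in "auto intro!: additive_mapsI simp:V.smult_r_distr")
 thus ?thesis by simp
qed

lemma gcomp_zero: "gcomp A (alg_gr A) \<zero>\<^sub>A j = \<zero>\<^sub>A"
 using AG.gcomp_homog[OF AG.piece_zero[of j], of j] by simp

lemma piece_subspace: "subspace K A (alg_gr A j)"
 unfolding subspace_def using AG.piece_closed AG.piece_add gr_smult by auto

text \<open>The elements of the basis are tagged with their degrees.\<close>

lemma based_algebra_exists:
 assumes fd: "!!j. EX S. finite S & S \<subseteq> alg_gr A j & (ALL M. subspace K A M --> S \<subseteq> M --> alg_gr A j \<subseteq> M)"
 shows "\<exists>(X :: (int \<times> 'a) set) co. based_algebra K A X snd fst co"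
proof -
 interpret W: vector_space_over K A by(rule vector_space)
 let ?g = "gcomp A (alg_gr A)"
 define I where "I j = {a : alg_gr A j. aug A a = \<zero>\<^sub>K}" for j
 \<comment> \<open>The projection onto the augmentation ideal along the scalars; it preserves
   degrees because the unit has degree zero.\<close>
 define rho where "rho a = a \<ominus>\<^sub>A aug A a \<odot>\<^sub>A \<one>\<^sub>A" for a
 have k1: "k \<odot>\<^sub>A \<one>\<^sub>A : car A" if "k : car K" for k using that by simp
 have rho_closed: "rho a : car A" if "a : car A" for a using that k1 by(simp add:rho_def)
 have rho_add: "rho (a \<oplus>\<^sub>A b) = rho a \<oplus>\<^sub>A rho b" if "a : car A" "b : car A" for a b
  using that k1 by(simp add:rho_def aug_add V.smult_l_distr A.minus_add4)
 have rho_smult: "rho (k \<odot>\<^sub>A a) = k \<odot>\<^sub>A rho a" if "k : car K" "a : car A" for k a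
  using that k1 by(simp add:rho_def aug_smult V.smult_assoc1 W.smult_diff_r)
 have rho_id: "rho a = a" if "a : car A" "aug A a = \<zero>\<^sub>K" for a
  using that by(simp add:rho_def V.smult_l_null A.diff_zero)
 have aug_rho: "aug A (rho a) = \<zero>\<^sub>K" if "a : car A" for a
  using that k1 additive_diff[OF A.ab K.ab aug_additive, of a "aug A a \<odot>\<^sub>A \<one>\<^sub>A"]
  by(simp add:rho_def aug_smult K.diff_self)
 have rho_gr: "rho a : alg_gr A j" if "a : alg_gr A j" for a j
 proof (cases "j = 0")
  case True
  thus ?thesis
  using that AG.piece_closed[OF that] gr_smult[OF _ one_homogeneous, of "aug A a"]
  by(auto simp:rho_def a_minus_def intro!: AG.piece_add AG.piece_neg)
 next
  case False
  thus ?thesis using rho_id[OF AG.piece_closed[OF that] gr_aug[OF False that]] that by simp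
 qed
 have Isub: "subspace K A (I j)" for j
  using AG.piece_closed gr_smult by(auto simp:subspace_def I_def AG.piece_add aug_add aug_smult)
 have "EX B cr. basis_of K A (I j) B cr" for j
 proof -
  obtain S where S: "finite S" "S \<subseteq> alg_gr A j" "!!M. subspace K A M ==> S \<subseteq> M ==> alg_gr A j \<subseteq> M"
  using fd[of j] by blast
  \<comment> \<open>The projection carries a spanning set of a graded piece to a spanning set of its
    intersection with the augmentation ideal.\<close>
  have "rho ` S \<subseteq> I j" using S(2) rho_gr aug_rho AG.piece_closed by(auto simp:I_def)
  moreover have "I j \<subseteq> M" if M: "subspace K A M" "rho ` S \<subseteq> M" for M
  proof -
  have "rho \<zero>\<^sub>A = \<zero>\<^sub>A" by(rule rho_id) simp_all
  hence "subspace K A {a : car A. rho a : M}"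
  using M(1) by(auto simp:subspace_def rho_add rho_smult)
  moreover have "S \<subseteq> {a : car A. rho a : M}" using S(2) AG.piece_closed M(2) by auto
  ultimately have "alg_gr A j \<subseteq> {a : car A. rho a : M}" by(rule S(3))
  thus ?thesis using rho_id by(auto simp:I_def subset_iff)
  qed
  ultimately show ?thesis using S(1) by(intro W.basis_exists[OF Isub, of "rho ` S"]) auto
 qed
 hence "ALL j. EX p. basis_of K A (I j) (fst p) (snd p)" by simp
 from choice[OF this] obtain p where p: "ALL j. basis_of K A (I j) (fst (p j)) (snd (p j))" by(rule exE)
 define B where "B j = fst (p j)" for j
 define cr where "cr j = snd (p j)" for j
 have bs: "basis_of K A (I j) (B j) (cr j)" for j using p by(simp add:B_def cr_def)
 have fB: "finite (B j)" and BI: "B j \<subseteq> I j" for j using bs[of j] by(simp_all add:basis_of_def)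
 have cr1: "cr j x : ffun K (B j)" and cr2: "x = (\<Oplus>\<^sub>A b\<in>B j. cr j x b \<odot>\<^sub>A b)"
  and cr4: "k : car K ==> cr j (k \<odot>\<^sub>A x) = (%b. k \<otimes>\<^sub>K cr j x b)" if "x : I j" for x j k
  using bs[of j] that by(simp_all add:basis_of_def)
 have cr3: "cr j (x \<oplus>\<^sub>A y) = (%b. cr j x b \<oplus>\<^sub>K cr j y b)" if "x : I j" "y : I j" for x y j
  using bs[of j] that by(simp add:basis_of_def)
 have cr5: "cr j b = mon K \<one>\<^sub>K b" if "b : B j" for b j using bs[of j] that by(simp add:basis_of_def)
 have I0: "\<zero>\<^sub>A : I j" for j by(simp add:I_def)
 have cr0: "cr j \<zero>\<^sub>A = zf.\<^sub>K" for j
  using cr4[OF I0, of "\<zero>\<^sub>K" j] ffun_closed[OF cr1[OF I0]] by(simp add:V.smult_r_null)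
 define pr where "pr a j = ?g (rho a) j" for a j
 have pr_I: "pr a j : I j" if a: "a : car A" for a j
  using AG.gcomp_props(1)[OF rho_closed[OF a], of j] gr_aug[of j] aug_gcomp[OF rho_closed[OF a]] aug_rho[OF a]
  by(cases "j = 0") (auto simp:pr_def I_def)
 define co where "co a = (%x. cr (fst x) (pr a (fst x)) (snd x))" for a
 let ?X = "Sigma UNIV B"
 have fin: "finite {j. pr a j ~= \<zero>\<^sub>A}" if "a : car A" for a
  unfolding pr_def by(rule AG.gcomp_props(2)[OF rho_closed[OF that]])
 have coX: "co a x : car K" "co a x ~= \<zero>\<^sub>K ==> x : Sigma {j. pr a j ~= \<zero>\<^sub>A} B" if a: "a : car A" for a x
 proof -
  show "co a x : car K" unfolding co_def by(rule ffun_closed[OF cr1[OF pr_I[OF a]]])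
  assume nz: "co a x ~= \<zero>\<^sub>K"
  hence "snd x : B (fst x)" unfolding co_def by(rule ffun_supp[OF cr1[OF pr_I[OF a]]])
  moreover have "pr a (fst x) ~= \<zero>\<^sub>A" using nz cr0 by(auto simp:co_def)
  ultimately show "x : Sigma {j. pr a j ~= \<zero>\<^sub>A} B" by(cases x) auto
 qed
 have cof: "co a : ffun K ?X" if a: "a : car A" for a
 proof (rule ffunI)
  show "finite (Sigma {j. pr a j ~= \<zero>\<^sub>A} B)" using fin[OF a] fB by(intro finite_SigmaI)
  show "x : ?X" if "co a x ~= \<zero>\<^sub>K" for x using coX(2)[OF a that] by auto
 qed (use coX[OF a] in auto)
 have prh: "pr a i = (if i = j then rho a else \<zero>\<^sub>A)" if "a : alg_gr A j" for a i j
  unfolding pr_def by(rule AG.gcomp_homog[OF rho_gr[OF that]])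
 have BA: "b : alg_gr A j" "aug A b = \<zero>\<^sub>K" "b : car A" if "b : B j" for b j
  using BI[of j] that AG.piece_closed by(auto simp:I_def)
 have "based_algebra K A ?X snd fst co"
 proof (intro based_algebra.intro based_algebra_axioms.intro graded_augmented_algebra_axioms cof)
  fix x assume x: "x : ?X"
  hence b: "snd x : B (fst x)" by auto
  show "snd x : alg_gr A (fst x)" "aug A (snd x) = \<zero>\<^sub>K" using BA[OF b] by auto
  show "0 \<le> fst x"
  proof (rule ccontr)
  assume "\<not> 0 \<le> fst x"
  hence "snd x = \<zero>\<^sub>A" using BA(1)[OF b] gr_nonneg[of "fst x"] by auto
  hence "mon K \<one>\<^sub>K (snd x) = zf.\<^sub>K" using cr5[OF b] cr0[of "fst x"] by simp
  hence "mon K \<one>\<^sub>K (snd x) (snd x) = \<zero>\<^sub>K" by(rule fun_cong)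
  thus False by(simp add:mon_def)
  qed
  show "co (snd x) = mon K \<one>\<^sub>K x"
  proof
  fix y :: "int \<times> 'a"
  have "pr (snd x) (fst y) = (if fst y = fst x then snd x else \<zero>\<^sub>A)"
  using prh[OF BA(1)[OF b]] rho_id[OF BA(3)[OF b] BA(2)[OF b]] by simp
  thus "co (snd x) y = mon K \<one>\<^sub>K x y"
  using cr5[OF b] cr0 by(auto simp:co_def mon_def prod_eq_iff)
  qed
 next
  fix j :: int
  have "{x : ?X. fst x = j} = Pair j ` B j" by auto
  thus "finite {x : ?X. fst x = j}" using fB by simp
 next
  fix a b assume ab: "a : car A" "b : car A"
  have "pr (a \<oplus>\<^sub>A b) j = pr a j \<oplus>\<^sub>A pr b j" for j
  using ab by(simp add:pr_def rho_add AG.gcomp_add rho_closed)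
  thus "co (a \<oplus>\<^sub>A b) = (%x. co a x \<oplus>\<^sub>K co b x)"
  using cr3[OF pr_I[OF ab(1)] pr_I[OF ab(2)]] by(simp add:co_def)
 next
  fix k a assume k: "k : car K" "a : car A"
  have "pr (k \<odot>\<^sub>A a) j = k \<odot>\<^sub>A pr a j" for j
  using k by(simp add:pr_def rho_smult gcomp_smult rho_closed)
  thus "co (k \<odot>\<^sub>A a) = (%x. k \<otimes>\<^sub>K co a x)"
  using cr4[OF pr_I[OF k(2)] k(1)] by(simp add:co_def)
 next
  have "rho \<one>\<^sub>A = \<zero>\<^sub>A" by(simp add:rho_def V.smult_one A.diff_self)
  thus "co \<one>\<^sub>A = zf.\<^sub>K" by(simp add:co_def pr_def gcomp_zero cr0)
 next
  fix a assume a: "a : car A"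
  let ?J = "{j. pr a j ~= \<zero>\<^sub>A}"
  have ce: "co a x \<odot>\<^sub>A snd x : car A" if "x : Sigma ?J B" for x
  using that BA(3) coX(1)[OF a] by auto
  have "rho a = (\<Oplus>\<^sub>A j\<in>?J. pr a j)" unfolding pr_def by(rule AG.gcomp_props(3)[OF rho_closed[OF a]])
  also have "... = (\<Oplus>\<^sub>A j\<in>?J. \<Oplus>\<^sub>A b\<in>B j. cr j (pr a j) b \<odot>\<^sub>A b)"
  using cr2[OF pr_I[OF a]] pr_I[OF a] AG.piece_closed by(intro A.finsum_cong') (auto simp:I_def)
  also have "... = (\<Oplus>\<^sub>A x\<in>Sigma ?J B. cr (fst x) (pr a (fst x)) (snd x) \<odot>\<^sub>A snd x)"
  using fin[OF a] fB BA(3) ffun_closed[OF cr1[OF pr_I[OF a]]] by(intro A.finsum_Sigma) auto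
  also have "... = (\<Oplus>\<^sub>A x\<in>Sigma ?J B. co a x \<odot>\<^sub>A snd x)" by(simp add:co_def)
  also have "... = (\<Oplus>\<^sub>A x\<in>{x. co a x ~= \<zero>\<^sub>K}. co a x \<odot>\<^sub>A snd x)"
  proof (rule A.finsum_superset[symmetric])
  show "finite (Sigma ?J B)" using fin[OF a] fB by(intro finite_SigmaI)
  show "{x. co a x ~= \<zero>\<^sub>K} \<subseteq> Sigma ?J B" using coX(2)[OF a] by blast
  show "(%x. co a x \<odot>\<^sub>A snd x) : Sigma ?J B \<rightarrow> car A" using ce by blast
  show "co a x \<odot>\<^sub>A snd x = \<zero>\<^sub>A" if "x : Sigma ?J B - {x. co a x ~= \<zero>\<^sub>K}" for x
  using that BA(3) by(auto simp:V.smult_l_null)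
  qed
  finally have "rho a = (\<Oplus>\<^sub>A x\<in>{x. co a x ~= \<zero>\<^sub>K}. co a x \<odot>\<^sub>A snd x)" .
  moreover have "a = aug A a \<odot>\<^sub>A \<one>\<^sub>A \<oplus>\<^sub>A rho a"
  using a k1[of "aug A a"] A.minus_minus_add[of a "aug A a \<odot>\<^sub>A \<one>\<^sub>A"]
  by(simp add:rho_def A.a_comm)
  ultimately show "a = aug A a \<odot>\<^sub>A \<one>\<^sub>A \<oplus>\<^sub>A (\<Oplus>\<^sub>A x\<in>{x. co a x ~= \<zero>\<^sub>K}. co a x \<odot>\<^sub>A snd x)" by simp
 next
  fix a j x assume "a : alg_gr A j" "co a x ~= \<zero>\<^sub>K"
  thus "fst x = j" using prh[of a j "fst x"] cr0 by(auto simp:co_def split:if_splits)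
 qed
 thus ?thesis by blast
qed

lemma concentrated_pieces:
 assumes "finite_dimensional K A" "concentrated_in_degree_0 A"
 shows "EX S. finite S & S \<subseteq> alg_gr A j & (ALL M. subspace K A M --> S \<subseteq> M --> alg_gr A j \<subseteq> M)"
proof (cases "j = 0")
 case True
 interpret W: vector_space_over K A by(rule vector_space)
 obtain S where S: "finite S" "S \<subseteq> car A"
  "ALL x:car A. EX c. c : S \<rightarrow> car K & x = (\<Oplus>\<^sub>A s\<in>S. c s \<odot>\<^sub>A s)"
  using assms(1) by(auto simp:finite_dimensional_def)
 have "car A \<subseteq> M" if "subspace K A M" "S \<subseteq> M" for M
 proof
  fix x assume "x : car A"
  then obtain c where "c : S \<rightarrow> car K" "x = (\<Oplus>\<^sub>A s\<in>S. c s \<odot>\<^sub>A s)" using S(3) by blast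
  thus "x : M" using W.lc_mem[OF that] by simp
 qed
 thus ?thesis using S assms(2) True by(auto simp:concentrated_in_degree_0_def)
next
 case False
 thus ?thesis
  using assms(2) by(intro exI[of _ "{}"]) (auto simp:concentrated_in_degree_0_def subspace_def)
qed

text \<open>The positive-degree components of the generators generate together with the scalars,
  since connectedness makes components of degree zero scalar. A monomial of total degree j in them
  has at most j factors, so there are finitely many.\<close>

lemma connected_pieces:
 assumes "connected_algebra K A" "fin_gen_algebra K A"
 shows "EX S. finite S & S \<subseteq> alg_gr A j & (ALL M. subspace K A M --> S \<subseteq> M --> alg_gr A j \<subseteq> M)"
proof -
 interpret W: vector_space_over K A by(rule vector_space)
 let ?g = "gcomp A (alg_gr A)"
 obtain S where S: "finite S" "S \<subseteq> car A"
  and gen: "!!B. subring B A ==> submodule B K A ==> S \<subseteq> B ==> B = car A"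
  using assms(2) unfolding fin_gen_algebra_def by(elim exE conjE) blast
 define L where "L = (\<Union>s\<in>S. (%i. (i, ?g s i)) ` {i. 0 < i & ?g s i ~= \<zero>\<^sub>A})"
 have finL: "finite L" unfolding L_def
 proof (intro finite_UN_I S(1) finite_imageI)
  fix s assume "s : S"
  hence "finite {i. ?g s i ~= \<zero>\<^sub>A}" using AG.gcomp_props(2) S(2) by blast
  thus "finite {i. 0 < i & ?g s i ~= \<zero>\<^sub>A}" by(rule finite_subset[rotated]) auto
 qed
 have L: "0 < fst l" "snd l : alg_gr A (fst l)" if "l : L" for l
  using that S(2) AG.gcomp_props(1) by(auto simp:L_def)
 define ev where "ev l = foldr (%x y. snd x \<otimes>\<^sub>A y) l \<one>\<^sub>A" for l :: "(int \<times> 'a) list"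
 define dg where "dg l = sum_list (map fst l)" for l :: "(int \<times> 'a) list"
 define Mn where "Mn j = ev ` {l : lists L. dg l = j}" for j
 have ev_gr: "l : lists L ==> ev l : alg_gr A (dg l)" for l
  by(induct l) (auto simp:ev_def dg_def one_homogeneous intro!: gr_mult L(2))
 have ev_append: "l : lists L ==> l' : lists L ==> ev (l @ l') = ev l \<otimes>\<^sub>A ev l'" for l l'
 proof (induct l)
  case Nil
  thus ?case using AG.piece_closed[OF ev_gr[of l']] by(simp add:ev_def)
 next
  case (Cons x l)
  have "snd x : car A" using Cons AG.piece_closed[OF L(2)] by auto
  thus ?case using Cons AG.piece_closed[OF ev_gr[of l']] AG.piece_closed[OF ev_gr[of l]]
  by(simp add:ev_def A.m_assoc)
 qed
 have len: "l : lists L ==> int (length l) \<le> dg l" for l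
  by(induct l) (auto simp:dg_def dest:L(1))
 have finM: "finite (Mn j)" for j
 proof -
  have "{l : lists L. dg l = j} \<subseteq> {l. set l \<subseteq> L & length l \<le> nat j}" using len by fastforce
  hence "finite {l : lists L. dg l = j}" using finite_lists_length_le[OF finL] finite_subset by blast
  thus ?thesis by(simp add:Mn_def)
 qed
 have Mn_gr: "Mn j \<subseteq> alg_gr A j" for j using ev_gr by(auto simp:Mn_def)
 define Sp where "Sp j = \<Inter>{M. subspace K A M & Mn j \<subseteq> M}" for j
 have SpI: "Mn j \<subseteq> Sp j" for j by(auto simp:Sp_def)
 have Sp_least: "Sp j \<subseteq> M" if "subspace K A M" "Mn j \<subseteq> M" for j M using that by(auto simp:Sp_def)
 have Sp_gr: "Sp j \<subseteq> alg_gr A j" for j by(rule Sp_least[OF piece_subspace Mn_gr])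
 have Sp_closed: "x : Sp j ==> x : car A" for x j using Sp_gr AG.piece_closed by blast
 have Sp_sub: "subspace K A (Sp j)" for j
 proof -
  have "Sp j \<subseteq> car A" using Sp_closed by blast
  thus ?thesis unfolding subspace_def by(auto simp:Sp_def subspace_def)
 qed
 \<comment> \<open>Closure under products is extended from monomials to their spans one factor at a
   time.\<close>
 have Sp_mult: "x \<otimes>\<^sub>A y : Sp (i + k)" if x: "x : Sp i" and y: "y : Sp k" for x y i k
 proof -
  have 1: "u \<otimes>\<^sub>A v : Sp (i + k)" if uv: "u : Mn i" "v : Mn k" for u v
  proof -
  obtain l l' where l: "l : lists L" "dg l = i" "u = ev l" "l' : lists L" "dg l' = k" "v = ev l'"
  using uv unfolding Mn_def by blast
  have "u \<otimes>\<^sub>A v = ev (l @ l')" using ev_append l by simp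
  moreover have "dg (l @ l') = i + k" using l by(simp add:dg_def)
  ultimately have "u \<otimes>\<^sub>A v : Mn (i + k)" using l(1,4) by(auto simp:Mn_def)
  thus ?thesis using SpI by blast
  qed
  have 2: "u \<otimes>\<^sub>A v : Sp (i + k)" if u: "u : Sp i" and v: "v : Mn k" for u v
  proof -
  have vc: "v : car A" using v SpI Sp_closed by blast
  have "subspace K A {u : car A. u \<otimes>\<^sub>A v : Sp (i + k)}"
  using Sp_sub[of "i + k"] vc by(auto simp:subspace_def A.l_distr smult_mult_left)
  moreover have "Mn i \<subseteq> {u : car A. u \<otimes>\<^sub>A v : Sp (i + k)}" using 1 v SpI Sp_closed by blast
  ultimately have "Sp i \<subseteq> {u : car A. u \<otimes>\<^sub>A v : Sp (i + k)}" by(rule Sp_least)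
  thus ?thesis using u by blast
  qed
  have xc: "x : car A" using Sp_closed[OF x] .
  have "subspace K A {v : car A. x \<otimes>\<^sub>A v : Sp (i + k)}"
  using Sp_sub[of "i + k"] xc by(auto simp:subspace_def A.r_distr smult_mult_right)
  moreover have "Mn k \<subseteq> {v : car A. x \<otimes>\<^sub>A v : Sp (i + k)}" using 2[OF x] SpI Sp_closed by blast
  ultimately have "Sp k \<subseteq> {v : car A. x \<otimes>\<^sub>A v : Sp (i + k)}" by(rule Sp_least)
  thus ?thesis using y by blast
 qed
 \<comment> \<open>The elements whose components all lie in the spans of monomials. They form a
   subalgebra containing the generators, hence exhaust A.\<close>
 define B where "B = {a : car A. ALL j. ?g a j : Sp j}"
 have Sp0: "\<zero>\<^sub>A : Sp j" for j using Sp_sub[of j] by(simp add:subspace_def)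
 have SpB: "x : B" if "x : Sp j" for x j
 proof -
  have "x : alg_gr A j" using that Sp_gr by blast
  from AG.gcomp_homog[OF this] show ?thesis using that Sp_closed[OF that] Sp0 by(simp add:B_def)
 qed
 have Bsub: "subspace K A B"
  unfolding subspace_def
 proof (intro conjI ballI)
  show "B \<subseteq> car A" by(auto simp:B_def)
  show "\<zero>\<^sub>A : B" by(rule SpB[OF Sp0])
  show "x \<oplus>\<^sub>A y : B" if "x : B" "y : B" for x y
  using that Sp_sub by(auto simp:B_def AG.gcomp_add subspace_def)
  show "k \<odot>\<^sub>A x : B" if "k : car K" "x : B" for k x
  using that Sp_sub by(auto simp:B_def gcomp_smult subspace_def)
 qed
 have one: "\<one>\<^sub>A : Sp 0"
  using SpI[of 0] by(rule subsetD) (auto simp:Mn_def ev_def dg_def intro!: image_eqI[of _ _ "[]"])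
 have "subring B A"
 proof (rule A.subringI)
  show "B \<subseteq> car A" by(auto simp:B_def)
  show "\<one>\<^sub>A : B" by(rule SpB[OF one])
  show "\<ominus>\<^sub>A x : B" if "x : B" for x by(rule W.subspace_neg[OF Bsub that])
  show "x \<oplus>\<^sub>A y : B" if "x : B" "y : B" for x y using Bsub that by(simp add:subspace_def)
  show "x \<otimes>\<^sub>A y : B" if x: "x : B" and y: "y : B" for x y
  proof -
  have xc: "x : car A" "y : car A" using x y by(auto simp:B_def)
  let ?I = "{i. ?g x i ~= \<zero>\<^sub>A}" and ?J = "{i. ?g y i ~= \<zero>\<^sub>A}"
  have IJ: "finite ?I" "finite ?J" using AG.gcomp_props(2) xc by auto
  have "x \<otimes>\<^sub>A y = (\<Oplus>\<^sub>A i\<in>?I. ?g x i) \<otimes>\<^sub>A y" using AG.gcomp_props(3)[OF xc(1)] by simp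
  also have "... = (\<Oplus>\<^sub>A i\<in>?I. ?g x i \<otimes>\<^sub>A y)" using xc by(intro A.finsum_ldistr IJ) auto
  finally have e: "x \<otimes>\<^sub>A y = (\<Oplus>\<^sub>A i\<in>?I. ?g x i \<otimes>\<^sub>A y)" .
  have "?g x i \<otimes>\<^sub>A y : B" for i
  proof -
  have "?g x i \<otimes>\<^sub>A y = ?g x i \<otimes>\<^sub>A (\<Oplus>\<^sub>A k\<in>?J. ?g y k)" using AG.gcomp_props(3)[OF xc(2)] by simp
  also have "... = (\<Oplus>\<^sub>A k\<in>?J. ?g x i \<otimes>\<^sub>A ?g y k)" using xc by(intro A.finsum_rdistr IJ) auto
  also have "... : B"
  proof (rule W.subspace_finsum[OF Bsub], rule)
  have "?g x i : Sp i" "?g y k : Sp k" for k using x y by(simp_all add:B_def)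
  thus "?g x i \<otimes>\<^sub>A ?g y k : B" for k by(intro SpB[OF Sp_mult])
  qed
  finally show ?thesis .
  qed
  thus ?thesis unfolding e by(intro W.subspace_finsum[OF Bsub]) auto
  qed
 qed
 moreover have "submodule B K A" using W.submodule_iff Bsub by blast
 moreover have "S \<subseteq> B"
 proof
  fix s assume s: "s : S"
  hence sc: "s : car A" using S(2) by blast
  have "?g s j : Sp j" for j
  proof (cases "?g s j = \<zero>\<^sub>A")
  case True
  thus ?thesis using Sp0 by simp
  next
  case False
  have gj: "?g s j : alg_gr A j" by(rule AG.gcomp_props(1)[OF sc])
  hence j: "0 \<le> j" using gr_nonneg[of j] False by(cases "j < 0") auto
  show ?thesis
  proof (cases "j = 0")
  case True
  then obtain c where "c : car K" "?g s j = c \<odot>\<^sub>A \<one>\<^sub>A"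
  using gj assms(1) by(auto simp:connected_algebra_def)
  thus ?thesis using True Sp_sub[of 0] one by(simp add:subspace_def)
  next
  case False
  hence "(j, ?g s j) : L" unfolding L_def
  using j \<open>?g s j ~= \<zero>\<^sub>A\<close> by(intro UN_I[OF s] image_eqI[of _ _ j]) auto
  hence "ev [(j, ?g s j)] : Mn j" by(auto simp:Mn_def dg_def)
  thus ?thesis using SpI[of j] sc by(auto simp:ev_def)
  qed
  qed
  thus "s : B" using sc by(simp add:B_def)
 qed
 ultimately have BA: "B = car A" by(rule gen)
 have span: "alg_gr A j \<subseteq> M" if M: "subspace K A M" "Mn j \<subseteq> M" for M
 proof
  fix a assume a: "a : alg_gr A j"
  hence "a : B" using BA AG.piece_closed by blast
  hence "?g a j : Sp j" by(simp add:B_def)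
  thus "a : M" using AG.gcomp_homog[OF a, of j] Sp_least[OF M] by auto
 qed
 show ?thesis by(rule exI[of _ "Mn j"]) (intro conjI allI impI finM Mn_gr span)
qed

end

section \<open>The product of based algebras\<close>

locale two_algebras = L: graded_augmented_algebra K A + G: graded_augmented_algebra K B
 for K :: "'k ring" and A :: "('k, 'a, 'r) gr_aug_algebra_scheme"
  and B :: "('k, 'b, 's) gr_aug_algebra_scheme"
begin

abbreviation "C \<equiv> aug_product A B"

lemma C_simps:
 "x : car C \<longleftrightarrow> fst x : car A & snd x : car B & aug A (fst x) = aug B (snd x)"
 "x \<otimes>\<^sub>C y = (fst x \<otimes>\<^sub>A fst y, snd x \<otimes>\<^sub>B snd y)"
 "\<one>\<^sub>C = (\<one>\<^sub>A, \<one>\<^sub>B)" "\<zero>\<^sub>C = (\<zero>\<^sub>A, \<zero>\<^sub>B)"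
 "x \<oplus>\<^sub>C y = (fst x \<oplus>\<^sub>A fst y, snd x \<oplus>\<^sub>B snd y)"
 "k \<odot>\<^sub>C x = (k \<odot>\<^sub>A fst x, k \<odot>\<^sub>B snd x)"
 "aug C x = aug A (fst x)"
 "x : alg_gr C j \<longleftrightarrow> fst x : alg_gr A j & snd x : alg_gr B j & aug A (fst x) = aug B (snd x)"
 by(auto simp:aug_product_def split_def)

lemma C_group: "abelian_group C"
proof (rule abelian_groupI)
 fix x assume x: "x : car C"
 have "aug A (\<ominus>\<^sub>A fst x) = aug B (\<ominus>\<^sub>B snd x)"
  using x additive_minus[OF L.A.ab L.K.ab L.aug_additive]
  additive_minus[OF G.A.ab L.K.ab G.aug_additive] by(simp add:C_simps)
 thus "EX y:car C. y \<oplus>\<^sub>C x = \<zero>\<^sub>C"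
  using x by(intro bexI[of _ "(\<ominus>\<^sub>A fst x, \<ominus>\<^sub>B snd x)"]) (simp_all add:C_simps L.A.l_neg G.A.l_neg)
qed (auto simp:C_simps L.aug_add G.aug_add L.A.a_assoc G.A.a_assoc intro:L.A.a_comm G.A.a_comm)

sublocale C: abelian_group C by(rule C_group)

lemma C_ring: "ring C"
 by(rule ringI[OF C_group], rule monoidI)
  (auto simp:C_simps L.aug_mult G.aug_mult L.A.m_assoc G.A.m_assoc
  L.A.l_distr G.A.l_distr L.A.r_distr G.A.r_distr)

lemma C_module: "module K C"
 by(rule moduleI[OF L.K.cring_axioms C_group])
  (auto simp:C_simps L.aug_smult G.aug_smult L.V.smult_l_distr G.V.smult_l_distr
  L.V.smult_r_distr G.V.smult_r_distr L.V.smult_assoc1 G.V.smult_assoc1 L.V.smult_one G.V.smult_one)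

lemma fst_additive: "fst : additive_maps C A" and snd_additive: "snd : additive_maps C B"
 by(auto intro!: additive_mapsI simp:C_simps)

lemma C_finsum:
 assumes "f : I \<rightarrow> car C"
 shows "(\<Oplus>\<^sub>C i\<in>I. f i) = (\<Oplus>\<^sub>A i\<in>I. fst (f i), \<Oplus>\<^sub>B i\<in>I. snd (f i))"
 using additive_finsum[OF C_group L.A.ab fst_additive assms]
  additive_finsum[OF C_group G.A.ab snd_additive assms] by(simp add:prod_eq_iff)

lemma C_piece: "x : alg_gr C j ==> x : car C"
 using L.AG.piece_closed G.AG.piece_closed by(auto simp:C_simps)

lemma C_grading: "is_grading C (alg_gr C)"
proof -
 let ?g = "gcomp A (alg_gr A)" and ?h = "gcomp B (alg_gr B)"
 let ?p = "%x j. (?g (fst x) j, ?h (snd x) j)"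
 \<comment> \<open>The augmentation is concentrated in degree zero: there the component has the full
   augmentation, elsewhere it has none. Componentwise splitting thus stays inside the fibre
   product.\<close>
 have aug: "aug A (?g (fst x) j) = aug B (?h (snd x) j)" if x: "x : car C" for x j
  using x L.gr_aug[OF _ L.AG.gcomp_props(1)] G.gr_aug[OF _ G.AG.gcomp_props(1)]
  by(cases "j = 0") (simp_all add:C_simps L.aug_gcomp G.aug_gcomp)
 have pc: "?p x j : car C" if "x : car C" for x j
  using aug[OF that] that by(simp add:C_simps)
 show ?thesis
 proof (rule is_gradingI[OF C_group, where p = ?p])
  fix j
  show "additive_subgroup (alg_gr C j) C"
  proof (rule C.additive_subgroup_intro)
  show "alg_gr C j \<subseteq> car C" using C_piece by blast
  show "\<zero>\<^sub>C : alg_gr C j" by(simp add:C_simps)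
  show "x \<oplus>\<^sub>C y : alg_gr C j" if "x : alg_gr C j" "y : alg_gr C j" for x y
  using that C_piece[OF that(1)] C_piece[OF that(2)]
  by(simp add:C_simps L.AG.piece_add G.AG.piece_add L.aug_add G.aug_add)
  show "\<ominus>\<^sub>C x : alg_gr C j" if x: "x : alg_gr C j" for x
  proof -
  have xc: "x : car C" by(rule C_piece[OF x])
  have "fst (\<ominus>\<^sub>C x) = \<ominus>\<^sub>A fst x" "snd (\<ominus>\<^sub>C x) = \<ominus>\<^sub>B snd x"
  using additive_minus[OF C_group L.A.ab fst_additive xc]
  additive_minus[OF C_group G.A.ab snd_additive xc] .
  moreover have "\<ominus>\<^sub>C x : car C" using xc by simp
  ultimately show ?thesis using x by(simp add:C_simps L.AG.piece_neg G.AG.piece_neg)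
  qed
  qed
 next
  fix x j assume x: "x : car C"
  thus "?p x j : alg_gr C j"
  using aug[OF x] L.AG.gcomp_props(1) G.AG.gcomp_props(1) by(simp add:C_simps)
 next
  fix x assume x: "x : car C"
  hence xc: "fst x : car A" "snd x : car B" by(simp_all add:C_simps)
  let ?S = "{j. ?p x j ~= \<zero>\<^sub>C}"
  have "?S = {j. ?g (fst x) j ~= \<zero>\<^sub>A} \<union> {j. ?h (snd x) j ~= \<zero>\<^sub>B}" by(auto simp:C_simps)
  thus fin: "finite ?S" using L.AG.gcomp_props(2)[OF xc(1)] G.AG.gcomp_props(2)[OF xc(2)] by simp
  have "(\<Oplus>\<^sub>C j\<in>?S. ?p x j) = (\<Oplus>\<^sub>A j\<in>?S. ?g (fst x) j, \<Oplus>\<^sub>B j\<in>?S. ?h (snd x) j)"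
  using pc[OF x] by(subst C_finsum) auto
  also have "... = x"
  using L.AG.gcomp_sum[OF xc(1) fin] G.AG.gcomp_sum[OF xc(2) fin] by(auto simp:prod_eq_iff C_simps)
  finally show "x = (\<Oplus>\<^sub>C j\<in>?S. ?p x j)" ..
 next
  fix x y j assume "x : car C" "y : car C"
  thus "?p (x \<oplus>\<^sub>C y) j = ?p x j \<oplus>\<^sub>C ?p y j"
  by(simp add:C_simps L.AG.gcomp_add G.AG.gcomp_add)
 next
  fix x and i j :: int assume "x : alg_gr C i"
  thus "?p x j = (if j = i then x else \<zero>\<^sub>C)"
  by(auto simp:C_simps L.AG.gcomp_homog G.AG.gcomp_homog prod_eq_iff)
 qed
qed

lemma C_graded_augmented: "graded_augmented_algebra K C"
proof -
 have "augmented_algebra K C"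
 proof (intro augmented_algebra.intro augmented_algebra_axioms.intro L.K.field_axioms C_ring C_module)
  show "aug C : ring_hom C K" by(rule ring_hom_memI) (auto simp:C_simps L.aug_mult L.aug_add)
 qed (auto simp:C_simps L.smult_mult_left L.smult_mult_right G.smult_mult_left G.smult_mult_right L.aug_smult)
 thus ?thesis
 proof (rule graded_augmented_algebra.intro, intro graded_augmented_algebra_axioms.intro C_grading)
  show "alg_gr C j = {\<zero>\<^sub>C}" if "j < 0" for j
  using L.gr_nonneg[OF that] G.gr_nonneg[OF that] by(auto simp:C_simps prod_eq_iff)
  show "k \<odot>\<^sub>C x : alg_gr C j" if "k : car K" "x : alg_gr C j" for k x j
  using that C_piece[OF that(2)]
  by(simp add:C_simps L.gr_smult G.gr_smult L.aug_smult G.aug_smult)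
  show "x \<otimes>\<^sub>C y : alg_gr C (i + j)" if "x : alg_gr C i" "y : alg_gr C j" for x y i j
  using that C_piece[OF that(1)] C_piece[OF that(2)]
  by(simp add:C_simps L.gr_mult G.gr_mult L.aug_mult G.aug_mult)
 qed (auto simp:C_simps L.gr_aug)
qed

end

locale two_based_algebras = two_algebras K A B + L: based_algebra K A X e1 deg1 co1 + G: based_algebra K B Y e2 deg2 co2
 for K :: "'k ring" and A :: "('k, 'a, 'r) gr_aug_algebra_scheme"
  and B :: "('k, 'b, 's) gr_aug_algebra_scheme"
  and X :: "'x set" and e1 deg1 co1 and Y :: "'y set" and e2 deg2 co2
begin

text \<open>The augmentation ideal of the fibre product is the direct sum of the two ideals, each
  embedded with zero in the other coordinate.\<close>

definition e where "e = case_sum (%x. (e1 x, \<zero>\<^sub>B)) (%y. (\<zero>\<^sub>A, e2 y))"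
definition co where "co a = case_sum (co1 (fst a)) (co2 (snd a))"

lemma C_based: "based_algebra K C (Sum_Type.Plus X Y) e (case_sum deg1 deg2) co"
proof (intro based_algebra.intro based_algebra_axioms.intro C_graded_augmented)
 fix z assume z: "z : Sum_Type.Plus X Y"
 show "e z : alg_gr C (case_sum deg1 deg2 z)" "aug C (e z) = \<zero>\<^sub>K" "0 \<le> case_sum deg1 deg2 z"
  using z L.e_gr G.e_gr L.e_aug G.e_aug L.deg_nonneg G.deg_nonneg by(auto simp:e_def C_simps)
 show "co (e z) = mon K \<one>\<^sub>K z"
  using z by(auto simp:co_def e_def L.co_e G.co_e mon_def split:sum.splits)
next
 fix j
 have "{z : Sum_Type.Plus X Y. case_sum deg1 deg2 z = j} = Inl ` {x : X. deg1 x = j} \<union> Inr ` {y : Y. deg2 y = j}" by auto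
 thus "finite {z : Sum_Type.Plus X Y. case_sum deg1 deg2 z = j}" using L.finite_deg G.finite_deg by simp
next
 fix a assume a: "a : car C"
 hence ac: "fst a : car A" "snd a : car B" "aug A (fst a) = aug B (snd a)" by(simp_all add:C_simps)
 let ?S1 = "{x. co1 (fst a) x ~= \<zero>\<^sub>K}" and ?S2 = "{y. co2 (snd a) y ~= \<zero>\<^sub>K}"
 have S: "{z. co a z ~= \<zero>\<^sub>K} = Inl ` ?S1 \<union> Inr ` ?S2"
 proof (rule Set.set_eqI)
  show "z : {z. co a z ~= \<zero>\<^sub>K} \<longleftrightarrow> z : Inl ` ?S1 \<union> Inr ` ?S2" for z by(cases z) (auto simp:co_def)
 qed
 have fin: "finite ?S1" "finite ?S2" using ffun_finite[OF L.co_fin[OF ac(1)]] ffun_finite[OF G.co_fin[OF ac(2)]] .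
 show "co a : ffun K (Sum_Type.Plus X Y)"
 proof (rule ffunI)
  show "co a z : car K" for z using ac by(simp add:co_def split:sum.splits)
  show "finite (Inl ` ?S1 \<union> Inr ` ?S2)" using fin by simp
  show "z : Inl ` ?S1 \<union> Inr ` ?S2" if "co a z ~= \<zero>\<^sub>K" for z using that S by blast
  show "z : Sum_Type.Plus X Y" if "co a z ~= \<zero>\<^sub>K" for z
  using that L.co_supp[OF ac(1)] G.co_supp[OF ac(2)] by(cases z) (auto simp:co_def)
 qed
 have ce: "co a z \<odot>\<^sub>C e z : car C" if "z : Inl ` ?S1 \<union> Inr ` ?S2" for z
  using that ac L.co_supp[OF ac(1)] G.co_supp[OF ac(2)] L.e_aug G.e_aug
  by(auto simp:co_def e_def C_simps L.aug_smult G.aug_smult)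
 have "(\<Oplus>\<^sub>A z\<in>Inl ` ?S1 \<union> Inr ` ?S2. fst (co a z \<odot>\<^sub>C e z)) = (\<Oplus>\<^sub>A z\<in>Inl ` ?S1. fst (co a z \<odot>\<^sub>C e z))"
  using fin ce ac by(intro L.A.finsum_superset[symmetric]) (auto simp:C_simps co_def e_def)
 also have "... = (\<Oplus>\<^sub>A x\<in>?S1. co1 (fst a) x \<odot>\<^sub>A e1 x)"
  using ce ac L.co_supp[OF ac(1)] by(subst L.A.finsum_reindex) (auto simp:C_simps co_def e_def)
 finally have 1: "(\<Oplus>\<^sub>A z\<in>{z. co a z ~= \<zero>\<^sub>K}. fst (co a z \<odot>\<^sub>C e z)) = (\<Oplus>\<^sub>A x\<in>?S1. co1 (fst a) x \<odot>\<^sub>A e1 x)"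
  unfolding S .
 have "(\<Oplus>\<^sub>B z\<in>Inl ` ?S1 \<union> Inr ` ?S2. snd (co a z \<odot>\<^sub>C e z)) = (\<Oplus>\<^sub>B z\<in>Inr ` ?S2. snd (co a z \<odot>\<^sub>C e z))"
  using fin ce ac by(intro G.A.finsum_superset[symmetric]) (auto simp:C_simps co_def e_def)
 also have "... = (\<Oplus>\<^sub>B y\<in>?S2. co2 (snd a) y \<odot>\<^sub>B e2 y)"
  using ce ac G.co_supp[OF ac(2)] by(subst G.A.finsum_reindex) (auto simp:C_simps co_def e_def)
 finally have 2: "(\<Oplus>\<^sub>B z\<in>{z. co a z ~= \<zero>\<^sub>K}. snd (co a z \<odot>\<^sub>C e z)) = (\<Oplus>\<^sub>B y\<in>?S2. co2 (snd a) y \<odot>\<^sub>B e2 y)"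
  unfolding S .
 have "(\<Oplus>\<^sub>C z\<in>{z. co a z ~= \<zero>\<^sub>K}. co a z \<odot>\<^sub>C e z)
  = (\<Oplus>\<^sub>A x\<in>?S1. co1 (fst a) x \<odot>\<^sub>A e1 x, \<Oplus>\<^sub>B y\<in>?S2. co2 (snd a) y \<odot>\<^sub>B e2 y)"
  using ce unfolding 1[symmetric] 2[symmetric] by(intro C_finsum) (auto simp:S)
 thus "a = aug C a \<odot>\<^sub>C \<one>\<^sub>C \<oplus>\<^sub>C (\<Oplus>\<^sub>C z\<in>{z. co a z ~= \<zero>\<^sub>K}. co a z \<odot>\<^sub>C e z)"
  using L.co_expand[OF ac(1)] G.co_expand[OF ac(2)] ac(3) by(simp add:C_simps prod_eq_iff)
next
 fix a b assume "a : car C" "b : car C"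
 thus "co (a \<oplus>\<^sub>C b) = (%z. co a z \<oplus>\<^sub>K co b z)"
  by(auto simp:co_def C_simps L.co_add G.co_add split:sum.splits)
next
 fix k a assume "k : car K" "a : car C"
 thus "co (k \<odot>\<^sub>C a) = (%z. k \<otimes>\<^sub>K co a z)"
  by(auto simp:co_def C_simps L.co_smult G.co_smult split:sum.splits)
next
 show "co \<one>\<^sub>C = zf.\<^sub>K" by(auto simp:co_def C_simps L.co_one G.co_one split:sum.splits)
next
 fix a j z assume "a : alg_gr C j" "co a z ~= \<zero>\<^sub>K"
 thus "case_sum deg1 deg2 z = j" using L.co_gr G.co_gr by(auto simp:co_def C_simps split:sum.splits)
qed

sublocale Pr: based_algebra K C "Sum_Type.Plus X Y" e "case_sum deg1 deg2" co by(rule C_based)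

text \<open>A product of letters from different sides is zero in both coordinates. This identifies
  the cobar algebra of the product with the one assumed in \<open>cobar_coproduct\<close>.\<close>

lemma cst_product: "Pr.cst = sum_consts K L.cst G.cst"
proof (intro ext)
 fix a b z
 show "Pr.cst a b z = sum_consts K L.cst G.cst a b z"
  unfolding Pr.cst_def L.cst_def G.cst_def
  by(cases a; cases b; cases z) (auto simp:sum_consts_def co_def e_def C_simps)
qed

end

section \<open>Assembly over homogeneous bases of the two algebras\<close>

theorem theorem5p2:
  fixes K :: "'k ring"
    and \<Lambda> :: "('k, 'a) gr_aug_algebra" and \<Gamma> :: "('k, 'b) gr_aug_algebra"
    and P :: "('a, 'p, 'k) resolution" and Q :: "('b, 'q, 'k) resolution"
    and R :: "('a \<times> 'b, 'r, 'k) resolution"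
  assumes "field K"
    and "graded_augmented_algebra K \<Lambda>" and "graded_augmented_algebra K \<Gamma>"
    and "finite_dimensional K \<Lambda> \<and> concentrated_in_degree_0 \<Lambda> \<or>
         connected_algebra K \<Lambda> \<and> fin_gen_algebra K \<Lambda>"
    and "finite_dimensional K \<Gamma> \<and> concentrated_in_degree_0 \<Gamma> \<or>
         connected_algebra K \<Gamma> \<and> fin_gen_algebra K \<Gamma>"
    and "graded_free_resolution K \<Lambda> P" and "graded_free_resolution K \<Gamma> Q"
    and "graded_free_resolution K (aug_product \<Lambda> \<Gamma>) R"
  shows "\<exists>\<phi>. \<phi> \<in> aug_algebra_isos K (Ext_algebra K (aug_product \<Lambda> \<Gamma>) R)
               (aug_coproduct K (Ext_algebra K \<Lambda> P) (Ext_algebra K \<Gamma> Q))"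
proof -
 interpret L: graded_augmented_algebra K \<Lambda> by fact
 interpret G: graded_augmented_algebra K \<Gamma> by fact
 \<comment> \<open>A letter is a pair of a degree and a basis element, hence the labels
   \<open>snd\<close> and \<open>fst\<close>.\<close>
 have "\<exists>(X :: (int \<times> 'a) set) co. based_algebra K \<Lambda> X snd fst co"
  using assms(4) L.concentrated_pieces L.connected_pieces by(intro L.based_algebra_exists) blast
 then obtain X :: "(int \<times> 'a) set" and co1 where X: "based_algebra K \<Lambda> X snd fst co1" by blast
 have "\<exists>(Y :: (int \<times> 'b) set) co. based_algebra K \<Gamma> Y snd fst co"
  using assms(5) G.concentrated_pieces G.connected_pieces by(intro G.based_algebra_exists) blast
 then obtain Y :: "(int \<times> 'b) set" and co2 where Y: "based_algebra K \<Gamma> Y snd fst co2" by blast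
 interpret T: two_based_algebras K \<Lambda> \<Gamma> X snd fst co1 Y snd fst co2
  by(intro two_based_algebras.intro two_algebras.intro assms(2,3) X Y)
 obtain ka1 where 1: "cobar_model K X T.L.cst (Ext_algebra K \<Lambda> P) ka1" by(rule T.L.Ext_cobar_model[OF assms(6)])
 obtain ka2 where 2: "cobar_model K Y T.G.cst (Ext_algebra K \<Gamma> Q) ka2" by(rule T.G.Ext_cobar_model[OF assms(7)])
 obtain ka where 3: "cobar_model K (Sum_Type.Plus X Y) T.Pr.cst (Ext_algebra K (aug_product \<Lambda> \<Gamma>) R) ka"
  by(rule T.Pr.Ext_cobar_model[OF assms(8)])
 \<comment> \<open>\<open>cst_product\<close> rewrites the constants of the third model into those
   of the disjoint union of the two alphabets.\<close>
 interpret CC: cobar_coproduct K X T.L.cst "Ext_algebra K \<Lambda> P" ka1 Y T.G.cst "Ext_algebra K \<Gamma> Q" ka2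
  "Ext_algebra K (aug_product \<Lambda> \<Gamma>) R" ka
  using 3 unfolding T.cst_product by(intro cobar_coproduct.intro assms(1) 1 2)
 show ?thesis using CC.coproduct_iso by blast
qed

end
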